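(* Let $G$ be a finite group, $\mathcal B$ a braided $\mathrm C^*$-tensor category and $\mathsf{Rep}(G)\hookrightarrow\mathcal B$ a unitary braided fully faithful tensor subcategory. Then there is a short exact sequence of groups $$0\to\widehat G\to\mathrm{Inv}(\mathcal B)\to\mathrm{Inv}(\mathcal B_G)_{\mathrm{lift}}\to0,$$ where $\mathrm{Inv}(-)$ denotes the group of isomorphism classes of invertible objects, $\mathcal B_G$ is the $G$-deequivariantization of $\mathcal B$, and $$\mathrm{Inv}(\mathcal B_G)_{\mathrm{lift}}=\{[y]\in\mathrm{Inv}(\mathcal B_G): y\text{ admits a unitary }G\text{-equivariant structure}\}.$$
   Context: $\widehat G=\mathrm{Hom}(G,U(1))$. $\mathrm C^*$-tensor categories are rigid with simple unit. $\mathsf{Rep}(G)$ is the category of finite dimensional unitary representations with its symmetric braiding. Deequivariantization: let $\beta$ be the braiding of $\mathcal B$ and $A\in\mathcal B$ the image of the commutative algebra (Q-system) $\mathrm{Fun}(G)\in\mathsf{Rep}(G)$. $\mathcal B_G$ is the category of right $A$-modules in $\mathcal B$, with tensor product $\otimes_A$ and unit $A$; a right module $(X,\rho_X)$ is made a bimodule using the left action $\lambda_X=\rho_X\circ\beta_{X,A}^{-1}$. The group $G\cong\mathrm{Aut}_{\mathrm{alg}}(A)$ acts on $\mathcal B_G$ by $T_g(Y,\rho_Y)=(Y,\rho_Y\circ(\mathrm{id}_Y\otimes g))$. A unitary $G$-equivariant structure on an object $y$ of a category with a $G$-action $T$ is a family of unitary isomorphisms $v_g:T_g(y)\to y$, $g\in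 G$, with $v_{gh}=v_g\circ T_g(v_h)$ (modulo the coherence isomorphisms of the action). *)

theory Defs
  imports
    Complex_Main
    "HOL-Library.Countable_Set"
    "HOL-Algebra.Coset"
    "Jordan_Normal_Form.Schur_Decomposition"
begin

section \<open>Categories and tensor products\<close>

record ('o, 'm) category_data =
  Ob :: "'o set"
  Arr :: "'m set"
  source :: "'m \<Rightarrow> 'o"
  target :: "'m \<Rightarrow> 'o"
  ident :: "'o \<Rightarrow> 'm"
  cmp :: "'m \<Rightarrow> 'm \<Rightarrow> 'm" (infixr \<open>\<cdot>\<index>\<close> 75)

record ('o, 'm) tensor_data = "('o, 'm) category_data" +
  tensor_ob :: "'o \<Rightarrow> 'o \<Rightarrow> 'o" (infixl \<open>\<star>\<index>\<close> 80)
  unit_ob :: "'o"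

text \<open>
  Tensor categories are not assumed to be strict. Composition \<open>g \<cdot> f\<close> means ``first \<open>f\<close>, then
  \<open>g\<close>''; \<open>f \<diamondop> g\<close> is the tensor product of morphisms, and the associator \<open>assr X Y Z\<close> goes from
  \<open>(X \<star> Y) \<star> Z\<close> to \<open>X \<star> (Y \<star> Z)\<close>.
\<close>

record ('o, 'm) cstar_tensor_data = "('o, 'm) tensor_data" +
  zero_arr :: "'o \<Rightarrow> 'o \<Rightarrow> 'm"
  add_arr :: "'m \<Rightarrow> 'm \<Rightarrow> 'm" (infixl \<open>\<^bold>+\<index>\<close> 65)
  scale_arr :: "complex \<Rightarrow> 'm \<Rightarrow> 'm" (infixr \<open>*\<^sub>a\<index>\<close> 70)
  adj :: "'m \<Rightarrow> 'm" (\<open>_\<dagger>\<index>\<close> [1000] 999)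
  tensor_arr :: "'m \<Rightarrow> 'm \<Rightarrow> 'm" (infixl \<open>\<diamondop>\<index>\<close> 80)
  assr :: "'o \<Rightarrow> 'o \<Rightarrow> 'o \<Rightarrow> 'm"
  lunit :: "'o \<Rightarrow> 'm"
  runit :: "'o \<Rightarrow> 'm"

record ('o, 'm) braided_data = "('o, 'm) cstar_tensor_data" +
  braid :: "'o \<Rightarrow> 'o \<Rightarrow> 'm"

definition Hom :: "('o, 'm, 'z) category_data_scheme \<Rightarrow> 'o \<Rightarrow> 'o \<Rightarrow> 'm set" where
  "Hom C X Y = {f \<in> Arr C. source C f = X \<and> target C f = Y}"

definition iso_ob :: "('o, 'm, 'z) category_data_scheme \<Rightarrow> 'o \<Rightarrow> 'o \<Rightarrow> bool" where
  "iso_ob C X Y \<longleftrightarrow>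
     (\<exists>f \<in> Hom C X Y. \<exists>g \<in> Hom C Y X. g \<cdot>\<^bsub>C\<^esub> f = ident C X \<and> f \<cdot>\<^bsub>C\<^esub> g = ident C Y)"

definition iso_class :: "('o, 'm, 'z) category_data_scheme \<Rightarrow> 'o \<Rightarrow> 'o set" where
  "iso_class C X = {Y \<in> Ob C. iso_ob C X Y}"

definition invertible_ob :: "('o, 'm, 'z) tensor_data_scheme \<Rightarrow> 'o \<Rightarrow> bool" where
  "invertible_ob C X \<longleftrightarrow> X \<in> Ob C \<and>
     (\<exists>Y \<in> Ob C. iso_ob C (X \<star>\<^bsub>C\<^esub> Y) (unit_ob C) \<and> iso_ob C (Y \<star>\<^bsub>C\<^esub> X) (unit_ob C))"

text \<open>
  The product of two classes is the union of the classes of all products of representatives, which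
  is the single class of \<open>X \<star> Y\<close> as soon as the tensor product respects isomorphism.
\<close>

definition Inv :: "('o, 'm, 'z) tensor_data_scheme \<Rightarrow> 'o set monoid" where
  "Inv C = \<lparr>carrier = {iso_class C X | X. invertible_ob C X},
            monoid.mult = (\<lambda>c d. \<Union>X\<in>c. \<Union>Y\<in>d. iso_class C (X \<star>\<^bsub>C\<^esub> Y)),
            one = iso_class C (unit_ob C)\<rparr>"


section \<open>Braided C*-tensor categories\<close>

locale category =
  fixes C :: "('o, 'm, 'z) category_data_scheme" (structure)
  assumes source_Ob: "f \<in> Arr C \<Longrightarrow> source C f \<in> Ob C"
    and target_Ob: "f \<in> Arr C \<Longrightarrow> target C f \<in> Ob C"
    and ident_Hom: "X \<in> Ob C \<Longrightarrow> ident C X \<in> Hom C X X"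
    and cmp_Hom: "\<lbrakk>f \<in> Hom C X Y; g \<in> Hom C Y Z\<rbrakk> \<Longrightarrow> g \<cdot> f \<in> Hom C X Z"
    and ident_cmp: "f \<in> Hom C X Y \<Longrightarrow> ident C Y \<cdot> f = f"
    and cmp_ident: "f \<in> Hom C X Y \<Longrightarrow> f \<cdot> ident C X = f"
    and cmp_assoc: "\<lbrakk>f \<in> Hom C W X; g \<in> Hom C X Y; h \<in> Hom C Y Z\<rbrakk>
      \<Longrightarrow> (h \<cdot> g) \<cdot> f = h \<cdot> (g \<cdot> f)"

definition cstar_norm :: "('o, 'm, 'z) cstar_tensor_data_scheme \<Rightarrow> ('m \<Rightarrow> real) \<Rightarrow> bool" where
  "cstar_norm C N \<longleftrightarrow>
     (\<forall>X \<in> Ob C. \<forall>Y \<in> Ob C.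
        (\<forall>f \<in> Hom C X Y. N f \<ge> 0 \<and> (N f = 0 \<longleftrightarrow> f = zero_arr C X Y)) \<and>
        (\<forall>f \<in> Hom C X Y. \<forall>c. N (c *\<^sub>a\<^bsub>C\<^esub> f) = cmod c * N f) \<and>
        (\<forall>f \<in> Hom C X Y. \<forall>g \<in> Hom C X Y. N (f \<^bold>+\<^bsub>C\<^esub> g) \<le> N f + N g) \<and>
        (\<forall>Z \<in> Ob C. \<forall>f \<in> Hom C X Y. \<forall>g \<in> Hom C Y Z. N (g \<cdot>\<^bsub>C\<^esub> f) \<le> N g * N f) \<and>
        (\<forall>f \<in> Hom C X Y. N (f\<dagger>\<^bsub>C\<^esub> \<cdot>\<^bsub>C\<^esub> f) = (N f)\<^sup>2) \<and>
        (\<forall>s. (\<forall>n::nat. s n \<in> Hom C X Y) \<and>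
             (\<forall>e>0. \<exists>M. \<forall>i\<ge>M. \<forall>j\<ge>M. N (s i \<^bold>+\<^bsub>C\<^esub> (-1) *\<^sub>a\<^bsub>C\<^esub> s j) < e) \<longrightarrow>
             (\<exists>l \<in> Hom C X Y. (\<lambda>n. N (s n \<^bold>+\<^bsub>C\<^esub> (-1) *\<^sub>a\<^bsub>C\<^esub> l)) \<longlonglongrightarrow> 0)))"

text \<open>
  Since a C*-norm is determined by the *-algebraic structure, its existence is required as a
  property instead of recording the norm as data.
\<close>

locale cstar_category = category C
  for C :: "('o, 'm, 'z) cstar_tensor_data_scheme" (structure) +
  assumes zero_Hom: "\<lbrakk>X \<in> Ob C; Y \<in> Ob C\<rbrakk> \<Longrightarrow> zero_arr C X Y \<in> Hom C X Y"
    and add_Hom: "\<lbrakk>f \<in> Hom C X Y; g \<in> Hom C X Y\<rbrakk> \<Longrightarrow> f \<^bold>+ g \<in> Hom C X Y"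
    and scale_Hom: "f \<in> Hom C X Y \<Longrightarrow> c *\<^sub>a f \<in> Hom C X Y"
    and add_assoc: "\<lbrakk>f \<in> Hom C X Y; g \<in> Hom C X Y; h \<in> Hom C X Y\<rbrakk>
      \<Longrightarrow> (f \<^bold>+ g) \<^bold>+ h = f \<^bold>+ (g \<^bold>+ h)"
    and add_comm: "\<lbrakk>f \<in> Hom C X Y; g \<in> Hom C X Y\<rbrakk> \<Longrightarrow> f \<^bold>+ g = g \<^bold>+ f"
    and zero_add: "f \<in> Hom C X Y \<Longrightarrow> zero_arr C X Y \<^bold>+ f = f"
    and add_neg: "f \<in> Hom C X Y \<Longrightarrow> f \<^bold>+ (-1) *\<^sub>a f = zero_arr C X Y"
    and scale_add: "\<lbrakk>f \<in> Hom C X Y; g \<in> Hom C X Y\<rbrakk> \<Longrightarrow> c *\<^sub>a (f \<^bold>+ g) = c *\<^sub>a f \<^bold>+ c *\<^sub>a g"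
    and add_scale: "f \<in> Hom C X Y \<Longrightarrow> (c + d) *\<^sub>a f = c *\<^sub>a f \<^bold>+ d *\<^sub>a f"
    and scale_scale: "f \<in> Hom C X Y \<Longrightarrow> c *\<^sub>a (d *\<^sub>a f) = (c * d) *\<^sub>a f"
    and one_scale: "f \<in> Hom C X Y \<Longrightarrow> 1 *\<^sub>a f = f"
    and cmp_add: "\<lbrakk>f \<in> Hom C X Y; f' \<in> Hom C X Y; g \<in> Hom C Y Z\<rbrakk>
      \<Longrightarrow> g \<cdot> (f \<^bold>+ f') = (g \<cdot> f) \<^bold>+ (g \<cdot> f')"
    and add_cmp: "\<lbrakk>f \<in> Hom C X Y; g \<in> Hom C Y Z; g' \<in> Hom C Y Z\<rbrakk>
      \<Longrightarrow> (g \<^bold>+ g') \<cdot> f = (g \<cdot> f) \<^bold>+ (g' \<cdot> f)"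
    and cmp_scale: "\<lbrakk>f \<in> Hom C X Y; g \<in> Hom C Y Z\<rbrakk> \<Longrightarrow> g \<cdot> (c *\<^sub>a f) = c *\<^sub>a (g \<cdot> f)"
    and scale_cmp: "\<lbrakk>f \<in> Hom C X Y; g \<in> Hom C Y Z\<rbrakk> \<Longrightarrow> (c *\<^sub>a g) \<cdot> f = c *\<^sub>a (g \<cdot> f)"
    and adj_Hom: "f \<in> Hom C X Y \<Longrightarrow> f\<dagger> \<in> Hom C Y X"
    and adj_adj: "f \<in> Hom C X Y \<Longrightarrow> (f\<dagger>)\<dagger> = f"
    and adj_cmp: "\<lbrakk>f \<in> Hom C X Y; g \<in> Hom C Y Z\<rbrakk> \<Longrightarrow> (g \<cdot> f)\<dagger> = f\<dagger> \<cdot> g\<dagger>"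
    and adj_add: "\<lbrakk>f \<in> Hom C X Y; g \<in> Hom C X Y\<rbrakk> \<Longrightarrow> (f \<^bold>+ g)\<dagger> = f\<dagger> \<^bold>+ g\<dagger>"
    and adj_scale: "f \<in> Hom C X Y \<Longrightarrow> (c *\<^sub>a f)\<dagger> = cnj c *\<^sub>a f\<dagger>"
    and ex_norm: "\<exists>N. cstar_norm C N"
    and positive: "f \<in> Hom C X Y \<Longrightarrow> \<exists>g \<in> Hom C X X. f\<dagger> \<cdot> f = g\<dagger> \<cdot> g"

definition unitary_arr :: "('o, 'm, 'z) cstar_tensor_data_scheme \<Rightarrow> 'm \<Rightarrow> bool" where
  "unitary_arr C f \<longleftrightarrow> f \<in> Arr C \<and>
     f\<dagger>\<^bsub>C\<^esub> \<cdot>\<^bsub>C\<^esub> f = ident C (source C f) \<and> f \<cdot>\<^bsub>C\<^esub> f\<dagger>\<^bsub>C\<^esub> = ident C (target C f)"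

text \<open>
  As usual in the C*-setting, finite direct sums and subobjects (a projection is the range
  projection of an isometry) are part of the definition, and the structural isomorphisms are
  unitary.
\<close>

locale cstar_tensor_category = cstar_category C
  for C :: "('o, 'm, 'z) cstar_tensor_data_scheme" (structure) +
  assumes unit_Ob: "unit_ob C \<in> Ob C"
    and tensor_Ob: "\<lbrakk>X \<in> Ob C; Y \<in> Ob C\<rbrakk> \<Longrightarrow> X \<star> Y \<in> Ob C"
    and tensor_Hom: "\<lbrakk>f \<in> Hom C X Y; g \<in> Hom C X' Y'\<rbrakk> \<Longrightarrow> f \<diamondop> g \<in> Hom C (X \<star> X') (Y \<star> Y')"
    and tensor_ident: "\<lbrakk>X \<in> Ob C; Y \<in> Ob C\<rbrakk> \<Longrightarrow> ident C X \<diamondop> ident C Y = ident C (X \<star> Y)"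
    and tensor_cmp: "\<lbrakk>f \<in> Hom C X Y; g \<in> Hom C Y Z; f' \<in> Hom C X' Y'; g' \<in> Hom C Y' Z'\<rbrakk>
      \<Longrightarrow> (g \<cdot> f) \<diamondop> (g' \<cdot> f') = (g \<diamondop> g') \<cdot> (f \<diamondop> f')"
    and tensor_add: "\<lbrakk>f \<in> Hom C X Y; g \<in> Hom C X' Y'; h \<in> Hom C X' Y'\<rbrakk>
      \<Longrightarrow> f \<diamondop> (g \<^bold>+ h) = (f \<diamondop> g) \<^bold>+ (f \<diamondop> h)"
    and add_tensor: "\<lbrakk>f \<in> Hom C X Y; g \<in> Hom C X Y; h \<in> Hom C X' Y'\<rbrakk>
      \<Longrightarrow> (f \<^bold>+ g) \<diamondop> h = (f \<diamondop> h) \<^bold>+ (g \<diamondop> h)"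
    and tensor_scale: "\<lbrakk>f \<in> Hom C X Y; g \<in> Hom C X' Y'\<rbrakk> \<Longrightarrow> f \<diamondop> (c *\<^sub>a g) = c *\<^sub>a (f \<diamondop> g)"
    and scale_tensor: "\<lbrakk>f \<in> Hom C X Y; g \<in> Hom C X' Y'\<rbrakk> \<Longrightarrow> (c *\<^sub>a f) \<diamondop> g = c *\<^sub>a (f \<diamondop> g)"
    and tensor_adj: "\<lbrakk>f \<in> Hom C X Y; g \<in> Hom C X' Y'\<rbrakk> \<Longrightarrow> (f \<diamondop> g)\<dagger> = f\<dagger> \<diamondop> g\<dagger>"
    and assr_Hom: "\<lbrakk>X \<in> Ob C; Y \<in> Ob C; Z \<in> Ob C\<rbrakk>
      \<Longrightarrow> assr C X Y Z \<in> Hom C ((X \<star> Y) \<star> Z) (X \<star> (Y \<star> Z)) \<and> unitary_arr C (assr C X Y Z)"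
    and lunit_Hom: "X \<in> Ob C \<Longrightarrow> lunit C X \<in> Hom C (unit_ob C \<star> X) X \<and> unitary_arr C (lunit C X)"
    and runit_Hom: "X \<in> Ob C \<Longrightarrow> runit C X \<in> Hom C (X \<star> unit_ob C) X \<and> unitary_arr C (runit C X)"
    and assr_natural: "\<lbrakk>f \<in> Hom C X X'; g \<in> Hom C Y Y'; h \<in> Hom C Z Z'\<rbrakk>
      \<Longrightarrow> assr C X' Y' Z' \<cdot> ((f \<diamondop> g) \<diamondop> h) = (f \<diamondop> (g \<diamondop> h)) \<cdot> assr C X Y Z"
    and lunit_natural: "f \<in> Hom C X Y
      \<Longrightarrow> lunit C Y \<cdot> (ident C (unit_ob C) \<diamondop> f) = f \<cdot> lunit C X"
    and runit_natural: "f \<in> Hom C X Y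
      \<Longrightarrow> runit C Y \<cdot> (f \<diamondop> ident C (unit_ob C)) = f \<cdot> runit C X"
    and pentagon: "\<lbrakk>W \<in> Ob C; X \<in> Ob C; Y \<in> Ob C; Z \<in> Ob C\<rbrakk>
      \<Longrightarrow> (ident C W \<diamondop> assr C X Y Z) \<cdot> assr C W (X \<star> Y) Z \<cdot> (assr C W X Y \<diamondop> ident C Z)
        = assr C W X (Y \<star> Z) \<cdot> assr C (W \<star> X) Y Z"
    and triangle: "\<lbrakk>X \<in> Ob C; Y \<in> Ob C\<rbrakk>
      \<Longrightarrow> (ident C X \<diamondop> lunit C Y) \<cdot> assr C X (unit_ob C) Y = runit C X \<diamondop> ident C Y"
    and direct_sums: "\<lbrakk>X \<in> Ob C; Y \<in> Ob C\<rbrakk>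
      \<Longrightarrow> \<exists>Z \<in> Ob C. \<exists>u \<in> Hom C X Z. \<exists>v \<in> Hom C Y Z.
            u\<dagger> \<cdot> u = ident C X \<and> v\<dagger> \<cdot> v = ident C Y \<and> (u \<cdot> u\<dagger>) \<^bold>+ (v \<cdot> v\<dagger>) = ident C Z"
    and subobjects: "\<lbrakk>p \<in> Hom C X X; p \<cdot> p = p; p\<dagger> = p\<rbrakk>
      \<Longrightarrow> \<exists>Y \<in> Ob C. \<exists>v \<in> Hom C Y X. v\<dagger> \<cdot> v = ident C Y \<and> v \<cdot> v\<dagger> = p"
    and simple_unit: "Hom C (unit_ob C) (unit_ob C) = range (\<lambda>c. c *\<^sub>a ident C (unit_ob C))"
    and unit_nonzero: "ident C (unit_ob C) \<noteq> zero_arr C (unit_ob C) (unit_ob C)"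
    and rigid: "X \<in> Ob C \<Longrightarrow> \<exists>Y \<in> Ob C.
      \<exists>R \<in> Hom C (unit_ob C) (Y \<star> X). \<exists>S \<in> Hom C (unit_ob C) (X \<star> Y).
        lunit C X \<cdot> (S\<dagger> \<diamondop> ident C X) \<cdot> (assr C X Y X)\<dagger> \<cdot> (ident C X \<diamondop> R) = runit C X \<and>
        lunit C Y \<cdot> (R\<dagger> \<diamondop> ident C Y) \<cdot> (assr C Y X Y)\<dagger> \<cdot> (ident C Y \<diamondop> S) = runit C Y"

locale braided_cstar_tensor_category = cstar_tensor_category C
  for C :: "('o, 'm, 'z) braided_data_scheme" (structure) +
  assumes braid_Hom: "\<lbrakk>X \<in> Ob C; Y \<in> Ob C\<rbrakk>
      \<Longrightarrow> braid C X Y \<in> Hom C (X \<star> Y) (Y \<star> X) \<and> unitary_arr C (braid C X Y)"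
    and braid_natural: "\<lbrakk>f \<in> Hom C X X'; g \<in> Hom C Y Y'\<rbrakk>
      \<Longrightarrow> braid C X' Y' \<cdot> (f \<diamondop> g) = (g \<diamondop> f) \<cdot> braid C X Y"
    and hexagon1: "\<lbrakk>X \<in> Ob C; Y \<in> Ob C; Z \<in> Ob C\<rbrakk>
      \<Longrightarrow> assr C Y Z X \<cdot> braid C X (Y \<star> Z) \<cdot> assr C X Y Z
        = (ident C Y \<diamondop> braid C X Z) \<cdot> assr C Y X Z \<cdot> (braid C X Y \<diamondop> ident C Z)"
    and hexagon2: "\<lbrakk>X \<in> Ob C; Y \<in> Ob C; Z \<in> Ob C\<rbrakk>
      \<Longrightarrow> (assr C Z X Y)\<dagger> \<cdot> braid C (X \<star> Y) Z \<cdot> (assr C X Y Z)\<dagger>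
        = (braid C X Z \<diamondop> ident C Y) \<cdot> (assr C X Z Y)\<dagger> \<cdot> (ident C X \<diamondop> braid C Y Z)"


section \<open>Fully faithful unitary braided tensor functors\<close>

text \<open>
  The structure morphisms of a tensor functor \<open>F\<close> are \<open>F_tensor F X Y\<close> from \<open>F X \<star> F Y\<close> to
  \<open>F (X \<star> Y)\<close>, and \<open>F_unit F\<close> from the unit to the image of the unit.
\<close>

record ('o, 'm, 'p, 'n) tensor_functor =
  F_ob :: "'o \<Rightarrow> 'p"
  F_arr :: "'m \<Rightarrow> 'n"
  F_tensor :: "'o \<Rightarrow> 'o \<Rightarrow> 'n"
  F_unit :: "'n"

locale unitary_braided_embedding =
  fixes C :: "('o, 'm, 'y) braided_data_scheme"
    and D :: "('p, 'n, 'z) braided_data_scheme" (structure)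
    and F :: "('o, 'm, 'p, 'n) tensor_functor"
  assumes F_Ob: "X \<in> Ob C \<Longrightarrow> F_ob F X \<in> Ob D"
    and fully_faithful: "\<lbrakk>X \<in> Ob C; Y \<in> Ob C\<rbrakk>
      \<Longrightarrow> bij_betw (F_arr F) (Hom C X Y) (Hom D (F_ob F X) (F_ob F Y))"
    and F_ident: "X \<in> Ob C \<Longrightarrow> F_arr F (ident C X) = ident D (F_ob F X)"
    and F_cmp: "\<lbrakk>f \<in> Hom C X Y; g \<in> Hom C Y Z\<rbrakk>
      \<Longrightarrow> F_arr F (g \<cdot>\<^bsub>C\<^esub> f) = F_arr F g \<cdot> F_arr F f"
    and F_add: "\<lbrakk>f \<in> Hom C X Y; g \<in> Hom C X Y\<rbrakk>
      \<Longrightarrow> F_arr F (f \<^bold>+\<^bsub>C\<^esub> g) = F_arr F f \<^bold>+ F_arr F g"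
    and F_scale: "f \<in> Hom C X Y \<Longrightarrow> F_arr F (c *\<^sub>a\<^bsub>C\<^esub> f) = c *\<^sub>a F_arr F f"
    and F_adj: "f \<in> Hom C X Y \<Longrightarrow> F_arr F (f\<dagger>\<^bsub>C\<^esub>) = (F_arr F f)\<dagger>"
    and F_unit_Hom: "F_unit F \<in> Hom D (unit_ob D) (F_ob F (unit_ob C))"
    and F_unit_unitary: "unitary_arr D (F_unit F)"
    and F_tensor_Hom: "\<lbrakk>X \<in> Ob C; Y \<in> Ob C\<rbrakk>
      \<Longrightarrow> F_tensor F X Y \<in> Hom D (F_ob F X \<star> F_ob F Y) (F_ob F (X \<star>\<^bsub>C\<^esub> Y))"
    and F_tensor_unitary: "\<lbrakk>X \<in> Ob C; Y \<in> Ob C\<rbrakk> \<Longrightarrow> unitary_arr D (F_tensor F X Y)"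
    and F_tensor_natural: "\<lbrakk>f \<in> Hom C X X'; g \<in> Hom C Y Y'\<rbrakk>
      \<Longrightarrow> F_tensor F X' Y' \<cdot> (F_arr F f \<diamondop> F_arr F g) = F_arr F (f \<diamondop>\<^bsub>C\<^esub> g) \<cdot> F_tensor F X Y"
    and F_assr: "\<lbrakk>X \<in> Ob C; Y \<in> Ob C; Z \<in> Ob C\<rbrakk>
      \<Longrightarrow> F_arr F (assr C X Y Z) \<cdot> F_tensor F (X \<star>\<^bsub>C\<^esub> Y) Z \<cdot> (F_tensor F X Y \<diamondop> ident D (F_ob F Z))
        = F_tensor F X (Y \<star>\<^bsub>C\<^esub> Z) \<cdot> (ident D (F_ob F X) \<diamondop> F_tensor F Y Z)
            \<cdot> assr D (F_ob F X) (F_ob F Y) (F_ob F Z)"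
    and F_lunit: "X \<in> Ob C
      \<Longrightarrow> F_arr F (lunit C X) \<cdot> F_tensor F (unit_ob C) X \<cdot> (F_unit F \<diamondop> ident D (F_ob F X))
        = lunit D (F_ob F X)"
    and F_runit: "X \<in> Ob C
      \<Longrightarrow> F_arr F (runit C X) \<cdot> F_tensor F X (unit_ob C) \<cdot> (ident D (F_ob F X) \<diamondop> F_unit F)
        = runit D (F_ob F X)"
    and F_braid: "\<lbrakk>X \<in> Ob C; Y \<in> Ob C\<rbrakk>
      \<Longrightarrow> F_arr F (braid C X Y) \<cdot> F_tensor F X Y
        = F_tensor F Y X \<cdot> braid D (F_ob F X) (F_ob F Y)"


section \<open>Finite dimensional unitary representations\<close>

type_synonym 'g urep = "nat \<times> ('g \<Rightarrow> complex mat)"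

text \<open>
  A representation is a pair \<open>(n, \<pi>)\<close> with \<open>\<pi>\<close> acting on the Hilbert space \<open>\<complex>\<^sup>n\<close>. The
  vector \<open>e\<^sub>i \<otimes> e\<^sub>j\<close> of \<open>\<complex>\<^sup>m \<otimes> \<complex>\<^sup>n\<close> is the basis vector with index \<open>i * n + j\<close> of the
  space of dimension \<open>m * n\<close>, so that the associators and unitors become identity matrices.
\<close>

definition kron :: "complex mat \<Rightarrow> complex mat \<Rightarrow> complex mat" where
  "kron S T = mat (dim_row S * dim_row T) (dim_col S * dim_col T)
     (\<lambda>(i, j). S $$ (i div dim_row T, j div dim_col T) * T $$ (i mod dim_row T, j mod dim_col T))"

definition flip_mat :: "nat \<Rightarrow> nat \<Rightarrow> complex mat" where
  "flip_mat m n = mat (n * m) (m * n)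
     (\<lambda>(i, j). if i div m = j mod n \<and> i mod m = j div n then 1 else 0)"

definition ureps :: "('g, 'b) monoid_scheme \<Rightarrow> 'g urep set" where
  "ureps G = {(n, \<pi>). \<pi> \<in> extensional (carrier G) \<and>
     (\<forall>g \<in> carrier G. \<pi> g \<in> carrier_mat n n \<and> mat_adjoint (\<pi> g) * \<pi> g = 1\<^sub>m n) \<and>
     (\<forall>g \<in> carrier G. \<forall>h \<in> carrier G. \<pi> (g \<otimes>\<^bsub>G\<^esub> h) = \<pi> g * \<pi> h)}"

definition intertwiners :: "('g, 'b) monoid_scheme \<Rightarrow> 'g urep \<Rightarrow> 'g urep \<Rightarrow> complex mat set" where
  "intertwiners G V W = {T \<in> carrier_mat (fst W) (fst V).
     \<forall>g \<in> carrier G. T * snd V g = snd W g * T}"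

definition urep_tensor :: "('g, 'b) monoid_scheme \<Rightarrow> 'g urep \<Rightarrow> 'g urep \<Rightarrow> 'g urep" where
  "urep_tensor G V W = (fst V * fst W, \<lambda>g \<in> carrier G. kron (snd V g) (snd W g))"

definition urep_unit :: "('g, 'b) monoid_scheme \<Rightarrow> 'g urep" where
  "urep_unit G = (1, \<lambda>g \<in> carrier G. 1\<^sub>m 1)"

definition Rep :: "('g, 'b) monoid_scheme
    \<Rightarrow> ('g urep, 'g urep \<times> complex mat \<times> 'g urep) braided_data" where
  "Rep G = \<lparr>
     Ob = ureps G,
     Arr = {(V, T, W). V \<in> ureps G \<and> W \<in> ureps G \<and> T \<in> intertwiners G V W},
     source = (\<lambda>(V, T, W). V),
     target = (\<lambda>(V, T, W). W),
     ident = (\<lambda>V. (V, 1\<^sub>m (fst V), V)),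
     cmp = (\<lambda>(_, S, W) (V, T, _). (V, S * T, W)),
     tensor_ob = urep_tensor G,
     unit_ob = urep_unit G,
     zero_arr = (\<lambda>V W. (V, 0\<^sub>m (fst W) (fst V), W)),
     add_arr = (\<lambda>(V, S, W) (_, T, _). (V, S + T, W)),
     scale_arr = (\<lambda>c (V, T, W). (V, c \<cdot>\<^sub>m T, W)),
     adj = (\<lambda>(V, T, W). (W, mat_adjoint T, V)),
     tensor_arr = (\<lambda>(V, S, W) (V', T, W'). (urep_tensor G V V', kron S T, urep_tensor G W W')),
     assr = (\<lambda>U V W. (urep_tensor G (urep_tensor G U V) W, 1\<^sub>m (fst U * fst V * fst W),
                      urep_tensor G U (urep_tensor G V W))),
     lunit = (\<lambda>V. (urep_tensor G (urep_unit G) V, 1\<^sub>m (fst V), V)),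
     runit = (\<lambda>V. (urep_tensor G V (urep_unit G), 1\<^sub>m (fst V), V)),
     braid = (\<lambda>V W. (urep_tensor G V W, flip_mat (fst V) (fst W), urep_tensor G W V))\<rparr>"


section \<open>The algebra of functions on the group\<close>

record ('o, 'm) algebra_data =
  alg_ob :: "'o"
  alg_mult :: "'m"
  alg_unit :: "'m"

text \<open>
  \<open>Fun(G)\<close> has the orthonormal basis of delta functions; the \<open>i\<close>-th one is the delta function at
  \<open>from_nat_into (carrier G) i\<close>, for \<open>i < card (carrier G)\<close>. The group acts by
  \<open>(g f)(h) = f(g\<inverse> h)\<close>, i.e. \<open>\<delta>\<^sub>h\<close> is mapped to \<open>\<delta>\<close> at \<open>g h\<close>; multiplication is pointwise.
\<close>

definition fun_ob :: "('g, 'b) monoid_scheme \<Rightarrow> 'g urep" where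
  "fun_ob G = (card (carrier G), \<lambda>g \<in> carrier G.
     mat (card (carrier G)) (card (carrier G)) (\<lambda>(i, j).
       if from_nat_into (carrier G) i = g \<otimes>\<^bsub>G\<^esub> from_nat_into (carrier G) j then 1 else 0))"

definition fun_alg :: "('g, 'b) monoid_scheme
    \<Rightarrow> ('g urep, 'g urep \<times> complex mat \<times> 'g urep) algebra_data" where
  "fun_alg G = (let n = card (carrier G) in \<lparr>
     alg_ob = fun_ob G,
     alg_mult = (urep_tensor G (fun_ob G) (fun_ob G),
                 mat n (n * n) (\<lambda>(i, j). if i = j div n \<and> i = j mod n then 1 else 0),
                 fun_ob G),
     alg_unit = (urep_unit G, mat n 1 (\<lambda>_. 1), fun_ob G)\<rparr>)"

text \<open>
  The algebra automorphism of \<open>Fun(G)\<close> given by \<open>g\<close> is the translation \<open>f \<mapsto> f(\<cdot> g\<inverse>)\<close>, mapping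
  \<open>\<delta>\<^sub>h\<close> to \<open>\<delta>\<close> at \<open>h g\<close>. It reverses products, \<open>a(g) a(h) = a(h g)\<close>, which is exactly what makes
  \<open>T\<^sub>g (Y, \<rho>) = (Y, \<rho> \<circ> (id \<otimes> a(g)))\<close> satisfy \<open>T\<^sub>g T\<^sub>h = T\<close> at \<open>g h\<close>.
\<close>

definition fun_aut :: "('g, 'b) monoid_scheme \<Rightarrow> 'g \<Rightarrow> 'g urep \<times> complex mat \<times> 'g urep" where
  "fun_aut G g = (fun_ob G,
     mat (card (carrier G)) (card (carrier G)) (\<lambda>(i, j).
       if from_nat_into (carrier G) i = from_nat_into (carrier G) j \<otimes>\<^bsub>G\<^esub> g then 1 else 0),
     fun_ob G)"

definition image_alg :: "('p, 'n, 'z) braided_data_scheme \<Rightarrow> ('o, 'm, 'p, 'n) tensor_functor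
    \<Rightarrow> ('o, 'm) algebra_data \<Rightarrow> ('p, 'n) algebra_data" where
  "image_alg D F A = \<lparr>
     alg_ob = F_ob F (alg_ob A),
     alg_mult = F_arr F (alg_mult A) \<cdot>\<^bsub>D\<^esub> F_tensor F (alg_ob A) (alg_ob A),
     alg_unit = F_arr F (alg_unit A) \<cdot>\<^bsub>D\<^esub> F_unit F\<rparr>"


section \<open>Modules and deequivariantization\<close>

definition right_modules :: "('o, 'm, 'z) braided_data_scheme \<Rightarrow> ('o, 'm) algebra_data
    \<Rightarrow> ('o \<times> 'm) set" where
  "right_modules C A = {(X, \<rho>). X \<in> Ob C \<and> \<rho> \<in> Hom C (X \<star>\<^bsub>C\<^esub> alg_ob A) X \<and>
     \<rho> \<cdot>\<^bsub>C\<^esub> (\<rho> \<diamondop>\<^bsub>C\<^esub> ident C (alg_ob A))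
       = \<rho> \<cdot>\<^bsub>C\<^esub> (ident C X \<diamondop>\<^bsub>C\<^esub> alg_mult A) \<cdot>\<^bsub>C\<^esub> assr C X (alg_ob A) (alg_ob A) \<and>
     \<rho> \<cdot>\<^bsub>C\<^esub> (ident C X \<diamondop>\<^bsub>C\<^esub> alg_unit A) = runit C X}"

definition module_maps :: "('o, 'm, 'z) braided_data_scheme \<Rightarrow> ('o, 'm) algebra_data
    \<Rightarrow> 'o \<times> 'm \<Rightarrow> 'o \<times> 'm \<Rightarrow> 'm set" where
  "module_maps C A M N = {f \<in> Hom C (fst M) (fst N).
     f \<cdot>\<^bsub>C\<^esub> snd M = snd N \<cdot>\<^bsub>C\<^esub> (f \<diamondop>\<^bsub>C\<^esub> ident C (alg_ob A))}"

text \<open>The inverse of the (unitary) braiding is its adjoint.\<close>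

definition left_action :: "('o, 'm, 'z) braided_data_scheme \<Rightarrow> ('o, 'm) algebra_data
    \<Rightarrow> 'o \<times> 'm \<Rightarrow> 'm" where
  "left_action C A M = snd M \<cdot>\<^bsub>C\<^esub> (braid C (fst M) (alg_ob A))\<dagger>\<^bsub>C\<^esub>"

definition is_coequalizer :: "('o, 'm, 'z) category_data_scheme \<Rightarrow> 'm \<Rightarrow> 'm \<Rightarrow> 'm \<Rightarrow> bool" where
  "is_coequalizer C f g q \<longleftrightarrow> q \<in> Arr C \<and> source C q = target C f \<and>
     q \<cdot>\<^bsub>C\<^esub> f = q \<cdot>\<^bsub>C\<^esub> g \<and>
     (\<forall>W \<in> Ob C. \<forall>h \<in> Hom C (target C f) W. h \<cdot>\<^bsub>C\<^esub> f = h \<cdot>\<^bsub>C\<^esub> g \<longrightarrow>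
        (\<exists>!k. k \<in> Hom C (target C q) W \<and> k \<cdot>\<^bsub>C\<^esub> q = h))"

text \<open>
  \<open>P\<close> is a tensor product over \<open>A\<close> of \<open>M\<close> and \<open>N\<close> if its underlying object is the coequalizer
  of the two actions of \<open>A\<close> on \<open>M \<star> N\<close>, with the right action induced from that of \<open>N\<close>.
\<close>

definition is_tensor_over :: "('o, 'm, 'z) braided_data_scheme \<Rightarrow> ('o, 'm) algebra_data
    \<Rightarrow> 'o \<times> 'm \<Rightarrow> 'o \<times> 'm \<Rightarrow> 'o \<times> 'm \<Rightarrow> bool" where
  "is_tensor_over C A M N P \<longleftrightarrow> P \<in> right_modules C A \<and>
     (\<exists>q \<in> Hom C (fst M \<star>\<^bsub>C\<^esub> fst N) (fst P).
        is_coequalizer C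
          (snd M \<diamondop>\<^bsub>C\<^esub> ident C (fst N))
          ((ident C (fst M) \<diamondop>\<^bsub>C\<^esub> left_action C A N) \<cdot>\<^bsub>C\<^esub> assr C (fst M) (alg_ob A) (fst N)) q \<and>
        snd P \<cdot>\<^bsub>C\<^esub> (q \<diamondop>\<^bsub>C\<^esub> ident C (alg_ob A))
          = q \<cdot>\<^bsub>C\<^esub> (ident C (fst M) \<diamondop>\<^bsub>C\<^esub> snd N) \<cdot>\<^bsub>C\<^esub> assr C (fst M) (fst N) (alg_ob A))"

definition Module_Cat :: "('o, 'm, 'z) braided_data_scheme \<Rightarrow> ('o, 'm) algebra_data
    \<Rightarrow> ('o \<times> 'm, ('o \<times> 'm) \<times> 'm \<times> ('o \<times> 'm)) tensor_data" where
  "Module_Cat C A = \<lparr>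
     Ob = right_modules C A,
     Arr = {(M, f, N). M \<in> right_modules C A \<and> N \<in> right_modules C A \<and> f \<in> module_maps C A M N},
     source = (\<lambda>(M, f, N). M),
     target = (\<lambda>(M, f, N). N),
     ident = (\<lambda>M. (M, ident C (fst M), M)),
     cmp = (\<lambda>(_, g, N) (M, f, _). (M, g \<cdot>\<^bsub>C\<^esub> f, N)),
     tensor_ob = (\<lambda>M N. SOME P. is_tensor_over C A M N P),
     unit_ob = (alg_ob A, alg_mult A)\<rparr>"

definition free_module :: "('o, 'm, 'z) braided_data_scheme \<Rightarrow> ('o, 'm) algebra_data
    \<Rightarrow> 'o \<Rightarrow> 'o \<times> 'm" where
  "free_module C A X = (X \<star>\<^bsub>C\<^esub> alg_ob A,
     (ident C X \<diamondop>\<^bsub>C\<^esub> alg_mult A) \<cdot>\<^bsub>C\<^esub> assr C X (alg_ob A) (alg_ob A))"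

type_synonym ('g, 'o, 'm) rep_embedding =
  "('g urep, 'g urep \<times> complex mat \<times> 'g urep, 'o, 'm) tensor_functor"

definition deequivariantization :: "('g, 'b) monoid_scheme \<Rightarrow> ('o, 'm, 'z) braided_data_scheme
    \<Rightarrow> ('g, 'o, 'm) rep_embedding \<Rightarrow> ('o \<times> 'm, ('o \<times> 'm) \<times> 'm \<times> ('o \<times> 'm)) tensor_data" where
  "deequivariantization G B F = Module_Cat B (image_alg B F (fun_alg G))"

definition act_ob :: "('g, 'b) monoid_scheme \<Rightarrow> ('o, 'm, 'z) braided_data_scheme
    \<Rightarrow> ('g, 'o, 'm) rep_embedding \<Rightarrow> 'g \<Rightarrow> 'o \<times> 'm \<Rightarrow> 'o \<times> 'm" where
  "act_ob G B F g M =
     (fst M, snd M \<cdot>\<^bsub>B\<^esub> (ident B (fst M) \<diamondop>\<^bsub>B\<^esub> F_arr F (fun_aut G g)))"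

definition act_arr :: "('g, 'b) monoid_scheme \<Rightarrow> ('o, 'm, 'z) braided_data_scheme
    \<Rightarrow> ('g, 'o, 'm) rep_embedding \<Rightarrow> 'g
    \<Rightarrow> ('o \<times> 'm) \<times> 'm \<times> ('o \<times> 'm) \<Rightarrow> ('o \<times> 'm) \<times> 'm \<times> ('o \<times> 'm)" where
  "act_arr G B F g = (\<lambda>(M, f, N). (act_ob G B F g M, f, act_ob G B F g N))"

text \<open>
  A module isomorphism is unitary if its underlying morphism in \<open>B\<close> is. The action is strict,
  so no coherence isomorphisms occur in the cocycle condition.
\<close>

definition unitary_equivariant_structure :: "('g, 'b) monoid_scheme
    \<Rightarrow> ('o, 'm, 'z) braided_data_scheme \<Rightarrow> ('g, 'o, 'm) rep_embedding \<Rightarrow> 'o \<times> 'm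
    \<Rightarrow> ('g \<Rightarrow> ('o \<times> 'm) \<times> 'm \<times> ('o \<times> 'm)) \<Rightarrow> bool" where
  "unitary_equivariant_structure G B F y v \<longleftrightarrow>
     (\<forall>g \<in> carrier G. v g \<in> Hom (deequivariantization G B F) (act_ob G B F g y) y \<and>
        unitary_arr B (fst (snd (v g)))) \<and>
     (\<forall>g \<in> carrier G. \<forall>h \<in> carrier G.
        v (g \<otimes>\<^bsub>G\<^esub> h) = v g \<cdot>\<^bsub>deequivariantization G B F\<^esub> act_arr G B F g (v h))"

definition Inv_lift :: "('g, 'b) monoid_scheme \<Rightarrow> ('o, 'm, 'z) braided_data_scheme
    \<Rightarrow> ('g, 'o, 'm) rep_embedding \<Rightarrow> ('o \<times> 'm) set monoid" where
  "Inv_lift G B F = (Inv (deequivariantization G B F))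
     \<lparr>carrier := {iso_class (deequivariantization G B F) y | y.
        invertible_ob (deequivariantization G B F) y \<and>
        (\<exists>v. unitary_equivariant_structure G B F y v)}\<rparr>"


section \<open>The exact sequence\<close>

definition U1 :: "complex monoid" where
  "U1 = \<lparr>carrier = {z. cmod z = 1}, monoid.mult = (*), one = 1\<rparr>"

definition dual_group :: "('g, 'b) monoid_scheme \<Rightarrow> ('g \<Rightarrow> complex) monoid" where
  "dual_group G = \<lparr>carrier = hom G U1 \<inter> extensional (carrier G),
     monoid.mult = (\<lambda>\<phi> \<psi>. \<lambda>g \<in> carrier G. \<phi> g * \<psi> g),
     one = (\<lambda>g \<in> carrier G. 1)\<rparr>"

definition character_rep :: "('g, 'b) monoid_scheme \<Rightarrow> ('g \<Rightarrow> complex) \<Rightarrow> 'g urep" where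
  "character_rep G \<phi> = (1, \<lambda>g \<in> carrier G. mat 1 1 (\<lambda>_. \<phi> g))"

definition character_map :: "('g, 'b) monoid_scheme \<Rightarrow> ('o, 'm, 'z) braided_data_scheme
    \<Rightarrow> ('g, 'o, 'm) rep_embedding \<Rightarrow> ('g \<Rightarrow> complex) \<Rightarrow> 'o set" where
  "character_map G B F \<phi> = iso_class B (F_ob F (character_rep G \<phi>))"

definition free_module_map :: "('g, 'b) monoid_scheme \<Rightarrow> ('o, 'm, 'z) braided_data_scheme
    \<Rightarrow> ('g, 'o, 'm) rep_embedding \<Rightarrow> 'o set \<Rightarrow> ('o \<times> 'm) set" where
  "free_module_map G B F c =
     (\<Union>X\<in>c. iso_class (deequivariantization G B F)
               (free_module B (image_alg B F (fun_alg G)) X))"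

text \<open>
  The library's \<open>short_exact_sequence\<close> forces all groups to have elements of one type; this is
  the same notion for groups of different types, in the order \<open>0 \<rightarrow> K \<rightarrow> H \<rightarrow> Q \<rightarrow> 0\<close>.
\<close>

definition short_exact :: "('a, 'x) monoid_scheme \<Rightarrow> ('b, 'y) monoid_scheme
    \<Rightarrow> ('c, 'z) monoid_scheme \<Rightarrow> ('a \<Rightarrow> 'b) \<Rightarrow> ('b \<Rightarrow> 'c) \<Rightarrow> bool" where
  "short_exact K H Q i p \<longleftrightarrow> group K \<and> group H \<and> group Q \<and> i \<in> mon K H \<and> p \<in> epi H Q \<and>
     i ` carrier K = kernel H Q p"

end

theory Submission imports Defs "HOL-Algebra.Multiplicative_Group" begin

text \<open>
  Let \<open>A\<close> be the image of \<open>Fun(G)\<close> in the braided category, let \<open>a g\<close> be its translation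
  automorphisms and \<open>n\<close> the order of \<open>G\<close>. The second map of the sequence sends \<open>X\<close> to the free
  module \<open>X \<otimes> A\<close>, the first sends a character to the image of the corresponding one-dimensional
  representation.

  \<^emph>\<open>The free module map is a homomorphism into the lifted modules.\<close> If \<open>M\<close> is isomorphic to
  \<open>X \<otimes> A\<close>, the coequalizer that defines \<open>M \<otimes>\<^sub>A N\<close> is split, with quotient \<open>X \<otimes> N\<close>
  (\<open>tensor_over_free\<close>, \<open>tensor_ob_free\<close>). So only tensor products in which one factor is free are
  ever computed, and \<open>(X \<otimes> A) \<otimes>\<^sub>A (Y \<otimes> A)\<close> is \<open>(X \<otimes> Y) \<otimes> A\<close>. The adjoints of the morphisms
  \<open>X \<otimes> a g\<close> form an equivariant structure on \<open>X \<otimes> A\<close>.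

  \<^emph>\<open>Surjectivity.\<close> A unitary equivariant structure \<open>V\<close> on a module \<open>(Y, \<rho>)\<close> gives the projection
  \<open>(1/n) \<Sum> V g\<close>, which splits through an isometry \<open>\<iota>\<close> from an object \<open>X\<close> to \<open>Y\<close>. As in Galois
  descent, \<open>\<rho> \<circ> (\<iota> \<otimes> A)\<close> is an isomorphism from \<open>X \<otimes> A\<close> to \<open>Y\<close>. Its inverse is written down
  with the element \<open>t = \<Sum> \<delta>\<^sub>g \<otimes> \<delta>\<^sub>g\<close> of \<open>A \<otimes> A\<close>, which satisfies \<open>\<mu> \<circ> (A \<otimes> a g) \<circ> t = 0\<close> for
  \<open>g \<noteq> 1\<close> and \<open>\<mu> \<circ> t = \<eta>\<close> (\<open>equivariant_free\<close>).

  It remains to see that \<open>X\<close> is invertible if \<open>Y\<close> is (\<open>invertible_base\<close>). Let \<open>(Z, \<rho>)\<close> be an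
  inverse of \<open>Y\<close>, so that \<open>X \<otimes> Z\<close> and \<open>A\<close> are isomorphic modules. A morphism from \<open>X\<close> to \<open>X \<otimes> A\<close>,
  followed by the action on \<open>Z\<close>, is a module endomorphism of \<open>X \<otimes> Z\<close> and hence a scalar. It can be
  recovered from that scalar, so \<open>Hom(X, X \<otimes> A)\<close> is one-dimensional. With a dual \<open>D\<close> of \<open>X\<close>, the
  space \<open>Hom(X \<otimes> D, A)\<close> is then spanned by the evaluation followed by the unit of \<open>A\<close>. Since
  \<open>D\<close> is a direct summand of \<open>Z\<close>, the identity of \<open>X \<otimes> D\<close> factors through \<open>A\<close>, hence through the
  evaluation, which is therefore invertible.

  \<^emph>\<open>The kernel.\<close> Let \<open>\<theta>\<close> be an isomorphism from \<open>X \<otimes> A\<close> to \<open>A\<close>. Since \<open>A\<close> has only scalar module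
  endomorphisms, \<open>\<theta> \<circ> (X \<otimes> a g) = c(g) a g \<circ> \<theta>\<close> with a character \<open>c\<close>. Summing over \<open>g\<close> gives
  \<open>X \<otimes> \<eta>\<eta>\<^sup>*\<close> on the left and a multiple of the projection onto an isotypic component of \<open>A\<close> on the
  right, so \<open>\<theta>\<close> identifies \<open>X\<close> with the image of a character (\<open>trivial_free_character\<close>). The
  converse is the descent statement, applied to \<open>A\<close> with its action twisted by the character
  (\<open>character_free\<close>). Full faithfulness makes the map from characters to objects injective.

  All facts about \<open>Fun(G)\<close> that enter are collected in the locale \<open>galois_algebra\<close>. They are
  identities between explicit matrices, and are transported along the embedding.
\<close>


section \<open>Morphisms in C*-categories\<close>

context category
begin

lemma Hom_iff: "f \<in> Hom C X Y \<longleftrightarrow> f \<in> Arr C \<and> source C f = X \<and> target C f = Y"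
  by (auto simp: Hom_def)

lemma Arr_Hom: "f \<in> Arr C \<Longrightarrow> f \<in> Hom C (source C f) (target C f)"
  by (simp add: Hom_iff)

lemma Hom_Ob: assumes "f \<in> Hom C X Y" shows "X \<in> Ob C" and "Y \<in> Ob C"
  using assms source_Ob target_Ob by (auto simp: Hom_iff)

lemmas Ob_simps [simp] = source_Ob target_Ob

lemma ident_simps [simp]:
  assumes "X \<in> Ob C"
  shows "ident C X \<in> Arr C" "source C (ident C X) = X" "target C (ident C X) = X"
  using ident_Hom[OF assms] by (auto simp: Hom_iff)

lemma cmp_simps [simp]:
  assumes "f \<in> Arr C" "g \<in> Arr C" "source C g = target C f"
  shows "g \<cdot> f \<in> Arr C" "source C (g \<cdot> f) = source C f" "target C (g \<cdot> f) = target C g"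
  using cmp_Hom[of f "source C f" "target C f" g "target C g"] assms by (auto simp: Hom_iff)

lemma ident_left [simp]: "f \<in> Arr C \<Longrightarrow> target C f = Y \<Longrightarrow> ident C Y \<cdot> f = f"
  using ident_cmp[OF Arr_Hom] by auto

lemma ident_right [simp]: "f \<in> Arr C \<Longrightarrow> source C f = X \<Longrightarrow> f \<cdot> ident C X = f"
  using cmp_ident[OF Arr_Hom] by auto

lemma assoc [simp]:
  assumes "f \<in> Arr C" "g \<in> Arr C" "h \<in> Arr C" "source C g = target C f" "source C h = target C g"
  shows "(h \<cdot> g) \<cdot> f = h \<cdot> (g \<cdot> f)"
  using cmp_assoc[of f "source C f" "target C f" g "target C g" h "target C h"] assms
  by (simp add: Hom_iff)

text \<open>
  Composites are kept in right-nested form. An equation between composites that is to be used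
  inside a longer chain needs a second version with an arbitrary further factor on the right.
\<close>

lemma chain2:
  assumes "g \<cdot> f = k" "h \<in> Arr C" "f \<in> Arr C" "g \<in> Arr C"
    "target C h = source C f" "source C g = target C f"
  shows "g \<cdot> (f \<cdot> h) = k \<cdot> h"
  using assms by (metis assoc)

lemma chain3:
  assumes "g \<cdot> (f \<cdot> e) = k" "h \<in> Arr C" "e \<in> Arr C" "f \<in> Arr C" "g \<in> Arr C"
    "target C h = source C e" "source C f = target C e" "source C g = target C f"
  shows "g \<cdot> (f \<cdot> (e \<cdot> h)) = k \<cdot> h"
proof -
  have "g \<cdot> (f \<cdot> (e \<cdot> h)) = (g \<cdot> (f \<cdot> e)) \<cdot> h" using assms(2-) by simp
  then show ?thesis using assms(1) by simp
qed

definition inverse_arrs :: "'m \<Rightarrow> 'm \<Rightarrow> bool" where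
  "inverse_arrs f g \<longleftrightarrow> f \<in> Arr C \<and> g \<in> Arr C \<and> source C g = target C f \<and> target C g = source C f
     \<and> g \<cdot> f = ident C (source C f) \<and> f \<cdot> g = ident C (target C f)"

lemma inverse_arrs_sym: "inverse_arrs f g \<Longrightarrow> inverse_arrs g f"
  by (auto simp: inverse_arrs_def)

lemma inverse_arrs_cmp:
  assumes "inverse_arrs f f'" "inverse_arrs g g'" "source C g = target C f"
  shows "inverse_arrs (g \<cdot> f) (f' \<cdot> g')"
proof -
  have *: "f \<in> Arr C" "f' \<in> Arr C" "g \<in> Arr C" "g' \<in> Arr C" "source C f' = target C f"
    "target C f' = source C f" "source C g' = target C g" "target C g' = target C f"
    "f' \<cdot> f = ident C (source C f)" "f \<cdot> f' = ident C (target C f)"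
    "g' \<cdot> g = ident C (target C f)" "g \<cdot> g' = ident C (target C g)"
    using assms by (auto simp: inverse_arrs_def)
  show ?thesis unfolding inverse_arrs_def
    using * assms(3) chain2[OF *(11)] chain2[OF *(10)] by simp
qed

lemma iso_ob_iff: "iso_ob C X Y \<longleftrightarrow> (\<exists>f g. inverse_arrs f g \<and> source C f = X \<and> target C f = Y)"
  unfolding iso_ob_def inverse_arrs_def Bex_def Hom_iff by auto

lemma iso_obI: "inverse_arrs f g \<Longrightarrow> iso_ob C (source C f) (target C f)"
  using iso_ob_iff by blast

lemma iso_ob_refl: "X \<in> Ob C \<Longrightarrow> iso_ob C X X"
  using iso_obI[of "ident C X" "ident C X"] by (simp add: inverse_arrs_def)

lemma iso_ob_sym: "iso_ob C X Y \<Longrightarrow> iso_ob C Y X"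
  unfolding iso_ob_iff using inverse_arrs_sym by (metis inverse_arrs_def)

lemma iso_ob_trans: assumes "iso_ob C X Y" "iso_ob C Y Z" shows "iso_ob C X Z"
proof -
  obtain f f' g g' where "inverse_arrs f f'" "source C f = X" "target C f = Y"
    "inverse_arrs g g'" "source C g = Y" "target C g = Z"
    using assms unfolding iso_ob_iff by blast
  then show ?thesis
    using iso_obI[OF inverse_arrs_cmp[of f f' g g']] by (simp add: inverse_arrs_def)
qed

lemma iso_ob_Ob: "iso_ob C X Y \<Longrightarrow> X \<in> Ob C" "iso_ob C X Y \<Longrightarrow> Y \<in> Ob C"
  by (auto simp: iso_ob_iff inverse_arrs_def)

lemma mem_iso_class: "Y \<in> iso_class C X \<longleftrightarrow> iso_ob C X Y"
  using iso_ob_Ob by (auto simp: iso_class_def)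

lemma iso_class_eq_iff: "X \<in> Ob C \<Longrightarrow> iso_class C X = iso_class C Y \<longleftrightarrow> iso_ob C X Y"
  using iso_ob_refl iso_ob_sym iso_ob_trans mem_iso_class by blast

lemma iso_class_eqI: "iso_ob C X Y \<Longrightarrow> iso_class C X = iso_class C Y"
  using iso_class_eq_iff iso_ob_Ob by blast

lemma UN_iso_class:
  assumes "X \<in> Ob C" "\<And>X'. iso_ob C X X' \<Longrightarrow> h X' = S"
  shows "(\<Union>X'\<in>iso_class C X. h X') = S"
  using assms iso_ob_refl[of X] by (auto simp: mem_iso_class)

end

context cstar_category
begin

lemma adj_simps [simp]:
  assumes "f \<in> Arr C"
  shows "f\<dagger> \<in> Arr C" "source C (f\<dagger>) = target C f" "target C (f\<dagger>) = source C f" "(f\<dagger>)\<dagger> = f"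
  using adj_Hom[OF Arr_Hom[OF assms]] adj_adj[OF Arr_Hom[OF assms]] by (auto simp: Hom_iff)

lemma adj_cmp' [simp]:
  assumes "f \<in> Arr C" "g \<in> Arr C" "source C g = target C f"
  shows "(g \<cdot> f)\<dagger> = f\<dagger> \<cdot> g\<dagger>"
  using adj_cmp[of f "source C f" "target C f" g "target C g"] assms by (simp add: Hom_iff)

lemma adj_ident [simp]:
  assumes "X \<in> Ob C" shows "(ident C X)\<dagger> = ident C X"
proof -
  have "(ident C X)\<dagger> = (((ident C X)\<dagger> \<cdot> ident C X)\<dagger>)\<dagger>" using assms by simp
  also have "\<dots> = ident C X" using assms by (subst adj_cmp') auto
  finally show ?thesis .
qed

lemma scale_simps [simp]:
  assumes "f \<in> Arr C"
  shows "c *\<^sub>a f \<in> Arr C" "source C (c *\<^sub>a f) = source C f" "target C (c *\<^sub>a f) = target C f"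
  using scale_Hom[OF Arr_Hom[OF assms]] by (auto simp: Hom_iff)

lemma add_simps [simp]:
  assumes "f \<in> Arr C" "g \<in> Arr C" "source C g = source C f" "target C g = target C f"
  shows "f \<^bold>+ g \<in> Arr C" "source C (f \<^bold>+ g) = source C f" "target C (f \<^bold>+ g) = target C f"
  using add_Hom[of f "source C f" "target C f" g] assms by (auto simp: Hom_iff)

lemma zero_simps [simp]:
  assumes "X \<in> Ob C" "Y \<in> Ob C"
  shows "zero_arr C X Y \<in> Arr C" "source C (zero_arr C X Y) = X" "target C (zero_arr C X Y) = Y"
  using zero_Hom[OF assms] by (auto simp: Hom_iff)

lemma cmp_scale' [simp]:
  assumes "f \<in> Arr C" "g \<in> Arr C" "source C g = target C f"
  shows "g \<cdot> (c *\<^sub>a f) = c *\<^sub>a (g \<cdot> f)"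
  using cmp_scale[of f "source C f" "target C f" g "target C g"] assms by (simp add: Hom_iff)

lemma scale_cmp' [simp]:
  assumes "f \<in> Arr C" "g \<in> Arr C" "source C g = target C f"
  shows "(c *\<^sub>a g) \<cdot> f = c *\<^sub>a (g \<cdot> f)"
  using scale_cmp[of f "source C f" "target C f" g "target C g"] assms by (simp add: Hom_iff)

lemma scale_scale' [simp]: "f \<in> Arr C \<Longrightarrow> c *\<^sub>a (d *\<^sub>a f) = (c * d) *\<^sub>a f"
  using scale_scale[OF Arr_Hom] by auto

lemma one_scale' [simp]: "f \<in> Arr C \<Longrightarrow> 1 *\<^sub>a f = f"
  using one_scale[OF Arr_Hom] by auto

lemma adj_scale' [simp]: "f \<in> Arr C \<Longrightarrow> (c *\<^sub>a f)\<dagger> = cnj c *\<^sub>a f\<dagger>"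
  using adj_scale[OF Arr_Hom] by auto

lemma scale_zero [simp]:
  assumes "X \<in> Ob C" "Y \<in> Ob C" shows "c *\<^sub>a zero_arr C X Y = zero_arr C X Y"
proof -
  let ?o = "zero_arr C X Y"
  have o: "?o \<in> Hom C X Y" using zero_Hom assms .
  have "?o = ?o \<^bold>+ (-1) *\<^sub>a ?o" using add_neg[OF o] by simp
  then have "c *\<^sub>a ?o = c *\<^sub>a ?o \<^bold>+ (-1) *\<^sub>a (c *\<^sub>a ?o)"
    using scale_add[OF o scale_Hom[OF o], of c "-1"] o by (simp add: Hom_iff)
  then show ?thesis using add_neg[OF scale_Hom[OF o]] by metis
qed

lemma zero_scale [simp]: assumes "f \<in> Arr C" shows "0 *\<^sub>a f = zero_arr C (source C f) (target C f)"
  using add_scale[OF Arr_Hom[OF assms], of 1 "-1"] add_neg[OF Arr_Hom[OF assms]] assms by simp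

lemma cmp_zero [simp]:
  assumes "g \<in> Arr C" "X \<in> Ob C" "source C g = Y"
  shows "g \<cdot> zero_arr C X Y = zero_arr C X (target C g)"
proof -
  have "g \<cdot> (0 *\<^sub>a zero_arr C X Y) = 0 *\<^sub>a (g \<cdot> zero_arr C X Y)"
    using assms by (intro cmp_scale') auto
  then show ?thesis using assms by (auto simp del: cmp_scale')
qed

lemma zero_cmp [simp]:
  assumes "f \<in> Arr C" "Y \<in> Ob C" "target C f = X"
  shows "zero_arr C X Y \<cdot> f = zero_arr C (source C f) Y"
proof -
  have "(0 *\<^sub>a zero_arr C X Y) \<cdot> f = 0 *\<^sub>a (zero_arr C X Y \<cdot> f)"
    using assms by (intro scale_cmp') auto
  then show ?thesis using assms by (auto simp del: scale_cmp')
qed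

lemma adj_zero [simp]:
  assumes "X \<in> Ob C" "Y \<in> Ob C" shows "(zero_arr C X Y)\<dagger> = zero_arr C Y X"
proof -
  have "(0 *\<^sub>a zero_arr C X Y)\<dagger> = 0 *\<^sub>a (zero_arr C X Y)\<dagger>"
    using assms by (subst adj_scale') simp_all
  then show ?thesis using assms by (simp del: adj_scale')
qed

lemma scale_eq_zeroD:
  assumes "c *\<^sub>a f = zero_arr C X Y" "f \<in> Hom C X Y" "c \<noteq> 0"
  shows "f = zero_arr C X Y"
proof -
  have "f = inverse c *\<^sub>a (c *\<^sub>a f)" using assms(2,3) by (simp add: Hom_iff)
  also have "\<dots> = zero_arr C X Y" using assms Hom_Ob[OF assms(2)] by simp
  finally show ?thesis .
qed

lemma scale_cancel:
  assumes "c *\<^sub>a f = d *\<^sub>a f" "f \<in> Hom C X Y" "f \<noteq> zero_arr C X Y"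
  shows "c = d"
proof (rule ccontr)
  assume "c \<noteq> d"
  have "(c + - d) *\<^sub>a f = c *\<^sub>a f \<^bold>+ (-1) *\<^sub>a (d *\<^sub>a f)"
    using add_scale[OF assms(2), of c "-d"] assms(2) by (simp add: Hom_iff)
  also have "\<dots> = zero_arr C X Y" using assms(1) add_neg[OF scale_Hom[OF assms(2)]] by metis
  finally show False using scale_eq_zeroD[OF _ assms(2), of "c + - d"] \<open>c \<noteq> d\<close> assms(3) by auto
qed

lemma adj_cmp_zeroD:
  assumes "f \<in> Hom C X Y" "f\<dagger> \<cdot> f = zero_arr C X X" shows "f = zero_arr C X Y"
proof -
  obtain N where N: "cstar_norm C N" using ex_norm by blast
  have "X \<in> Ob C" "Y \<in> Ob C" using Hom_Ob assms(1) by auto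
  then have "N (f\<dagger> \<cdot> f) = (N f)\<^sup>2" "N f = 0 \<longleftrightarrow> f = zero_arr C X Y" "N (zero_arr C X X) = 0"
    using N assms(1) zero_Hom[of X X] unfolding cstar_norm_def by blast+
  then show ?thesis using assms(2) by simp
qed

lemma unitaryD:
  assumes "unitary_arr C f"
  shows "f \<in> Arr C" "f\<dagger> \<cdot> f = ident C (source C f)" "f \<cdot> f\<dagger> = ident C (target C f)"
  using assms by (auto simp: unitary_arr_def)

text \<open>
  The section is a parameter because every morphism to be cancelled comes with one: it is a composite of
  coherence isomorphisms or a split quotient map.
\<close>

lemma epi_cancel:
  assumes "f \<cdot> e = g \<cdot> e" "e \<cdot> e' = ident C Y" "e \<in> Hom C X Y" "e' \<in> Hom C Y X"
    "f \<in> Hom C Y Z" "g \<in> Hom C Y Z"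
  shows "f = g"
proof -
  have "f = (f \<cdot> e) \<cdot> e'" "g = (g \<cdot> e) \<cdot> e'" using assms(2-) by (auto simp: Hom_iff)
  then show ?thesis using assms(1) by simp
qed

lemma mono_cancel:
  assumes "e \<cdot> f = e \<cdot> g" "e' \<cdot> e = ident C Y" "e \<in> Hom C Y X" "e' \<in> Hom C X Y"
    "f \<in> Hom C Z Y" "g \<in> Hom C Z Y"
  shows "f = g"
proof -
  have "f = e' \<cdot> (e \<cdot> f)" "g = e' \<cdot> (e \<cdot> g)"
    using chain2[OF assms(2)] assms(3-) by (simp_all add: Hom_iff)
  then show ?thesis using assms(1) by simp
qed

end


section \<open>Coherence in tensor categories\<close>

context cstar_tensor_category
begin

text \<open>
  Tensoring with an identity on the left and on the right. In this form a composite is a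
  sequence of steps that change one factor at a time.
\<close>

abbreviation lwhisk (infixr \<open>\<triangleright>\<close> 85) where "X \<triangleright> f \<equiv> ident C X \<diamondop> f"
abbreviation rwhisk (infixl \<open>\<triangleleft>\<close> 84) where "f \<triangleleft> X \<equiv> f \<diamondop> ident C X"

lemmas tensor_Ob' [simp] = tensor_Ob unit_Ob

lemma tensor_simps [simp]:
  assumes "f \<in> Arr C" "g \<in> Arr C"
  shows "f \<diamondop> g \<in> Arr C" "source C (f \<diamondop> g) = source C f \<star> source C g"
    "target C (f \<diamondop> g) = target C f \<star> target C g"
  using tensor_Hom[OF Arr_Hom[OF assms(1)] Arr_Hom[OF assms(2)]] by (auto simp: Hom_iff)

lemma tensor_ident' [simp]: "X \<in> Ob C \<Longrightarrow> Y \<in> Ob C \<Longrightarrow> X \<triangleright> ident C Y = ident C (X \<star> Y)"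
  by (rule tensor_ident)

lemma interchange:
  assumes "f \<in> Arr C" "g \<in> Arr C" "source C g = target C f"
    "f' \<in> Arr C" "g' \<in> Arr C" "source C g' = target C f'"
  shows "(g \<diamondop> g') \<cdot> (f \<diamondop> f') = (g \<cdot> f) \<diamondop> (g' \<cdot> f')"
  using tensor_cmp[of f "source C f" "target C f" g "target C g" f' "source C f'" "target C f'" g'
      "target C g'"] assms by (simp add: Hom_iff)

lemma lwhisk_cmp [simp]:
  assumes "f \<in> Arr C" "g \<in> Arr C" "source C g = target C f" "X \<in> Ob C"
  shows "X \<triangleright> (g \<cdot> f) = (X \<triangleright> g) \<cdot> (X \<triangleright> f)"
  using assms by (simp add: interchange)

lemma rwhisk_cmp [simp]:
  assumes "f \<in> Arr C" "g \<in> Arr C" "source C g = target C f" "X \<in> Ob C"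
  shows "(g \<cdot> f) \<triangleleft> X = (g \<triangleleft> X) \<cdot> (f \<triangleleft> X)"
  using assms by (simp add: interchange)

lemma slide:
  assumes "f \<in> Hom C X X'" "g \<in> Hom C Y Y'"
  shows "(f \<triangleleft> Y') \<cdot> (X \<triangleright> g) = (X' \<triangleright> g) \<cdot> (f \<triangleleft> Y)"
  using assms Hom_Ob[OF assms(1)] Hom_Ob[OF assms(2)] by (simp add: interchange Hom_iff)

lemma tensor_adj' [simp]: "f \<in> Arr C \<Longrightarrow> g \<in> Arr C \<Longrightarrow> (f \<diamondop> g)\<dagger> = f\<dagger> \<diamondop> g\<dagger>"
  using tensor_adj[OF Arr_Hom Arr_Hom] by auto

lemma tensor_scale' [simp]: "f \<in> Arr C \<Longrightarrow> g \<in> Arr C \<Longrightarrow> f \<diamondop> (c *\<^sub>a g) = c *\<^sub>a (f \<diamondop> g)"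
  using tensor_scale[OF Arr_Hom Arr_Hom] by auto

lemma scale_tensor' [simp]: "f \<in> Arr C \<Longrightarrow> g \<in> Arr C \<Longrightarrow> (c *\<^sub>a f) \<diamondop> g = c *\<^sub>a (f \<diamondop> g)"
  using scale_tensor[OF Arr_Hom Arr_Hom] by auto

lemma tensor_zero [simp]:
  assumes "f \<in> Arr C" "X \<in> Ob C" "Y \<in> Ob C"
  shows "f \<diamondop> zero_arr C X Y = zero_arr C (source C f \<star> X) (target C f \<star> Y)"
proof -
  have "f \<diamondop> (0 *\<^sub>a zero_arr C X Y) = 0 *\<^sub>a (f \<diamondop> zero_arr C X Y)"
    using assms by (intro tensor_scale') simp_all
  then show ?thesis using assms by (simp del: tensor_scale')
qed

lemma zero_tensor [simp]:
  assumes "f \<in> Arr C" "X \<in> Ob C" "Y \<in> Ob C"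
  shows "zero_arr C X Y \<diamondop> f = zero_arr C (X \<star> source C f) (Y \<star> target C f)"
proof -
  have "(0 *\<^sub>a zero_arr C X Y) \<diamondop> f = 0 *\<^sub>a (zero_arr C X Y \<diamondop> f)"
    using assms by (intro scale_tensor') simp_all
  then show ?thesis using assms by (simp del: scale_tensor')
qed

lemma assr_simps [simp]:
  assumes "X \<in> Ob C" "Y \<in> Ob C" "Z \<in> Ob C"
  shows "assr C X Y Z \<in> Arr C" "source C (assr C X Y Z) = (X \<star> Y) \<star> Z"
    "target C (assr C X Y Z) = X \<star> (Y \<star> Z)"
    "(assr C X Y Z)\<dagger> \<cdot> assr C X Y Z = ident C ((X \<star> Y) \<star> Z)"
    "assr C X Y Z \<cdot> (assr C X Y Z)\<dagger> = ident C (X \<star> (Y \<star> Z))"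
  using assr_Hom[OF assms] unitaryD[of "assr C X Y Z"] by (auto simp: Hom_iff)

lemma lunit_simps [simp]:
  assumes "X \<in> Ob C"
  shows "lunit C X \<in> Arr C" "source C (lunit C X) = unit_ob C \<star> X" "target C (lunit C X) = X"
    "(lunit C X)\<dagger> \<cdot> lunit C X = ident C (unit_ob C \<star> X)" "lunit C X \<cdot> (lunit C X)\<dagger> = ident C X"
  using lunit_Hom[OF assms] unitaryD[of "lunit C X"] by (auto simp: Hom_iff)

lemma runit_simps [simp]:
  assumes "X \<in> Ob C"
  shows "runit C X \<in> Arr C" "source C (runit C X) = X \<star> unit_ob C" "target C (runit C X) = X"
    "(runit C X)\<dagger> \<cdot> runit C X = ident C (X \<star> unit_ob C)" "runit C X \<cdot> (runit C X)\<dagger> = ident C X"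
  using runit_Hom[OF assms] unitaryD[of "runit C X"] by (auto simp: Hom_iff)

lemma assr_chain [simp]:
  assumes "f \<in> Arr C" "X \<in> Ob C" "Y \<in> Ob C" "Z \<in> Ob C"
  shows "target C f = (X \<star> Y) \<star> Z \<Longrightarrow> (assr C X Y Z)\<dagger> \<cdot> (assr C X Y Z \<cdot> f) = f"
    "target C f = X \<star> (Y \<star> Z) \<Longrightarrow> assr C X Y Z \<cdot> ((assr C X Y Z)\<dagger> \<cdot> f) = f"
  using assms by (simp_all add: chain2[OF assr_simps(4)] chain2[OF assr_simps(5)])

lemma unit_chain [simp]:
  assumes "f \<in> Arr C" "X \<in> Ob C"
  shows "target C f = unit_ob C \<star> X \<Longrightarrow> (lunit C X)\<dagger> \<cdot> (lunit C X \<cdot> f) = f"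
    "target C f = X \<Longrightarrow> lunit C X \<cdot> ((lunit C X)\<dagger> \<cdot> f) = f"
    "target C f = X \<star> unit_ob C \<Longrightarrow> (runit C X)\<dagger> \<cdot> (runit C X \<cdot> f) = f"
    "target C f = X \<Longrightarrow> runit C X \<cdot> ((runit C X)\<dagger> \<cdot> f) = f"
  using assms by (simp_all add: chain2[OF lunit_simps(4)] chain2[OF lunit_simps(5)]
    chain2[OF runit_simps(4)] chain2[OF runit_simps(5)])

lemma assr_nat:
  assumes "f \<in> Arr C" "g \<in> Arr C" "h \<in> Arr C" "target C f = X" "target C g = Y" "target C h = Z"
  shows "assr C X Y Z \<cdot> ((f \<diamondop> g) \<diamondop> h)
    = (f \<diamondop> (g \<diamondop> h)) \<cdot> assr C (source C f) (source C g) (source C h)"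
  using assr_natural[OF assms(1-3)[THEN Arr_Hom]] assms by simp

lemma assr_adj_nat:
  assumes "f \<in> Arr C" "g \<in> Arr C" "h \<in> Arr C" "target C f = X" "target C g = Y" "target C h = Z"
  shows "(assr C X Y Z)\<dagger> \<cdot> (f \<diamondop> (g \<diamondop> h))
    = ((f \<diamondop> g) \<diamondop> h) \<cdot> (assr C (source C f) (source C g) (source C h))\<dagger>"
proof -
  have [simp]: "X \<in> Ob C" "Y \<in> Ob C" "Z \<in> Ob C"
    using target_Ob[of f] target_Ob[of g] target_Ob[of h] assms by simp_all
  have "(f \<diamondop> (g \<diamondop> h)) = assr C X Y Z \<cdot> ((f \<diamondop> g) \<diamondop> h) \<cdot> (assr C (source C f) (source C g) (source C h))\<dagger>"
    using chain2[OF assr_nat[OF assms]] assms by simp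
  then show ?thesis using assms by simp
qed

lemma lunit_nat: "f \<in> Arr C \<Longrightarrow> target C f = Y \<Longrightarrow>
    lunit C Y \<cdot> (unit_ob C \<triangleright> f) = f \<cdot> lunit C (source C f)"
  using lunit_natural[OF Arr_Hom] by auto

lemma runit_nat: "f \<in> Arr C \<Longrightarrow> target C f = Y \<Longrightarrow>
    runit C Y \<cdot> (f \<triangleleft> unit_ob C) = f \<cdot> runit C (source C f)"
  using runit_natural[OF Arr_Hom] by auto

lemma lunit_adj_nat: assumes "f \<in> Arr C" "target C f = Y"
  shows "(lunit C Y)\<dagger> \<cdot> f = (unit_ob C \<triangleright> f) \<cdot> (lunit C (source C f))\<dagger>"
proof -
  have [simp]: "Y \<in> Ob C" using target_Ob[of f] assms by simp
  have "f = lunit C Y \<cdot> (unit_ob C \<triangleright> f) \<cdot> (lunit C (source C f))\<dagger>"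
    using chain2[OF lunit_nat[OF assms]] assms by simp
  then have "(lunit C Y)\<dagger> \<cdot> f
      = (lunit C Y)\<dagger> \<cdot> (lunit C Y \<cdot> (unit_ob C \<triangleright> f) \<cdot> (lunit C (source C f))\<dagger>)" by simp
  also have "\<dots> = (unit_ob C \<triangleright> f) \<cdot> (lunit C (source C f))\<dagger>" using assms by simp
  finally show ?thesis .
qed

lemma runit_adj_nat: assumes "f \<in> Arr C" "target C f = Y"
  shows "(runit C Y)\<dagger> \<cdot> f = (f \<triangleleft> unit_ob C) \<cdot> (runit C (source C f))\<dagger>"
proof -
  have [simp]: "Y \<in> Ob C" using target_Ob[of f] assms by simp
  have "f = runit C Y \<cdot> (f \<triangleleft> unit_ob C) \<cdot> (runit C (source C f))\<dagger>"
    using chain2[OF runit_nat[OF assms]] assms by simp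
  then have "(runit C Y)\<dagger> \<cdot> f
      = (runit C Y)\<dagger> \<cdot> (runit C Y \<cdot> (f \<triangleleft> unit_ob C) \<cdot> (runit C (source C f))\<dagger>)" by simp
  also have "\<dots> = (f \<triangleleft> unit_ob C) \<cdot> (runit C (source C f))\<dagger>" using assms by simp
  finally show ?thesis .
qed

text \<open>
  The unitor is a natural isomorphism from \<open>I \<otimes> -\<close> to the identity functor.
\<close>

lemma lunit_faithful:
  assumes "unit_ob C \<triangleright> f = unit_ob C \<triangleright> g" "f \<in> Hom C X Y" "g \<in> Hom C X Y"
  shows "f = g"
proof -
  have "f = lunit C Y \<cdot> (unit_ob C \<triangleright> f) \<cdot> (lunit C X)\<dagger>" if "f \<in> Hom C X Y" for f
    using chain2[OF lunit_nat[of f Y]] that Hom_Ob[OF that] by (simp add: Hom_iff)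
  then show ?thesis using assms by metis
qed

lemma runit_faithful:
  assumes "f \<triangleleft> unit_ob C = g \<triangleleft> unit_ob C" "f \<in> Hom C X Y" "g \<in> Hom C X Y"
  shows "f = g"
proof -
  have "f = runit C Y \<cdot> (f \<triangleleft> unit_ob C) \<cdot> (runit C X)\<dagger>" if "f \<in> Hom C X Y" for f
    using chain2[OF runit_nat[of f Y]] that Hom_Ob[OF that] by (simp add: Hom_iff)
  then show ?thesis using assms by metis
qed

lemma pentagon_lwhisk:
  assumes [simp]: "W \<in> Ob C" "X \<in> Ob C" "Y \<in> Ob C" "Z \<in> Ob C"
  shows "assr C W (X \<star> Y) Z \<cdot> (assr C W X Y \<triangleleft> Z)
    = (W \<triangleright> (assr C X Y Z)\<dagger>) \<cdot> assr C W X (Y \<star> Z) \<cdot> assr C (W \<star> X) Y Z"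
proof -
  have e: "(W \<triangleright> (assr C X Y Z)\<dagger>) \<cdot> (W \<triangleright> assr C X Y Z) = ident C (W \<star> ((X \<star> Y) \<star> Z))"
    by (simp flip: lwhisk_cmp)
  show ?thesis by (simp flip: pentagon add: chain2[OF e])
qed

lemma triangle':
  assumes [simp]: "X \<in> Ob C" "Y \<in> Ob C"
  shows "(runit C X \<triangleleft> Y) \<cdot> (assr C X (unit_ob C) Y)\<dagger> = X \<triangleright> lunit C Y"
    "assr C X (unit_ob C) Y \<cdot> ((runit C X)\<dagger> \<triangleleft> Y) = X \<triangleright> (lunit C Y)\<dagger>"
proof -
  show "(runit C X \<triangleleft> Y) \<cdot> (assr C X (unit_ob C) Y)\<dagger> = X \<triangleright> lunit C Y"
    by (simp flip: triangle)
  then have "((runit C X \<triangleleft> Y) \<cdot> (assr C X (unit_ob C) Y)\<dagger>)\<dagger> = (X \<triangleright> lunit C Y)\<dagger>" by simp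
  then show "assr C X (unit_ob C) Y \<cdot> ((runit C X)\<dagger> \<triangleleft> Y) = X \<triangleright> (lunit C Y)\<dagger>" by simp
qed

text \<open>
  The three classical consequences of the pentagon and triangle axioms. For the first two,
  tensoring with the unit object is faithful, so that the identities can be checked after
  tensoring, where they follow from the pentagon with one factor equal to the unit.
\<close>

lemma lunit_tensor:
  assumes [simp]: "X \<in> Ob C" "Y \<in> Ob C"
  shows "lunit C (X \<star> Y) \<cdot> assr C (unit_ob C) X Y = lunit C X \<triangleleft> Y"
proof -
  let ?I = "unit_ob C"
  \<comment> \<open>an inverse of the composite of associators that is cancelled below\<close>
  let ?k = "((assr C ?I ?I X \<triangleleft> Y)\<dagger> \<cdot> (assr C ?I (?I \<star> X) Y)\<dagger>)"
  have inv: "(assr C ?I (?I \<star> X) Y \<cdot> (assr C ?I ?I X \<triangleleft> Y)) \<cdot> ?k = ident C (?I \<star> ((?I \<star> X) \<star> Y))"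
  proof -
    have e: "(assr C ?I ?I X \<triangleleft> Y) \<cdot> ((assr C ?I ?I X)\<dagger> \<triangleleft> Y) = ident C ((?I \<star> (?I \<star> X)) \<star> Y)"
      by (simp flip: rwhisk_cmp)
    show ?thesis by (simp add: chain2[OF e])
  qed
  have e2: "(?I \<triangleright> lunit C (X \<star> Y)) \<cdot> (assr C ?I ?I (X \<star> Y) \<cdot> assr C (?I \<star> ?I) X Y)
      = assr C ?I X Y \<cdot> ((runit C ?I \<triangleleft> X) \<triangleleft> Y)"
    using chain2[OF triangle[of ?I "X \<star> Y"]] assr_nat[of "runit C ?I" "ident C X" "ident C Y"]
    by simp
  have e3: "(?I \<triangleright> (lunit C X \<triangleleft> Y)) \<cdot> (assr C ?I (?I \<star> X) Y \<cdot> (assr C ?I ?I X \<triangleleft> Y))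
      = assr C ?I X Y \<cdot> ((runit C ?I \<triangleleft> X) \<triangleleft> Y)"
  proof -
    have "(?I \<triangleright> (lunit C X \<triangleleft> Y)) \<cdot> assr C ?I (?I \<star> X) Y = assr C ?I X Y \<cdot> ((?I \<triangleright> lunit C X) \<triangleleft> Y)"
      using assr_nat[of "ident C ?I" "lunit C X" "ident C Y"] by simp
    from chain2[OF this] show ?thesis by (simp flip: triangle)
  qed
  have "?I \<triangleright> (lunit C (X \<star> Y) \<cdot> assr C ?I X Y) = ?I \<triangleright> (lunit C X \<triangleleft> Y)"
  proof (rule epi_cancel[OF _ inv])
    show "(?I \<triangleright> (lunit C (X \<star> Y) \<cdot> assr C ?I X Y)) \<cdot> (assr C ?I (?I \<star> X) Y \<cdot> (assr C ?I ?I X \<triangleleft> Y))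
      = (?I \<triangleright> (lunit C X \<triangleleft> Y)) \<cdot> (assr C ?I (?I \<star> X) Y \<cdot> (assr C ?I ?I X \<triangleleft> Y))"
      unfolding e3 using pentagon[of ?I ?I X Y] e2 by simp
  qed (simp_all add: Hom_iff)
  then show ?thesis by (rule lunit_faithful) (simp_all add: Hom_iff)
qed

lemma runit_tensor:
  assumes [simp]: "X \<in> Ob C" "Y \<in> Ob C"
  shows "(X \<triangleright> runit C Y) \<cdot> assr C X Y (unit_ob C) = runit C (X \<star> Y)"
proof -
  let ?I = "unit_ob C"
  have "((X \<triangleright> runit C Y) \<cdot> assr C X Y ?I) \<triangleleft> ?I = runit C (X \<star> Y) \<triangleleft> ?I"
  proof (rule mono_cancel)
    show "(assr C X Y ?I)\<dagger> \<cdot> assr C X Y ?I = ident C ((X \<star> Y) \<star> ?I)" by simp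
    have "assr C X Y ?I \<cdot> (((X \<triangleright> runit C Y) \<cdot> assr C X Y ?I) \<triangleleft> ?I)
        = (X \<triangleright> (runit C Y \<triangleleft> ?I)) \<cdot> (assr C X (Y \<star> ?I) ?I \<cdot> (assr C X Y ?I \<triangleleft> ?I))"
      using chain2[OF assr_nat[of "ident C X" "runit C Y" "ident C ?I" X Y ?I]] by simp
    also have "\<dots> = (X \<triangleright> (Y \<triangleright> lunit C ?I)) \<cdot> (X \<triangleright> assr C Y ?I ?I)
        \<cdot> (assr C X (Y \<star> ?I) ?I \<cdot> (assr C X Y ?I \<triangleleft> ?I))"
      using lwhisk_cmp[of "assr C Y ?I ?I" "Y \<triangleright> lunit C ?I" X] by (simp add: triangle)
    also have "\<dots> = (X \<triangleright> (Y \<triangleright> lunit C ?I)) \<cdot> assr C X Y (?I \<star> ?I) \<cdot> assr C (X \<star> Y) ?I ?I"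
      using pentagon[of X Y ?I ?I] by simp
    also have "\<dots> = assr C X Y ?I \<cdot> (((X \<star> Y) \<triangleright> lunit C ?I) \<cdot> assr C (X \<star> Y) ?I ?I)"
      using chain2[OF assr_nat[of "ident C X" "ident C Y" "lunit C ?I" X Y ?I]] by simp
    also have "\<dots> = assr C X Y ?I \<cdot> (runit C (X \<star> Y) \<triangleleft> ?I)" by (simp add: triangle)
    finally show "assr C X Y ?I \<cdot> (((X \<triangleright> runit C Y) \<cdot> assr C X Y ?I) \<triangleleft> ?I)
      = assr C X Y ?I \<cdot> (runit C (X \<star> Y) \<triangleleft> ?I)" .
  qed (simp_all add: Hom_iff)
  then show ?thesis by (rule runit_faithful) (simp_all add: Hom_iff)
qed

lemma lunit_unit: "lunit C (unit_ob C) = runit C (unit_ob C)"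
proof -
  let ?I = "unit_ob C"
  have "lunit C (?I \<star> ?I) = ?I \<triangleright> lunit C ?I"
  proof (rule mono_cancel)
    show "lunit C ?I \<cdot> lunit C (?I \<star> ?I) = lunit C ?I \<cdot> (?I \<triangleright> lunit C ?I)"
      using lunit_nat[of "lunit C ?I"] by simp
    show "(lunit C ?I)\<dagger> \<cdot> lunit C ?I = ident C (?I \<star> ?I)" by simp
  qed (simp_all add: Hom_iff)
  then have "lunit C ?I \<triangleleft> ?I = runit C ?I \<triangleleft> ?I"
    using lunit_tensor[of ?I ?I] triangle[of ?I ?I] by simp
  then show ?thesis by (rule runit_faithful) (simp_all add: Hom_iff)
qed

end


section \<open>Reassociated morphisms and braidings\<close>

context cstar_tensor_category
begin

lemma pentagon_inverse:
  assumes [simp]: "W \<in> Ob C" "X \<in> Ob C" "Y \<in> Ob C" "Z \<in> Ob C"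
  shows "(assr C W X Y \<triangleleft> Z) \<cdot> (assr C (W \<star> X) Y Z)\<dagger> \<cdot> (assr C W X (Y \<star> Z))\<dagger>
    = (assr C W (X \<star> Y) Z)\<dagger> \<cdot> (W \<triangleright> (assr C X Y Z)\<dagger>)"
proof -
  let ?P = "(assr C (W \<star> X) Y Z)\<dagger> \<cdot> (assr C W X (Y \<star> Z))\<dagger>"
  have "assr C W (X \<star> Y) Z \<cdot> ((assr C W X Y \<triangleleft> Z) \<cdot> ?P) = W \<triangleright> (assr C X Y Z)\<dagger>"
    using chain2[OF pentagon_lwhisk[of W X Y Z]] by simp
  then have "(assr C W (X \<star> Y) Z)\<dagger> \<cdot> (assr C W (X \<star> Y) Z \<cdot> ((assr C W X Y \<triangleleft> Z) \<cdot> ?P))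
    = (assr C W (X \<star> Y) Z)\<dagger> \<cdot> (W \<triangleright> (assr C X Y Z)\<dagger>)" by simp
  then show ?thesis by (subst (asm) assr_chain) simp_all
qed

text \<open>
  Iterated tensor products are kept in the right-nested form \<open>X \<otimes> (Y \<otimes> W)\<close>. There \<open>merge X Y f W\<close>
  applies \<open>f : X \<otimes> Y \<rightarrow> Z\<close> to the first two factors, and \<open>branch X Y f W\<close> applies
  \<open>f : Z \<rightarrow> X \<otimes> Y\<close> to the first one. In this form the associators disappear from the laws of
  actions: associativity of a right action \<open>\<rho>\<close> reads \<open>\<rho> \<circ> merge Y A \<rho> A = \<rho> \<circ> (Y \<otimes> \<mu>)\<close>.
\<close>

definition merge :: "'o \<Rightarrow> 'o \<Rightarrow> 'm \<Rightarrow> 'o \<Rightarrow> 'm" where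
  "merge X Y f W = (f \<triangleleft> W) \<cdot> (assr C X Y W)\<dagger>"

definition branch :: "'o \<Rightarrow> 'o \<Rightarrow> 'm \<Rightarrow> 'o \<Rightarrow> 'm" where
  "branch X Y f W = assr C X Y W \<cdot> (f \<triangleleft> W)"

lemma merge_simps [simp]:
  assumes "f \<in> Arr C" "source C f = X \<star> Y" "X \<in> Ob C" "Y \<in> Ob C" "W \<in> Ob C"
  shows "merge X Y f W \<in> Arr C" "source C (merge X Y f W) = X \<star> (Y \<star> W)"
    "target C (merge X Y f W) = target C f \<star> W"
  using assms by (simp_all add: merge_def)

lemma branch_simps [simp]:
  assumes "f \<in> Arr C" "target C f = X \<star> Y" "X \<in> Ob C" "Y \<in> Ob C" "W \<in> Ob C"
  shows "branch X Y f W \<in> Arr C" "target C (branch X Y f W) = X \<star> (Y \<star> W)"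
    "source C (branch X Y f W) = source C f \<star> W"
  using assms by (simp_all add: branch_def)

lemma merge_nat:
  assumes "f \<in> Arr C" "source C f = X \<star> Y" "X \<in> Ob C" "Y \<in> Ob C" "u \<in> Arr C" "target C u = W'"
  shows "merge X Y f W' \<cdot> (X \<triangleright> (Y \<triangleright> u)) = (target C f \<triangleright> u) \<cdot> merge X Y f (source C u)"
proof -
  have [simp]: "W' \<in> Ob C" using target_Ob[of u] assms by simp
  have "merge X Y f W' \<cdot> (X \<triangleright> (Y \<triangleright> u)) = ((f \<triangleleft> W') \<cdot> ((X \<star> Y) \<triangleright> u)) \<cdot> (assr C X Y (source C u))\<dagger>"
    using assms assr_adj_nat[of "ident C X" "ident C Y" u X Y W'] by (simp add: merge_def)
  also have "\<dots> = (target C f \<triangleright> u) \<cdot> merge X Y f (source C u)"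
    using assms slide[OF Arr_Hom Arr_Hom, of f u] by (simp add: merge_def)
  finally show ?thesis .
qed

lemma branch_nat:
  assumes "f \<in> Arr C" "target C f = X \<star> Y" "X \<in> Ob C" "Y \<in> Ob C" "u \<in> Arr C" "target C u = W'"
    "source C f = S"
  shows "branch X Y f W' \<cdot> (S \<triangleright> u) = (X \<triangleright> (Y \<triangleright> u)) \<cdot> branch X Y f (source C u)"
proof -
  have [simp]: "W' \<in> Ob C" "S \<in> Ob C" using target_Ob[of u] source_Ob[of f] assms by simp_all
  have "branch X Y f W' \<cdot> (S \<triangleright> u) = assr C X Y W' \<cdot> ((X \<star> Y) \<triangleright> u) \<cdot> (f \<triangleleft> source C u)"
    using assms slide[OF Arr_Hom Arr_Hom, of f u] by (simp add: branch_def)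
  also have "\<dots> = (X \<triangleright> (Y \<triangleright> u)) \<cdot> branch X Y f (source C u)"
    using assms chain2[OF assr_nat[of "ident C X" "ident C Y" u X Y W']] by (simp add: branch_def)
  finally show ?thesis .
qed

text \<open>
  An associativity law between \<open>f\<close>, \<open>m\<close>, \<open>f'\<close> and \<open>m'\<close> persists when a further factor \<open>W\<close> is added;
  this is where the pentagon enters.
\<close>

lemma merge_merge:
  assumes eq: "m \<cdot> merge X Y f D = m' \<cdot> (X \<triangleright> f')"
    and [simp]: "f \<in> Arr C" "m \<in> Arr C" "f' \<in> Arr C" "m' \<in> Arr C"
      "X \<in> Ob C" "Y \<in> Ob C" "D \<in> Ob C" "W \<in> Ob C"
      "source C f = X \<star> Y" "target C f = Z" "source C m = Z \<star> D" "source C f' = Y \<star> D"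
      "target C f' = D'" "source C m' = X \<star> D'"
  shows "merge Z D m W \<cdot> merge X Y f (D \<star> W) = merge X D' m' W \<cdot> (X \<triangleright> merge Y D f' W)"
proof -
  have [simp]: "Z \<in> Ob C" "D' \<in> Ob C"
    using target_Ob[of f] target_Ob[of f'] by simp_all
  have eq': "m \<cdot> (f \<triangleleft> D) = m' \<cdot> (X \<triangleright> f') \<cdot> assr C X Y D"
  proof -
    have "m \<cdot> (f \<triangleleft> D) = (m \<cdot> merge X Y f D) \<cdot> assr C X Y D"
      by (simp add: merge_def)
    then show ?thesis by (simp add: eq)
  qed
  let ?P = "(assr C (X \<star> Y) D W)\<dagger> \<cdot> (assr C X Y (D \<star> W))\<dagger>"
  have "merge Z D m W \<cdot> merge X Y f (D \<star> W) = ((m \<cdot> (f \<triangleleft> D)) \<triangleleft> W) \<cdot> ?P"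
    using chain2[OF assr_adj_nat[of f "ident C D" "ident C W" Z D W]] by (simp add: merge_def)
  also have "\<dots> = (m' \<triangleleft> W) \<cdot> (((X \<triangleright> f') \<triangleleft> W) \<cdot> ((assr C X Y D \<triangleleft> W) \<cdot> ?P))"
    unfolding eq' by simp
  also have "\<dots> = (m' \<triangleleft> W) \<cdot> (((X \<triangleright> f') \<triangleleft> W) \<cdot> ((assr C X (Y \<star> D) W)\<dagger> \<cdot> (X \<triangleright> (assr C Y D W)\<dagger>)))"
    by (simp add: pentagon_inverse)
  also have "\<dots> = merge X D' m' W \<cdot> (X \<triangleright> merge Y D f' W)"
    using chain2[OF assr_adj_nat[of "ident C X" f' "ident C W" X D' W]] by (simp add: merge_def)
  finally show ?thesis .
qed

text \<open>
  The composite on the left sends a factor split off from \<open>M\<close> into \<open>N\<close> by the action \<open>l\<close>, in the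
  presence of \<open>W\<close>. By the pentagon, \<open>W\<close> can be attached to \<open>N\<close> before the splitting.
\<close>

lemma branch_lwhisk:
  assumes [simp]: "f \<in> Arr C" "target C f = X \<star> Y" "source C f = M" "X \<in> Ob C" "Y \<in> Ob C" "N \<in> Ob C" "W \<in> Ob C"
    "l \<in> Arr C" "source C l = Y \<star> N" "target C l = L"
  shows "assr C X L W \<cdot> (((X \<triangleright> l) \<cdot> branch X Y f N) \<triangleleft> W)
    = (X \<triangleright> merge Y N l W) \<cdot> branch X Y f (N \<star> W) \<cdot> assr C M N W"
proof -
  have [simp]: "L \<in> Ob C" "M \<in> Ob C"
    using target_Ob[of l] source_Ob[of f] by simp_all
  have "assr C X L W \<cdot> (((X \<triangleright> l) \<cdot> branch X Y f N) \<triangleleft> W)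
    = (X \<triangleright> (l \<triangleleft> W)) \<cdot> (assr C X (Y \<star> N) W \<cdot> (assr C X Y N \<triangleleft> W)) \<cdot> ((f \<triangleleft> N) \<triangleleft> W)"
    using chain2[OF assr_nat[of "ident C X" l "ident C W" X L W]] by (simp add: branch_def)
  also have "\<dots> = (X \<triangleright> merge Y N l W) \<cdot> assr C X Y (N \<star> W) \<cdot> (assr C (X \<star> Y) N W \<cdot> ((f \<triangleleft> N) \<triangleleft> W))"
    by (simp add: pentagon_lwhisk merge_def)
  also have "\<dots> = (X \<triangleright> merge Y N l W) \<cdot> branch X Y f (N \<star> W) \<cdot> assr C M N W"
    by (simp add: assr_nat[of f "ident C N" "ident C W"] branch_def)
  finally show ?thesis .
qed

end

context braided_cstar_tensor_category
begin

lemma braid_simps [simp]: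
  assumes "X \<in> Ob C" "Y \<in> Ob C"
  shows "braid C X Y \<in> Arr C" "source C (braid C X Y) = X \<star> Y" "target C (braid C X Y) = Y \<star> X"
    "(braid C X Y)\<dagger> \<cdot> braid C X Y = ident C (X \<star> Y)"
    "braid C X Y \<cdot> (braid C X Y)\<dagger> = ident C (Y \<star> X)"
  using braid_Hom[OF assms] unitaryD[of "braid C X Y"] by (auto simp: Hom_iff)

lemma braid_chain [simp]:
  assumes "f \<in> Arr C" "X \<in> Ob C" "Y \<in> Ob C"
  shows "target C f = X \<star> Y \<Longrightarrow> (braid C X Y)\<dagger> \<cdot> (braid C X Y \<cdot> f) = f"
    "target C f = Y \<star> X \<Longrightarrow> braid C X Y \<cdot> ((braid C X Y)\<dagger> \<cdot> f) = f"
  using assms by (simp_all add: chain2[OF braid_simps(4)] chain2[OF braid_simps(5)])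

lemma braid_nat:
  assumes "f \<in> Arr C" "g \<in> Arr C" "target C f = X'" "target C g = Y'"
  shows "braid C X' Y' \<cdot> (f \<diamondop> g) = (g \<diamondop> f) \<cdot> braid C (source C f) (source C g)"
  using braid_natural[OF assms(1,2)[THEN Arr_Hom]] assms by simp

text \<open>
  Tensoring the hexagon for \<open>X\<close> and two units with the unitors shows that
  \<open>\<gamma> = lunit \<circ> braid X I\<close> satisfies \<open>\<gamma> \<circ> (\<gamma> \<otimes> I) = \<gamma> \<circ> (runit \<otimes> I)\<close>; now cancel \<open>\<gamma>\<close>.
\<close>

lemma braid_unit:
  assumes [simp]: "X \<in> Ob C"
  shows "braid C X (unit_ob C) = (lunit C X)\<dagger> \<cdot> runit C X"
proof -
  let ?I = "unit_ob C" and ?b = "braid C X (unit_ob C)"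
  have h: "lunit C X \<cdot> ((?I \<triangleright> lunit C X) \<cdot> (assr C ?I ?I X \<cdot> braid C X (?I \<star> ?I) \<cdot> assr C X ?I ?I))
     = lunit C X \<cdot> ((?I \<triangleright> lunit C X) \<cdot> ((?I \<triangleright> ?b) \<cdot> assr C ?I X ?I \<cdot> (?b \<triangleleft> ?I)))"
    by (subst hexagon1) simp_all
  have l: "(?I \<triangleright> lunit C X) \<cdot> (assr C ?I ?I X \<cdot> braid C X (?I \<star> ?I) \<cdot> assr C X ?I ?I) = ?b \<cdot> (runit C X \<triangleleft> ?I)"
  proof -
    have "(?I \<triangleright> lunit C X) \<cdot> (assr C ?I ?I X \<cdot> braid C X (?I \<star> ?I) \<cdot> assr C X ?I ?I)
       = ((lunit C ?I \<triangleleft> X) \<cdot> braid C X (?I \<star> ?I)) \<cdot> assr C X ?I ?I"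
      using chain2[OF triangle[of ?I X]] by (simp add: lunit_unit)
    also have "\<dots> = (?b \<cdot> (X \<triangleright> lunit C ?I)) \<cdot> assr C X ?I ?I"
      using braid_nat[of "ident C X" "lunit C ?I" X ?I] by simp
    finally show ?thesis by (simp add: triangle)
  qed
  have r: "lunit C X \<cdot> ((?I \<triangleright> lunit C X) \<cdot> ((?I \<triangleright> ?b) \<cdot> assr C ?I X ?I \<cdot> (?b \<triangleleft> ?I)))
      = (lunit C X \<cdot> ?b) \<cdot> ((lunit C X \<cdot> ?b) \<triangleleft> ?I)"
  proof -
    have "(lunit C X \<cdot> ?b) \<cdot> ((lunit C X \<cdot> ?b) \<triangleleft> ?I)
        = (lunit C X \<cdot> ?b) \<cdot> ((lunit C (X \<star> ?I) \<cdot> assr C ?I X ?I) \<cdot> (?b \<triangleleft> ?I))"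
      by (subst lunit_tensor) simp_all
    also have "\<dots> = ((lunit C X \<cdot> ?b) \<cdot> lunit C (X \<star> ?I)) \<cdot> assr C ?I X ?I \<cdot> (?b \<triangleleft> ?I)"
      by simp
    also have "(lunit C X \<cdot> ?b) \<cdot> lunit C (X \<star> ?I) = lunit C X \<cdot> (?I \<triangleright> (lunit C X \<cdot> ?b))"
      using lunit_nat[of "lunit C X \<cdot> ?b" X] by (simp del: lwhisk_cmp)
    finally show ?thesis by simp
  qed
  have "(lunit C X \<cdot> ?b) \<cdot> ((lunit C X \<cdot> ?b) \<triangleleft> ?I) = (lunit C X \<cdot> ?b) \<cdot> (runit C X \<triangleleft> ?I)"
    using h unfolding l r by simp
  then have "(lunit C X \<cdot> ?b) \<triangleleft> ?I = runit C X \<triangleleft> ?I"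
    by (rule mono_cancel[of _ _ _ "?b\<dagger> \<cdot> (lunit C X)\<dagger>"]) (simp_all add: Hom_iff del: rwhisk_cmp)
  then have e: "lunit C X \<cdot> ?b = runit C X"
    by (rule runit_faithful) (simp_all add: Hom_iff)
  show ?thesis unfolding e[symmetric] by simp
qed

text \<open>
  The braiding of the first two factors of a right-nested product.
\<close>

definition cross :: "'o \<Rightarrow> 'o \<Rightarrow> 'o \<Rightarrow> 'm" where
  "cross X Y W = assr C Y X W \<cdot> (braid C X Y \<triangleleft> W) \<cdot> (assr C X Y W)\<dagger>"

lemma cross_simps [simp]:
  assumes "X \<in> Ob C" "Y \<in> Ob C" "W \<in> Ob C"
  shows "cross X Y W \<in> Arr C" "source C (cross X Y W) = X \<star> (Y \<star> W)"
    "target C (cross X Y W) = Y \<star> (X \<star> W)"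
    "(cross X Y W)\<dagger> \<cdot> cross X Y W = ident C (X \<star> (Y \<star> W))"
    "cross X Y W \<cdot> (cross X Y W)\<dagger> = ident C (Y \<star> (X \<star> W))"
proof -
  have 1: "((braid C X Y)\<dagger> \<triangleleft> W) \<cdot> (braid C X Y \<triangleleft> W) = ident C ((X \<star> Y) \<star> W)"
    "(braid C X Y \<triangleleft> W) \<cdot> ((braid C X Y)\<dagger> \<triangleleft> W) = ident C ((Y \<star> X) \<star> W)"
    using assms by (simp_all flip: rwhisk_cmp)
  show "(cross X Y W)\<dagger> \<cdot> cross X Y W = ident C (X \<star> (Y \<star> W))"
    "cross X Y W \<cdot> (cross X Y W)\<dagger> = ident C (Y \<star> (X \<star> W))"
    using assms by (simp_all add: cross_def chain2[OF 1(1)] chain2[OF 1(2)])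
qed (use assms in \<open>simp_all add: cross_def\<close>)

lemma cross_chain [simp]:
  assumes "f \<in> Arr C" "X \<in> Ob C" "Y \<in> Ob C" "W \<in> Ob C"
  shows "target C f = X \<star> (Y \<star> W) \<Longrightarrow> (cross X Y W)\<dagger> \<cdot> (cross X Y W \<cdot> f) = f"
    "target C f = Y \<star> (X \<star> W) \<Longrightarrow> cross X Y W \<cdot> ((cross X Y W)\<dagger> \<cdot> f) = f"
  using assms by (simp_all add: chain2[OF cross_simps(4)] chain2[OF cross_simps(5)])

lemma cross_hexagon1:
  assumes [simp]: "X \<in> Ob C" "Y \<in> Ob C" "Z \<in> Ob C"
  shows "assr C Y Z X \<cdot> braid C X (Y \<star> Z) = (Y \<triangleright> braid C X Z) \<cdot> cross X Y Z"
proof -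
  have "assr C Y Z X \<cdot> braid C X (Y \<star> Z)
      = (assr C Y Z X \<cdot> braid C X (Y \<star> Z) \<cdot> assr C X Y Z) \<cdot> (assr C X Y Z)\<dagger>" by simp
  also have "\<dots> = (Y \<triangleright> braid C X Z) \<cdot> cross X Y Z"
    by (subst hexagon1) (simp_all add: cross_def)
  finally show ?thesis .
qed

lemma cross_hexagon2:
  assumes [simp]: "X \<in> Ob C" "Y \<in> Ob C" "Z \<in> Ob C"
  shows "braid C (X \<star> Y) Z \<cdot> (assr C X Y Z)\<dagger> = cross X Z Y \<cdot> (X \<triangleright> braid C Y Z)"
proof -
  have "braid C (X \<star> Y) Z \<cdot> (assr C X Y Z)\<dagger>
      = assr C Z X Y \<cdot> ((assr C Z X Y)\<dagger> \<cdot> braid C (X \<star> Y) Z \<cdot> (assr C X Y Z)\<dagger>)" by simp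
  also have "\<dots> = cross X Z Y \<cdot> (X \<triangleright> braid C Y Z)"
    by (subst hexagon2) (simp_all add: cross_def)
  finally show ?thesis .
qed

text \<open>Moving \<open>X\<close> past a merged pair is moving it past both factors, and conversely.\<close>

lemma braid_merge_right:
  assumes [simp]: "f \<in> Arr C" "source C f = Y \<star> Z" "target C f = L" "X \<in> Ob C" "Y \<in> Ob C" "Z \<in> Ob C"
  shows "braid C X L \<cdot> (X \<triangleright> f) = merge Y Z f X \<cdot> (Y \<triangleright> braid C X Z) \<cdot> cross X Y Z"
proof -
  have "braid C X L \<cdot> (X \<triangleright> f) = (f \<triangleleft> X) \<cdot> braid C X (Y \<star> Z)"
    using braid_nat[of "ident C X" f X L] by simp
  also have "\<dots> = merge Y Z f X \<cdot> (assr C Y Z X \<cdot> braid C X (Y \<star> Z))"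
    by (simp add: merge_def)
  finally show ?thesis by (simp add: cross_hexagon1)
qed

lemma braid_merge_left:
  assumes [simp]: "f \<in> Arr C" "source C f = X \<star> Y" "target C f = L" "X \<in> Ob C" "Y \<in> Ob C" "Z \<in> Ob C"
  shows "braid C L Z \<cdot> merge X Y f Z = (Z \<triangleright> f) \<cdot> cross X Z Y \<cdot> (X \<triangleright> braid C Y Z)"
proof -
  have "braid C L Z \<cdot> merge X Y f Z = (braid C L Z \<cdot> (f \<triangleleft> Z)) \<cdot> (assr C X Y Z)\<dagger>"
    using target_Ob[of f] by (simp add: merge_def)
  also have "\<dots> = (Z \<triangleright> f) \<cdot> (braid C (X \<star> Y) Z \<cdot> (assr C X Y Z)\<dagger>)"
    using braid_nat[of f "ident C Z" L Z] by simp
  finally show ?thesis by (simp add: cross_hexagon2)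
qed

lemma merge_cross:
  assumes [simp]: "f \<in> Arr C" "source C f = Y \<star> X" "X \<in> Ob C" "Y \<in> Ob C" "W \<in> Ob C"
  shows "merge Y X f W \<cdot> cross X Y W = merge X Y (f \<cdot> braid C X Y) W"
  by (simp add: merge_def cross_def)

end


section \<open>Modules over a commutative algebra\<close>

context category
begin

text \<open>
  The classical splitting data \<open>s\<close>, \<open>t\<close> of a fork; the factorization of \<open>h\<close> through \<open>q\<close> is
  \<open>h \<circ> s\<close>.
\<close>

lemma split_coequalizer:
  assumes [simp]: "f \<in> Arr C" "g \<in> Arr C" "q \<in> Arr C" "s \<in> Arr C" "t \<in> Arr C"
      "target C f = V" "target C g = V" "source C f = U" "source C g = U" "source C q = V" "target C q = W" "source C s = W"
      "target C s = V" "source C t = V" "target C t = U"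
    and eqs: "q \<cdot> f = q \<cdot> g" "q \<cdot> s = ident C W" "f \<cdot> t = ident C V" "g \<cdot> t = s \<cdot> q"
  shows "is_coequalizer C f g q"
  unfolding is_coequalizer_def
proof (intro conjI ballI impI ex1I)
  fix E h assume "h \<in> Hom C (target C f) E" and h: "h \<cdot> f = h \<cdot> g"
  then have [simp]: "h \<in> Arr C" "source C h = V" "target C h = E" by (auto simp: Hom_iff)
  show "h \<cdot> s \<in> Hom C (target C q) E" by (simp add: Hom_iff)
  have "(h \<cdot> s) \<cdot> q = h \<cdot> (g \<cdot> t)" by (simp add: eqs)
  also have "\<dots> = h \<cdot> (f \<cdot> t)" using h chain2[OF h, of t] by simp
  finally show "(h \<cdot> s) \<cdot> q = h" by (simp add: eqs)
  fix k assume k: "k \<in> Hom C (target C q) E \<and> k \<cdot> q = h"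
  then have "h \<cdot> s = k \<cdot> (q \<cdot> s)" by (auto simp: Hom_iff)
  then show "k = h \<cdot> s" using k by (simp add: eqs Hom_iff)
qed (use eqs in auto)

end

locale commutative_algebra = braided_cstar_tensor_category C
  for C :: "('o, 'm, 'z) braided_data_scheme" (structure) +
  fixes A :: "('o, 'm) algebra_data"
  assumes mult_Hom: "alg_mult A \<in> Hom C (alg_ob A \<star> alg_ob A) (alg_ob A)"
    and unit_Hom: "alg_unit A \<in> Hom C (unit_ob C) (alg_ob A)"
    and mult_assoc: "alg_mult A \<cdot> (alg_mult A \<diamondop> ident C (alg_ob A))
      = alg_mult A \<cdot> (ident C (alg_ob A) \<diamondop> alg_mult A) \<cdot> assr C (alg_ob A) (alg_ob A) (alg_ob A)"
    and mult_unit: "alg_mult A \<cdot> (ident C (alg_ob A) \<diamondop> alg_unit A) = runit C (alg_ob A)"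
    and unit_mult: "alg_mult A \<cdot> (alg_unit A \<diamondop> ident C (alg_ob A)) = lunit C (alg_ob A)"
    and mult_comm: "alg_mult A \<cdot> braid C (alg_ob A) (alg_ob A) = alg_mult A"
begin

abbreviation (input) algo (\<open>\<A>\<close>) where "\<A> \<equiv> alg_ob A"
abbreviation (input) algm (\<open>\<mu>\<close>) where "\<mu> \<equiv> alg_mult A"
abbreviation (input) algu (\<open>\<eta>\<close>) where "\<eta> \<equiv> alg_unit A"
abbreviation \<M> where "\<M> \<equiv> Module_Cat C A"

lemma alg_simps [simp]:
  "\<A> \<in> Ob C" "\<mu> \<in> Arr C" "source C \<mu> = \<A> \<star> \<A>" "target C \<mu> = \<A>"
  "\<eta> \<in> Arr C" "source C \<eta> = unit_ob C" "target C \<eta> = \<A>"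
  using mult_Hom unit_Hom Hom_Ob(2)[OF unit_Hom] by (auto simp: Hom_iff)

lemma right_module_iff:
  "(Y, \<rho>) \<in> right_modules C A \<longleftrightarrow> Y \<in> Ob C \<and> \<rho> \<in> Arr C \<and> source C \<rho> = Y \<star> \<A> \<and> target C \<rho> = Y
     \<and> \<rho> \<cdot> merge Y \<A> \<rho> \<A> = \<rho> \<cdot> (Y \<triangleright> \<mu>) \<and> \<rho> \<cdot> (Y \<triangleright> \<eta>) \<cdot> (runit C Y)\<dagger> = ident C Y"
    (is "_ \<longleftrightarrow> ?R")
proof -
  have 1: "\<rho> \<cdot> (\<rho> \<triangleleft> \<A>) = \<rho> \<cdot> (Y \<triangleright> \<mu>) \<cdot> assr C Y \<A> \<A> \<longleftrightarrow> \<rho> \<cdot> merge Y \<A> \<rho> \<A> = \<rho> \<cdot> (Y \<triangleright> \<mu>)"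
    if [simp]: "Y \<in> Ob C" "\<rho> \<in> Arr C" "source C \<rho> = Y \<star> \<A>" "target C \<rho> = Y"
  proof
    assume "\<rho> \<cdot> (\<rho> \<triangleleft> \<A>) = \<rho> \<cdot> (Y \<triangleright> \<mu>) \<cdot> assr C Y \<A> \<A>"
    then have "(\<rho> \<cdot> (\<rho> \<triangleleft> \<A>)) \<cdot> (assr C Y \<A> \<A>)\<dagger> = (\<rho> \<cdot> (Y \<triangleright> \<mu>) \<cdot> assr C Y \<A> \<A>) \<cdot> (assr C Y \<A> \<A>)\<dagger>"
      by simp
    then show "\<rho> \<cdot> merge Y \<A> \<rho> \<A> = \<rho> \<cdot> (Y \<triangleright> \<mu>)" by (simp add: merge_def)
  next
    assume "\<rho> \<cdot> merge Y \<A> \<rho> \<A> = \<rho> \<cdot> (Y \<triangleright> \<mu>)"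
    then have "(\<rho> \<cdot> merge Y \<A> \<rho> \<A>) \<cdot> assr C Y \<A> \<A> = (\<rho> \<cdot> (Y \<triangleright> \<mu>)) \<cdot> assr C Y \<A> \<A>" by simp
    then show "\<rho> \<cdot> (\<rho> \<triangleleft> \<A>) = \<rho> \<cdot> (Y \<triangleright> \<mu>) \<cdot> assr C Y \<A> \<A>" by (simp add: merge_def)
  qed
  have 2: "\<rho> \<cdot> (Y \<triangleright> \<eta>) = runit C Y \<longleftrightarrow> \<rho> \<cdot> (Y \<triangleright> \<eta>) \<cdot> (runit C Y)\<dagger> = ident C Y"
    if [simp]: "Y \<in> Ob C" "\<rho> \<in> Arr C" "source C \<rho> = Y \<star> \<A>" "target C \<rho> = Y"
  proof
    assume "\<rho> \<cdot> (Y \<triangleright> \<eta>) = runit C Y"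
    then show "\<rho> \<cdot> (Y \<triangleright> \<eta>) \<cdot> (runit C Y)\<dagger> = ident C Y" by (simp add: chain2)
  next
    assume "\<rho> \<cdot> (Y \<triangleright> \<eta>) \<cdot> (runit C Y)\<dagger> = ident C Y"
    then have "(\<rho> \<cdot> (Y \<triangleright> \<eta>) \<cdot> (runit C Y)\<dagger>) \<cdot> runit C Y = ident C Y \<cdot> runit C Y" by simp
    then show "\<rho> \<cdot> (Y \<triangleright> \<eta>) = runit C Y" by simp
  qed
  show ?thesis using 1 2 by (auto simp: right_modules_def Hom_iff)
qed

lemma moduleD:
  assumes "(Y, \<rho>) \<in> right_modules C A"
  shows "Y \<in> Ob C" "\<rho> \<in> Arr C" "source C \<rho> = Y \<star> \<A>" "target C \<rho> = Y"
    "\<rho> \<cdot> merge Y \<A> \<rho> \<A> = \<rho> \<cdot> (Y \<triangleright> \<mu>)" "\<rho> \<cdot> (Y \<triangleright> \<eta>) \<cdot> (runit C Y)\<dagger> = ident C Y"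
  using assms by (auto simp: right_module_iff)

lemma unit_module: "(\<A>, \<mu>) \<in> right_modules C A"
  by (simp add: right_modules_def mult_assoc mult_unit Hom_iff)

lemma mult_unit': "\<mu> \<cdot> (\<A> \<triangleright> \<eta>) \<cdot> (runit C \<A>)\<dagger> = ident C \<A>"
  using moduleD[OF unit_module] by simp


lemma left_action_simps [simp]:
  assumes "(Y, \<rho>) \<in> right_modules C A"
  shows "left_action C A (Y, \<rho>) \<in> Arr C" "source C (left_action C A (Y, \<rho>)) = \<A> \<star> Y"
    "target C (left_action C A (Y, \<rho>)) = Y"
  using moduleD(1-4)[OF assms] by (simp_all add: left_action_def)

lemma left_action_braid:
  assumes "(Y, \<rho>) \<in> right_modules C A"
  shows "left_action C A (Y, \<rho>) \<cdot> braid C Y \<A> = \<rho>"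
  using moduleD(1-4)[OF assms] by (simp add: left_action_def)

text \<open>
  The left action is the right action transported by the braiding, so that acting with \<open>A \<otimes> A\<close> from
  the right and acting on both sides differ by a braiding of \<open>A\<close> with itself, which commutativity
  of \<open>\<mu>\<close> absorbs. The left action laws and the bimodule law below follow from this identity.
\<close>

lemma left_right_cross:
  assumes "(Y, \<rho>) \<in> right_modules C A"
  shows "left_action C A (Y, \<rho>) \<cdot> (\<A> \<triangleright> \<rho>) \<cdot> cross Y \<A> \<A> = \<rho> \<cdot> (Y \<triangleright> \<mu>)"
proof -
  note [simp] = moduleD(1-4)[OF assms] assms
  let ?l = "left_action C A (Y, \<rho>)" and ?b = "braid C \<A> \<A>"
  have "(?l \<cdot> (\<A> \<triangleright> \<rho>) \<cdot> cross Y \<A> \<A>) \<cdot> (Y \<triangleright> ?b) = ?l \<cdot> (braid C Y \<A> \<cdot> merge Y \<A> \<rho> \<A>)"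
    by (subst braid_merge_left) simp_all
  also have "\<dots> = \<rho> \<cdot> (Y \<triangleright> \<mu>)"
    using chain2[OF left_action_braid[OF assms], of "merge Y \<A> \<rho> \<A>"] moduleD(5)[OF assms] by simp
  also have "\<dots> = (\<rho> \<cdot> (Y \<triangleright> \<mu>)) \<cdot> (Y \<triangleright> ?b)"
    using lwhisk_cmp[of ?b \<mu> Y] by (simp add: mult_comm)
  finally have eq: "(?l \<cdot> (\<A> \<triangleright> \<rho>) \<cdot> cross Y \<A> \<A>) \<cdot> (Y \<triangleright> ?b) = (\<rho> \<cdot> (Y \<triangleright> \<mu>)) \<cdot> (Y \<triangleright> ?b)" .
  show ?thesis
    by (rule epi_cancel[OF eq, of "Y \<triangleright> ?b\<dagger>"])
      (simp_all add: Hom_iff flip: lwhisk_cmp)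
qed

lemma left_action_assoc:
  assumes "(Y, \<rho>) \<in> right_modules C A"
  shows "left_action C A (Y, \<rho>) \<cdot> merge \<A> \<A> \<mu> Y
    = left_action C A (Y, \<rho>) \<cdot> (\<A> \<triangleright> left_action C A (Y, \<rho>))"
proof -
  note [simp] = moduleD(1-4)[OF assms] assms
  let ?l = "left_action C A (Y, \<rho>)" and ?b = "braid C Y \<A>"
  have eq: "(?l \<cdot> merge \<A> \<A> \<mu> Y) \<cdot> ((\<A> \<triangleright> ?b) \<cdot> cross Y \<A> \<A>)
      = (?l \<cdot> (\<A> \<triangleright> ?l)) \<cdot> ((\<A> \<triangleright> ?b) \<cdot> cross Y \<A> \<A>)"
  proof -
    have "(?l \<cdot> merge \<A> \<A> \<mu> Y) \<cdot> ((\<A> \<triangleright> ?b) \<cdot> cross Y \<A> \<A>) = ?l \<cdot> (?b \<cdot> (Y \<triangleright> \<mu>))"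
      by (subst braid_merge_right) simp_all
    also have "\<dots> = \<rho> \<cdot> (Y \<triangleright> \<mu>)"
      using chain2[OF left_action_braid[OF assms], of "Y \<triangleright> \<mu>"] by simp
    also have "\<dots> = ?l \<cdot> ((\<A> \<triangleright> (?l \<cdot> ?b)) \<cdot> cross Y \<A> \<A>)"
      using left_right_cross[OF assms] left_action_braid[OF assms] by simp
    finally show ?thesis by simp
  qed
  have e: "((\<A> \<triangleright> ?b) \<cdot> cross Y \<A> \<A>) \<cdot> ((cross Y \<A> \<A>)\<dagger> \<cdot> (\<A> \<triangleright> ?b\<dagger>)) = ident C (\<A> \<star> (\<A> \<star> Y))"
    by (simp flip: lwhisk_cmp)
  show ?thesis by (rule epi_cancel[OF eq e]) (simp_all add: Hom_iff)
qed

lemma left_action_unit: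
  assumes "(Y, \<rho>) \<in> right_modules C A"
  shows "left_action C A (Y, \<rho>) \<cdot> (\<eta> \<triangleleft> Y) \<cdot> (lunit C Y)\<dagger> = ident C Y"
proof -
  note [simp] = moduleD(1-4)[OF assms] assms
  let ?l = "left_action C A (Y, \<rho>)"
  have "(\<eta> \<triangleleft> Y) \<cdot> (lunit C Y)\<dagger> = (\<eta> \<triangleleft> Y) \<cdot> (braid C Y (unit_ob C) \<cdot> (runit C Y)\<dagger>)"
    by (simp add: braid_unit)
  also have "\<dots> = braid C Y \<A> \<cdot> (Y \<triangleright> \<eta>) \<cdot> (runit C Y)\<dagger>"
    using chain2[OF braid_nat[of "ident C Y" \<eta> Y \<A>]] by simp
  finally show ?thesis
    using chain2[OF left_action_braid[OF assms], of "(Y \<triangleright> \<eta>) \<cdot> (runit C Y)\<dagger>"] moduleD(6)[OF assms]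
    by simp
qed

lemma left_right_action:
  assumes "(Y, \<rho>) \<in> right_modules C A"
  shows "left_action C A (Y, \<rho>) \<cdot> (\<A> \<triangleright> \<rho>) = \<rho> \<cdot> merge \<A> Y (left_action C A (Y, \<rho>)) \<A>"
proof -
  note [simp] = moduleD(1-4)[OF assms] assms
  let ?l = "left_action C A (Y, \<rho>)"
  have eq: "(?l \<cdot> (\<A> \<triangleright> \<rho>)) \<cdot> cross Y \<A> \<A> = (\<rho> \<cdot> merge \<A> Y ?l \<A>) \<cdot> cross Y \<A> \<A>"
    using left_right_cross[OF assms] moduleD(5)[OF assms]
    by (simp add: merge_cross left_action_braid)
  show ?thesis by (rule epi_cancel[OF eq cross_simps(5)]) (simp_all add: Hom_iff)
qed


lemma module_mapD:
  assumes "f \<in> module_maps C A M N"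
  shows "f \<in> Arr C" "source C f = fst M" "target C f = fst N" "f \<cdot> snd M = snd N \<cdot> (f \<triangleleft> \<A>)"
  using assms by (auto simp: module_maps_def Hom_iff)

lemma Module_simps:
  "Ob \<M> = right_modules C A" "source \<M> (M, f, N) = M" "target \<M> (M, f, N) = N"
  "ident \<M> M = (M, ident C (fst M), M)" "unit_ob \<M> = (\<A>, \<mu>)"
  "tensor_ob \<M> M N = (SOME P. is_tensor_over C A M N P)"
  by (simp_all add: Module_Cat_def)

lemma Module_Hom: "x \<in> Hom \<M> M N \<longleftrightarrow> M \<in> right_modules C A \<and> N \<in> right_modules C A
    \<and> (\<exists>f \<in> module_maps C A M N. x = (M, f, N))"
  by (auto simp: Hom_def Module_Cat_def)

lemma Module_cmp: "cmp \<M> (N', g, K) (M, f, N) = (M, g \<cdot> f, K)"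
  by (simp add: Module_Cat_def)

lemma module_map_cmp:
  assumes "M \<in> right_modules C A" "N \<in> right_modules C A" "K \<in> right_modules C A"
    "f \<in> module_maps C A M N" "g \<in> module_maps C A N K"
  shows "g \<cdot> f \<in> module_maps C A M K"
proof -
  obtain Y \<sigma> Z \<rho> W \<tau> where [simp]: "M = (Y, \<sigma>)" "N = (Z, \<rho>)" "K = (W, \<tau>)" by (metis surj_pair)
  note s = moduleD(1-4)[OF assms(1)[simplified]] moduleD(1-4)[OF assms(2)[simplified]]
    moduleD(1-4)[OF assms(3)[simplified]] module_mapD(1-3)[OF assms(4)] module_mapD(1-3)[OF assms(5)]
  note [simp] = s[simplified]
  note f = module_mapD(4)[OF assms(4), simplified] and g = module_mapD(4)[OF assms(5), simplified]
  show ?thesis by (simp add: module_maps_def Hom_iff f chain2[OF g])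
qed

lemma ident_module_map: "M \<in> right_modules C A \<Longrightarrow> ident C (fst M) \<in> module_maps C A M M"
  using moduleD(1-4)[of "fst M" "snd M"] by (simp add: module_maps_def Hom_iff)

lemma Module_category: "category \<M>"
proof
  fix x assume x: "x \<in> Arr \<M>"
  show "source \<M> x \<in> Ob \<M>" "target \<M> x \<in> Ob \<M>"
    using x by (auto simp: Module_Cat_def)
next
  fix M assume "M \<in> Ob \<M>"
  then show "ident \<M> M \<in> Hom \<M> M M"
    using ident_module_map by (auto simp: Module_Hom Module_simps)
next
  fix x y M N K assume "x \<in> Hom \<M> M N" "y \<in> Hom \<M> N K"
  then show "cmp \<M> y x \<in> Hom \<M> M K"
    using module_map_cmp[of M N K] by (auto simp: Module_Hom Module_cmp)
next
  fix x M N assume "x \<in> Hom \<M> M N"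
  then show "cmp \<M> (ident \<M> N) x = x" "cmp \<M> x (ident \<M> M) = x"
    using module_mapD[of _ M N] by (auto simp: Module_Hom Module_cmp Module_simps)
next
  fix x y z M N K L assume "x \<in> Hom \<M> M N" "y \<in> Hom \<M> N K" "z \<in> Hom \<M> K L"
  then show "cmp \<M> (cmp \<M> z y) x = cmp \<M> z (cmp \<M> y x)"
    using module_mapD[of _ M N] module_mapD[of _ N K] module_mapD[of _ K L]
    by (auto simp: Module_Hom Module_cmp)
qed

text \<open>
  Hence an isomorphism of modules is a module map that is invertible in the underlying category
  (\<open>module_iso_iff\<close>).
\<close>

lemma inverse_module_map:
  assumes "(Y, \<sigma>) \<in> right_modules C A" "(Z, \<rho>) \<in> right_modules C A"
    "inverse_arrs f f'" "f \<in> module_maps C A (Y, \<sigma>) (Z, \<rho>)"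
  shows "f' \<in> module_maps C A (Z, \<rho>) (Y, \<sigma>)"
proof -
  note [simp] = moduleD(1-4)[OF assms(1)] moduleD(1-4)[OF assms(2)] module_mapD(1-3)[OF assms(4)]
  have [simp]: "f' \<in> Arr C" "source C f' = Z" "target C f' = Y" "f' \<cdot> f = ident C Y" "f \<cdot> f' = ident C Z"
    using assms(3) by (auto simp: inverse_arrs_def)
  have e: "(f \<triangleleft> \<A>) \<cdot> (f' \<triangleleft> \<A>) = ident C (Z \<star> \<A>)" by (simp flip: rwhisk_cmp)
  have "f' \<cdot> \<rho> = f' \<cdot> (\<rho> \<cdot> (f \<triangleleft> \<A>)) \<cdot> (f' \<triangleleft> \<A>)" by (simp add: e)
  also have "\<dots> = f' \<cdot> (f \<cdot> \<sigma>) \<cdot> (f' \<triangleleft> \<A>)"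
    using module_mapD(4)[OF assms(4)] by simp
  also have "\<dots> = \<sigma> \<cdot> (f' \<triangleleft> \<A>)" using chain2[OF \<open>f' \<cdot> f = ident C Y\<close>] by simp
  finally show ?thesis by (simp add: module_maps_def Hom_iff)
qed

lemma module_iso_iff:
  "iso_ob \<M> (Y, \<sigma>) (Z, \<rho>) \<longleftrightarrow> (Y, \<sigma>) \<in> right_modules C A \<and> (Z, \<rho>) \<in> right_modules C A \<and>
     (\<exists>f f'. inverse_arrs f f' \<and> f \<in> module_maps C A (Y, \<sigma>) (Z, \<rho>))" (is "_ \<longleftrightarrow> ?R")
proof
  assume ?R
  then obtain f f' where f: "inverse_arrs f f'" "f \<in> module_maps C A (Y, \<sigma>) (Z, \<rho>)"
    and m: "(Y, \<sigma>) \<in> right_modules C A" "(Z, \<rho>) \<in> right_modules C A" by blast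
  have "f' \<in> module_maps C A (Z, \<rho>) (Y, \<sigma>)" by (rule inverse_module_map[OF m f])
  then show "iso_ob \<M> (Y, \<sigma>) (Z, \<rho>)"
    unfolding iso_ob_def
    by (intro bexI[of _ "((Y, \<sigma>), f, (Z, \<rho>))"] bexI[of _ "((Z, \<rho>), f', (Y, \<sigma>))"])
      (use f m module_mapD[OF f(2)] in \<open>auto simp: Module_Hom Module_cmp Module_simps inverse_arrs_def\<close>)
next
  assume "iso_ob \<M> (Y, \<sigma>) (Z, \<rho>)"
  then obtain f f' where f: "f \<in> module_maps C A (Y, \<sigma>) (Z, \<rho>)" "f' \<in> module_maps C A (Z, \<rho>) (Y, \<sigma>)"
    and m: "(Y, \<sigma>) \<in> right_modules C A" "(Z, \<rho>) \<in> right_modules C A"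
    and i: "f' \<cdot> f = ident C Y" "f \<cdot> f' = ident C Z"
    unfolding iso_ob_def by (auto simp: Module_Hom Module_cmp Module_simps)
  have "inverse_arrs f f'"
    using i module_mapD(1-3)[OF f(1)] module_mapD(1-3)[OF f(2)] by (simp add: inverse_arrs_def)
  then show ?R using f m by blast
qed


lemma free_module_eq: "free_module C A X = (X \<star> \<A>, (X \<triangleright> \<mu>) \<cdot> assr C X \<A> \<A>)"
  by (simp add: free_module_def)

text \<open>
  The action on \<open>X \<otimes> Z\<close> through the factor \<open>Z\<close>. The free module on \<open>X\<close> is the case \<open>Z = A\<close>.
\<close>

lemma whisk_module:
  assumes "(Z, \<rho>) \<in> right_modules C A" and [simp]: "X \<in> Ob C"
  shows "(X \<star> Z, (X \<triangleright> \<rho>) \<cdot> assr C X Z \<A>) \<in> right_modules C A"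
proof -
  note [simp] = moduleD(1-4)[OF assms(1)]
  let ?r = "(X \<triangleright> \<rho>) \<cdot> assr C X Z \<A>"
  have 1: "(X \<triangleright> (\<rho> \<triangleleft> \<A>)) \<cdot> (X \<triangleright> (assr C Z \<A> \<A>)\<dagger>) = X \<triangleright> merge Z \<A> \<rho> \<A>"
    by (simp add: merge_def)
  have "?r \<cdot> merge (X \<star> Z) \<A> ?r \<A> = (X \<triangleright> \<rho>) \<cdot> (X \<triangleright> (\<rho> \<triangleleft> \<A>)) \<cdot> (assr C X (Z \<star> \<A>) \<A> \<cdot> (assr C X Z \<A> \<triangleleft> \<A>))
      \<cdot> (assr C (X \<star> Z) \<A> \<A>)\<dagger>"
    using chain2[OF assr_nat[of "ident C X" \<rho> "ident C \<A>" X Z \<A>]] by (simp add: merge_def)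
  also have "\<dots> = (X \<triangleright> (\<rho> \<cdot> merge Z \<A> \<rho> \<A>)) \<cdot> assr C X Z (\<A> \<star> \<A>)"
    by (simp add: pentagon_lwhisk merge_def)
  also have "\<dots> = ?r \<cdot> ((X \<star> Z) \<triangleright> \<mu>)"
    using moduleD(5)[OF assms(1)] chain2[OF assr_nat[of "ident C X" "ident C Z" \<mu> X Z \<A>]]
      assr_nat[of "ident C X" "ident C Z" \<mu> X Z \<A>] by simp
  finally have a: "?r \<cdot> merge (X \<star> Z) \<A> ?r \<A> = ?r \<cdot> ((X \<star> Z) \<triangleright> \<mu>)" .
  have r: "(runit C (X \<star> Z))\<dagger> = (assr C X Z (unit_ob C))\<dagger> \<cdot> (X \<triangleright> (runit C Z)\<dagger>)"
    by (simp flip: runit_tensor)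
  have "?r \<cdot> ((X \<star> Z) \<triangleright> \<eta>) \<cdot> (runit C (X \<star> Z))\<dagger> = X \<triangleright> (\<rho> \<cdot> (Z \<triangleright> \<eta>) \<cdot> (runit C Z)\<dagger>)"
    using chain2[OF assr_nat[of "ident C X" "ident C Z" \<eta> X Z \<A>]] by (simp add: r)
  then have b: "?r \<cdot> ((X \<star> Z) \<triangleright> \<eta>) \<cdot> (runit C (X \<star> Z))\<dagger> = ident C (X \<star> Z)"
    using moduleD(6)[OF assms(1)] by simp
  show ?thesis using a b by (simp add: right_module_iff)
qed

lemma free_module: "X \<in> Ob C \<Longrightarrow> free_module C A X \<in> right_modules C A"
  unfolding free_module_eq by (rule whisk_module[OF unit_module])

end


section \<open>Tensor products with free modules\<close>

context commutative_algebra
begin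

abbreviation wmod where "wmod X N \<equiv> (X \<star> fst N, (X \<triangleright> snd N) \<cdot> assr C X (fst N) \<A>)"

text \<open>
  The left action on \<open>Z\<close> is a map of right modules, so a morphism \<open>f : Y \<rightarrow> X \<otimes> A\<close> followed by the
  left action on \<open>Z\<close> is a map of right modules from \<open>Y \<otimes> Z\<close> to \<open>X \<otimes> Z\<close>.
\<close>

lemma whisk_action:
  assumes "(Z, \<rho>) \<in> right_modules C A"
    and [simp]: "f \<in> Arr C" "source C f = Y" "target C f = X \<star> \<A>" "X \<in> Ob C"
  shows "(X \<triangleright> \<rho>) \<cdot> assr C X Z \<A> \<cdot> (((X \<triangleright> left_action C A (Z, \<rho>)) \<cdot> branch X \<A> f Z) \<triangleleft> \<A>)
    = ((X \<triangleright> left_action C A (Z, \<rho>)) \<cdot> branch X \<A> f Z) \<cdot> (Y \<triangleright> \<rho>) \<cdot> assr C Y Z \<A>"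
proof -
  note [simp] = moduleD(1-4)[OF assms(1)] assms(1)
  have [simp]: "Y \<in> Ob C" using source_Ob[of f] by simp
  let ?l = "left_action C A (Z, \<rho>)"
  have "(X \<triangleright> \<rho>) \<cdot> assr C X Z \<A> \<cdot> (((X \<triangleright> ?l) \<cdot> branch X \<A> f Z) \<triangleleft> \<A>)
      = (X \<triangleright> (\<rho> \<cdot> merge \<A> Z ?l \<A>)) \<cdot> branch X \<A> f (Z \<star> \<A>) \<cdot> assr C Y Z \<A>"
    by (subst branch_lwhisk) simp_all
  also have "\<dots> = (X \<triangleright> ?l) \<cdot> ((X \<triangleright> (\<A> \<triangleright> \<rho>)) \<cdot> branch X \<A> f (Z \<star> \<A>)) \<cdot> assr C Y Z \<A>"
    by (simp flip: left_right_action[OF assms(1)])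
  also have "\<dots> = ((X \<triangleright> ?l) \<cdot> branch X \<A> f Z) \<cdot> (Y \<triangleright> \<rho>) \<cdot> assr C Y Z \<A>"
    using branch_nat[of f X \<A> \<rho> Z Y] chain2[OF branch_nat[of f X \<A> \<rho> Z Y]] by simp
  finally show ?thesis .
qed

text \<open>
  For \<open>Y = X \<otimes> A\<close> the two actions on \<open>(Y \<otimes> A) \<otimes> Z\<close> are the beginning of the bar resolution of
  \<open>X \<otimes> Z\<close>, which is split by the unit of \<open>A\<close>. A general \<open>Y\<close> that is isomorphic to a free module
  carries the same splitting, transported along the isomorphism \<open>f\<close>.
\<close>

lemma tensor_over_free:
  assumes M: "(Y, \<sigma>) \<in> right_modules C A" and N: "(Z, \<rho>) \<in> right_modules C A"
    and X[simp]: "X \<in> Ob C"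
    and f: "f \<in> module_maps C A (Y, \<sigma>) (free_module C A X)" "inverse_arrs f f'"
  obtains q s where "q \<in> Hom C (Y \<star> Z) (X \<star> Z)" "s \<in> Hom C (X \<star> Z) (Y \<star> Z)" "q \<cdot> s = ident C (X \<star> Z)"
    "is_coequalizer C (\<sigma> \<triangleleft> Z) ((Y \<triangleright> left_action C A (Z, \<rho>)) \<cdot> assr C Y \<A> Z) q"
    "((X \<triangleright> \<rho>) \<cdot> assr C X Z \<A>) \<cdot> (q \<triangleleft> \<A>) = q \<cdot> (Y \<triangleright> \<rho>) \<cdot> assr C Y Z \<A>"
proof -
  note [simp] = moduleD(1-4)[OF N] moduleD(1-4)[OF M] N
  let ?l = "left_action C A (Z, \<rho>)"
  have [simp]: "f \<in> Arr C" "source C f = Y" "target C f = X \<star> \<A>"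
    using module_mapD(1-3)[OF f(1)] by (simp_all add: free_module_eq)
  have [simp]: "f' \<in> Arr C" "source C f' = X \<star> \<A>" "target C f' = Y"
    "f' \<cdot> f = ident C Y" "f \<cdot> f' = ident C (X \<star> \<A>)"
    using f(2) by (auto simp: inverse_arrs_def)
  have fs: "f \<cdot> \<sigma> = (X \<triangleright> \<mu>) \<cdot> branch X \<A> f \<A>"
    using module_mapD(4)[OF f(1)] by (simp add: free_module_eq branch_def)
  have "f' \<in> module_maps C A (free_module C A X) (Y, \<sigma>)"
    using inverse_module_map[of Y \<sigma> "X \<star> \<A>" _ f f'] M f free_module[OF X] by (simp add: free_module_eq)
  from module_mapD(4)[OF this] have fs': "\<sigma> \<cdot> (f' \<triangleleft> \<A>) = f' \<cdot> (X \<triangleright> \<mu>) \<cdot> assr C X \<A> \<A>"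
    by (simp add: free_module_eq)
  \<comment> \<open>\<open>j\<close> is the inclusion of the generators \<open>X\<close> of the free module \<open>Y\<close>\<close>
  define j where "j = f' \<cdot> (X \<triangleright> \<eta>) \<cdot> (runit C X)\<dagger>"
  have [simp]: "j \<in> Arr C" "source C j = X" "target C j = Y"
    by (simp_all add: j_def)
  have fj: "f \<cdot> j = (X \<triangleright> \<eta>) \<cdot> (runit C X)\<dagger>"
    using chain2[OF \<open>f \<cdot> f' = ident C (X \<star> \<A>)\<close>] by (simp add: j_def)
  have sj: "\<sigma> \<cdot> (j \<triangleleft> \<A>) = f'"
  proof -
    have "\<sigma> \<cdot> (j \<triangleleft> \<A>) = (\<sigma> \<cdot> (f' \<triangleleft> \<A>)) \<cdot> ((X \<triangleright> \<eta>) \<triangleleft> \<A>) \<cdot> ((runit C X)\<dagger> \<triangleleft> \<A>)"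
      by (simp add: j_def)
    also have "\<dots> = f' \<cdot> (X \<triangleright> \<mu>) \<cdot> (assr C X \<A> \<A> \<cdot> ((X \<triangleright> \<eta>) \<triangleleft> \<A>)) \<cdot> ((runit C X)\<dagger> \<triangleleft> \<A>)"
      unfolding fs' by simp
    also have "\<dots> = f' \<cdot> (X \<triangleright> \<mu>) \<cdot> (X \<triangleright> (\<eta> \<triangleleft> \<A>)) \<cdot> (assr C X (unit_ob C) \<A> \<cdot> ((runit C X)\<dagger> \<triangleleft> \<A>))"
      by (simp add: assr_nat[of "ident C X" \<eta> "ident C \<A>" X \<A> \<A>])
    also have "\<dots> = f' \<cdot> (X \<triangleright> (\<mu> \<cdot> (\<eta> \<triangleleft> \<A>) \<cdot> (lunit C \<A>)\<dagger>))"
      by (simp add: triangle')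
    also have "\<mu> \<cdot> (\<eta> \<triangleleft> \<A>) \<cdot> (lunit C \<A>)\<dagger> = ident C \<A>"
      using chain2[OF unit_mult, of "(lunit C \<A>)\<dagger>"] by simp
    finally show ?thesis by simp
  qed
  define q where "q = (X \<triangleright> ?l) \<cdot> branch X \<A> f Z"
  define s where "s = j \<triangleleft> Z"
  define t where "t = ((j \<triangleleft> \<A>) \<cdot> f) \<triangleleft> Z"
  let ?d0 = "\<sigma> \<triangleleft> Z" and ?d1 = "(Y \<triangleright> ?l) \<cdot> assr C Y \<A> Z"
  have [simp]: "q \<in> Arr C" "source C q = Y \<star> Z" "target C q = X \<star> Z"
    "s \<in> Arr C" "source C s = X \<star> Z" "target C s = Y \<star> Z"
    "t \<in> Arr C" "source C t = Y \<star> Z" "target C t = (Y \<star> \<A>) \<star> Z"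
    by (simp_all add: q_def s_def t_def)
  have qs: "q \<cdot> s = ident C (X \<star> Z)"
  proof -
    have "q \<cdot> s = (X \<triangleright> ?l) \<cdot> assr C X \<A> Z \<cdot> ((f \<cdot> j) \<triangleleft> Z)" by (simp add: q_def s_def branch_def)
    also have "\<dots> = (X \<triangleright> ?l) \<cdot> (X \<triangleright> (\<eta> \<triangleleft> Z)) \<cdot> assr C X (unit_ob C) Z \<cdot> ((runit C X)\<dagger> \<triangleleft> Z)"
      using chain2[OF assr_nat[of "ident C X" \<eta> "ident C Z" X \<A> Z]] by (simp add: fj)
    also have "\<dots> = X \<triangleright> (?l \<cdot> (\<eta> \<triangleleft> Z) \<cdot> (lunit C Z)\<dagger>)"
      by (simp add: triangle')
    finally show ?thesis using left_action_unit[OF N] by simp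
  qed
  have coeq: "is_coequalizer C ?d0 ?d1 q"
  proof (rule split_coequalizer[where s = s and t = t and U = "(Y \<star> \<A>) \<star> Z" and V = "Y \<star> Z" and W = "X \<star> Z"])
    have "q \<cdot> ?d0 = (X \<triangleright> ?l) \<cdot> assr C X \<A> Z \<cdot> ((f \<cdot> \<sigma>) \<triangleleft> Z)" by (simp add: q_def branch_def)
    also have "\<dots> = (X \<triangleright> ?l) \<cdot> (assr C X \<A> Z \<cdot> ((X \<triangleright> \<mu>) \<cdot> branch X \<A> f \<A>) \<triangleleft> Z)"
      by (simp only: fs)
    also have "\<dots> = (X \<triangleright> (?l \<cdot> merge \<A> \<A> \<mu> Z)) \<cdot> branch X \<A> f (\<A> \<star> Z) \<cdot> assr C Y \<A> Z"
      by (subst branch_lwhisk) simp_all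
    also have "\<dots> = (X \<triangleright> ?l) \<cdot> ((X \<triangleright> (\<A> \<triangleright> ?l)) \<cdot> branch X \<A> f (\<A> \<star> Z)) \<cdot> assr C Y \<A> Z"
      by (simp add: left_action_assoc[OF N])
    also have "\<dots> = q \<cdot> ?d1"
      using chain2[OF branch_nat[of f X \<A> ?l Z Y]] by (simp add: q_def)
    finally show "q \<cdot> ?d0 = q \<cdot> ?d1" .
    have "?d0 \<cdot> t = (\<sigma> \<cdot> (j \<triangleleft> \<A>) \<cdot> f) \<triangleleft> Z" by (simp add: t_def)
    also have "\<sigma> \<cdot> (j \<triangleleft> \<A>) \<cdot> f = ident C Y" using chain2[OF sj, of f] by simp
    finally show "?d0 \<cdot> t = ident C (Y \<star> Z)" by simp
    have "?d1 \<cdot> t = ((Y \<triangleright> ?l) \<cdot> (j \<triangleleft> (\<A> \<star> Z))) \<cdot> assr C X \<A> Z \<cdot> (f \<triangleleft> Z)"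
      using chain2[OF assr_nat[of j "ident C \<A>" "ident C Z" Y \<A> Z]] by (simp add: t_def)
    also have "(Y \<triangleright> ?l) \<cdot> (j \<triangleleft> (\<A> \<star> Z)) = (j \<triangleleft> Z) \<cdot> (X \<triangleright> ?l)"
      using slide[of j X Y ?l "\<A> \<star> Z" Z] by (simp add: Hom_iff)
    finally show "?d1 \<cdot> t = s \<cdot> q" by (simp add: s_def q_def branch_def)
  qed (use qs in simp_all)
  have "((X \<triangleright> \<rho>) \<cdot> assr C X Z \<A>) \<cdot> (q \<triangleleft> \<A>) = q \<cdot> (Y \<triangleright> \<rho>) \<cdot> assr C Y Z \<A>"
    using whisk_action[OF N, of f Y X] by (simp add: q_def del: rwhisk_cmp)
  then show thesis using that[of q s] qs coeq by (simp add: Hom_iff)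
qed

lemma coequalizer_epi:
  assumes "is_coequalizer C f g q" "k \<cdot> q = k' \<cdot> q" "k \<in> Hom C (target C q) W" "k' \<in> Hom C (target C q) W"
    "f \<in> Arr C" "g \<in> Arr C" "source C f = source C g" "target C g = target C f"
  shows "k = k'"
proof -
  have [simp]: "q \<in> Arr C" "source C q = target C f" and qe: "q \<cdot> f = q \<cdot> g"
    using assms(1) by (auto simp: is_coequalizer_def)
  have [simp]: "k \<in> Arr C" "source C k = target C q" "target C k = W" using assms(3) by (auto simp: Hom_iff)
  have "k \<cdot> q \<in> Hom C (target C f) W" by (simp add: Hom_iff)
  moreover have "(k \<cdot> q) \<cdot> f = (k \<cdot> q) \<cdot> g" using assms(5-8) by (simp add: qe)
  moreover have "W \<in> Ob C" using target_Ob[of k] by simp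
  ultimately have "\<exists>!l. l \<in> Hom C (target C q) W \<and> l \<cdot> q = k \<cdot> q"
    using assms(1) unfolding is_coequalizer_def by blast
  then show ?thesis using assms(2-4) by metis
qed

text \<open>
  Two coequalizers of the two actions are isomorphic. The isomorphism is compatible with the right
  actions because the quotient maps stay epimorphic after tensoring with \<open>A\<close>: the section \<open>s\<close> of one of them
  yields a section of the other.
\<close>

lemma tensor_over_unique:
  assumes M: "(Y, \<sigma>) \<in> right_modules C A" and N: "(Z, \<rho>) \<in> right_modules C A"
    and P: "is_tensor_over C A (Y, \<sigma>) (Z, \<rho>) P" and P': "(P', \<tau>') \<in> right_modules C A"
    and q': "q' \<in> Hom C (Y \<star> Z) P'" "s \<in> Hom C P' (Y \<star> Z)" "q' \<cdot> s = ident C P'"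
    "is_coequalizer C (\<sigma> \<triangleleft> Z) ((Y \<triangleright> left_action C A (Z, \<rho>)) \<cdot> assr C Y \<A> Z) q'"
    "\<tau>' \<cdot> (q' \<triangleleft> \<A>) = q' \<cdot> (Y \<triangleright> \<rho>) \<cdot> assr C Y Z \<A>"
  shows "iso_ob \<M> P (P', \<tau>')"
proof -
  obtain Q \<tau> where [simp]: "P = (Q, \<tau>)" by (cases P) auto
  let ?d0 = "\<sigma> \<triangleleft> Z" and ?d1 = "(Y \<triangleright> left_action C A (Z, \<rho>)) \<cdot> assr C Y \<A> Z"
  obtain q where Qm: "(Q, \<tau>) \<in> right_modules C A" and q: "q \<in> Hom C (Y \<star> Z) Q" "is_coequalizer C ?d0 ?d1 q"
    "\<tau> \<cdot> (q \<triangleleft> \<A>) = q \<cdot> (Y \<triangleright> \<rho>) \<cdot> assr C Y Z \<A>"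
    using P unfolding is_tensor_over_def by auto
  note [simp] = moduleD(1-4)[OF N] moduleD(1-4)[OF M] moduleD(1-4)[OF Qm] moduleD(1-4)[OF P'] N M
  have [simp]: "q \<in> Arr C" "source C q = Y \<star> Z" "target C q = Q" "q' \<in> Arr C" "source C q' = Y \<star> Z"
    "target C q' = P'" "s \<in> Arr C" "source C s = P'" "target C s = Y \<star> Z"
    using q q' by (auto simp: Hom_iff)
  have u: "\<exists>k. k \<in> Hom C (target C p) W \<and> k \<cdot> p = h"
    if "is_coequalizer C ?d0 ?d1 p" "is_coequalizer C ?d0 ?d1 h" "h \<in> Hom C (Y \<star> Z) W" for p h W
  proof -
    have "h \<in> Hom C (target C ?d0) W" "h \<cdot> ?d0 = h \<cdot> ?d1" "W \<in> Ob C"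
      using that(2,3) Hom_Ob[OF that(3)] by (simp_all add: is_coequalizer_def)
    then have "\<exists>!k. k \<in> Hom C (target C p) W \<and> k \<cdot> p = h"
      using that(1) unfolding is_coequalizer_def by blast
    then show ?thesis by blast
  qed
  obtain k where k: "k \<in> Hom C Q P'" "k \<cdot> q = q'" using u[OF q(2) q'(4,1)] by auto
  obtain k' where k': "k' \<in> Hom C P' Q" "k' \<cdot> q' = q" using u[OF q'(4) q(2,1)] by auto
  have [simp]: "k \<in> Arr C" "source C k = Q" "target C k = P'" "k' \<in> Arr C" "source C k' = P'" "target C k' = Q"
    using k k' by (auto simp: Hom_iff)
  have 1: "k' \<cdot> k = ident C Q"
    by (rule coequalizer_epi[OF q(2)]) (simp_all add: k k' Hom_iff)
  have 2: "k \<cdot> k' = ident C P'"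
    by (rule coequalizer_epi[OF q'(4)]) (simp_all add: k k' Hom_iff)
  have eq: "(k \<cdot> \<tau>) \<cdot> (q \<triangleleft> \<A>) = (\<tau>' \<cdot> (k \<triangleleft> \<A>)) \<cdot> (q \<triangleleft> \<A>)"
  proof -
    have "(k \<cdot> \<tau>) \<cdot> (q \<triangleleft> \<A>) = (k \<cdot> q) \<cdot> (Y \<triangleright> \<rho>) \<cdot> assr C Y Z \<A>" by (simp add: q(3))
    also have "\<dots> = \<tau>' \<cdot> ((k \<cdot> q) \<triangleleft> \<A>)" by (simp add: k(2) q'(5))
    finally show ?thesis by simp
  qed
  have qsk: "q \<cdot> (s \<cdot> k) = ident C Q"
  proof -
    have "q \<cdot> (s \<cdot> k) = (k' \<cdot> q') \<cdot> (s \<cdot> k)" by (simp only: k')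
    also have "\<dots> = k' \<cdot> ((q' \<cdot> s) \<cdot> k)" by simp
    finally show ?thesis by (simp add: q'(3) 1)
  qed
  have "k \<cdot> \<tau> = \<tau>' \<cdot> (k \<triangleleft> \<A>)"
  proof (rule epi_cancel[OF eq])
    show "(q \<triangleleft> \<A>) \<cdot> ((s \<cdot> k) \<triangleleft> \<A>) = ident C (Q \<star> \<A>)"
      by (simp add: qsk del: rwhisk_cmp flip: rwhisk_cmp)
  qed (simp_all add: Hom_iff)
  then have "k \<in> module_maps C A (Q, \<tau>) (P', \<tau>')" by (simp add: module_maps_def Hom_iff)
  moreover have "inverse_arrs k k'" using 1 2 by (simp add: inverse_arrs_def)
  ultimately show ?thesis using Qm P' by (auto simp: module_iso_iff)
qed

text \<open>
  The tensor product of modules is chosen by Hilbert's operator; it is determined up to isomorphism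
  because one tensor product, the one on \<open>X \<otimes> N\<close>, is known.
\<close>

lemma tensor_ob_free:
  assumes iso: "iso_ob \<M> M (free_module C A X)" and N: "N \<in> right_modules C A" and [simp]: "X \<in> Ob C"
  shows "iso_ob \<M> (tensor_ob \<M> M N) (wmod X N)"
proof -
  obtain Y \<sigma> Z \<rho> where [simp]: "M = (Y, \<sigma>)" "N = (Z, \<rho>)" by (metis surj_pair)
  note N' = N[simplified]
  obtain f f' where M: "(Y, \<sigma>) \<in> right_modules C A" and f: "inverse_arrs f f'"
    "f \<in> module_maps C A (Y, \<sigma>) (free_module C A X)"
    using iso unfolding free_module_eq by (auto simp: module_iso_iff)
  obtain q s where q: "q \<in> Hom C (Y \<star> Z) (X \<star> Z)" "s \<in> Hom C (X \<star> Z) (Y \<star> Z)" "q \<cdot> s = ident C (X \<star> Z)"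
    "is_coequalizer C (\<sigma> \<triangleleft> Z) ((Y \<triangleright> left_action C A (Z, \<rho>)) \<cdot> assr C Y \<A> Z) q"
    "((X \<triangleright> \<rho>) \<cdot> assr C X Z \<A>) \<cdot> (q \<triangleleft> \<A>) = q \<cdot> (Y \<triangleright> \<rho>) \<cdot> assr C Y Z \<A>"
    using tensor_over_free[OF M N' _ f(2,1)] by auto
  have w: "(X \<star> Z, (X \<triangleright> \<rho>) \<cdot> assr C X Z \<A>) \<in> right_modules C A"
    by (rule whisk_module[OF N']) simp
  have "is_tensor_over C A M N (X \<star> Z, (X \<triangleright> \<rho>) \<cdot> assr C X Z \<A>)"
    unfolding is_tensor_over_def using w q by auto
  then have "is_tensor_over C A M N (tensor_ob \<M> M N)"
    unfolding Module_simps by (rule someI)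
  then show ?thesis using tensor_over_unique[OF M N' _ w q] by simp
qed

lemma free_module_iso:
  assumes "iso_ob C X X'" shows "iso_ob \<M> (free_module C A X) (free_module C A X')"
proof -
  note [simp] = iso_ob_Ob[OF assms]
  obtain f f' where f: "inverse_arrs f f'" "source C f = X" "target C f = X'"
    using assms by (auto simp: iso_ob_iff)
  then have [simp]: "f \<in> Arr C" "f' \<in> Arr C" "source C f = X" "target C f = X'" "source C f' = X'" "target C f' = X"
     "f' \<cdot> f = ident C X" "f \<cdot> f' = ident C X'"
    by (auto simp: inverse_arrs_def)
  have "inverse_arrs (f \<triangleleft> \<A>) (f' \<triangleleft> \<A>)"
    by (simp add: inverse_arrs_def flip: rwhisk_cmp)
  moreover have "f \<triangleleft> \<A> \<in> module_maps C A (free_module C A X) (free_module C A X')"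
    using slide[of f X X' \<mu> "\<A> \<star> \<A>" \<A>] assr_nat[of f "ident C \<A>" "ident C \<A>" X' \<A> \<A>]
      chain2[OF slide[of f X X' \<mu> "\<A> \<star> \<A>" \<A>]]
    by (simp add: module_maps_def Hom_iff free_module_eq)
  ultimately show ?thesis
    using free_module[of X] free_module[of X'] unfolding free_module_eq by (auto simp: module_iso_iff)
qed

lemma whisk_module_iso:
  assumes "iso_ob \<M> M N" and [simp]: "X \<in> Ob C" shows "iso_ob \<M> (wmod X M) (wmod X N)"
proof -
  obtain Y \<sigma> Z \<rho> where [simp]: "M = (Y, \<sigma>)" "N = (Z, \<rho>)" by (metis surj_pair)
  obtain f f' where f: "inverse_arrs f f'" "f \<in> module_maps C A M N"
    and M: "(Y, \<sigma>) \<in> right_modules C A" and N: "(Z, \<rho>) \<in> right_modules C A"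
    using assms by (auto simp: module_iso_iff)
  note [simp] = moduleD(1-4)[OF M] moduleD(1-4)[OF N] module_mapD(1-3)[OF f(2), simplified]
  have [simp]: "f' \<in> Arr C" "source C f' = Z" "target C f' = Y" "f' \<cdot> f = ident C Y" "f \<cdot> f' = ident C Z"
    using f(1) by (auto simp: inverse_arrs_def)
  have "inverse_arrs (X \<triangleright> f) (X \<triangleright> f')"
    by (simp add: inverse_arrs_def flip: lwhisk_cmp)
  moreover have "X \<triangleright> f \<in> module_maps C A (wmod X M) (wmod X N)"
  proof -
    have "(X \<triangleright> f) \<cdot> (X \<triangleright> \<sigma>) = (X \<triangleright> \<rho>) \<cdot> (X \<triangleright> (f \<triangleleft> \<A>))"
      using module_mapD(4)[OF f(2)] by (simp flip: lwhisk_cmp)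
    then show ?thesis
      using assr_nat[of "ident C X" f "ident C \<A>" X Z \<A>] chain2[of "X \<triangleright> f" "X \<triangleright> \<sigma>"]
      by (simp add: module_maps_def Hom_iff)
  qed
  ultimately show ?thesis
    using whisk_module[OF M, of X] whisk_module[OF N, of X] by (auto simp: module_iso_iff)
qed

lemma free_module_tensor:
  assumes [simp]: "X \<in> Ob C" "Y \<in> Ob C"
  shows "iso_ob \<M> (free_module C A (X \<star> Y)) (wmod X (free_module C A Y))"
proof -
  have "inverse_arrs (assr C X Y \<A>) ((assr C X Y \<A>)\<dagger>)" by (simp add: inverse_arrs_def)
  moreover have "assr C X Y \<A> \<in> module_maps C A (free_module C A (X \<star> Y)) (wmod X (free_module C A Y))"
    using chain2[OF assr_nat[of "ident C X" "ident C Y" \<mu> X Y \<A>]] pentagon[of X Y \<A> \<A>]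
    by (simp add: module_maps_def Hom_iff free_module_eq)
  ultimately show ?thesis
    using free_module[of "X \<star> Y"] whisk_module[OF free_module[of Y, unfolded free_module_eq], of X]
    by (auto simp: module_iso_iff free_module_eq)
qed

lemma free_module_unit: "iso_ob \<M> (free_module C A (unit_ob C)) (\<A>, \<mu>)"
proof -
  have "inverse_arrs (lunit C \<A>) ((lunit C \<A>)\<dagger>)" by (simp add: inverse_arrs_def)
  moreover have "lunit C \<A> \<in> module_maps C A (free_module C A (unit_ob C)) (\<A>, \<mu>)"
    using chain2[OF lunit_nat[of \<mu> \<A>]] lunit_tensor[of \<A> \<A>]
    by (simp add: module_maps_def Hom_iff free_module_eq)
  ultimately show ?thesis
    using free_module[of "unit_ob C"] unit_module by (auto simp: module_iso_iff free_module_eq)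
qed

lemma tensor_free_free:
  assumes "iso_ob \<M> M (free_module C A X)" "iso_ob \<M> N (free_module C A Y)" "X \<in> Ob C" "Y \<in> Ob C"
  shows "iso_ob \<M> (tensor_ob \<M> M N) (free_module C A (X \<star> Y))"
proof -
  interpret M: category \<M> by (rule Module_category)
  have "N \<in> right_modules C A" using M.iso_ob_Ob(1)[OF assms(2)] by (simp add: Module_simps)
  from M.iso_ob_trans[OF tensor_ob_free[OF assms(1) this assms(3)] whisk_module_iso[OF assms(2,3)]]
  show ?thesis using M.iso_ob_sym[OF free_module_tensor[OF assms(3,4)]] M.iso_ob_trans by blast
qed

end


section \<open>Duality and invertibility of the base object\<close>

context cstar_tensor_category
begin

text \<open>
  For a dual \<open>D\<close> of \<open>X\<close> with coevaluation \<open>R : I \<rightarrow> D \<otimes> X\<close>, the transpose of \<open>f : X \<otimes> D \<rightarrow> Y\<close> is the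
  morphism from \<open>X\<close> to \<open>Y \<otimes> X\<close> obtained by bending the factor \<open>D\<close> to the right.
\<close>

definition transpose_map :: "'o \<Rightarrow> 'o \<Rightarrow> 'm \<Rightarrow> 'm \<Rightarrow> 'm" where
  "transpose_map X D R f = merge X D f X \<cdot> (X \<triangleright> R) \<cdot> (runit C X)\<dagger>"

lemma runit_merge:
  assumes [simp]: "X \<in> Ob C" "D \<in> Ob C" "f \<in> Arr C" "source C f = X \<star> D" "target C f = Y"
  shows "runit C Y \<cdot> merge X D f (unit_ob C) = f \<cdot> (X \<triangleright> runit C D)"
proof -
  have [simp]: "Y \<in> Ob C" using target_Ob[of f] by simp
  have "runit C Y \<cdot> merge X D f (unit_ob C) = f \<cdot> runit C (X \<star> D) \<cdot> (assr C X D (unit_ob C))\<dagger>"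
    by (simp add: merge_def chain2[OF runit_nat[of f Y]])
  then show ?thesis by (simp flip: runit_tensor)
qed

context
  fixes X D R S
  assumes XD [simp]: "X \<in> Ob C" "D \<in> Ob C"
    and RH: "R \<in> Hom C (unit_ob C) (D \<star> X)" and SH: "S \<in> Hom C (unit_ob C) (X \<star> D)"
    and snake1: "lunit C X \<cdot> (S\<dagger> \<diamondop> ident C X) \<cdot> (assr C X D X)\<dagger> \<cdot> (ident C X \<diamondop> R) = runit C X"
    and snake2: "lunit C D \<cdot> (R\<dagger> \<diamondop> ident C D) \<cdot> (assr C D X D)\<dagger> \<cdot> (ident C D \<diamondop> S) = runit C D"
begin

lemma RS_simps [simp]: "R \<in> Arr C" "source C R = unit_ob C" "target C R = D \<star> X"
  "S \<in> Arr C" "source C S = unit_ob C" "target C S = X \<star> D"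
  using RH SH by (auto simp: Hom_iff)

lemma transpose_simps [simp]:
  assumes "f \<in> Arr C" "source C f = X \<star> D"
  shows "transpose_map X D R f \<in> Arr C" "source C (transpose_map X D R f) = X"
    "target C (transpose_map X D R f) = target C f \<star> X"
  using assms by (simp_all add: transpose_map_def)

text \<open>
  Transposing and then adding a factor \<open>W\<close> is the same as adding \<open>D \<otimes> X\<close> in front of \<open>W\<close> and then
  applying \<open>f\<close>. With \<open>W = D\<close> this brings the second duality equation into play.
\<close>

lemma branch_transpose:
  assumes [simp]: "f \<in> Arr C" "source C f = X \<star> D" "target C f = Y" "W \<in> Ob C"
  shows "branch Y X (transpose_map X D R f) W = merge X D f (X \<star> W) \<cdot> (X \<triangleright> (branch D X R W \<cdot> (lunit C W)\<dagger>))"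
proof -
  have [simp]: "Y \<in> Ob C" using target_Ob[of f] by simp
  let ?I = "unit_ob C"
  have p: "assr C (X \<star> D) X W \<cdot> ((assr C X D X)\<dagger> \<triangleleft> W)
      = (assr C X D (X \<star> W))\<dagger> \<cdot> (X \<triangleright> assr C D X W) \<cdot> assr C X (D \<star> X) W"
  proof -
    have "assr C X D (X \<star> W) \<cdot> (assr C (X \<star> D) X W \<cdot> ((assr C X D X)\<dagger> \<triangleleft> W))
        = (assr C X D (X \<star> W) \<cdot> assr C (X \<star> D) X W) \<cdot> ((assr C X D X)\<dagger> \<triangleleft> W)" by simp
    also have "\<dots> = (X \<triangleright> assr C D X W) \<cdot> assr C X (D \<star> X) W \<cdot> ((assr C X D X \<triangleleft> W) \<cdot> ((assr C X D X)\<dagger> \<triangleleft> W))"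
      by (simp flip: pentagon)
    also have "\<dots> = (X \<triangleright> assr C D X W) \<cdot> assr C X (D \<star> X) W" by (simp flip: rwhisk_cmp)
    finally have "(assr C X D (X \<star> W))\<dagger> \<cdot> (assr C X D (X \<star> W) \<cdot> (assr C (X \<star> D) X W \<cdot> ((assr C X D X)\<dagger> \<triangleleft> W)))
      = (assr C X D (X \<star> W))\<dagger> \<cdot> (X \<triangleright> assr C D X W) \<cdot> assr C X (D \<star> X) W" by simp
    then show ?thesis by (subst (asm) assr_chain) simp_all
  qed
  have "branch Y X (transpose_map X D R f) W
      = (assr C Y X W \<cdot> ((f \<triangleleft> X) \<triangleleft> W)) \<cdot> ((assr C X D X)\<dagger> \<triangleleft> W) \<cdot> ((X \<triangleright> R) \<triangleleft> W) \<cdot> ((runit C X)\<dagger> \<triangleleft> W)"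
    by (simp add: branch_def transpose_map_def merge_def)
  also have "\<dots> = (f \<triangleleft> (X \<star> W)) \<cdot> (assr C (X \<star> D) X W \<cdot> ((assr C X D X)\<dagger> \<triangleleft> W)) \<cdot> ((X \<triangleright> R) \<triangleleft> W) \<cdot> ((runit C X)\<dagger> \<triangleleft> W)"
    by (subst assr_nat) simp_all
  also have "\<dots> = merge X D f (X \<star> W) \<cdot> (X \<triangleright> assr C D X W) \<cdot> (assr C X (D \<star> X) W \<cdot> ((X \<triangleright> R) \<triangleleft> W)) \<cdot> ((runit C X)\<dagger> \<triangleleft> W)"
    unfolding p by (simp add: merge_def)
  also have "\<dots> = merge X D f (X \<star> W) \<cdot> (X \<triangleright> assr C D X W) \<cdot> (X \<triangleright> (R \<triangleleft> W)) \<cdot> (assr C X ?I W \<cdot> ((runit C X)\<dagger> \<triangleleft> W))"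
    using assr_nat[of "ident C X" R "ident C W" X "D \<star> X" W] by simp
  also have "\<dots> = merge X D f (X \<star> W) \<cdot> (X \<triangleright> (branch D X R W \<cdot> (lunit C W)\<dagger>))"
    by (simp add: triangle' branch_def)
  finally show ?thesis .
qed

lemma snake2_adj: "runit C D \<cdot> (D \<triangleright> S\<dagger>) \<cdot> branch D X R D \<cdot> (lunit C D)\<dagger> = ident C D"
proof -
  have "(D \<triangleright> S\<dagger>) \<cdot> branch D X R D \<cdot> (lunit C D)\<dagger> = (runit C D)\<dagger>"
    using arg_cong[OF snake2, of "\<lambda>f. f\<dagger>"] by (simp add: branch_def)
  then show ?thesis by simp
qed

text \<open>The transpose determines a morphism, by one of the two duality equations.\<close>

lemma untranspose:
  assumes [simp]: "f \<in> Arr C" "source C f = X \<star> D" "target C f = Y"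
  shows "f = runit C Y \<cdot> (Y \<triangleright> S\<dagger>) \<cdot> branch Y X (transpose_map X D R f) D"
proof -
  have [simp]: "Y \<in> Ob C" using target_Ob[of f] by simp
  let ?b = "branch D X R D \<cdot> (lunit C D)\<dagger>"
  have "runit C Y \<cdot> (Y \<triangleright> S\<dagger>) \<cdot> branch Y X (transpose_map X D R f) D
      = runit C Y \<cdot> ((Y \<triangleright> S\<dagger>) \<cdot> merge X D f (X \<star> D)) \<cdot> (X \<triangleright> ?b)"
    by (subst branch_transpose) simp_all
  also have "\<dots> = (runit C Y \<cdot> merge X D f (unit_ob C)) \<cdot> (X \<triangleright> (D \<triangleright> S\<dagger>)) \<cdot> (X \<triangleright> ?b)"
    using merge_nat[of f X D "S\<dagger>" "unit_ob C"] chain2[OF merge_nat[of f X D "S\<dagger>" "unit_ob C"]] by simp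
  also have "\<dots> = f \<cdot> (X \<triangleright> (runit C D \<cdot> (D \<triangleright> S\<dagger>) \<cdot> ?b))"
    by (subst runit_merge) simp_all
  finally show ?thesis by (simp add: snake2_adj)
qed

lemma transpose_eq:
  assumes "f \<in> Hom C (X \<star> D) Y" "g \<in> Hom C (X \<star> D) Y" "transpose_map X D R f = transpose_map X D R g"
  shows "f = g"
  using untranspose[of f Y] untranspose[of g Y] assms by (metis Hom_iff)

text \<open>
  The transpose of the evaluation \<open>S\<^sup>*\<close> is the identity of \<open>X\<close>, up to a unitor.
\<close>

lemma transpose_unit:
  assumes [simp]: "g \<in> Arr C" "source C g = unit_ob C"
  shows "transpose_map X D R (g \<cdot> S\<dagger>) = (g \<triangleleft> X) \<cdot> (lunit C X)\<dagger>"
proof -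
  have "transpose_map X D R (g \<cdot> S\<dagger>) = (g \<triangleleft> X) \<cdot> (lunit C X)\<dagger>
      \<cdot> (lunit C X \<cdot> (S\<dagger> \<triangleleft> X) \<cdot> (assr C X D X)\<dagger> \<cdot> (X \<triangleright> R)) \<cdot> (runit C X)\<dagger>"
    by (simp add: transpose_map_def merge_def)
  then show ?thesis by (simp add: snake1)
qed

text \<open>
  Every pairing of \<open>X\<close> with some object \<open>Z\<close> factors through the evaluation of \<open>X\<close> on \<open>D\<close>, and, by
  \<open>dual_cancel\<close>, in only one way.
\<close>

lemma dual_cap:
  assumes [simp]: "e \<in> Arr C" "source C e = X \<star> Z" "target C e = unit_ob C" "Z \<in> Ob C"
  defines "h \<equiv> runit C D \<cdot> (D \<triangleright> e) \<cdot> branch D X R Z \<cdot> (lunit C Z)\<dagger>"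
  shows "h \<in> Hom C Z D" "S\<dagger> \<cdot> (X \<triangleright> h) = e"
proof -
  let ?I = "unit_ob C" and ?b = "branch D X R Z \<cdot> (lunit C Z)\<dagger>"
  show "h \<in> Hom C Z D" by (simp add: h_def Hom_iff)
  have "S\<dagger> \<cdot> (X \<triangleright> h) = (S\<dagger> \<cdot> (X \<triangleright> runit C D)) \<cdot> (X \<triangleright> (D \<triangleright> e)) \<cdot> (X \<triangleright> ?b)"
    by (simp add: h_def)
  also have "\<dots> = runit C ?I \<cdot> (merge X D (S\<dagger>) ?I \<cdot> (X \<triangleright> (D \<triangleright> e))) \<cdot> (X \<triangleright> ?b)"
    by (simp flip: runit_merge)
  also have "\<dots> = (lunit C ?I \<cdot> (?I \<triangleright> e)) \<cdot> (merge X D (S\<dagger>) (X \<star> Z) \<cdot> (X \<triangleright> ?b))"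
    using merge_nat[of "S\<dagger>" X D e ?I] chain2[OF merge_nat[of "S\<dagger>" X D e ?I]] by (simp add: lunit_unit)
  also have "\<dots> = e \<cdot> lunit C (X \<star> Z) \<cdot> (merge X D (S\<dagger>) (X \<star> Z) \<cdot> (X \<triangleright> ?b))"
    using chain2[OF lunit_nat[of e ?I]] by (simp add: lunit_nat)
  also have "merge X D (S\<dagger>) (X \<star> Z) \<cdot> (X \<triangleright> ?b) = branch ?I X (transpose_map X D R (S\<dagger>)) Z"
    by (subst branch_transpose) simp_all
  also have "transpose_map X D R (S\<dagger>) = (lunit C X)\<dagger>"
    using transpose_unit[of "ident C ?I"] by simp
  also have "branch ?I X ((lunit C X)\<dagger>) Z = (lunit C (X \<star> Z))\<dagger>"
  proof -
    have "(lunit C X \<triangleleft> Z)\<dagger> = (lunit C (X \<star> Z) \<cdot> assr C ?I X Z)\<dagger>"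
      by (simp only: lunit_tensor XD assms)
    then show ?thesis by (simp add: branch_def)
  qed
  finally show "S\<dagger> \<cdot> (X \<triangleright> h) = e" by simp
qed

lemma dual_cancel:
  assumes [simp]: "g \<in> Arr C" "source C g = Z" "target C g = D" "h \<in> Arr C" "source C h = Z" "target C h = D"
    and eq: "S\<dagger> \<cdot> (X \<triangleright> g) = S\<dagger> \<cdot> (X \<triangleright> h)"
  shows "g = h"
proof -
  have "runit C D \<cdot> (D \<triangleright> (S\<dagger> \<cdot> (X \<triangleright> g))) \<cdot> branch D X R Z \<cdot> (lunit C Z)\<dagger> = g"
    if [simp]: "g \<in> Arr C" "source C g = Z" "target C g = D" for g
  proof -
    have [simp]: "Z \<in> Ob C" using source_Ob[of g] by simp
    have "(D \<triangleright> (X \<triangleright> g)) \<cdot> branch D X R Z \<cdot> (lunit C Z)\<dagger> = branch D X R D \<cdot> (unit_ob C \<triangleright> g) \<cdot> (lunit C Z)\<dagger>"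
      by (simp add: chain2[OF branch_nat[of R D X g D "unit_ob C"]])
    also have "\<dots> = branch D X R D \<cdot> (lunit C D)\<dagger> \<cdot> g" by (simp add: lunit_adj_nat[of g D])
    finally have "runit C D \<cdot> (D \<triangleright> (S\<dagger> \<cdot> (X \<triangleright> g))) \<cdot> branch D X R Z \<cdot> (lunit C Z)\<dagger>
        = (runit C D \<cdot> (D \<triangleright> S\<dagger>) \<cdot> branch D X R D \<cdot> (lunit C D)\<dagger>) \<cdot> g" by simp
    then show ?thesis by (simp only: snake2_adj) simp
  qed
  note recover = this
  show ?thesis
    by (rule trans[OF sym[OF recover[of g, unfolded eq]] recover[of h]]) simp_all
qed

end

declare RS_simps [simp del] transpose_simps [simp del]

end

text \<open>
  A module endomorphism of \<open>A\<close> is determined by its value on the unit, so connectedness means that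
  \<open>A\<close> has only scalar module endomorphisms (\<open>algebra_endo_scalar\<close>).
\<close>

locale connected_algebra = commutative_algebra +
  assumes connected: "Hom C (unit_ob C) \<A> = range (\<lambda>c. c *\<^sub>a \<eta>)"
    and unit_neq_zero: "\<eta> \<noteq> zero_arr C (unit_ob C) \<A>"
begin

lemma unit_norm: obtains d where "\<eta>\<dagger> \<cdot> \<eta> = d *\<^sub>a ident C (unit_ob C)" "d \<noteq> 0"
proof -
  have "\<eta>\<dagger> \<cdot> \<eta> \<in> Hom C (unit_ob C) (unit_ob C)" by (simp add: Hom_iff)
  then obtain d where d: "\<eta>\<dagger> \<cdot> \<eta> = d *\<^sub>a ident C (unit_ob C)" using simple_unit by auto
  moreover have "d \<noteq> 0"
  proof
    assume "d = 0"
    then show False using d adj_cmp_zeroD[OF unit_Hom] unit_neq_zero by simp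
  qed
  ultimately show thesis by (rule that)
qed

lemma algebra_ident_nonzero: "ident C \<A> \<noteq> zero_arr C \<A> \<A>"
proof
  assume "ident C \<A> = zero_arr C \<A> \<A>"
  then have "ident C \<A> \<cdot> \<eta> = zero_arr C \<A> \<A> \<cdot> \<eta>" by simp
  then show False using unit_neq_zero by simp
qed

lemma algebra_endo_scalar:
  assumes k: "k \<in> module_maps C A (\<A>, \<mu>) (\<A>, \<mu>)"
  obtains c where "k = c *\<^sub>a ident C \<A>"
proof -
  note [simp] = module_mapD(1-3)[OF k, simplified]
  have "k \<cdot> \<eta> \<in> Hom C (unit_ob C) \<A>" by (simp add: Hom_iff)
  then obtain c where c: "k \<cdot> \<eta> = c *\<^sub>a \<eta>" using connected by auto
  have u: "\<mu> \<cdot> (\<eta> \<triangleleft> \<A>) \<cdot> (lunit C \<A>)\<dagger> = ident C \<A>"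
    using chain2[OF unit_mult, of "(lunit C \<A>)\<dagger>"] by simp
  have "k = k \<cdot> (\<mu> \<cdot> (\<eta> \<triangleleft> \<A>) \<cdot> (lunit C \<A>)\<dagger>)" by (simp add: u)
  also have "\<dots> = \<mu> \<cdot> ((k \<cdot> \<eta>) \<triangleleft> \<A>) \<cdot> (lunit C \<A>)\<dagger>"
    using module_mapD(4)[OF k, simplified] chain2[OF module_mapD(4)[OF k, simplified]] by simp
  also have "\<dots> = c *\<^sub>a ident C \<A>" by (simp add: c u)
  finally show thesis by (rule that)
qed

context
  fixes X Z \<rho> \<alpha> \<alpha>'
  assumes X [simp]: "X \<in> Ob C" and N: "(Z, \<rho>) \<in> right_modules C A"
    and iso: "inverse_arrs \<alpha> \<alpha>'" and map: "\<alpha> \<in> module_maps C A (wmod X (Z, \<rho>)) (\<A>, \<mu>)"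
begin

text \<open>
  In this context \<open>N = (Z, \<rho>)\<close> is an inverse, over \<open>A\<close>, of the free module on \<open>X\<close>: the module \<open>X \<otimes> N\<close>
  is isomorphic to \<open>A\<close> by \<open>\<alpha>\<close>. The aim is that \<open>X\<close> itself is invertible.
\<close>

abbreviation (input) "lam \<equiv> left_action C A (Z, \<rho>)"

lemma N_simps [simp]: "(Z, \<rho>) \<in> right_modules C A" "Z \<in> Ob C" "\<rho> \<in> Arr C" "source C \<rho> = Z \<star> \<A>" "target C \<rho> = Z"
  using moduleD(1-4)[OF N] N by auto

lemma alpha_simps [simp]: "\<alpha> \<in> Arr C" "source C \<alpha> = X \<star> Z" "target C \<alpha> = \<A>"
  "\<alpha>' \<in> Arr C" "source C \<alpha>' = \<A>" "target C \<alpha>' = X \<star> Z" "\<alpha>' \<cdot> \<alpha> = ident C (X \<star> Z)" "\<alpha> \<cdot> \<alpha>' = ident C \<A>"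
proof -
  show 1: "\<alpha> \<in> Arr C" "source C \<alpha> = X \<star> Z" "target C \<alpha> = \<A>"
    using module_mapD(1-3)[OF map] by simp_all
  show "\<alpha>' \<in> Arr C" "source C \<alpha>' = \<A>" "target C \<alpha>' = X \<star> Z" "\<alpha>' \<cdot> \<alpha> = ident C (X \<star> Z)" "\<alpha> \<cdot> \<alpha>' = ident C \<A>"
    using iso unfolding inverse_arrs_def 1 by blast+
qed

lemma alpha_map: "\<alpha> \<cdot> (X \<triangleright> \<rho>) \<cdot> assr C X Z \<A> = \<mu> \<cdot> (\<alpha> \<triangleleft> \<A>)"
  using module_mapD(4)[OF map] by simp

lemma alpha_map': "\<alpha> \<cdot> (X \<triangleright> \<rho>) = \<mu> \<cdot> (\<alpha> \<triangleleft> \<A>) \<cdot> (assr C X Z \<A>)\<dagger>"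
  using chain3[OF alpha_map, of "(assr C X Z \<A>)\<dagger>"] by simp

lemma alpha_left: "\<alpha> \<cdot> (X \<triangleright> lam) = \<mu> \<cdot> (\<A> \<triangleright> \<alpha>) \<cdot> cross X \<A> Z"
proof -
  let ?b = "X \<triangleright> braid C Z \<A>"
  have "(\<alpha> \<cdot> (X \<triangleright> lam)) \<cdot> ?b = \<alpha> \<cdot> (X \<triangleright> \<rho>)"
    using lwhisk_cmp[of "braid C Z \<A>" lam X] by (simp add: left_action_braid)
  also have "\<dots> = (\<mu> \<cdot> braid C \<A> \<A>) \<cdot> (\<alpha> \<triangleleft> \<A>) \<cdot> (assr C X Z \<A>)\<dagger>"
    by (simp add: alpha_map' chain2[OF mult_comm])
  also have "\<dots> = \<mu> \<cdot> (\<A> \<triangleright> \<alpha>) \<cdot> (braid C (X \<star> Z) \<A> \<cdot> (assr C X Z \<A>)\<dagger>)"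
    by (simp add: chain2[OF braid_nat[of \<alpha> "ident C \<A>" \<A> \<A>]])
  also have "\<dots> = (\<mu> \<cdot> (\<A> \<triangleright> \<alpha>) \<cdot> cross X \<A> Z) \<cdot> ?b"
    by (simp add: cross_hexagon2)
  finally have eq: "(\<alpha> \<cdot> (X \<triangleright> lam)) \<cdot> ?b = (\<mu> \<cdot> (\<A> \<triangleright> \<alpha>) \<cdot> cross X \<A> Z) \<cdot> ?b" .
  show ?thesis
    by (rule epi_cancel[OF eq, of "X \<triangleright> (braid C Z \<A>)\<dagger>"]) (simp_all add: Hom_iff flip: lwhisk_cmp)
qed

text \<open>
  The isomorphism \<open>\<alpha>\<close> with its two factors exchanged. While \<open>\<alpha>\<close> is linear in the action of \<open>A\<close> on
  the right, \<open>\<beta>\<close> is linear for the left action on \<open>Z\<close>, which now stands in the first factor.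
\<close>

abbreviation (input) "\<beta> \<equiv> \<alpha> \<cdot> (braid C X Z)\<dagger>"

lemma beta_left: "\<beta> \<cdot> merge \<A> Z lam X = \<mu> \<cdot> (\<A> \<triangleright> \<beta>)"
proof -
  let ?e = "(\<A> \<triangleright> braid C X Z) \<cdot> cross X \<A> Z"
  have "(\<beta> \<cdot> merge \<A> Z lam X) \<cdot> ?e = \<alpha> \<cdot> (braid C X Z)\<dagger> \<cdot> (braid C X Z \<cdot> (X \<triangleright> lam))"
    by (subst braid_merge_right) simp_all
  also have "\<dots> = \<mu> \<cdot> (\<A> \<triangleright> \<alpha>) \<cdot> cross X \<A> Z" by (simp add: alpha_left)
  also have "\<dots> = (\<mu> \<cdot> (\<A> \<triangleright> \<beta>)) \<cdot> ?e"
  proof -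
    have e: "(\<A> \<triangleright> (braid C X Z)\<dagger>) \<cdot> (\<A> \<triangleright> braid C X Z) = ident C (\<A> \<star> (X \<star> Z))"
      by (simp flip: lwhisk_cmp)
    show ?thesis by (simp add: chain2[OF e])
  qed
  finally have eq: "(\<beta> \<cdot> merge \<A> Z lam X) \<cdot> ?e = (\<mu> \<cdot> (\<A> \<triangleright> \<beta>)) \<cdot> ?e" .
  have e: "?e \<cdot> ((cross X \<A> Z)\<dagger> \<cdot> (\<A> \<triangleright> (braid C X Z)\<dagger>)) = ident C (\<A> \<star> (Z \<star> X))"
    by (simp flip: lwhisk_cmp)
  show ?thesis by (rule epi_cancel[OF eq e]) (simp_all add: Hom_iff)
qed

text \<open>
  By \<open>whisk_action\<close> the morphism in question is a module endomorphism of \<open>X \<otimes> N\<close>, which is isomorphic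
  to \<open>A\<close>.
\<close>

lemma act_through_scalar:
  assumes k [simp]: "k \<in> Arr C" "source C k = X" "target C k = X \<star> \<A>"
  obtains c where "(X \<triangleright> lam) \<cdot> branch X \<A> k Z = c *\<^sub>a ident C (X \<star> Z)"
proof -
  let ?K = "(X \<triangleright> lam) \<cdot> branch X \<A> k Z"
  let ?W = "wmod X (Z, \<rho>)"
  have w: "?W \<in> right_modules C A" using whisk_module[OF N X] by simp
  have K: "?K \<in> module_maps C A ?W ?W"
  proof -
    have "((X \<triangleright> \<rho>) \<cdot> assr C X Z \<A>) \<cdot> (?K \<triangleleft> \<A>) = (X \<triangleright> \<rho>) \<cdot> assr C X Z \<A> \<cdot> (?K \<triangleleft> \<A>)"
      by (rule assoc) simp_all
    then have "?K \<cdot> snd ?W = snd ?W \<cdot> (?K \<triangleleft> \<A>)"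
      using whisk_action[OF N k X] by (simp only: fst_conv snd_conv)
    moreover have "?K \<in> Hom C (fst ?W) (fst ?W)" by (simp add: Hom_iff)
    ultimately show ?thesis unfolding module_maps_def by blast
  qed
  have "\<alpha>' \<in> module_maps C A (\<A>, \<mu>) ?W"
    using inverse_module_map[of "X \<star> Z" _ \<A> \<mu> \<alpha> \<alpha>'] w unit_module iso map by simp
  then have "\<alpha> \<cdot> (?K \<cdot> \<alpha>') \<in> module_maps C A (\<A>, \<mu>) (\<A>, \<mu>)"
    using module_map_cmp[OF unit_module w unit_module _ map] module_map_cmp[OF unit_module w w _ K] by blast
  then obtain c where c: "\<alpha> \<cdot> ?K \<cdot> \<alpha>' = c *\<^sub>a ident C \<A>" by (rule algebra_endo_scalar) simp
  have 1: "\<alpha>' \<cdot> (\<alpha> \<cdot> ?K \<cdot> \<alpha>') \<cdot> \<alpha> = ?K"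
    by (simp add: chain2[OF alpha_simps(7)])
  have "?K = c *\<^sub>a ident C (X \<star> Z)" by (subst 1[symmetric], subst c) simp
  then show thesis by (rule that)
qed

text \<open>
  The action on \<open>Z\<close> is faithful: tensor it with \<open>X\<close> and use \<open>\<beta>\<close> to turn \<open>Z \<otimes> X\<close> into \<open>A\<close>. This
  gives the action of \<open>k\<close> on \<open>A\<close> by multiplication, whose value on the unit of \<open>A\<close> is \<open>k\<close>.
\<close>

lemma act_through_recover:
  assumes [simp]: "k \<in> Arr C" "source C k = X" "target C k = X \<star> \<A>"
  shows "k = (X \<triangleright> \<beta>) \<cdot> assr C X Z X \<cdot> (((X \<triangleright> lam) \<cdot> branch X \<A> k Z) \<triangleleft> X) \<cdot> (assr C X Z X)\<dagger>
      \<cdot> (X \<triangleright> (braid C X Z \<cdot> \<alpha>')) \<cdot> (X \<triangleright> \<eta>) \<cdot> (runit C X)\<dagger>" (is "_ = ?R \<cdot> _ \<cdot> _ \<cdot> _ \<cdot> _ \<cdot> _")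
proof -
  let ?K = "(X \<triangleright> lam) \<cdot> branch X \<A> k Z"
  have b: "assr C X Z X \<cdot> (?K \<triangleleft> X) = (X \<triangleright> merge \<A> Z lam X) \<cdot> branch X \<A> k (Z \<star> X) \<cdot> assr C X Z X"
    by (rule branch_lwhisk) simp_all
  have "assr C X Z X \<cdot> (?K \<triangleleft> X) \<cdot> (assr C X Z X)\<dagger> = (assr C X Z X \<cdot> (?K \<triangleleft> X)) \<cdot> (assr C X Z X)\<dagger>"
    by (simp del: rwhisk_cmp)
  also have "\<dots> = (X \<triangleright> merge \<A> Z lam X) \<cdot> branch X \<A> k (Z \<star> X)"
    unfolding b by simp
  finally have "(X \<triangleright> \<beta>) \<cdot> assr C X Z X \<cdot> (?K \<triangleleft> X) \<cdot> (assr C X Z X)\<dagger>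
      = (X \<triangleright> (\<beta> \<cdot> merge \<A> Z lam X)) \<cdot> branch X \<A> k (Z \<star> X)" by simp
  also have "\<dots> = (X \<triangleright> \<mu>) \<cdot> ((X \<triangleright> (\<A> \<triangleright> \<beta>)) \<cdot> branch X \<A> k (Z \<star> X))"
    unfolding beta_left by simp
  also have "(X \<triangleright> (\<A> \<triangleright> \<beta>)) \<cdot> branch X \<A> k (Z \<star> X) = branch X \<A> k \<A> \<cdot> (X \<triangleright> \<beta>)"
    by (rule sym, rule trans[OF branch_nat]) simp_all
  finally have 1: "(X \<triangleright> \<beta>) \<cdot> assr C X Z X \<cdot> (?K \<triangleleft> X) \<cdot> (assr C X Z X)\<dagger> = (X \<triangleright> \<mu>) \<cdot> branch X \<A> k \<A> \<cdot> (X \<triangleright> \<beta>)" .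
  have bn: "branch X \<A> k \<A> \<cdot> (X \<triangleright> \<eta>) = (X \<triangleright> (\<A> \<triangleright> \<eta>)) \<cdot> assr C X \<A> (unit_ob C) \<cdot> (k \<triangleleft> unit_ob C)"
    by (rule trans[OF branch_nat]) (simp_all add: branch_def)
  have "(X \<triangleright> \<beta>) \<cdot> assr C X Z X \<cdot> (?K \<triangleleft> X) \<cdot> (assr C X Z X)\<dagger> \<cdot> (X \<triangleright> (braid C X Z \<cdot> \<alpha>')) \<cdot> (X \<triangleright> \<eta>) \<cdot> (runit C X)\<dagger>
     = ((X \<triangleright> \<beta>) \<cdot> assr C X Z X \<cdot> (?K \<triangleleft> X) \<cdot> (assr C X Z X)\<dagger>) \<cdot> (X \<triangleright> (braid C X Z \<cdot> \<alpha>')) \<cdot> (X \<triangleright> \<eta>) \<cdot> (runit C X)\<dagger>"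
    by simp
  also have "\<dots> = (X \<triangleright> \<mu>) \<cdot> branch X \<A> k \<A> \<cdot> ((X \<triangleright> \<beta>) \<cdot> (X \<triangleright> (braid C X Z \<cdot> \<alpha>'))) \<cdot> (X \<triangleright> \<eta>) \<cdot> (runit C X)\<dagger>"
    unfolding 1 by simp
  also have "(X \<triangleright> \<beta>) \<cdot> (X \<triangleright> (braid C X Z \<cdot> \<alpha>')) = ident C (X \<star> \<A>)"
    by (simp flip: lwhisk_cmp)
  also have "(X \<triangleright> \<mu>) \<cdot> branch X \<A> k \<A> \<cdot> ident C (X \<star> \<A>) \<cdot> (X \<triangleright> \<eta>) \<cdot> (runit C X)\<dagger>
      = (X \<triangleright> \<mu>) \<cdot> (X \<triangleright> (\<A> \<triangleright> \<eta>)) \<cdot> assr C X \<A> (unit_ob C) \<cdot> ((k \<triangleleft> unit_ob C) \<cdot> (runit C X)\<dagger>)"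
    by (simp add: chain2[OF bn])
  also have "(k \<triangleleft> unit_ob C) \<cdot> (runit C X)\<dagger> = (runit C (X \<star> \<A>))\<dagger> \<cdot> k"
    using runit_adj_nat[of k "X \<star> \<A>"] by simp
  also have "(runit C (X \<star> \<A>))\<dagger> = (assr C X \<A> (unit_ob C))\<dagger> \<cdot> (X \<triangleright> (runit C \<A>)\<dagger>)"
    by (simp flip: runit_tensor)
  also have "(X \<triangleright> \<mu>) \<cdot> (X \<triangleright> (\<A> \<triangleright> \<eta>)) \<cdot> assr C X \<A> (unit_ob C) \<cdot> ((assr C X \<A> (unit_ob C))\<dagger> \<cdot> (X \<triangleright> (runit C \<A>)\<dagger>)) \<cdot> k
      = (X \<triangleright> (\<mu> \<cdot> (\<A> \<triangleright> \<eta>) \<cdot> (runit C \<A>)\<dagger>)) \<cdot> k" by simp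
  also have "\<dots> = k" by (simp only: mult_unit') simp
  finally show ?thesis by simp
qed

lemma act_through_unit: "(X \<triangleright> lam) \<cdot> branch X \<A> ((X \<triangleright> \<eta>) \<cdot> (runit C X)\<dagger>) Z = ident C (X \<star> Z)"
proof -
  have "(X \<triangleright> lam) \<cdot> branch X \<A> ((X \<triangleright> \<eta>) \<cdot> (runit C X)\<dagger>) Z
      = (X \<triangleright> lam) \<cdot> (X \<triangleright> (\<eta> \<triangleleft> Z)) \<cdot> assr C X (unit_ob C) Z \<cdot> ((runit C X)\<dagger> \<triangleleft> Z)"
    by (simp add: branch_def chain2[OF assr_nat[of "ident C X" \<eta> "ident C Z" X \<A> Z]])
  also have "\<dots> = X \<triangleright> (lam \<cdot> (\<eta> \<triangleleft> Z) \<cdot> (lunit C Z)\<dagger>)"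
    by (simp add: triangle')
  finally show ?thesis using left_action_unit[OF N] by simp
qed

text \<open>The free module on \<open>X\<close> is simple: \<open>End\<^sub>A (X \<otimes> A) = Hom(X, X \<otimes> A)\<close> is one-dimensional.\<close>

lemma free_simple:
  assumes k [simp]: "k \<in> Arr C" "source C k = X" "target C k = X \<star> \<A>"
  obtains c where "k = c *\<^sub>a ((X \<triangleright> \<eta>) \<cdot> (runit C X)\<dagger>)"
proof -
  let ?u = "(X \<triangleright> \<eta>) \<cdot> (runit C X)\<dagger>"
  obtain c where c: "(X \<triangleright> lam) \<cdot> branch X \<A> k Z = c *\<^sub>a ident C (X \<star> Z)"
    using act_through_scalar[OF k] .
  have "(X \<triangleright> lam) \<cdot> branch X \<A> (c *\<^sub>a ?u) Z = c *\<^sub>a ((X \<triangleright> lam) \<cdot> branch X \<A> ?u Z)"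
    by (simp add: branch_def)
  then have c': "(X \<triangleright> lam) \<cdot> branch X \<A> (c *\<^sub>a ?u) Z = c *\<^sub>a ident C (X \<star> Z)"
    by (simp only: act_through_unit)
  have "k = c *\<^sub>a ?u"
    using act_through_recover[OF k] act_through_recover[of "c *\<^sub>a ?u"] unfolding c c' by simp
  then show thesis by (rule that)
qed

text \<open>
  Since \<open>Hom(X \<otimes> D, A)\<close> is spanned by \<open>\<eta> \<circ> S\<^sup>*\<close>, the dual \<open>D\<close> is simple. The pairing of \<open>X\<close> with
  \<open>Z\<close> coming from \<open>\<alpha>\<close> gives a nonzero morphism from \<open>Z\<close> to \<open>D\<close>, which makes \<open>D\<close> a direct summand
  of \<open>Z\<close>. So the identity of \<open>X \<otimes> D\<close> factors through \<open>X \<otimes> Z\<close>, that is, through \<open>A\<close>, and therefore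
  through the evaluation \<open>S\<^sup>*\<close>.
\<close>

lemma invertible_base: "invertible_ob C X"
proof -
  let ?I = "unit_ob C"
  obtain D R S where D [simp]: "D \<in> Ob C" and R: "R \<in> Hom C ?I (D \<star> X)" and S: "S \<in> Hom C ?I (X \<star> D)"
    and snake1: "lunit C X \<cdot> (S\<dagger> \<diamondop> ident C X) \<cdot> (assr C X D X)\<dagger> \<cdot> (ident C X \<diamondop> R) = runit C X"
    and snake2: "lunit C D \<cdot> (R\<dagger> \<diamondop> ident C D) \<cdot> (assr C D X D)\<dagger> \<cdot> (ident C D \<diamondop> S) = runit C D"
    using rigid[OF X] by blast
  note dual = X D R S snake1 snake2
  note [simp] = RS_simps[OF dual] transpose_simps[OF dual]
  let ?T = "transpose_map X D R"
  \<comment> \<open>the transpose of \<open>f\<close>, braided, is a morphism from \<open>X\<close> to \<open>X \<otimes> A\<close>, and so a multiple of \<open>X \<otimes> \<eta>\<close>\<close>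
  have hom: "\<exists>c. f = c *\<^sub>a (\<eta> \<cdot> S\<dagger>)" if f: "f \<in> Hom C (X \<star> D) \<A>" for f
  proof -
    have [simp]: "f \<in> Arr C" "source C f = X \<star> D" "target C f = \<A>" using f by (auto simp: Hom_iff)
    obtain c where c: "(braid C X \<A>)\<dagger> \<cdot> ?T f = c *\<^sub>a ((X \<triangleright> \<eta>) \<cdot> (runit C X)\<dagger>)"
      by (rule free_simple[of "(braid C X \<A>)\<dagger> \<cdot> ?T f"]) simp_all
    have "?T f = braid C X \<A> \<cdot> ((braid C X \<A>)\<dagger> \<cdot> ?T f)" by simp
    also have "\<dots> = c *\<^sub>a ((braid C X \<A> \<cdot> (X \<triangleright> \<eta>)) \<cdot> (runit C X)\<dagger>)" unfolding c by simp
    also have "\<dots> = c *\<^sub>a ((\<eta> \<triangleleft> X) \<cdot> (lunit C X)\<dagger>)"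
      using braid_nat[of "ident C X" \<eta> X \<A>] by (simp add: braid_unit)
    also have "\<dots> = ?T ((c *\<^sub>a \<eta>) \<cdot> S\<dagger>)"
      using transpose_unit[OF dual, of "c *\<^sub>a \<eta>"] by simp
    finally have "f = (c *\<^sub>a \<eta>) \<cdot> S\<dagger>"
      by (rule transpose_eq[OF dual, rotated 2]) (simp_all add: Hom_iff)
    then show ?thesis by auto
  qed
  obtain d where d: "\<eta>\<dagger> \<cdot> \<eta> = d *\<^sub>a ident C ?I" "d \<noteq> 0" by (rule unit_norm)
  \<comment> \<open>\<open>g\<close> is determined by its effect on the evaluation, which by the preceding step is a scalar\<close>
  have simple: "\<exists>c. g = c *\<^sub>a ident C D" if g: "g \<in> Hom C D D" for g
  proof -
    have [simp]: "g \<in> Arr C" "source C g = D" "target C g = D" using g by (auto simp: Hom_iff)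
    obtain c where c: "\<eta> \<cdot> S\<dagger> \<cdot> (X \<triangleright> g) = c *\<^sub>a (\<eta> \<cdot> S\<dagger>)"
      using hom[of "\<eta> \<cdot> S\<dagger> \<cdot> (X \<triangleright> g)"] by (auto simp: Hom_iff)
    have "inverse d *\<^sub>a (\<eta>\<dagger> \<cdot> (\<eta> \<cdot> S\<dagger> \<cdot> (X \<triangleright> g))) = inverse d *\<^sub>a (\<eta>\<dagger> \<cdot> (c *\<^sub>a (\<eta> \<cdot> S\<dagger>)))"
      by (simp only: c)
    moreover have "inverse d * (c * d) = c" using d(2) by simp
    ultimately have "S\<dagger> \<cdot> (X \<triangleright> g) = c *\<^sub>a S\<dagger>"
      using d(2) by (simp add: chain2[OF d(1)])
    then have "g = c *\<^sub>a ident C D"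
      by - (rule dual_cancel[OF dual, where Z = D], simp_all)
    then show ?thesis by blast
  qed
  define \<epsilon> where "\<epsilon> = \<eta>\<dagger> \<cdot> \<alpha>"
  have [simp]: "\<epsilon> \<in> Arr C" "source C \<epsilon> = X \<star> Z" "target C \<epsilon> = ?I" by (simp_all add: \<epsilon>_def)
  have eps0: "\<epsilon> \<noteq> zero_arr C (X \<star> Z) ?I"
  proof
    assume e: "\<epsilon> = zero_arr C (X \<star> Z) ?I"
    have "\<epsilon> \<cdot> (\<alpha>' \<cdot> \<eta>) = d *\<^sub>a ident C ?I"
      using chain2[OF alpha_simps(8), of \<eta>] d by (simp add: \<epsilon>_def)
    then have "d *\<^sub>a ident C ?I = zero_arr C ?I ?I" by (simp add: e)
    then show False using scale_eq_zeroD[OF _ ident_Hom[OF unit_Ob] d(2)] unit_nonzero by simp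
  qed
  \<comment> \<open>\<open>e\<close> is a multiple of a coisometry, because \<open>D\<close> is simple and \<open>e\<close> does not vanish\<close>
  obtain e where e: "e \<in> Hom C Z D" "S\<dagger> \<cdot> (X \<triangleright> e) = \<epsilon>"
    using dual_cap[OF dual, of \<epsilon> Z] by simp
  have [simp]: "e \<in> Arr C" "source C e = Z" "target C e = D" using e by (auto simp: Hom_iff)
  obtain c where c: "e \<cdot> e\<dagger> = c *\<^sub>a ident C D" using simple[of "e \<cdot> e\<dagger>"] by (auto simp: Hom_iff)
  have "c \<noteq> 0"
  proof
    assume "c = 0"
    then have "e\<dagger> = zero_arr C D Z" using adj_cmp_zeroD[of "e\<dagger>" D Z] c by (simp add: Hom_iff)
    then have "e = zero_arr C Z D" using adj_simps(4)[of e] by simp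
    then have "\<epsilon> = zero_arr C (X \<star> Z) ?I" using e(2) by simp
    then show False using eps0 by simp
  qed
  obtain c' where c': "\<alpha> \<cdot> (X \<triangleright> e\<dagger>) = c' *\<^sub>a (\<eta> \<cdot> S\<dagger>)"
    using hom[of "\<alpha> \<cdot> (X \<triangleright> e\<dagger>)"] by (auto simp: Hom_iff)
  \<comment> \<open>the candidate for the inverse of the evaluation \<open>S\<^sup>*\<close>\<close>
  define m where "m = (c' * inverse c) *\<^sub>a ((X \<triangleright> e) \<cdot> \<alpha>' \<cdot> \<eta>)"
  have [simp]: "m \<in> Arr C" "source C m = ?I" "target C m = X \<star> D" by (simp_all add: m_def)
  have mS: "m \<cdot> S\<dagger> = ident C (X \<star> D)"
  proof -
    have "m \<cdot> S\<dagger> = inverse c *\<^sub>a ((X \<triangleright> e) \<cdot> \<alpha>' \<cdot> (c' *\<^sub>a (\<eta> \<cdot> S\<dagger>)))"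
      by (simp add: m_def mult.commute)
    also have "\<dots> = inverse c *\<^sub>a ((X \<triangleright> e) \<cdot> (X \<triangleright> e\<dagger>))"
      unfolding c'[symmetric] using chain2[OF alpha_simps(7), of "X \<triangleright> e\<dagger>"] by simp
    also have "(X \<triangleright> e) \<cdot> (X \<triangleright> e\<dagger>) = c *\<^sub>a ident C (X \<star> D)" by (simp add: c flip: lwhisk_cmp)
    finally show ?thesis using \<open>c \<noteq> 0\<close> by simp
  qed
  have "S\<dagger> \<cdot> m \<in> Hom C ?I ?I" by (simp add: Hom_iff)
  then obtain b where b: "S\<dagger> \<cdot> m = b *\<^sub>a ident C ?I" using simple_unit by auto
  have "b *\<^sub>a S\<dagger> = 1 *\<^sub>a S\<dagger>"
    using chain2[OF b, of "S\<dagger>"] by (simp add: mS)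
  moreover have "S\<dagger> \<noteq> zero_arr C (X \<star> D) ?I" using eps0 e(2) by auto
  ultimately have "b = 1" using scale_cancel[of b "S\<dagger>" 1 "X \<star> D" ?I] by (simp add: Hom_iff)
  then have "inverse_arrs m (S\<dagger>)" using mS b by (simp add: inverse_arrs_def)
  then have i: "iso_ob C (X \<star> D) ?I" using iso_obI iso_ob_sym by fastforce
  have "iso_ob C (D \<star> X) (X \<star> D)"
    using iso_obI[of "braid C D X" "(braid C D X)\<dagger>"] by (simp add: inverse_arrs_def)
  then have "iso_ob C (D \<star> X) ?I" by (rule iso_ob_trans[OF _ i])
  then show ?thesis unfolding invertible_ob_def using i X D by blast
qed

end

declare N_simps [simp del] alpha_simps [simp del]

end


section \<open>Finite sums of morphisms\<close>

context cstar_category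
begin

text \<open>
  Sums of morphisms are taken with the iterated product of the commutative monoid of all morphisms
  from \<open>X\<close> to \<open>Y\<close>; both objects are parameters, since the empty sum has to know them.
\<close>

definition hom_monoid :: "'o \<Rightarrow> 'o \<Rightarrow> 'm monoid" where
  "hom_monoid X Y = \<lparr>carrier = Hom C X Y, monoid.mult = add_arr C, one = zero_arr C X Y\<rparr>"

definition hsum :: "'o \<Rightarrow> 'o \<Rightarrow> ('i \<Rightarrow> 'm) \<Rightarrow> 'i set \<Rightarrow> 'm" where
  "hsum X Y f I = finprod (hom_monoid X Y) f I"

lemma hom_comm_monoid:
  assumes "X \<in> Ob C" "Y \<in> Ob C" shows "comm_monoid (hom_monoid X Y)"
proof (rule comm_monoidI)
  fix f assume "f \<in> carrier (hom_monoid X Y)"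
  then show "\<one>\<^bsub>hom_monoid X Y\<^esub> \<otimes>\<^bsub>hom_monoid X Y\<^esub> f = f"
    by (simp add: hom_monoid_def zero_add)
qed (use assms zero_Hom add_Hom add_assoc add_comm in \<open>auto simp: hom_monoid_def\<close>)

lemma hsum_Hom:
  assumes "X \<in> Ob C" "Y \<in> Ob C" "\<And>i. i \<in> I \<Longrightarrow> f i \<in> Hom C X Y"
  shows "hsum X Y f I \<in> Hom C X Y"
  using comm_monoid.finprod_closed[OF hom_comm_monoid[OF assms(1,2)], of f I] assms(3)
  by (auto simp: hsum_def hom_monoid_def)

lemma hsum_empty: "X \<in> Ob C \<Longrightarrow> Y \<in> Ob C \<Longrightarrow> hsum X Y f {} = zero_arr C X Y"
  using comm_monoid.finprod_empty[OF hom_comm_monoid] by (auto simp: hsum_def hom_monoid_def)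

lemma hsum_insert:
  assumes "X \<in> Ob C" "Y \<in> Ob C" "finite I" "j \<notin> I" "\<And>i. i \<in> insert j I \<Longrightarrow> f i \<in> Hom C X Y"
  shows "hsum X Y f (insert j I) = f j \<^bold>+ hsum X Y f I"
  using comm_monoid.finprod_insert[OF hom_comm_monoid[OF assms(1,2)] assms(3,4), of f] assms(5)
  by (auto simp: hsum_def hom_monoid_def)

lemma hsum_cong:
  assumes "X \<in> Ob C" "Y \<in> Ob C" "\<And>i. i \<in> I \<Longrightarrow> f i = g i" "\<And>i. i \<in> I \<Longrightarrow> g i \<in> Hom C X Y"
  shows "hsum X Y f I = hsum X Y g I"
  using comm_monoid.finprod_cong'[OF hom_comm_monoid[OF assms(1,2)], of I I g f] assms(3,4)
  by (auto simp: hsum_def hom_monoid_def)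

lemma hsum_reindex:
  assumes "X \<in> Ob C" "Y \<in> Ob C" "bij_betw p I I" "\<And>i. i \<in> I \<Longrightarrow> f i \<in> Hom C X Y"
  shows "hsum X Y (\<lambda>i. f (p i)) I = hsum X Y f I"
proof -
  have "finprod (hom_monoid X Y) f (p ` I) = finprod (hom_monoid X Y) (\<lambda>i. f (p i)) I"
    using assms by (intro comm_monoid.finprod_reindex[OF hom_comm_monoid[OF assms(1,2)]])
      (auto simp: bij_betw_def hom_monoid_def)
  then show ?thesis using assms(3) by (simp add: hsum_def bij_betw_def)
qed

text \<open>
  Composition, tensoring and the adjoint commute with finite sums for this one reason.
\<close>

lemma hsum_additive:
  assumes "finite I" and [simp]: "X \<in> Ob C" "Y \<in> Ob C" "X' \<in> Ob C" "Y' \<in> Ob C"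
    and f: "\<And>i. i \<in> I \<Longrightarrow> f i \<in> Hom C X Y"
    and h: "\<And>k. k \<in> Hom C X Y \<Longrightarrow> h k \<in> Hom C X' Y'" "h (zero_arr C X Y) = zero_arr C X' Y'"
      "\<And>k l. k \<in> Hom C X Y \<Longrightarrow> l \<in> Hom C X Y \<Longrightarrow> h (k \<^bold>+ l) = h k \<^bold>+ h l"
  shows "h (hsum X Y f I) = hsum X' Y' (\<lambda>i. h (f i)) I"
  using assms(1) f
proof (induction I rule: finite_induct)
  case empty
  then show ?case by (simp add: hsum_empty h(2))
next
  case (insert j I)
  have "h (hsum X Y f (insert j I)) = h (f j \<^bold>+ hsum X Y f I)"
    using insert by (subst hsum_insert) auto
  also have "\<dots> = h (f j) \<^bold>+ h (hsum X Y f I)"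
    using insert by (intro h(3) hsum_Hom) auto
  also have "\<dots> = h (f j) \<^bold>+ hsum X' Y' (\<lambda>i. h (f i)) I" using insert by auto
  also have "\<dots> = hsum X' Y' (\<lambda>i. h (f i)) (insert j I)"
    using insert h(1) by (subst hsum_insert) auto
  finally show ?case .
qed

lemma hsum_const:
  assumes "finite I" "f \<in> Hom C X Y"
  shows "hsum X Y (\<lambda>_. f) I = of_nat (card I) *\<^sub>a f"
  using assms(1)
proof (induction I rule: finite_induct)
  case empty
  then show ?case using assms(2) Hom_Ob[OF assms(2)] by (simp add: hsum_empty Hom_iff)
next
  case (insert j I)
  have "hsum X Y (\<lambda>_. f) (insert j I) = 1 *\<^sub>a f \<^bold>+ of_nat (card I) *\<^sub>a f"
    using insert assms(2) Hom_Ob[OF assms(2)] by (subst hsum_insert) (auto simp: Hom_iff)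
  also have "\<dots> = of_nat (card (insert j I)) *\<^sub>a f"
    using add_scale[OF assms(2), of 1 "of_nat (card I)"] insert by simp
  finally show ?case .
qed

lemma hsum_delta:
  assumes "finite I" "j \<in> I" "f \<in> Hom C X Y"
  shows "hsum X Y (\<lambda>i. if i = j then f else zero_arr C X Y) I = f"
proof -
  have [simp]: "X \<in> Ob C" "Y \<in> Ob C" using Hom_Ob[OF assms(3)] by auto
  have z: "hsum X Y (\<lambda>i. if i = j then f else zero_arr C X Y) (I - {j}) = zero_arr C X Y"
  proof -
    have "hsum X Y (\<lambda>i. if i = j then f else zero_arr C X Y) (I - {j})
        = hsum X Y (\<lambda>i. zero_arr C X Y) (I - {j})"
      by (rule hsum_cong) (auto simp: Hom_iff)
    also have "\<dots> = zero_arr C X Y"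
      using assms(1) by (subst hsum_const) (auto simp: Hom_iff)
    finally show ?thesis .
  qed
  have "hsum X Y (\<lambda>i. if i = j then f else zero_arr C X Y) (insert j (I - {j})) = f \<^bold>+ zero_arr C X Y"
    using assms by (subst hsum_insert) (auto simp: z Hom_iff)
  then show ?thesis
    using assms zero_add[OF assms(3)] add_comm[OF assms(3), of "zero_arr C X Y"]
    by (simp add: insert_absorb Hom_iff)
qed

lemma cmp_hsum:
  assumes "finite I" "X \<in> Ob C" "\<And>i. i \<in> I \<Longrightarrow> f i \<in> Hom C X Y" "g \<in> Hom C Y Z"
  shows "g \<cdot> hsum X Y f I = hsum X Z (\<lambda>i. g \<cdot> f i) I"
proof (rule hsum_additive[where h = "\<lambda>k. g \<cdot> k"])
  show "\<And>k l. k \<in> Hom C X Y \<Longrightarrow> l \<in> Hom C X Y \<Longrightarrow> g \<cdot> (k \<^bold>+ l) = (g \<cdot> k) \<^bold>+ (g \<cdot> l)"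
    using cmp_add assms(4) by blast
qed (use assms Hom_Ob[OF assms(4)] in \<open>auto simp: Hom_iff\<close>)

lemma hsum_cmp:
  assumes "finite I" "Z \<in> Ob C" "\<And>i. i \<in> I \<Longrightarrow> f i \<in> Hom C Y Z" "g \<in> Hom C X Y"
  shows "hsum Y Z f I \<cdot> g = hsum X Z (\<lambda>i. f i \<cdot> g) I"
proof (rule hsum_additive[where h = "\<lambda>k. k \<cdot> g"])
  show "\<And>k l. k \<in> Hom C Y Z \<Longrightarrow> l \<in> Hom C Y Z \<Longrightarrow> (k \<^bold>+ l) \<cdot> g = (k \<cdot> g) \<^bold>+ (l \<cdot> g)"
    using add_cmp assms(4) by blast
qed (use assms Hom_Ob[OF assms(4)] in \<open>auto simp: Hom_iff\<close>)

lemma hsum_adj: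
  assumes "finite I" "X \<in> Ob C" "Y \<in> Ob C" "\<And>i. i \<in> I \<Longrightarrow> f i \<in> Hom C X Y"
  shows "(hsum X Y f I)\<dagger> = hsum Y X (\<lambda>i. (f i)\<dagger>) I"
  by (rule hsum_additive[where h = "adj C"]) (use assms adj_add in \<open>auto simp: Hom_iff\<close>)

end

context cstar_tensor_category
begin

lemma lwhisk_hsum:
  assumes "finite I" "W \<in> Ob C" "X \<in> Ob C" "Y \<in> Ob C" "\<And>i. i \<in> I \<Longrightarrow> f i \<in> Hom C X Y"
  shows "W \<triangleright> hsum X Y f I = hsum (W \<star> X) (W \<star> Y) (\<lambda>i. W \<triangleright> f i) I"
proof (rule hsum_additive[where h = "\<lambda>k. W \<triangleright> k"])
  show "\<And>k l. k \<in> Hom C X Y \<Longrightarrow> l \<in> Hom C X Y \<Longrightarrow> W \<triangleright> (k \<^bold>+ l) = (W \<triangleright> k) \<^bold>+ (W \<triangleright> l)"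
    using tensor_add ident_Hom assms(2) by blast
  show "k \<in> Hom C X Y \<Longrightarrow> W \<triangleright> k \<in> Hom C (W \<star> X) (W \<star> Y)" for k
    by (rule tensor_Hom[OF ident_Hom[OF assms(2)]])
  show "W \<triangleright> zero_arr C X Y = zero_arr C (W \<star> X) (W \<star> Y)"
    using assms(2-4) by simp
qed (fact assms | simp add: assms(2-4))+

lemma rwhisk_hsum:
  assumes "finite I" "W \<in> Ob C" "X \<in> Ob C" "Y \<in> Ob C" "\<And>i. i \<in> I \<Longrightarrow> f i \<in> Hom C X Y"
  shows "hsum X Y f I \<triangleleft> W = hsum (X \<star> W) (Y \<star> W) (\<lambda>i. f i \<triangleleft> W) I"
proof (rule hsum_additive[where h = "\<lambda>k. k \<triangleleft> W"])
  show "\<And>k l. k \<in> Hom C X Y \<Longrightarrow> l \<in> Hom C X Y \<Longrightarrow> (k \<^bold>+ l) \<triangleleft> W = (k \<triangleleft> W) \<^bold>+ (l \<triangleleft> W)"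
    using add_tensor ident_Hom assms(2) by blast
  show "k \<in> Hom C X Y \<Longrightarrow> k \<triangleleft> W \<in> Hom C (X \<star> W) (Y \<star> W)" for k
    by (rule tensor_Hom[OF _ ident_Hom[OF assms(2)]])
  show "zero_arr C X Y \<triangleleft> W = zero_arr C (X \<star> W) (Y \<star> W)"
    using assms(2-4) by simp
qed (fact assms | simp add: assms(2-4))+

end


section \<open>Galois descent for equivariant modules\<close>

text \<open>
  The properties of the image of \<open>Fun(G)\<close> on which the argument rests. The operator \<open>a g\<close> is right
  translation by \<open>g\<close>, which reverses products. The element \<open>t = \<Sum> \<delta>\<^sub>g \<otimes> \<delta>\<^sub>g\<close> satisfies
  \<open>\<mu> \<circ> (A \<otimes> a g) \<circ> t = 0\<close> for \<open>g \<noteq> 1\<close>, which says that the action is free, and it is dual to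
  the pairing \<open>\<eta>\<^sup>* \<circ> \<mu>\<close>. For a character \<open>\<phi>\<close>, the morphism \<open>w \<phi>\<close> embeds the image \<open>L \<phi>\<close> of the
  character into \<open>A\<close> as its \<open>\<phi>\<close>-isotypic component. Units, \<open>t\<close> and \<open>w \<phi>\<close> are not normalized, so that
  powers of \<open>n\<close> appear instead of square roots.
\<close>

locale galois_algebra = connected_algebra C A + group G
  for C :: "('o, 'm, 'z) braided_data_scheme" (structure)
    and A :: "('o, 'm) algebra_data"
    and G :: "('g, 'b) monoid_scheme" +
  fixes a :: "'g \<Rightarrow> 'm" and t :: 'm and L :: "('g \<Rightarrow> complex) \<Rightarrow> 'o" and w :: "('g \<Rightarrow> complex) \<Rightarrow> 'm"
  assumes finite_G: "finite (carrier G)"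
    and act_Hom: "g \<in> carrier G \<Longrightarrow> a g \<in> Hom C \<A> \<A>"
    and act_unitary: "g \<in> carrier G \<Longrightarrow> unitary_arr C (a g)"
    and act_mult: "g \<in> carrier G \<Longrightarrow> a g \<cdot> \<mu> = \<mu> \<cdot> (a g \<diamondop> a g)"
    and act_unit: "g \<in> carrier G \<Longrightarrow> a g \<cdot> \<eta> = \<eta>"
    and act_comp: "g \<in> carrier G \<Longrightarrow> h \<in> carrier G \<Longrightarrow> a g \<cdot> a h = a (h \<otimes>\<^bsub>G\<^esub> g)"
    and act_sum: "hsum \<A> \<A> a (carrier G) = \<eta> \<cdot> \<eta>\<dagger>"
    and unit_norm_card: "\<eta>\<dagger> \<cdot> \<eta> = of_nat (card (carrier G)) *\<^sub>a ident C (unit_ob C)"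
    and t_Hom: "t \<in> Hom C (unit_ob C) (\<A> \<star> \<A>)"
    and mult_act_t: "g \<in> carrier G \<Longrightarrow> \<mu> \<cdot> (\<A> \<triangleright> a g) \<cdot> t
      = (if g = \<one>\<^bsub>G\<^esub> then \<eta> else zero_arr C (unit_ob C) \<A>)"
    and t_dual: "lunit C \<A> \<cdot> (\<eta>\<dagger> \<triangleleft> \<A>) \<cdot> merge \<A> \<A> \<mu> \<A> \<cdot> (\<A> \<triangleright> t) \<cdot> (runit C \<A>)\<dagger> = ident C \<A>"
    and w_Hom: "\<phi> \<in> carrier (dual_group G) \<Longrightarrow> w \<phi> \<in> Hom C (L \<phi>) \<A>"
    and w_norm: "\<phi> \<in> carrier (dual_group G) \<Longrightarrow> (w \<phi>)\<dagger> \<cdot> w \<phi> = of_nat (card (carrier G)) *\<^sub>a ident C (L \<phi>)"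
    and w_sum: "\<phi> \<in> carrier (dual_group G) \<Longrightarrow>
      w \<phi> \<cdot> (w \<phi>)\<dagger> = hsum \<A> \<A> (\<lambda>g. cnj (\<phi> g) *\<^sub>a a g) (carrier G)"
begin

abbreviation n :: complex where "n \<equiv> of_nat (card (carrier G))"

lemma n_nonzero [simp]: "n \<noteq> 0"
  using finite_G one_closed by auto

lemma act_simps [simp]:
  assumes "g \<in> carrier G"
  shows "a g \<in> Arr C" "source C (a g) = \<A>" "target C (a g) = \<A>"
    "(a g)\<dagger> \<cdot> a g = ident C \<A>" "a g \<cdot> (a g)\<dagger> = ident C \<A>"
proof -
  show 1: "a g \<in> Arr C" "source C (a g) = \<A>" "target C (a g) = \<A>"
    using act_Hom[OF assms] unfolding Hom_iff by blast+
  show "(a g)\<dagger> \<cdot> a g = ident C \<A>" "a g \<cdot> (a g)\<dagger> = ident C \<A>"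
    using unitaryD(2,3)[OF act_unitary[OF assms]] by (simp_all add: 1)
qed

lemma t_simps [simp]: "t \<in> Arr C" "source C t = unit_ob C" "target C t = \<A> \<star> \<A>"
  using t_Hom unfolding Hom_iff by blast+

lemma w_simps [simp]:
  assumes "\<phi> \<in> carrier (dual_group G)"
  shows "w \<phi> \<in> Arr C" "source C (w \<phi>) = L \<phi>" "target C (w \<phi>) = \<A>" "L \<phi> \<in> Ob C"
  using w_Hom[OF assms] Hom_Ob(1)[OF w_Hom[OF assms]] unfolding Hom_iff by blast+

text \<open>
  An idempotent unitary is the identity.
\<close>

lemma act_one: "a \<one>\<^bsub>G\<^esub> = ident C \<A>"
proof -
  have "a \<one>\<^bsub>G\<^esub> \<cdot> a \<one>\<^bsub>G\<^esub> = a \<one>\<^bsub>G\<^esub>" using act_comp[of "\<one>\<^bsub>G\<^esub>" "\<one>\<^bsub>G\<^esub>"] by simp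
  then have "(a \<one>\<^bsub>G\<^esub>)\<dagger> \<cdot> (a \<one>\<^bsub>G\<^esub> \<cdot> a \<one>\<^bsub>G\<^esub>) = (a \<one>\<^bsub>G\<^esub>)\<dagger> \<cdot> a \<one>\<^bsub>G\<^esub>" by simp
  then show ?thesis using chain2[OF act_simps(4)[of "\<one>\<^bsub>G\<^esub>"]] by simp
qed

lemma act_adj_mult:
  assumes [simp]: "g \<in> carrier G" shows "(a g)\<dagger> \<cdot> \<mu> = \<mu> \<cdot> ((a g)\<dagger> \<diamondop> (a g)\<dagger>)"
proof -
  have "(a g)\<dagger> \<cdot> \<mu> = (a g)\<dagger> \<cdot> \<mu> \<cdot> ((a g \<diamondop> a g) \<cdot> ((a g)\<dagger> \<diamondop> (a g)\<dagger>))"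
    by (simp add: interchange)
  also have "\<dots> = (a g)\<dagger> \<cdot> ((a g \<cdot> \<mu>) \<cdot> ((a g)\<dagger> \<diamondop> (a g)\<dagger>))"
    unfolding act_mult[OF assms] by simp
  also have "\<dots> = \<mu> \<cdot> ((a g)\<dagger> \<diamondop> (a g)\<dagger>)"
    by (simp add: chain2[OF act_simps(4)])
  finally show ?thesis .
qed

lemma act_adj_mult_act:
  assumes [simp]: "g \<in> carrier G" shows "(a g)\<dagger> \<cdot> \<mu> \<cdot> (\<A> \<triangleright> a g) = \<mu> \<cdot> ((a g)\<dagger> \<triangleleft> \<A>)"
  by (simp add: chain2[OF act_adj_mult[OF assms]] interchange)

lemma twisted_module:
  assumes Y: "(Y, \<rho>) \<in> right_modules C A" and [simp]: "g \<in> carrier G"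
  shows "(Y, \<rho> \<cdot> (Y \<triangleright> a g)) \<in> right_modules C A"
proof -
  note [simp] = moduleD(1-4)[OF Y]
  note Y_Ob = moduleD(1)[OF Y]
  have m: "merge Y \<A> (\<rho> \<cdot> (Y \<triangleright> a g)) \<A> = merge Y \<A> \<rho> \<A> \<cdot> (Y \<triangleright> (a g \<triangleleft> \<A>))"
  proof -
    have "merge Y \<A> (\<rho> \<cdot> (Y \<triangleright> a g)) \<A> = (\<rho> \<triangleleft> \<A>) \<cdot> (((Y \<triangleright> a g) \<triangleleft> \<A>) \<cdot> (assr C Y \<A> \<A>)\<dagger>)"
      by (simp add: merge_def)
    also have "((Y \<triangleright> a g) \<triangleleft> \<A>) \<cdot> (assr C Y \<A> \<A>)\<dagger> = (assr C Y \<A> \<A>)\<dagger> \<cdot> (Y \<triangleright> (a g \<triangleleft> \<A>))"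
      by (subst assr_adj_nat) simp_all
    finally show ?thesis by (simp add: merge_def)
  qed
  have "(\<rho> \<cdot> (Y \<triangleright> a g)) \<cdot> merge Y \<A> (\<rho> \<cdot> (Y \<triangleright> a g)) \<A>
      = \<rho> \<cdot> ((Y \<triangleright> a g) \<cdot> merge Y \<A> \<rho> \<A>) \<cdot> (Y \<triangleright> (a g \<triangleleft> \<A>))"
    unfolding m by simp
  also have "(Y \<triangleright> a g) \<cdot> merge Y \<A> \<rho> \<A> = merge Y \<A> \<rho> \<A> \<cdot> (Y \<triangleright> (\<A> \<triangleright> a g))"
    by (subst merge_nat) simp_all
  also have "\<rho> \<cdot> (merge Y \<A> \<rho> \<A> \<cdot> (Y \<triangleright> (\<A> \<triangleright> a g))) \<cdot> (Y \<triangleright> (a g \<triangleleft> \<A>))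
      = (\<rho> \<cdot> merge Y \<A> \<rho> \<A>) \<cdot> (Y \<triangleright> ((\<A> \<triangleright> a g) \<cdot> (a g \<triangleleft> \<A>)))"
    by simp
  also have "(\<A> \<triangleright> a g) \<cdot> (a g \<triangleleft> \<A>) = a g \<diamondop> a g" by (simp add: interchange)
  also have "(\<rho> \<cdot> merge Y \<A> \<rho> \<A>) \<cdot> (Y \<triangleright> (a g \<diamondop> a g)) = \<rho> \<cdot> (Y \<triangleright> (\<mu> \<cdot> (a g \<diamondop> a g)))"
    unfolding moduleD(5)[OF Y] by simp
  also have "\<dots> = (\<rho> \<cdot> (Y \<triangleright> a g)) \<cdot> (Y \<triangleright> \<mu>)"
    by (simp flip: act_mult[OF assms(2)])
  finally have 1: "(\<rho> \<cdot> (Y \<triangleright> a g)) \<cdot> merge Y \<A> (\<rho> \<cdot> (Y \<triangleright> a g)) \<A> = (\<rho> \<cdot> (Y \<triangleright> a g)) \<cdot> (Y \<triangleright> \<mu>)" .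
  have "(\<rho> \<cdot> (Y \<triangleright> a g)) \<cdot> (Y \<triangleright> \<eta>) \<cdot> (runit C Y)\<dagger> = \<rho> \<cdot> (Y \<triangleright> (a g \<cdot> \<eta>)) \<cdot> (runit C Y)\<dagger>"
    by simp
  also have "\<dots> = ident C Y" unfolding act_unit[OF assms(2)] by (rule moduleD(6)[OF Y])
  finally have 2: "(\<rho> \<cdot> (Y \<triangleright> a g)) \<cdot> (Y \<triangleright> \<eta>) \<cdot> (runit C Y)\<dagger> = ident C Y" .
  have 3: "\<rho> \<cdot> (Y \<triangleright> a g) \<in> Arr C" "source C (\<rho> \<cdot> (Y \<triangleright> a g)) = Y \<star> \<A>"
    "target C (\<rho> \<cdot> (Y \<triangleright> a g)) = Y" by simp_all
  show ?thesis unfolding right_module_iff using 1 2 3 Y_Ob by blast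
qed

text \<open>
  The adjoint appears because an equivariant structure goes from the twisted module to the module.
\<close>

lemma free_equivariant:
  assumes [simp]: "X \<in> Ob C" "g \<in> carrier G"
  shows "(X \<triangleright> (a g)\<dagger>) \<cdot> ((X \<triangleright> \<mu>) \<cdot> assr C X \<A> \<A>) \<cdot> ((X \<star> \<A>) \<triangleright> a g)
    = ((X \<triangleright> \<mu>) \<cdot> assr C X \<A> \<A>) \<cdot> ((X \<triangleright> (a g)\<dagger>) \<triangleleft> \<A>)"
proof -
  have 1: "assr C X \<A> \<A> \<cdot> ((X \<star> \<A>) \<triangleright> a g) = (X \<triangleright> (\<A> \<triangleright> a g)) \<cdot> assr C X \<A> \<A>"
    using assr_nat[of "ident C X" "ident C \<A>" "a g" X \<A> \<A>] by simp
  have 2: "assr C X \<A> \<A> \<cdot> ((X \<triangleright> (a g)\<dagger>) \<triangleleft> \<A>) = (X \<triangleright> ((a g)\<dagger> \<triangleleft> \<A>)) \<cdot> assr C X \<A> \<A>"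
    by (subst assr_nat) simp_all
  have "(X \<triangleright> (a g)\<dagger>) \<cdot> ((X \<triangleright> \<mu>) \<cdot> assr C X \<A> \<A>) \<cdot> ((X \<star> \<A>) \<triangleright> a g)
      = (X \<triangleright> ((a g)\<dagger> \<cdot> \<mu> \<cdot> (\<A> \<triangleright> a g))) \<cdot> assr C X \<A> \<A>"
    by (simp add: 1)
  also have "\<dots> = ((X \<triangleright> \<mu>) \<cdot> assr C X \<A> \<A>) \<cdot> ((X \<triangleright> (a g)\<dagger>) \<triangleleft> \<A>)"
    unfolding act_adj_mult_act[OF assms(2)] by (simp add: 2)
  finally show ?thesis .
qed

context
  fixes Y \<rho> V
  assumes Y: "(Y, \<rho>) \<in> right_modules C A"
    and V_Hom: "\<And>g. g \<in> carrier G \<Longrightarrow> V g \<in> Hom C Y Y"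
    and V_map: "\<And>g. g \<in> carrier G \<Longrightarrow> V g \<cdot> \<rho> \<cdot> (Y \<triangleright> a g) = \<rho> \<cdot> (V g \<triangleleft> \<A>)"
    and V_mult: "\<And>g h. g \<in> carrier G \<Longrightarrow> h \<in> carrier G \<Longrightarrow> V (g \<otimes>\<^bsub>G\<^esub> h) = V g \<cdot> V h"
    and V_one: "V \<one>\<^bsub>G\<^esub> = ident C Y"
begin

lemma Y_simps [simp]: "Y \<in> Ob C" "\<rho> \<in> Arr C" "source C \<rho> = Y \<star> \<A>" "target C \<rho> = Y"
  using moduleD(1-4)[OF Y] by blast+

lemma V_simps [simp]: "g \<in> carrier G \<Longrightarrow> V g \<in> Arr C" "g \<in> carrier G \<Longrightarrow> source C (V g) = Y"
  "g \<in> carrier G \<Longrightarrow> target C (V g) = Y"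
  using V_Hom unfolding Hom_iff by blast+

text \<open>
  The sum over the group is \<open>n\<close> times the projection onto the part fixed by \<open>V\<close>.
\<close>

abbreviation "\<Sigma> \<equiv> hsum Y Y V (carrier G)"

lemma Sigma_Hom: "\<Sigma> \<in> Hom C Y Y" by (rule hsum_Hom) (auto simp: V_Hom)

lemma Sigma_simps [simp]: "\<Sigma> \<in> Arr C" "source C \<Sigma> = Y" "target C \<Sigma> = Y"
  using Sigma_Hom unfolding Hom_iff by blast+

lemma V_Sigma: assumes [simp]: "h \<in> carrier G" shows "V h \<cdot> \<Sigma> = \<Sigma>" "\<Sigma> \<cdot> V h = \<Sigma>"
proof -
  have "V h \<cdot> \<Sigma> = hsum Y Y (\<lambda>g. V h \<cdot> V g) (carrier G)"
    using finite_G V_Hom by (intro cmp_hsum) auto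
  also have "\<dots> = hsum Y Y (\<lambda>g. V (h \<otimes>\<^bsub>G\<^esub> g)) (carrier G)"
    by (rule hsum_cong) (auto simp: V_mult Hom_iff)
  also have "\<dots> = \<Sigma>"
    using V_Hom by (intro hsum_reindex) (auto simp: bij_betw_def inj_on_cmult surj_const_mult)
  finally show "V h \<cdot> \<Sigma> = \<Sigma>" .
  have "\<Sigma> \<cdot> V h = hsum Y Y (\<lambda>g. V g \<cdot> V h) (carrier G)"
    using finite_G V_Hom by (intro hsum_cmp) auto
  also have "\<dots> = hsum Y Y (\<lambda>g. V (g \<otimes>\<^bsub>G\<^esub> h)) (carrier G)"
    by (rule hsum_cong) (auto simp: V_mult Hom_iff)
  also have "\<dots> = \<Sigma>"
  proof (rule hsum_reindex)
    show "bij_betw (\<lambda>g. g \<otimes>\<^bsub>G\<^esub> h) (carrier G) (carrier G)"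
      by (rule bij_betw_byWitness[where f' = "\<lambda>g. g \<otimes>\<^bsub>G\<^esub> inv\<^bsub>G\<^esub> h"]) (auto simp: m_assoc)
  qed (auto simp: V_Hom)
  finally show "\<Sigma> \<cdot> V h = \<Sigma>" .
qed

context
  fixes X \<iota>
  assumes iota: "\<iota> \<in> Hom C X Y" and iota_isometry: "\<iota>\<dagger> \<cdot> \<iota> = ident C X"
    and iota_range: "n *\<^sub>a (\<iota> \<cdot> \<iota>\<dagger>) = \<Sigma>"
begin

lemma iota_simps [simp]: "\<iota> \<in> Arr C" "source C \<iota> = X" "target C \<iota> = Y" "X \<in> Ob C"
  using iota Hom_Ob[OF iota] unfolding Hom_iff by blast+

lemma iota_Sigma: "\<Sigma> \<cdot> \<iota> = n *\<^sub>a \<iota>" "\<iota>\<dagger> \<cdot> \<Sigma> = n *\<^sub>a \<iota>\<dagger>"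
proof -
  have "(n *\<^sub>a (\<iota> \<cdot> \<iota>\<dagger>)) \<cdot> \<iota> = n *\<^sub>a \<iota>" by (simp add: iota_isometry)
  then show "\<Sigma> \<cdot> \<iota> = n *\<^sub>a \<iota>" by (simp only: iota_range)
  have "\<iota>\<dagger> \<cdot> (n *\<^sub>a (\<iota> \<cdot> \<iota>\<dagger>)) = n *\<^sub>a \<iota>\<dagger>" by (simp add: chain2[OF iota_isometry])
  then show "\<iota>\<dagger> \<cdot> \<Sigma> = n *\<^sub>a \<iota>\<dagger>" by (simp only: iota_range)
qed

lemma V_iota: assumes [simp]: "g \<in> carrier G" shows "V g \<cdot> \<iota> = \<iota>" "\<iota>\<dagger> \<cdot> V g = \<iota>\<dagger>"
proof -
  have "n *\<^sub>a (V g \<cdot> \<iota>) = (V g \<cdot> \<Sigma>) \<cdot> \<iota>" by (simp add: iota_Sigma)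
  also have "\<dots> = n *\<^sub>a \<iota>" by (simp only: V_Sigma iota_Sigma assms)
  finally have "inverse n *\<^sub>a (n *\<^sub>a (V g \<cdot> \<iota>)) = inverse n *\<^sub>a (n *\<^sub>a \<iota>)" by simp
  then show "V g \<cdot> \<iota> = \<iota>" by (simp del: of_nat_eq_0_iff)
  have "n *\<^sub>a (\<iota>\<dagger> \<cdot> V g) = (\<iota>\<dagger> \<cdot> \<Sigma>) \<cdot> V g" by (subst iota_Sigma) simp
  also have "\<dots> = \<iota>\<dagger> \<cdot> (\<Sigma> \<cdot> V g)" by simp
  also have "\<dots> = n *\<^sub>a \<iota>\<dagger>" by (simp only: V_Sigma iota_Sigma assms)
  finally have "inverse n *\<^sub>a (n *\<^sub>a (\<iota>\<dagger> \<cdot> V g)) = inverse n *\<^sub>a (n *\<^sub>a \<iota>\<dagger>)" by simp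
  then show "\<iota>\<dagger> \<cdot> V g = \<iota>\<dagger>" by (simp del: of_nat_eq_0_iff)
qed

text \<open>
  The descent isomorphism from \<open>X \<otimes> A\<close> to \<open>Y\<close> and its inverse. In terms of functions on \<open>G\<close>, the
  module \<open>Y\<close> is graded by the points of \<open>G\<close>, and \<open>cosec\<close>, which is \<open>y \<mapsto> \<Sum> y\<delta>\<^sub>g \<otimes> \<delta>\<^sub>g\<close>, records the
  degree; \<open>fix_inv\<close> moves every homogeneous part into the fixed part by averaging.
\<close>

definition "fix_map = \<rho> \<cdot> (\<iota> \<triangleleft> \<A>)"
definition "cosec = merge Y \<A> \<rho> \<A> \<cdot> (Y \<triangleright> t) \<cdot> (runit C Y)\<dagger>"
definition "fix_inv = n *\<^sub>a ((\<iota>\<dagger> \<triangleleft> \<A>) \<cdot> cosec)"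

lemma fix_simps [simp]:
  "fix_map \<in> Arr C" "source C fix_map = X \<star> \<A>" "target C fix_map = Y"
  "cosec \<in> Arr C" "source C cosec = Y" "target C cosec = Y \<star> \<A>"
  "fix_inv \<in> Arr C" "source C fix_inv = Y" "target C fix_inv = X \<star> \<A>"
  by (simp_all add: fix_map_def cosec_def fix_inv_def)

lemma act_cosec:
  assumes [simp]: "g \<in> carrier G"
  shows "\<rho> \<cdot> (Y \<triangleright> a g) \<cdot> cosec = (if g = \<one>\<^bsub>G\<^esub> then ident C Y else zero_arr C Y Y)"
proof -
  have m: "(Y \<triangleright> a g) \<cdot> merge Y \<A> \<rho> \<A> = merge Y \<A> \<rho> \<A> \<cdot> (Y \<triangleright> (\<A> \<triangleright> a g))"
    by (subst merge_nat) simp_all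
  have "\<rho> \<cdot> (Y \<triangleright> a g) \<cdot> cosec = \<rho> \<cdot> ((Y \<triangleright> a g) \<cdot> merge Y \<A> \<rho> \<A>) \<cdot> (Y \<triangleright> t) \<cdot> (runit C Y)\<dagger>"
    by (simp add: cosec_def)
  also have "\<dots> = (\<rho> \<cdot> merge Y \<A> \<rho> \<A>) \<cdot> (Y \<triangleright> (\<A> \<triangleright> a g)) \<cdot> (Y \<triangleright> t) \<cdot> (runit C Y)\<dagger>"
    unfolding m by simp
  also have "\<dots> = \<rho> \<cdot> (Y \<triangleright> (\<mu> \<cdot> (\<A> \<triangleright> a g) \<cdot> t)) \<cdot> (runit C Y)\<dagger>"
    unfolding moduleD(5)[OF Y] by simp
  also have "\<dots> = (if g = \<one>\<^bsub>G\<^esub> then ident C Y else zero_arr C Y Y)"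
    unfolding mult_act_t[OF assms] using moduleD(6)[OF Y] by simp
  finally show ?thesis .
qed

text \<open>
  By equivariance \<open>\<rho> \<circ> (V g \<otimes> A) = V g \<circ> \<rho> \<circ> (Y \<otimes> a g)\<close>, so averaging over \<open>G\<close> leaves, by
  \<open>act_cosec\<close>, only the term with \<open>g = 1\<close>.
\<close>

lemma fix_map_inv: "fix_map \<cdot> fix_inv = ident C Y"
proof -
  have "fix_map \<cdot> fix_inv = \<rho> \<cdot> ((n *\<^sub>a (\<iota> \<cdot> \<iota>\<dagger>)) \<triangleleft> \<A>) \<cdot> cosec"
    by (simp add: fix_map_def fix_inv_def)
  also have "\<dots> = \<rho> \<cdot> (hsum (Y \<star> \<A>) (Y \<star> \<A>) (\<lambda>g. V g \<triangleleft> \<A>) (carrier G) \<cdot> cosec)"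
    unfolding iota_range using finite_G V_Hom by (subst rwhisk_hsum) auto
  also have "hsum (Y \<star> \<A>) (Y \<star> \<A>) (\<lambda>g. V g \<triangleleft> \<A>) (carrier G) \<cdot> cosec
      = hsum Y (Y \<star> \<A>) (\<lambda>g. (V g \<triangleleft> \<A>) \<cdot> cosec) (carrier G)"
    using finite_G by (intro hsum_cmp) (auto simp: Hom_iff)
  also have "\<rho> \<cdot> \<dots> = hsum Y Y (\<lambda>g. \<rho> \<cdot> (V g \<triangleleft> \<A>) \<cdot> cosec) (carrier G)"
    using finite_G by (intro cmp_hsum) (auto simp: Hom_iff)
  also have "\<dots> = hsum Y Y (\<lambda>g. if g = \<one>\<^bsub>G\<^esub> then ident C Y else zero_arr C Y Y) (carrier G)"
  proof (rule hsum_cong)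
    fix g assume g [simp]: "g \<in> carrier G"
    have "\<rho> \<cdot> (V g \<triangleleft> \<A>) \<cdot> cosec = (V g \<cdot> \<rho> \<cdot> (Y \<triangleright> a g)) \<cdot> cosec"
      unfolding V_map[OF g] by simp
    also have "\<dots> = V g \<cdot> (\<rho> \<cdot> (Y \<triangleright> a g) \<cdot> cosec)" by simp
    also have "\<dots> = (if g = \<one>\<^bsub>G\<^esub> then ident C Y else zero_arr C Y Y)"
      unfolding act_cosec[OF g] using V_one by simp
    finally show "\<rho> \<cdot> (V g \<triangleleft> \<A>) \<cdot> cosec = (if g = \<one>\<^bsub>G\<^esub> then ident C Y else zero_arr C Y Y)" .
  qed (auto simp: Hom_iff)
  also have "\<dots> = ident C Y"
    using finite_G by (intro hsum_delta) (auto simp: Hom_iff)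
  finally show ?thesis .
qed

text \<open>
  Compressing the action to the fixed part makes it invariant under all \<open>X \<otimes> a g\<close>, so that it may be
  averaged. The average of the \<open>a g\<close> is \<open>\<eta>\<eta>\<^sup>*\<close> up to a factor, and only the counit remains.
\<close>

lemma iota_action: "n *\<^sub>a (\<iota>\<dagger> \<cdot> \<rho> \<cdot> (\<iota> \<triangleleft> \<A>)) = runit C X \<cdot> (X \<triangleright> \<eta>\<dagger>)"
proof -
  let ?u = "\<iota>\<dagger> \<cdot> \<rho> \<cdot> (\<iota> \<triangleleft> \<A>)"
  have u: "?u \<cdot> (X \<triangleright> a g) = ?u" if [simp]: "g \<in> carrier G" for g
  proof -
    have s: "(\<iota> \<triangleleft> \<A>) \<cdot> (X \<triangleright> a g) = (Y \<triangleright> a g) \<cdot> (\<iota> \<triangleleft> \<A>)"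
      by (rule slide) (simp_all add: Hom_iff)
    have "?u \<cdot> (X \<triangleright> a g) = \<iota>\<dagger> \<cdot> \<rho> \<cdot> ((\<iota> \<triangleleft> \<A>) \<cdot> (X \<triangleright> a g))" by simp
    also have "\<dots> = (\<iota>\<dagger> \<cdot> V g) \<cdot> \<rho> \<cdot> (Y \<triangleright> a g) \<cdot> (\<iota> \<triangleleft> \<A>)"
      unfolding s V_iota[OF that] ..
    also have "\<dots> = \<iota>\<dagger> \<cdot> (V g \<cdot> \<rho> \<cdot> (Y \<triangleright> a g)) \<cdot> (\<iota> \<triangleleft> \<A>)" by simp
    also have "\<dots> = \<iota>\<dagger> \<cdot> \<rho> \<cdot> ((V g \<cdot> \<iota>) \<triangleleft> \<A>)"
      unfolding V_map[OF that] by simp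
    finally show ?thesis unfolding V_iota[OF that] .
  qed
  have "n *\<^sub>a ?u = hsum (X \<star> \<A>) X (\<lambda>_. ?u) (carrier G)"
    using finite_G by (intro hsum_const[symmetric]) (auto simp: Hom_iff)
  also have "\<dots> = hsum (X \<star> \<A>) X (\<lambda>g. ?u \<cdot> (X \<triangleright> a g)) (carrier G)"
    by (rule hsum_cong) (use u in \<open>auto simp: Hom_iff\<close>)
  also have "\<dots> = ?u \<cdot> hsum (X \<star> \<A>) (X \<star> \<A>) (\<lambda>g. X \<triangleright> a g) (carrier G)"
    using finite_G by (intro cmp_hsum[symmetric]) (auto simp: Hom_iff)
  also have "hsum (X \<star> \<A>) (X \<star> \<A>) (\<lambda>g. X \<triangleright> a g) (carrier G) = X \<triangleright> (\<eta> \<cdot> \<eta>\<dagger>)"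
    unfolding act_sum[symmetric] using finite_G act_Hom by (intro lwhisk_hsum[symmetric]) auto
  also have "?u \<cdot> (X \<triangleright> (\<eta> \<cdot> \<eta>\<dagger>)) = (\<iota>\<dagger> \<cdot> \<rho> \<cdot> ((\<iota> \<triangleleft> \<A>) \<cdot> (X \<triangleright> \<eta>))) \<cdot> (X \<triangleright> \<eta>\<dagger>)"
    by simp
  also have "(\<iota> \<triangleleft> \<A>) \<cdot> (X \<triangleright> \<eta>) = (Y \<triangleright> \<eta>) \<cdot> (\<iota> \<triangleleft> unit_ob C)"
    by (rule slide) (simp_all add: Hom_iff)
  also have "\<iota>\<dagger> \<cdot> \<rho> \<cdot> ((Y \<triangleright> \<eta>) \<cdot> (\<iota> \<triangleleft> unit_ob C)) = runit C X"
  proof -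
    have r: "\<rho> \<cdot> (Y \<triangleright> \<eta>) = runit C Y"
      using Y by (simp add: right_modules_def)
    have "\<iota>\<dagger> \<cdot> \<rho> \<cdot> ((Y \<triangleright> \<eta>) \<cdot> (\<iota> \<triangleleft> unit_ob C)) = \<iota>\<dagger> \<cdot> (runit C Y \<cdot> (\<iota> \<triangleleft> unit_ob C))"
      by (simp add: chain2[OF r])
    also have "\<dots> = runit C X"
      by (simp add: runit_nat chain2[OF iota_isometry])
    finally show ?thesis .
  qed
  finally show ?thesis .
qed

text \<open>
  Associativity of \<open>\<rho>\<close> turns the composite into the comultiplication of \<open>A\<close>, which is \<open>?k\<close> below,
  followed by the compressed action; by \<open>iota_action\<close> the claim becomes the counit law \<open>t_dual\<close>.
\<close>

lemma fix_inv_map: "fix_inv \<cdot> fix_map = ident C (X \<star> \<A>)"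
proof -
  let ?k = "merge \<A> \<A> \<mu> \<A> \<cdot> (\<A> \<triangleright> t) \<cdot> (runit C \<A>)\<dagger>"
  have 1: "cosec \<cdot> \<rho> = merge Y \<A> \<rho> \<A> \<cdot> (Y \<triangleright> ?k)"
  proof -
    have r: "(runit C (Y \<star> \<A>))\<dagger> = (assr C Y \<A> (unit_ob C))\<dagger> \<cdot> (Y \<triangleright> (runit C \<A>)\<dagger>)"
      by (simp flip: runit_tensor)
    have m: "(Y \<triangleright> t) \<cdot> merge Y \<A> \<rho> (unit_ob C) = merge Y \<A> \<rho> (\<A> \<star> \<A>) \<cdot> (Y \<triangleright> (\<A> \<triangleright> t))"
      by (subst merge_nat) simp_all
    have "cosec \<cdot> \<rho> = merge Y \<A> \<rho> \<A> \<cdot> (Y \<triangleright> t) \<cdot> ((runit C Y)\<dagger> \<cdot> \<rho>)"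
      by (simp add: cosec_def)
    also have "(runit C Y)\<dagger> \<cdot> \<rho> = merge Y \<A> \<rho> (unit_ob C) \<cdot> (Y \<triangleright> (runit C \<A>)\<dagger>)"
      by (subst runit_adj_nat) (simp_all add: r merge_def)
    also have "merge Y \<A> \<rho> \<A> \<cdot> (Y \<triangleright> t) \<cdot> (merge Y \<A> \<rho> (unit_ob C) \<cdot> (Y \<triangleright> (runit C \<A>)\<dagger>))
        = merge Y \<A> \<rho> \<A> \<cdot> ((Y \<triangleright> t) \<cdot> merge Y \<A> \<rho> (unit_ob C)) \<cdot> (Y \<triangleright> (runit C \<A>)\<dagger>)"
      by simp
    also have "\<dots> = (merge Y \<A> \<rho> \<A> \<cdot> merge Y \<A> \<rho> (\<A> \<star> \<A>)) \<cdot> (Y \<triangleright> (\<A> \<triangleright> t)) \<cdot> (Y \<triangleright> (runit C \<A>)\<dagger>)"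
      unfolding m by simp
    also have "merge Y \<A> \<rho> \<A> \<cdot> merge Y \<A> \<rho> (\<A> \<star> \<A>) = merge Y \<A> \<rho> \<A> \<cdot> (Y \<triangleright> merge \<A> \<A> \<mu> \<A>)"
      by (rule merge_merge[OF moduleD(5)[OF Y]]) simp_all
    finally show ?thesis by simp
  qed
  have 2: "(\<iota>\<dagger> \<triangleleft> \<A>) \<cdot> merge Y \<A> \<rho> \<A> \<cdot> (\<iota> \<triangleleft> (\<A> \<star> \<A>)) = merge X \<A> (\<iota>\<dagger> \<cdot> \<rho> \<cdot> (\<iota> \<triangleleft> \<A>)) \<A>"
  proof -
    have "(assr C Y \<A> \<A>)\<dagger> \<cdot> (\<iota> \<triangleleft> (\<A> \<star> \<A>)) = ((\<iota> \<triangleleft> \<A>) \<triangleleft> \<A>) \<cdot> (assr C X \<A> \<A>)\<dagger>"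
      using assr_adj_nat[of \<iota> "ident C \<A>" "ident C \<A>" Y \<A> \<A>] by simp
    then show ?thesis by (simp add: merge_def)
  qed
  have s: "(Y \<triangleright> ?k) \<cdot> (\<iota> \<triangleleft> \<A>) = (\<iota> \<triangleleft> (\<A> \<star> \<A>)) \<cdot> (X \<triangleright> ?k)"
    by (rule slide[symmetric]) (simp_all add: Hom_iff)
  have "fix_inv \<cdot> fix_map = n *\<^sub>a ((\<iota>\<dagger> \<triangleleft> \<A>) \<cdot> (cosec \<cdot> \<rho>) \<cdot> (\<iota> \<triangleleft> \<A>))"
    by (simp add: fix_inv_def fix_map_def)
  also have "\<dots> = n *\<^sub>a ((\<iota>\<dagger> \<triangleleft> \<A>) \<cdot> merge Y \<A> \<rho> \<A> \<cdot> ((Y \<triangleright> ?k) \<cdot> (\<iota> \<triangleleft> \<A>)))"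
    unfolding 1 by simp
  also have "\<dots> = n *\<^sub>a (((\<iota>\<dagger> \<triangleleft> \<A>) \<cdot> merge Y \<A> \<rho> \<A> \<cdot> (\<iota> \<triangleleft> (\<A> \<star> \<A>))) \<cdot> (X \<triangleright> ?k))"
    unfolding s by simp
  also have "\<dots> = merge X \<A> (n *\<^sub>a (\<iota>\<dagger> \<cdot> \<rho> \<cdot> (\<iota> \<triangleleft> \<A>))) \<A> \<cdot> (X \<triangleright> ?k)"
    unfolding 2 by (simp add: merge_def)
  also have "merge X \<A> (n *\<^sub>a (\<iota>\<dagger> \<cdot> \<rho> \<cdot> (\<iota> \<triangleleft> \<A>))) \<A> = X \<triangleright> (lunit C \<A> \<cdot> (\<eta>\<dagger> \<triangleleft> \<A>))"
  proof -
    have e: "((X \<triangleright> \<eta>\<dagger>) \<triangleleft> \<A>) \<cdot> (assr C X \<A> \<A>)\<dagger> = (assr C X (unit_ob C) \<A>)\<dagger> \<cdot> (X \<triangleright> (\<eta>\<dagger> \<triangleleft> \<A>))"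
      using assr_adj_nat[of "ident C X" "\<eta>\<dagger>" "ident C \<A>" X "unit_ob C" \<A>] by simp
    have "merge X \<A> (runit C X \<cdot> (X \<triangleright> \<eta>\<dagger>)) \<A> = ((runit C X \<triangleleft> \<A>) \<cdot> (assr C X (unit_ob C) \<A>)\<dagger>) \<cdot> (X \<triangleright> (\<eta>\<dagger> \<triangleleft> \<A>))"
      by (simp add: merge_def e)
    then show ?thesis unfolding iota_action by (simp add: triangle')
  qed
  also have "(X \<triangleright> (lunit C \<A> \<cdot> (\<eta>\<dagger> \<triangleleft> \<A>))) \<cdot> (X \<triangleright> ?k) = X \<triangleright> (lunit C \<A> \<cdot> (\<eta>\<dagger> \<triangleleft> \<A>) \<cdot> ?k)"
    by simp
  also have "\<dots> = ident C (X \<star> \<A>)" unfolding t_dual by simp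
  finally show ?thesis .
qed

lemma fix_map_module: "fix_map \<in> module_maps C A (free_module C A X) (Y, \<rho>)"
proof -
  have s: "(\<iota> \<triangleleft> \<A>) \<cdot> (X \<triangleright> \<mu>) = (Y \<triangleright> \<mu>) \<cdot> (\<iota> \<triangleleft> (\<A> \<star> \<A>))"
    by (rule slide) (simp_all add: Hom_iff)
  have r: "(\<iota> \<triangleleft> (\<A> \<star> \<A>)) \<cdot> assr C X \<A> \<A> = assr C Y \<A> \<A> \<cdot> ((\<iota> \<triangleleft> \<A>) \<triangleleft> \<A>)"
    using assr_nat[of \<iota> "ident C \<A>" "ident C \<A>" Y \<A> \<A>] by simp
  have "fix_map \<cdot> ((X \<triangleright> \<mu>) \<cdot> assr C X \<A> \<A>) = \<rho> \<cdot> ((\<iota> \<triangleleft> \<A>) \<cdot> (X \<triangleright> \<mu>)) \<cdot> assr C X \<A> \<A>"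
    by (simp add: fix_map_def)
  also have "\<dots> = (\<rho> \<cdot> (Y \<triangleright> \<mu>)) \<cdot> ((\<iota> \<triangleleft> (\<A> \<star> \<A>)) \<cdot> assr C X \<A> \<A>)"
    unfolding s by simp
  also have "\<dots> = (\<rho> \<cdot> merge Y \<A> \<rho> \<A>) \<cdot> (assr C Y \<A> \<A> \<cdot> ((\<iota> \<triangleleft> \<A>) \<triangleleft> \<A>))"
    unfolding r moduleD(5)[OF Y] ..
  also have "\<dots> = \<rho> \<cdot> (fix_map \<triangleleft> \<A>)" by (simp add: merge_def fix_map_def)
  finally show ?thesis by (simp add: module_maps_def free_module_eq Hom_iff)
qed

lemma equivariant_free: "iso_ob \<M> (free_module C A X) (Y, \<rho>)"
proof -
  have "inverse_arrs fix_map fix_inv"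
    by (simp add: inverse_arrs_def fix_map_inv fix_inv_map)
  then show ?thesis
    using fix_map_module Y free_module[of X] by (auto simp: module_iso_iff free_module_eq)
qed

end

declare iota_simps [simp del] fix_simps [simp del]

lemma equivariant_imp_free:
  assumes unitary: "\<And>g. g \<in> carrier G \<Longrightarrow> (V g)\<dagger> \<cdot> V g = ident C Y"
  obtains X where "X \<in> Ob C" "iso_ob \<M> (free_module C A X) (Y, \<rho>)"
proof -
  \<comment> \<open>unitarity is what makes \<open>\<Sigma>\<close> self-adjoint, so that the idempotent below splits as a projection\<close>
  have V_adj: "(V g)\<dagger> = V (inv\<^bsub>G\<^esub> g)" if [simp]: "g \<in> carrier G" for g
  proof -
    have "(V g)\<dagger> = (V g)\<dagger> \<cdot> (V g \<cdot> V (inv\<^bsub>G\<^esub> g))"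
      by (simp add: V_one flip: V_mult)
    also have "\<dots> = V (inv\<^bsub>G\<^esub> g)" by (simp add: chain2[OF unitary])
    finally show ?thesis .
  qed
  have "\<Sigma>\<dagger> = hsum Y Y (\<lambda>g. (V g)\<dagger>) (carrier G)"
    using finite_G V_Hom by (intro hsum_adj) auto
  also have "\<dots> = hsum Y Y (\<lambda>g. V (inv\<^bsub>G\<^esub> g)) (carrier G)"
    by (rule hsum_cong) (auto simp: V_adj V_Hom)
  also have "\<dots> = \<Sigma>"
  proof (rule hsum_reindex)
    show "bij_betw (\<lambda>g. inv\<^bsub>G\<^esub> g) (carrier G) (carrier G)"
      by (rule bij_betw_byWitness[where f' = "\<lambda>g. inv\<^bsub>G\<^esub> g"]) auto
  qed (auto simp: V_Hom)
  finally have adj: "\<Sigma>\<dagger> = \<Sigma>" .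
  have "\<Sigma> \<cdot> \<Sigma> = hsum Y Y (\<lambda>g. V g \<cdot> \<Sigma>) (carrier G)"
    using finite_G V_Hom Sigma_Hom by (intro hsum_cmp) auto
  also have "\<dots> = hsum Y Y (\<lambda>g. \<Sigma>) (carrier G)"
    by (rule hsum_cong) (auto simp: V_Sigma Sigma_Hom)
  also have "\<dots> = n *\<^sub>a \<Sigma>" using finite_G Sigma_Hom by (rule hsum_const)
  finally have sq: "\<Sigma> \<cdot> \<Sigma> = n *\<^sub>a \<Sigma>" .
  define c where "c = inverse n"
  have c: "c * n = 1" "n * c = 1" "cnj c = c" unfolding c_def using n_nonzero by simp_all
  define p where "p = c *\<^sub>a \<Sigma>"
  note p = p_def
  have p_Hom: "p \<in> Hom C Y Y" by (simp add: p Hom_iff)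
  have "p \<cdot> p = c *\<^sub>a (c *\<^sub>a (\<Sigma> \<cdot> \<Sigma>))" by (simp add: p)
  also have "\<dots> = (c * (c * n)) *\<^sub>a \<Sigma>" unfolding sq by simp
  finally have p_idem: "p \<cdot> p = p" by (simp add: c p)
  have "p\<dagger> = cnj c *\<^sub>a \<Sigma>\<dagger>" by (simp add: p)
  then have "p\<dagger> = p" unfolding adj c p .
  note p_Hom p_idem this
  then obtain X \<iota> where X: "X \<in> Ob C" "\<iota> \<in> Hom C X Y" "\<iota>\<dagger> \<cdot> \<iota> = ident C X" "\<iota> \<cdot> \<iota>\<dagger> = p"
    using subobjects by blast
  have "n *\<^sub>a (\<iota> \<cdot> \<iota>\<dagger>) = \<Sigma>" unfolding X(4) p by (simp add: c)
  then show thesis using that X(1) equivariant_free[OF X(2,3)] by blast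
qed

end

declare Y_simps [simp del] V_simps [simp del] Sigma_simps [simp del]

end


section \<open>Groups of invertible objects and characters\<close>

context braided_cstar_tensor_category
begin

lemma tensor_iso:
  assumes "iso_ob C X X'" "iso_ob C Y Y'" shows "iso_ob C (X \<star> Y) (X' \<star> Y')"
proof -
  obtain f f' g g' where f: "inverse_arrs f f'" "source C f = X" "target C f = X'"
    and g: "inverse_arrs g g'" "source C g = Y" "target C g = Y'"
    using assms unfolding iso_ob_iff by blast
  have [simp]: "f \<in> Arr C" "f' \<in> Arr C" "g \<in> Arr C" "g' \<in> Arr C" "source C f' = X'" "target C f' = X"
    "source C g' = Y'" "target C g' = Y" "source C f = X" "target C f = X'" "source C g = Y" "target C g = Y'"
    "f' \<cdot> f = ident C X" "f \<cdot> f' = ident C X'" "g' \<cdot> g = ident C Y" "g \<cdot> g' = ident C Y'"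
    using f g unfolding inverse_arrs_def by auto
  have "inverse_arrs (f \<diamondop> g) (f' \<diamondop> g')"
    using iso_ob_Ob[OF assms(1)] iso_ob_Ob[OF assms(2)] by (simp add: inverse_arrs_def interchange)
  then show ?thesis using iso_obI by fastforce
qed

lemma assoc_iso: "X \<in> Ob C \<Longrightarrow> Y \<in> Ob C \<Longrightarrow> Z \<in> Ob C \<Longrightarrow> iso_ob C ((X \<star> Y) \<star> Z) (X \<star> (Y \<star> Z))"
  using iso_obI[of "assr C X Y Z" "(assr C X Y Z)\<dagger>"] by (simp add: inverse_arrs_def)

lemma lunit_iso: "X \<in> Ob C \<Longrightarrow> iso_ob C (unit_ob C \<star> X) X"
  using iso_obI[of "lunit C X" "(lunit C X)\<dagger>"] by (simp add: inverse_arrs_def)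

lemma braid_iso: "X \<in> Ob C \<Longrightarrow> Y \<in> Ob C \<Longrightarrow> iso_ob C (X \<star> Y) (Y \<star> X)"
  using iso_obI[of "braid C X Y" "(braid C X Y)\<dagger>"] by (simp add: inverse_arrs_def)

lemma Inv_mult:
  assumes "X \<in> Ob C" "Y \<in> Ob C"
  shows "iso_class C X \<otimes>\<^bsub>Inv C\<^esub> iso_class C Y = iso_class C (X \<star> Y)"
  unfolding Inv_def monoid.simps
proof (intro UN_iso_class assms)
  fix X' Y' assume "iso_ob C X X'" "iso_ob C Y Y'"
  then show "iso_class C (X' \<star> Y') = iso_class C (X \<star> Y)"
    by (intro iso_class_eqI iso_ob_sym[OF tensor_iso])
qed

lemma Inv_carrier: "c \<in> carrier (Inv C) \<longleftrightarrow> (\<exists>X. invertible_ob C X \<and> c = iso_class C X)"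
  by (auto simp: Inv_def)

lemma invertibleI: "X \<in> Ob C \<Longrightarrow> Y \<in> Ob C \<Longrightarrow> iso_ob C (X \<star> Y) (unit_ob C) \<Longrightarrow> invertible_ob C X"
  using iso_ob_trans[OF braid_iso] unfolding invertible_ob_def by blast

lemma invertible_inverse:
  assumes "invertible_ob C X"
  obtains Y where "invertible_ob C Y" "iso_ob C (X \<star> Y) (unit_ob C)" "iso_ob C (Y \<star> X) (unit_ob C)"
  using assms unfolding invertible_ob_def by blast

lemma invertible_Ob: "invertible_ob C X \<Longrightarrow> X \<in> Ob C"
  by (simp add: invertible_ob_def)

lemma invertible_tensor:
  assumes "invertible_ob C X" "invertible_ob C Y" shows "invertible_ob C (X \<star> Y)"
proof -
  obtain X' Y' where X': "X' \<in> Ob C" "iso_ob C (X \<star> X') (unit_ob C)" and Y': "Y' \<in> Ob C" "iso_ob C (Y \<star> Y') (unit_ob C)"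
    using assms unfolding invertible_ob_def by blast
  note o [simp] = invertible_Ob[OF assms(1)] invertible_Ob[OF assms(2)] X'(1) Y'(1)
  have "iso_ob C ((X \<star> Y) \<star> (Y' \<star> X')) (X \<star> (Y \<star> (Y' \<star> X')))" by (rule assoc_iso) simp_all
  moreover have "iso_ob C (X \<star> (Y \<star> (Y' \<star> X'))) (X \<star> ((Y \<star> Y') \<star> X'))"
    by (intro tensor_iso iso_ob_refl iso_ob_sym[OF assoc_iso]) simp_all
  moreover have "iso_ob C (X \<star> ((Y \<star> Y') \<star> X')) (X \<star> (unit_ob C \<star> X'))"
    by (intro tensor_iso iso_ob_refl Y'(2)) simp_all
  moreover have "iso_ob C (X \<star> (unit_ob C \<star> X')) (X \<star> X')"
    by (intro tensor_iso iso_ob_refl lunit_iso) simp_all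
  ultimately have "iso_ob C ((X \<star> Y) \<star> (Y' \<star> X')) (unit_ob C)"
    using X'(2) iso_ob_trans by metis
  then show ?thesis by (intro invertibleI[of _ "Y' \<star> X'"]) simp_all
qed

lemma invertible_unit: "invertible_ob C (unit_ob C)"
  using invertibleI[of "unit_ob C" "unit_ob C"] lunit_iso by simp

lemma Inv_group: "group (Inv C)"
proof (rule groupI)
  show "\<one>\<^bsub>Inv C\<^esub> \<in> carrier (Inv C)"
    using invertible_unit by (auto simp: Inv_def)
next
  fix c d assume "c \<in> carrier (Inv C)" "d \<in> carrier (Inv C)"
  then show "c \<otimes>\<^bsub>Inv C\<^esub> d \<in> carrier (Inv C)"
    using Inv_mult invertible_Ob invertible_tensor unfolding Inv_carrier by metis
next
  fix c d e assume "c \<in> carrier (Inv C)" "d \<in> carrier (Inv C)" "e \<in> carrier (Inv C)"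
  then obtain X Y Z where [simp]: "c = iso_class C X" "d = iso_class C Y" "e = iso_class C Z"
    "X \<in> Ob C" "Y \<in> Ob C" "Z \<in> Ob C"
    unfolding Inv_carrier using invertible_Ob by metis
  show "c \<otimes>\<^bsub>Inv C\<^esub> d \<otimes>\<^bsub>Inv C\<^esub> e = c \<otimes>\<^bsub>Inv C\<^esub> (d \<otimes>\<^bsub>Inv C\<^esub> e)"
    using iso_class_eqI[OF assoc_iso[of X Y Z]] by (simp add: Inv_mult)
next
  fix c assume "c \<in> carrier (Inv C)"
  then obtain X where X: "c = iso_class C X" "invertible_ob C X" unfolding Inv_carrier by blast
  have one: "\<one>\<^bsub>Inv C\<^esub> = iso_class C (unit_ob C)" by (simp add: Inv_def)
  show "\<one>\<^bsub>Inv C\<^esub> \<otimes>\<^bsub>Inv C\<^esub> c = c"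
    using iso_class_eqI[OF lunit_iso[OF invertible_Ob[OF X(2)]]] invertible_Ob[OF X(2)]
    by (simp add: one X Inv_mult)
  obtain Y where Y: "invertible_ob C Y" "iso_ob C (Y \<star> X) (unit_ob C)"
    using invertible_inverse[OF X(2)] by blast
  then have "iso_class C Y \<otimes>\<^bsub>Inv C\<^esub> c = \<one>\<^bsub>Inv C\<^esub>"
    using iso_class_eqI[OF Y(2)] invertible_Ob[OF X(2)] invertible_Ob[OF Y(1)] by (simp add: one X Inv_mult)
  then show "\<exists>d\<in>carrier (Inv C). d \<otimes>\<^bsub>Inv C\<^esub> c = \<one>\<^bsub>Inv C\<^esub>"
  proof (rule bexI)
    show "iso_class C Y \<in> carrier (Inv C)" using Y(1) by (auto simp: Inv_def)
  qed
qed

end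

lemma dual_groupD:
  assumes "\<phi> \<in> carrier (dual_group G)" "g \<in> carrier G"
  shows "cmod (\<phi> g) = 1" "cnj (\<phi> g) * \<phi> g = 1" "h \<in> carrier G \<Longrightarrow> \<phi> (g \<otimes>\<^bsub>G\<^esub> h) = \<phi> g * \<phi> h"
proof -
  show 1: "cmod (\<phi> g) = 1" and "h \<in> carrier G \<Longrightarrow> \<phi> (g \<otimes>\<^bsub>G\<^esub> h) = \<phi> g * \<phi> h"
    using assms by (auto simp: dual_group_def U1_def hom_def)
  have "\<phi> g * cnj (\<phi> g) = of_real ((cmod (\<phi> g))\<^sup>2)" by (rule complex_norm_square[symmetric])
  then show "cnj (\<phi> g) * \<phi> g = 1" using 1 by (simp add: mult.commute)
qed

context galois_algebra
begin

lemma dual_one: assumes "\<phi> \<in> carrier (dual_group G)" shows "\<phi> \<one>\<^bsub>G\<^esub> = 1"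
proof -
  have "\<phi> \<one>\<^bsub>G\<^esub> = \<phi> \<one>\<^bsub>G\<^esub> * \<phi> \<one>\<^bsub>G\<^esub>" using dual_groupD(3)[OF assms, of "\<one>\<^bsub>G\<^esub>" "\<one>\<^bsub>G\<^esub>"] by simp
  moreover have "\<phi> \<one>\<^bsub>G\<^esub> \<noteq> 0" using dual_groupD(1)[OF assms, of "\<one>\<^bsub>G\<^esub>"] by auto
  ultimately show ?thesis by simp
qed

text \<open>
  Twisting the equivariant structure of \<open>A\<close> by \<open>\<phi>\<close> makes the \<open>\<phi>\<close>-isotypic component the fixed part,
  and descent identifies \<open>A\<close> with the free module on it.
\<close>

lemma character_free:
  assumes \<phi>: "\<phi> \<in> carrier (dual_group G)"
  shows "iso_ob \<M> (free_module C A (L \<phi>)) (\<A>, \<mu>)"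
proof -
  note [simp] = w_simps[OF \<phi>]
  \<comment> \<open>\<open>w \<phi>\<close> is \<open>sqrt n\<close> times an isometry\<close>
  define r where "r = complex_of_real (inverse (sqrt (real (card (carrier G)))))"
  have r: "cnj r * r * n = 1" "n * (cnj r * r) = 1"
  proof -
    have "inverse (sqrt (real (card (carrier G)))) * inverse (sqrt (real (card (carrier G)))) * real (card (carrier G)) = 1"
      using n_nonzero by (simp add: field_simps)
    then have "complex_of_real (inverse (sqrt (real (card (carrier G)))) * inverse (sqrt (real (card (carrier G)))) * real (card (carrier G))) = 1"
      by simp
    then show "cnj r * r * n = 1" unfolding r_def by simp
    then show "n * (cnj r * r) = 1" by (simp add: mult.commute)
  qed
  define V where "V g = \<phi> g *\<^sub>a (a g)\<dagger>" for g
  have ww: "hsum \<A> \<A> V (carrier G) = w \<phi> \<cdot> (w \<phi>)\<dagger>"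
  proof -
    have "hsum \<A> \<A> V (carrier G) = hsum \<A> \<A> (\<lambda>g. (cnj (\<phi> g) *\<^sub>a a g)\<dagger>) (carrier G)"
      by (rule hsum_cong) (auto simp: V_def Hom_iff)
    also have "\<dots> = (hsum \<A> \<A> (\<lambda>g. cnj (\<phi> g) *\<^sub>a a g) (carrier G))\<dagger>"
      using finite_G by (intro hsum_adj[symmetric]) (auto simp: Hom_iff)
    also have "\<dots> = w \<phi> \<cdot> (w \<phi>)\<dagger>" by (simp flip: w_sum[OF \<phi>])
    finally show ?thesis .
  qed
  show ?thesis
  proof (rule equivariant_free[OF unit_module, where V = V and \<iota> = "r *\<^sub>a w \<phi>"])
    fix g assume g [simp]: "g \<in> carrier G"
    show "V g \<in> Hom C \<A> \<A>" by (simp add: V_def Hom_iff)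
    have "V g \<cdot> \<mu> \<cdot> (\<A> \<triangleright> a g) = \<phi> g *\<^sub>a ((a g)\<dagger> \<cdot> \<mu> \<cdot> (\<A> \<triangleright> a g))" by (simp add: V_def)
    also have "\<dots> = \<mu> \<cdot> (V g \<triangleleft> \<A>)" unfolding act_adj_mult_act[OF g] by (simp add: V_def)
    finally show "V g \<cdot> \<mu> \<cdot> (\<A> \<triangleright> a g) = \<mu> \<cdot> (V g \<triangleleft> \<A>)" .
    fix h assume h [simp]: "h \<in> carrier G"
    have "(a (g \<otimes>\<^bsub>G\<^esub> h))\<dagger> = (a g)\<dagger> \<cdot> (a h)\<dagger>" by (simp flip: act_comp)
    then show "V (g \<otimes>\<^bsub>G\<^esub> h) = V g \<cdot> V h"
      by (simp add: V_def dual_groupD(3)[OF \<phi>] mult.commute[of "\<phi> g"])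
  next
    show "V \<one>\<^bsub>G\<^esub> = ident C \<A>" by (simp add: V_def dual_one[OF \<phi>] act_one)
    show "r *\<^sub>a w \<phi> \<in> Hom C (L \<phi>) \<A>" by (simp add: Hom_iff)
    have "(r *\<^sub>a w \<phi>)\<dagger> \<cdot> (r *\<^sub>a w \<phi>) = (cnj r * r) *\<^sub>a ((w \<phi>)\<dagger> \<cdot> w \<phi>)"
      by (simp add: mult.commute)
    also have "\<dots> = (cnj r * r * n) *\<^sub>a ident C (L \<phi>)" unfolding w_norm[OF \<phi>] by simp
    finally show "(r *\<^sub>a w \<phi>)\<dagger> \<cdot> (r *\<^sub>a w \<phi>) = ident C (L \<phi>)" by (simp only: r) simp
    have "n *\<^sub>a ((r *\<^sub>a w \<phi>) \<cdot> (r *\<^sub>a w \<phi>)\<dagger>) = (n * (cnj r * r)) *\<^sub>a (w \<phi> \<cdot> (w \<phi>)\<dagger>)" by (simp add: mult.commute)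
    then show "n *\<^sub>a ((r *\<^sub>a w \<phi>) \<cdot> (r *\<^sub>a w \<phi>)\<dagger>) = hsum \<A> \<A> V (carrier G)"
      unfolding ww r by simp
  qed
qed

text \<open>
  Conjugating \<open>X \<otimes> a g\<close> by \<open>\<theta>\<close> and correcting by the adjoint of \<open>a g\<close> gives a module endomorphism of \<open>A\<close>,
  because both operators twist the action of \<open>A\<close> in the same way.
\<close>

lemma act_character:
  assumes [simp]: "X \<in> Ob C" and \<theta>: "\<theta> \<in> module_maps C A (free_module C A X) (\<A>, \<mu>)" "inverse_arrs \<theta> \<theta>'"
    and g [simp]: "g \<in> carrier G"
  obtains c where "\<theta> \<cdot> (X \<triangleright> a g) = c *\<^sub>a (a g \<cdot> \<theta>)"
proof -
  have fm: "(X \<star> \<A>, (X \<triangleright> \<mu>) \<cdot> assr C X \<A> \<A>) \<in> right_modules C A"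
    using free_module[of X] by (simp add: free_module_eq)
  have 1: "\<theta> \<in> Arr C" "source C \<theta> = X \<star> \<A>" "target C \<theta> = \<A>"
    using module_mapD(1-3)[OF \<theta>(1)] by (simp_all add: free_module_eq)
  have 2: "\<theta>' \<in> Arr C" "source C \<theta>' = \<A>" "target C \<theta>' = X \<star> \<A>" "\<theta>' \<cdot> \<theta> = ident C (X \<star> \<A>)" "\<theta> \<cdot> \<theta>' = ident C \<A>"
    using \<theta>(2) unfolding inverse_arrs_def 1 by blast+
  note [simp] = 1 2
  have m: "\<theta> \<cdot> (X \<triangleright> \<mu>) \<cdot> assr C X \<A> \<A> = \<mu> \<cdot> (\<theta> \<triangleleft> \<A>)"
    using module_mapD(4)[OF \<theta>(1)] by (simp add: free_module_eq)
  have m': "\<theta>' \<cdot> \<mu> = ((X \<triangleright> \<mu>) \<cdot> assr C X \<A> \<A>) \<cdot> (\<theta>' \<triangleleft> \<A>)"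
    using module_mapD(4)[OF inverse_module_map[OF fm unit_module \<theta>(2) \<theta>(1)[unfolded free_module_eq]]] by simp
  let ?K = "(a g)\<dagger> \<cdot> \<theta> \<cdot> (X \<triangleright> a g) \<cdot> \<theta>'"
  have e: "(X \<triangleright> a g) \<cdot> (X \<triangleright> \<mu>) \<cdot> assr C X \<A> \<A> = ((X \<triangleright> \<mu>) \<cdot> assr C X \<A> \<A>) \<cdot> ((X \<triangleright> a g) \<diamondop> a g)"
  proof -
    have "(X \<triangleright> a g) \<cdot> (X \<triangleright> \<mu>) \<cdot> assr C X \<A> \<A> = (X \<triangleright> (a g \<cdot> \<mu>)) \<cdot> assr C X \<A> \<A>" by simp
    also have "\<dots> = (X \<triangleright> \<mu>) \<cdot> ((X \<triangleright> (a g \<diamondop> a g)) \<cdot> assr C X \<A> \<A>)" unfolding act_mult[OF g] by simp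
    also have "(X \<triangleright> (a g \<diamondop> a g)) \<cdot> assr C X \<A> \<A> = assr C X \<A> \<A> \<cdot> ((X \<triangleright> a g) \<diamondop> a g)"
      using assr_nat[of "ident C X" "a g" "a g" X \<A> \<A>] by simp
    finally show ?thesis by simp
  qed
  have "?K \<cdot> \<mu> = (a g)\<dagger> \<cdot> \<theta> \<cdot> (X \<triangleright> a g) \<cdot> (\<theta>' \<cdot> \<mu>)" by simp
  also have "\<dots> = (a g)\<dagger> \<cdot> \<theta> \<cdot> ((X \<triangleright> a g) \<cdot> (X \<triangleright> \<mu>) \<cdot> assr C X \<A> \<A>) \<cdot> (\<theta>' \<triangleleft> \<A>)" unfolding m' by simp
  also have "\<dots> = (a g)\<dagger> \<cdot> (\<theta> \<cdot> (X \<triangleright> \<mu>) \<cdot> assr C X \<A> \<A>) \<cdot> ((X \<triangleright> a g) \<diamondop> a g) \<cdot> (\<theta>' \<triangleleft> \<A>)"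
    unfolding e by simp
  also have "\<dots> = ((a g)\<dagger> \<cdot> \<mu>) \<cdot> (\<theta> \<triangleleft> \<A>) \<cdot> ((X \<triangleright> a g) \<diamondop> a g) \<cdot> (\<theta>' \<triangleleft> \<A>)" unfolding m by simp
  also have "\<dots> = \<mu> \<cdot> (((a g)\<dagger> \<diamondop> (a g)\<dagger>) \<cdot> (\<theta> \<triangleleft> \<A>) \<cdot> ((X \<triangleright> a g) \<diamondop> a g) \<cdot> (\<theta>' \<triangleleft> \<A>))"
    unfolding act_adj_mult[OF g] by simp
  also have "((a g)\<dagger> \<diamondop> (a g)\<dagger>) \<cdot> (\<theta> \<triangleleft> \<A>) \<cdot> ((X \<triangleright> a g) \<diamondop> a g) \<cdot> (\<theta>' \<triangleleft> \<A>) = ?K \<triangleleft> \<A>"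
    by (simp add: interchange del: rwhisk_cmp)
  finally have "?K \<in> module_maps C A (\<A>, \<mu>) (\<A>, \<mu>)"
    by (simp add: module_maps_def Hom_iff del: rwhisk_cmp)
  then obtain c where c: "?K = c *\<^sub>a ident C \<A>" by (rule algebra_endo_scalar)
  have "\<theta> \<cdot> (X \<triangleright> a g) = a g \<cdot> ?K \<cdot> \<theta>" by (simp add: chain2[OF act_simps(5)])
  also have "\<dots> = c *\<^sub>a (a g \<cdot> \<theta>)" unfolding c by simp
  finally show thesis by (rule that)
qed

text \<open>
  Summing the relation of \<open>act_character\<close> over \<open>G\<close> shows that \<open>\<theta>\<close> carries the summand \<open>X\<close> of
  \<open>X \<otimes> A\<close> onto an isotypic component of \<open>A\<close>.
\<close>

lemma trivial_free_character:
  assumes [simp]: "X \<in> Ob C" and iso: "iso_ob \<M> (free_module C A X) (\<A>, \<mu>)"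
  obtains \<phi> where "\<phi> \<in> carrier (dual_group G)" "iso_ob C X (L \<phi>)"
proof -
  obtain \<theta> \<theta>' where \<theta>: "\<theta> \<in> module_maps C A (free_module C A X) (\<A>, \<mu>)" "inverse_arrs \<theta> \<theta>'"
    using iso unfolding free_module_eq module_iso_iff by blast
  have 1: "\<theta> \<in> Arr C" "source C \<theta> = X \<star> \<A>" "target C \<theta> = \<A>"
    using module_mapD(1-3)[OF \<theta>(1)] by (simp_all add: free_module_eq)
  have 2: "\<theta>' \<in> Arr C" "source C \<theta>' = \<A>" "target C \<theta>' = X \<star> \<A>" "\<theta>' \<cdot> \<theta> = ident C (X \<star> \<A>)" "\<theta> \<cdot> \<theta>' = ident C \<A>"
    using \<theta>(2) unfolding inverse_arrs_def 1 by blast+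
  note [simp] = 1 2
  have "\<forall>g\<in>carrier G. \<exists>c. \<theta> \<cdot> (X \<triangleright> a g) = c *\<^sub>a (a g \<cdot> \<theta>)"
    using act_character[OF assms(1) \<theta>] by metis
  then obtain c where c: "\<And>g. g \<in> carrier G \<Longrightarrow> \<theta> \<cdot> (X \<triangleright> a g) = c g *\<^sub>a (a g \<cdot> \<theta>)" by metis
  have inj: "k = l" if [simp]: "g \<in> carrier G" and kl: "k *\<^sub>a (a g \<cdot> \<theta>) = l *\<^sub>a (a g \<cdot> \<theta>)" for k l g
  proof -
    have "(a g)\<dagger> \<cdot> (k *\<^sub>a (a g \<cdot> \<theta>)) \<cdot> \<theta>' = (a g)\<dagger> \<cdot> (l *\<^sub>a (a g \<cdot> \<theta>)) \<cdot> \<theta>'"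
      unfolding kl ..
    then have "k *\<^sub>a ident C \<A> = l *\<^sub>a ident C \<A>" by simp
    then show ?thesis
      by (rule scale_cancel[OF _ _ algebra_ident_nonzero]) (simp add: Hom_iff)
  qed
  have c_mult: "c (h \<otimes>\<^bsub>G\<^esub> g) = c g * c h" if [simp]: "g \<in> carrier G" "h \<in> carrier G" for g h
  proof (rule inj[of "h \<otimes>\<^bsub>G\<^esub> g"])
    have "c (h \<otimes>\<^bsub>G\<^esub> g) *\<^sub>a (a (h \<otimes>\<^bsub>G\<^esub> g) \<cdot> \<theta>) = \<theta> \<cdot> (X \<triangleright> (a g \<cdot> a h))"
      by (simp add: c act_comp del: lwhisk_cmp)
    also have "\<dots> = (\<theta> \<cdot> (X \<triangleright> a g)) \<cdot> (X \<triangleright> a h)" by simp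
    also have "\<dots> = c g *\<^sub>a (a g \<cdot> (\<theta> \<cdot> (X \<triangleright> a h)))" unfolding c[OF that(1)] by simp
    also have "\<dots> = (c g * c h) *\<^sub>a ((a g \<cdot> a h) \<cdot> \<theta>)" unfolding c[OF that(2)] by simp
    finally show "c (h \<otimes>\<^bsub>G\<^esub> g) *\<^sub>a (a (h \<otimes>\<^bsub>G\<^esub> g) \<cdot> \<theta>) = (c g * c h) *\<^sub>a (a (h \<otimes>\<^bsub>G\<^esub> g) \<cdot> \<theta>)"
      by (simp add: act_comp)
  qed simp
  have c_one: "c \<one>\<^bsub>G\<^esub> = 1"
    by (rule inj[of "\<one>\<^bsub>G\<^esub>"]) (use c[of "\<one>\<^bsub>G\<^esub>"] in \<open>simp_all add: act_one\<close>)
  \<comment> \<open>a homomorphism from a finite group to the nonzero complex numbers takes values in roots of unity\<close>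
  have c_norm: "cmod (c g) = 1" if g [simp]: "g \<in> carrier G" for g
  proof -
    have "c (g [^]\<^bsub>G\<^esub> k) = c g ^ k" for k :: nat
      by (induction k) (simp_all add: c_one c_mult)
    from this[of "Coset.order G"] have "c g ^ Coset.order G = 1"
      by (simp add: pow_order_eq_1 c_one)
    then have "cmod (c g) ^ Coset.order G = 1 ^ Coset.order G" by (metis norm_one norm_power power_one)
    moreover have "Coset.order G > 0" using n_nonzero by (simp add: Coset.order_def)
    ultimately show ?thesis by (metis norm_ge_zero power_eq_imp_eq_base zero_le_one)
  qed
  \<comment> \<open>the conjugate, because \<open>w_sum\<close> weights \<open>a g\<close> with the conjugate of the character\<close>
  define \<phi> where "\<phi> = (\<lambda>g\<in>carrier G. cnj (c g))"
  have \<phi>: "\<phi> \<in> carrier (dual_group G)"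
    by (auto simp: \<phi>_def dual_group_def U1_def hom_def c_norm c_mult)
  note [simp] = w_simps[OF \<phi>]
  have key: "\<theta> \<cdot> (X \<triangleright> (\<eta> \<cdot> \<eta>\<dagger>)) = w \<phi> \<cdot> (w \<phi>)\<dagger> \<cdot> \<theta>"
  proof -
    have "\<theta> \<cdot> (X \<triangleright> (\<eta> \<cdot> \<eta>\<dagger>)) = \<theta> \<cdot> hsum (X \<star> \<A>) (X \<star> \<A>) (\<lambda>g. X \<triangleright> a g) (carrier G)"
      unfolding act_sum[symmetric] using finite_G act_Hom by (subst lwhisk_hsum) auto
    also have "\<dots> = hsum (X \<star> \<A>) \<A> (\<lambda>g. \<theta> \<cdot> (X \<triangleright> a g)) (carrier G)"
      using finite_G by (intro cmp_hsum) (auto simp: Hom_iff)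
    also have "\<dots> = hsum (X \<star> \<A>) \<A> (\<lambda>g. (cnj (\<phi> g) *\<^sub>a a g) \<cdot> \<theta>) (carrier G)"
      by (rule hsum_cong) (auto simp: Hom_iff c \<phi>_def)
    also have "\<dots> = hsum \<A> \<A> (\<lambda>g. cnj (\<phi> g) *\<^sub>a a g) (carrier G) \<cdot> \<theta>"
      using finite_G by (intro hsum_cmp[symmetric]) (auto simp: Hom_iff)
    also have "\<dots> = w \<phi> \<cdot> (w \<phi>)\<dagger> \<cdot> \<theta>"
      unfolding w_sum[OF \<phi>, symmetric] by simp
    finally show ?thesis .
  qed
  \<comment> \<open>up to the factor \<open>n\<^sup>2\<close>, \<open>u\<close> and \<open>v\<close> are inverse to each other\<close>
  define u where "u = (w \<phi>)\<dagger> \<cdot> \<theta> \<cdot> (X \<triangleright> \<eta>) \<cdot> (runit C X)\<dagger>"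
  define v where "v = runit C X \<cdot> (X \<triangleright> \<eta>\<dagger>) \<cdot> \<theta>' \<cdot> w \<phi>"
  have [simp]: "u \<in> Arr C" "source C u = X" "target C u = L \<phi>" "v \<in> Arr C" "source C v = L \<phi>" "target C v = X"
    by (simp_all add: u_def v_def)
  have eta: "(X \<triangleright> \<eta>\<dagger>) \<cdot> (X \<triangleright> \<eta>) = n *\<^sub>a ident C (X \<star> unit_ob C)"
    by (simp add: unit_norm_card flip: lwhisk_cmp)
  have vu: "v \<cdot> u = (n * n) *\<^sub>a ident C X"
  proof -
    have "v \<cdot> u = runit C X \<cdot> (X \<triangleright> \<eta>\<dagger>) \<cdot> \<theta>' \<cdot> (w \<phi> \<cdot> (w \<phi>)\<dagger> \<cdot> \<theta>) \<cdot> (X \<triangleright> \<eta>) \<cdot> (runit C X)\<dagger>"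
      by (simp add: u_def v_def)
    also have "\<dots> = runit C X \<cdot> (X \<triangleright> \<eta>\<dagger>) \<cdot> (\<theta>' \<cdot> \<theta>) \<cdot> (X \<triangleright> \<eta>) \<cdot> (X \<triangleright> \<eta>\<dagger>) \<cdot> (X \<triangleright> \<eta>) \<cdot> (runit C X)\<dagger>"
      unfolding key[symmetric] by (simp add: chain2[OF 2(4)])
    also have "\<dots> = (n * n) *\<^sub>a ident C X" by (simp add: eta chain2[OF eta])
    finally show ?thesis .
  qed
  have uv: "u \<cdot> v = (n * n) *\<^sub>a ident C (L \<phi>)"
  proof -
    have "u \<cdot> v = (w \<phi>)\<dagger> \<cdot> (\<theta> \<cdot> (X \<triangleright> (\<eta> \<cdot> \<eta>\<dagger>))) \<cdot> \<theta>' \<cdot> w \<phi>"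
      by (simp add: u_def v_def)
    also have "\<dots> = (w \<phi>)\<dagger> \<cdot> w \<phi> \<cdot> (w \<phi>)\<dagger> \<cdot> (\<theta> \<cdot> \<theta>') \<cdot> w \<phi>"
      unfolding key by (simp add: chain2[OF 2(5)])
    also have "\<dots> = (n * n) *\<^sub>a ident C (L \<phi>)"
      by (simp add: w_norm[OF \<phi>] chain2[OF w_norm[OF \<phi>]])
    finally show ?thesis .
  qed
  define k where "k = inverse (n * n)"
  have k: "k * (n * n) = 1" unfolding k_def using n_nonzero by (metis mult_eq_0_iff left_inverse)
  have "inverse_arrs u (k *\<^sub>a v)"
    unfolding inverse_arrs_def by (simp add: vu uv) (simp only: k, simp)
  then have "iso_ob C X (L \<phi>)" using iso_obI by fastforce
  then show thesis by (rule that[OF \<phi>])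
qed

end


section \<open>The group of lifted modules\<close>

context galois_algebra
begin

text \<open>
  Equivariant structures in terms of their underlying morphisms in the braided category, where the
  twisted module has the action \<open>\<rho> \<circ> (Y \<otimes> a g)\<close>.
\<close>

definition equivariant :: "'o \<times> 'm \<Rightarrow> bool" where
  "equivariant y \<longleftrightarrow> (\<exists>V.
     (\<forall>g\<in>carrier G. V g \<in> Hom C (fst y) (fst y) \<and> V g \<cdot> snd y \<cdot> (fst y \<triangleright> a g) = snd y \<cdot> (V g \<triangleleft> \<A>)
        \<and> unitary_arr C (V g)) \<and>
     (\<forall>g\<in>carrier G. \<forall>h\<in>carrier G. V (g \<otimes>\<^bsub>G\<^esub> h) = V g \<cdot> V h))"

definition lift_group :: "('o \<times> 'm) set monoid" where
  "lift_group = (Inv \<M>)\<lparr>carrier := {iso_class \<M> y | y. invertible_ob \<M> y \<and> equivariant y}\<rparr>"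

definition free_map :: "'o set \<Rightarrow> ('o \<times> 'm) set" where
  "free_map c = (\<Union>X\<in>c. iso_class \<M> (free_module C A X))"

interpretation M: category \<M> by (rule Module_category)

lemma free_map_class:
  assumes "X \<in> Ob C" shows "free_map (iso_class C X) = iso_class \<M> (free_module C A X)"
  unfolding free_map_def
  by (rule UN_iso_class[OF assms]) (intro M.iso_class_eqI M.iso_ob_sym[OF free_module_iso])

lemma free_equivariant_structure:
  assumes [simp]: "X \<in> Ob C" shows "equivariant (free_module C A X)"
  unfolding equivariant_def free_module_eq fst_conv snd_conv
proof (intro exI[of _ "\<lambda>g. X \<triangleright> (a g)\<dagger>"] conjI ballI)
  fix g assume g [simp]: "g \<in> carrier G"
  show "X \<triangleright> (a g)\<dagger> \<in> Hom C (X \<star> \<A>) (X \<star> \<A>)" by (simp add: Hom_iff)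
  show "(X \<triangleright> (a g)\<dagger>) \<cdot> ((X \<triangleright> \<mu>) \<cdot> assr C X \<A> \<A>) \<cdot> ((X \<star> \<A>) \<triangleright> a g)
    = ((X \<triangleright> \<mu>) \<cdot> assr C X \<A> \<A>) \<cdot> ((X \<triangleright> (a g)\<dagger>) \<triangleleft> \<A>)"
    by (rule free_equivariant) simp_all
  show "unitary_arr C (X \<triangleright> (a g)\<dagger>)"
    by (simp add: unitary_arr_def flip: lwhisk_cmp)
  fix h assume h [simp]: "h \<in> carrier G"
  show "X \<triangleright> (a (g \<otimes>\<^bsub>G\<^esub> h))\<dagger> = (X \<triangleright> (a g)\<dagger>) \<cdot> (X \<triangleright> (a h)\<dagger>)"
    by (simp flip: act_comp)
qed

lemma free_invertible:
  assumes "invertible_ob C X" shows "invertible_ob \<M> (free_module C A X)"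
proof -
  obtain Y where Y: "invertible_ob C Y" "iso_ob C (X \<star> Y) (unit_ob C)" "iso_ob C (Y \<star> X) (unit_ob C)"
    by (rule invertible_inverse[OF assms])
  note o = invertible_Ob[OF assms] invertible_Ob[OF Y(1)]
  have *: "iso_ob \<M> (tensor_ob \<M> (free_module C A U) (free_module C A W)) (unit_ob \<M>)"
    if "U \<in> Ob C" "W \<in> Ob C" "iso_ob C (U \<star> W) (unit_ob C)" for U W
  proof -
    have r: "iso_ob \<M> (free_module C A U) (free_module C A U)" "iso_ob \<M> (free_module C A W) (free_module C A W)"
      using that free_module by (auto intro: M.iso_ob_refl simp: Module_simps)
    show ?thesis
      using M.iso_ob_trans[OF tensor_free_free[OF r that(1,2)] M.iso_ob_trans[OF free_module_iso[OF that(3)] free_module_unit]]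
      by (simp add: Module_simps)
  qed
  have "free_module C A X \<in> Ob \<M>" "free_module C A Y \<in> Ob \<M>"
    using o free_module by (auto simp: Module_simps)
  then show ?thesis
    unfolding invertible_ob_def using *[OF o Y(2)] *[OF o(2,1) Y(3)] by blast
qed

text \<open>
  Descent writes \<open>y\<close> as a free module on some \<open>X\<close>, and the inverse of \<open>y\<close> over \<open>A\<close> provides the module that
  is needed to conclude that \<open>X\<close> is invertible.
\<close>

lemma lifted_is_free:
  assumes "invertible_ob \<M> y" "equivariant y"
  obtains X where "invertible_ob C X" "iso_ob \<M> (free_module C A X) y"
proof -
  obtain Y \<rho> where y: "y = (Y, \<rho>)" by (cases y) auto
  have Y: "(Y, \<rho>) \<in> right_modules C A"
    using assms(1) by (simp add: invertible_ob_def Module_simps y)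
  note [simp] = moduleD(1-4)[OF Y]
  obtain V where V: "\<And>g. g \<in> carrier G \<Longrightarrow> V g \<in> Hom C Y Y"
    "\<And>g. g \<in> carrier G \<Longrightarrow> V g \<cdot> \<rho> \<cdot> (Y \<triangleright> a g) = \<rho> \<cdot> (V g \<triangleleft> \<A>)"
    "\<And>g h. g \<in> carrier G \<Longrightarrow> h \<in> carrier G \<Longrightarrow> V (g \<otimes>\<^bsub>G\<^esub> h) = V g \<cdot> V h"
    and V_unitary: "\<And>g. g \<in> carrier G \<Longrightarrow> unitary_arr C (V g)"
    using assms(2) unfolding equivariant_def y by auto
  have unitary: "(V g)\<dagger> \<cdot> V g = ident C Y" if "g \<in> carrier G" for g
    using unitaryD(2)[OF V_unitary[OF that]] V(1)[OF that] by (simp add: Hom_iff)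
  have V1: "V \<one>\<^bsub>G\<^esub> \<in> Arr C" "source C (V \<one>\<^bsub>G\<^esub>) = Y" "target C (V \<one>\<^bsub>G\<^esub>) = Y"
    using V(1)[of "\<one>\<^bsub>G\<^esub>"] by (simp_all add: Hom_iff)
  have "(V \<one>\<^bsub>G\<^esub>)\<dagger> \<cdot> (V \<one>\<^bsub>G\<^esub> \<cdot> V \<one>\<^bsub>G\<^esub>) = (V \<one>\<^bsub>G\<^esub>)\<dagger> \<cdot> V \<one>\<^bsub>G\<^esub>"
    using V(3)[of "\<one>\<^bsub>G\<^esub>" "\<one>\<^bsub>G\<^esub>"] by simp
  then have one: "V \<one>\<^bsub>G\<^esub> = ident C Y"
    by (simp add: chain2[OF unitary] unitary V1)
  obtain X where X: "X \<in> Ob C" "iso_ob \<M> (free_module C A X) (Y, \<rho>)"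
    by (rule equivariant_imp_free[OF Y V one unitary])
  obtain z where z: "z \<in> right_modules C A" "iso_ob \<M> (tensor_ob \<M> (Y, \<rho>) z) (\<A>, \<mu>)"
    using assms(1) unfolding invertible_ob_def by (auto simp: Module_simps y)
  obtain Z \<tau> where [simp]: "z = (Z, \<tau>)" by (cases z) auto
  have "iso_ob \<M> (tensor_ob \<M> (Y, \<rho>) z) (wmod X z)"
    by (rule tensor_ob_free[OF M.iso_ob_sym[OF X(2)] z(1) X(1)])
  then have "iso_ob \<M> (wmod X z) (\<A>, \<mu>)"
    using M.iso_ob_trans[OF M.iso_ob_sym z(2)] by blast
  then obtain \<alpha> \<alpha>' where "inverse_arrs \<alpha> \<alpha>'" "\<alpha> \<in> module_maps C A (wmod X (Z, \<tau>)) (\<A>, \<mu>)"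
    unfolding module_iso_iff by auto
  then have "invertible_ob C X"
    using invertible_base[OF X(1)] z(1) by simp
  then show thesis using that X(2) y by simp
qed

text \<open>
  Since lifted modules are exactly the free modules on invertible objects, \<open>lift_group\<close> is the image of
  a group under a multiplicative map. Its group laws are inherited in this way.
\<close>

lemma lift_carrier: "carrier lift_group = free_map ` carrier (Inv C)"
proof
  show "carrier lift_group \<subseteq> free_map ` carrier (Inv C)"
  proof
    fix c assume "c \<in> carrier lift_group"
    then obtain y where y: "c = iso_class \<M> y" "invertible_ob \<M> y" "equivariant y"
      by (auto simp: lift_group_def)
    obtain X where X: "invertible_ob C X" "iso_ob \<M> (free_module C A X) y"
      by (rule lifted_is_free[OF y(2,3)])
    have "c = free_map (iso_class C X)"
      using M.iso_class_eqI[OF X(2)] y(1) free_map_class[OF invertible_Ob[OF X(1)]] by simp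
    then show "c \<in> free_map ` carrier (Inv C)" using X(1) Inv_carrier by blast
  qed
  show "free_map ` carrier (Inv C) \<subseteq> carrier lift_group"
  proof
    fix c assume "c \<in> free_map ` carrier (Inv C)"
    then obtain d where d: "d \<in> carrier (Inv C)" "c = free_map d" by blast
    obtain X where X: "invertible_ob C X" "d = iso_class C X" using d(1) unfolding Inv_carrier by blast
    have "c = iso_class \<M> (free_module C A X)" using free_map_class[OF invertible_Ob[OF X(1)]] d(2) X(2) by simp
    then show "c \<in> carrier lift_group"
      using free_invertible[OF X(1)] free_equivariant_structure[OF invertible_Ob[OF X(1)]]
      by (auto simp: lift_group_def simp del: split_paired_Ex)
  qed
qed

lemma lift_mult:
  assumes "X \<in> Ob C" "Y \<in> Ob C"
  shows "iso_class \<M> (free_module C A X) \<otimes>\<^bsub>lift_group\<^esub> iso_class \<M> (free_module C A Y)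
    = iso_class \<M> (free_module C A (X \<star> Y))"
proof -
  have "(\<Union>M\<in>iso_class \<M> (free_module C A X). \<Union>N\<in>iso_class \<M> (free_module C A Y). iso_class \<M> (tensor_ob \<M> M N))
      = iso_class \<M> (free_module C A (X \<star> Y))"
  proof (intro M.UN_iso_class)
    fix M N assume "iso_ob \<M> (free_module C A X) M" "iso_ob \<M> (free_module C A Y) N"
    then show "iso_class \<M> (tensor_ob \<M> M N) = iso_class \<M> (free_module C A (X \<star> Y))"
      by (rule M.iso_class_eqI[OF tensor_free_free[OF M.iso_ob_sym M.iso_ob_sym assms]])
  qed (use assms free_module in \<open>auto simp: Module_simps\<close>)
  then show ?thesis by (simp add: lift_group_def Inv_def)
qed

lemma lift_one: "\<one>\<^bsub>lift_group\<^esub> = iso_class \<M> (free_module C A (unit_ob C))"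
  using M.iso_class_eqI[OF free_module_unit] by (simp add: lift_group_def Inv_def Module_simps)

lemma free_map_mult:
  assumes "c \<in> carrier (Inv C)" "d \<in> carrier (Inv C)"
  shows "free_map (c \<otimes>\<^bsub>Inv C\<^esub> d) = free_map c \<otimes>\<^bsub>lift_group\<^esub> free_map d"
proof -
  obtain X Y where X: "c = iso_class C X" "invertible_ob C X" and Y: "d = iso_class C Y" "invertible_ob C Y"
    using assms unfolding Inv_carrier by blast
  show ?thesis
    using invertible_Ob[OF X(2)] invertible_Ob[OF Y(2)]
    by (simp add: X(1) Y(1) Inv_mult free_map_class lift_mult)
qed

lemma free_map_one: "free_map \<one>\<^bsub>Inv C\<^esub> = \<one>\<^bsub>lift_group\<^esub>"
  using free_map_class[of "unit_ob C"] by (simp add: lift_one Inv_def)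

lemma lift_group: "group lift_group"
proof -
  interpret I: group "Inv C" by (rule Inv_group)
  show ?thesis
  proof (rule groupI)
    show "\<one>\<^bsub>lift_group\<^esub> \<in> carrier lift_group"
      unfolding lift_carrier free_map_one[symmetric] by simp
  next
    fix x y assume "x \<in> carrier lift_group" "y \<in> carrier lift_group"
    then show "x \<otimes>\<^bsub>lift_group\<^esub> y \<in> carrier lift_group"
      unfolding lift_carrier by (auto simp flip: free_map_mult)
  next
    fix x y z assume "x \<in> carrier lift_group" "y \<in> carrier lift_group" "z \<in> carrier lift_group"
    then show "x \<otimes>\<^bsub>lift_group\<^esub> y \<otimes>\<^bsub>lift_group\<^esub> z = x \<otimes>\<^bsub>lift_group\<^esub> (y \<otimes>\<^bsub>lift_group\<^esub> z)"
      unfolding lift_carrier by (auto simp: I.m_assoc simp flip: free_map_mult)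
  next
    fix x assume "x \<in> carrier lift_group"
    then obtain c where c: "c \<in> carrier (Inv C)" "x = free_map c" unfolding lift_carrier by blast
    show "\<one>\<^bsub>lift_group\<^esub> \<otimes>\<^bsub>lift_group\<^esub> x = x"
      using c by (simp flip: free_map_mult free_map_one)
    have "free_map (inv\<^bsub>Inv C\<^esub> c) \<otimes>\<^bsub>lift_group\<^esub> x = \<one>\<^bsub>lift_group\<^esub>"
      using c by (simp flip: free_map_mult free_map_one)
    then show "\<exists>y\<in>carrier lift_group. y \<otimes>\<^bsub>lift_group\<^esub> x = \<one>\<^bsub>lift_group\<^esub>"
      unfolding lift_carrier using c by auto
  qed
qed

lemma free_map_epi: "free_map \<in> epi (Inv C) lift_group"
  by (auto simp: epi_def hom_def free_map_mult lift_carrier)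

lemma free_map_kernel:
  assumes "\<And>\<phi>. \<phi> \<in> carrier (dual_group G) \<Longrightarrow> invertible_ob C (L \<phi>)"
  shows "kernel (Inv C) lift_group free_map = (\<lambda>\<phi>. iso_class C (L \<phi>)) ` carrier (dual_group G)"
proof
  show "kernel (Inv C) lift_group free_map \<subseteq> (\<lambda>\<phi>. iso_class C (L \<phi>)) ` carrier (dual_group G)"
  proof
    fix c assume "c \<in> kernel (Inv C) lift_group free_map"
    then obtain X where X: "invertible_ob C X" "c = iso_class C X" "free_map c = \<one>\<^bsub>lift_group\<^esub>"
      unfolding kernel_def by (auto simp: Inv_carrier)
    note o = invertible_Ob[OF X(1)]
    have "iso_class \<M> (free_module C A X) = iso_class \<M> (\<A>, \<mu>)"
      using X(3) free_map_class[OF o] by (simp add: X(2) lift_group_def Inv_def Module_simps)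
    then have "iso_ob \<M> (free_module C A X) (\<A>, \<mu>)"
      using M.iso_class_eq_iff free_module[OF o] by (simp add: Module_simps)
    then obtain \<phi> where "\<phi> \<in> carrier (dual_group G)" "iso_ob C X (L \<phi>)"
      by (rule trivial_free_character[OF o])
    then show "c \<in> (\<lambda>\<phi>. iso_class C (L \<phi>)) ` carrier (dual_group G)"
      using iso_class_eqI X(2) by blast
  qed
  show "(\<lambda>\<phi>. iso_class C (L \<phi>)) ` carrier (dual_group G) \<subseteq> kernel (Inv C) lift_group free_map"
  proof
    fix c assume "c \<in> (\<lambda>\<phi>. iso_class C (L \<phi>)) ` carrier (dual_group G)"
    then obtain \<phi> where \<phi>: "\<phi> \<in> carrier (dual_group G)" "c = iso_class C (L \<phi>)" by blast
    have "free_map c = iso_class \<M> (\<A>, \<mu>)"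
      using M.iso_class_eqI[OF character_free[OF \<phi>(1)]] free_map_class[OF w_simps(4)[OF \<phi>(1)]] \<phi>(2) by simp
    then have "free_map c = \<one>\<^bsub>lift_group\<^esub>" by (simp add: lift_group_def Inv_def Module_simps)
    then show "c \<in> kernel (Inv C) lift_group free_map"
      using assms[OF \<phi>(1)] \<phi>(2) by (auto simp: kernel_def Inv_carrier)
  qed
qed

end


section \<open>Kronecker products and column maps\<close>

lemma mult_add_bound: assumes "i < m" "j < (n::nat)" shows "i * n + j < m * n"
proof -
  have "i * n + j < Suc i * n" using assms(2) by simp
  also have "\<dots> \<le> m * n" using assms(1) by (intro mult_le_mono1) simp
  finally show ?thesis .
qed

text \<open>
  Indices of a Kronecker product are decoded by quotient and remainder.
\<close>

lemma eq_mult_add_iff: "y < (n::nat) \<Longrightarrow> k = x * n + y \<longleftrightarrow> k div n = x \<and> k mod n = y"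
  using div_mult_mod_eq[of k n] by auto

lemma div_mod_less:
  fixes i m n :: nat assumes "i < m * n" shows "i div n < m" "i mod n < n"
  using assms by (cases "n = 0"; simp add: less_mult_imp_div_less)+

lemma sum_div_mod:
  fixes f :: "nat \<Rightarrow> nat \<Rightarrow> 'a::comm_monoid_add"
  shows "(\<Sum>k<m * n. f (k div n) (k mod n)) = (\<Sum>x<m. \<Sum>y<n. f x y)"
proof -
  have "(\<Sum>k<m * n. f (k div n) (k mod n)) = (\<Sum>(x, y)\<in>{..<m} \<times> {..<n}. f x y)"
    by (rule sum.reindex_bij_witness[where j = "\<lambda>k. (k div n, k mod n)" and i = "\<lambda>(x, y). x * n + y"])
      (auto simp: div_mod_less mult_add_bound)
  then show ?thesis by (simp add: sum.cartesian_product)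
qed

lemma mat_adjoint_dim [simp]: "dim_row (mat_adjoint A) = dim_col A" "dim_col (mat_adjoint A) = dim_row A"
  by (simp_all add: mat_adjoint_def)

lemma mat_adjoint_index [simp]:
  fixes A :: "complex mat"
  shows "i < dim_col A \<Longrightarrow> j < dim_row A \<Longrightarrow> mat_adjoint A $$ (i, j) = cnj (A $$ (j, i))"
  by (simp add: mat_adjoint_def mat_of_rows_index conjugate_complex_def)

lemma mat_adjoint_adjoint [simp]: fixes A :: "complex mat" shows "mat_adjoint (mat_adjoint A) = A"
  by (rule eq_matI) simp_all

lemma mat_adjoint_mult:
  fixes A B :: "complex mat"
  assumes "dim_col A = dim_row B"
  shows "mat_adjoint (A * B) = mat_adjoint B * mat_adjoint A"
  by (rule eq_matI) (use assms in \<open>auto simp: scalar_prod_def mult.commute\<close>)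

lemma mat_adjoint_one [simp]: "mat_adjoint (1\<^sub>m n :: complex mat) = 1\<^sub>m n"
  by (rule eq_matI) auto

lemma kron_dim [simp]: "dim_row (kron A B) = dim_row A * dim_row B" "dim_col (kron A B) = dim_col A * dim_col B"
  by (simp_all add: kron_def)

lemma kron_index [simp]:
  "i < dim_row A * dim_row B \<Longrightarrow> j < dim_col A * dim_col B \<Longrightarrow> kron A B $$ (i, j)
    = A $$ (i div dim_row B, j div dim_col B) * B $$ (i mod dim_row B, j mod dim_col B)"
  by (simp add: kron_def)

lemma kron_adjoint: "mat_adjoint (kron A B) = kron (mat_adjoint A) (mat_adjoint B)"
  by (rule eq_matI) (auto simp: div_mod_less)

lemma kron_mult:
  assumes "dim_col A = dim_row C" "dim_col B = dim_row D"
  shows "kron A B * kron C D = kron (A * C) (B * D)"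
proof (rule eq_matI)
  fix i j assume "i < dim_row (kron (A * C) (B * D))" "j < dim_col (kron (A * C) (B * D))"
  then have i: "i < dim_row A * dim_row B" and j: "j < dim_col C * dim_col D" by simp_all
  have "(kron A B * kron C D) $$ (i, j) = (\<Sum>k<dim_row C * dim_row D.
      A $$ (i div dim_row B, k div dim_row D) * B $$ (i mod dim_row B, k mod dim_row D)
      * (C $$ (k div dim_row D, j div dim_col D) * D $$ (k mod dim_row D, j mod dim_col D)))"
    using i j assms by (simp add: scalar_prod_def atLeast0LessThan)
  also have "\<dots> = (\<Sum>x<dim_row C. \<Sum>y<dim_row D. A $$ (i div dim_row B, x) * B $$ (i mod dim_row B, y)
      * (C $$ (x, j div dim_col D) * D $$ (y, j mod dim_col D)))"
    by (rule sum_div_mod)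
  also have "\<dots> = (\<Sum>x<dim_row C. A $$ (i div dim_row B, x) * C $$ (x, j div dim_col D))
      * (\<Sum>y<dim_row D. B $$ (i mod dim_row B, y) * D $$ (y, j mod dim_col D))"
    by (simp add: sum_product mult_ac)
  also have "\<dots> = kron (A * C) (B * D) $$ (i, j)"
    using i j assms div_mod_less[OF i] div_mod_less[OF j] by (simp add: scalar_prod_def atLeast0LessThan)
  finally show "(kron A B * kron C D) $$ (i, j) = kron (A * C) (B * D) $$ (i, j)" .
qed simp_all

lemma div_mod_swap: "(i::nat) div c mod b = i mod (b * c) div c"
  by (cases "c = 0") (simp_all only: mult.commute[of b] mod_mult2_eq, simp_all)

lemma kron_assoc: "kron (kron A B) C = kron A (kron B C)"
proof (rule eq_matI)
  fix i j assume "i < dim_row (kron A (kron B C))" "j < dim_col (kron A (kron B C))"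
  then have i: "i < dim_row A * (dim_row B * dim_row C)" and j: "j < dim_col A * (dim_col B * dim_col C)"
    by simp_all
  have i': "i < dim_row A * dim_row B * dim_row C" "j < dim_col A * dim_col B * dim_col C"
    using i j by (simp_all add: mult.assoc)
  note d = div_mod_less[OF i] div_mod_less[OF j] div_mod_less[OF i'(1)] div_mod_less[OF i'(2)]
  have 1: "i div dim_row C div dim_row B = i div (dim_row B * dim_row C)"
    "j div dim_col C div dim_col B = j div (dim_col B * dim_col C)"
    by (simp_all only: mult.commute[of "dim_row B"] mult.commute[of "dim_col B"] div_mult2_eq)
  have 2: "i div dim_row C mod dim_row B = i mod (dim_row B * dim_row C) div dim_row C"
    "j div dim_col C mod dim_col B = j mod (dim_col B * dim_col C) div dim_col C"
    by (rule div_mod_swap)+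
  have 3: "i mod (dim_row B * dim_row C) mod dim_row C = i mod dim_row C"
    "j mod (dim_col B * dim_col C) mod dim_col C = j mod dim_col C"
    by (simp_all add: mod_mod_cancel)
  show "kron (kron A B) C $$ (i, j) = kron A (kron B C) $$ (i, j)"
    using i j i' d by (simp add: 1 2 3 mult.assoc)
qed (simp_all add: mult.assoc)

lemma kron_one: "kron (1\<^sub>m m) (1\<^sub>m n) = 1\<^sub>m (m * n)"
proof (rule eq_matI)
  fix i j assume "i < dim_row (1\<^sub>m (m * n) :: complex mat)" "j < dim_col (1\<^sub>m (m * n) :: complex mat)"
  then have i: "i < m * n" and j: "j < m * n" by simp_all
  have "i = j \<longleftrightarrow> i div n = j div n \<and> i mod n = j mod n" by (metis div_mult_mod_eq)
  then show "kron (1\<^sub>m m) (1\<^sub>m n) $$ (i, j) = 1\<^sub>m (m * n) $$ (i, j)"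
    using i j div_mod_less[OF i] div_mod_less[OF j] by auto
qed simp_all

lemma kron_one_left: "kron (1\<^sub>m 1) A = A"
  by (rule eq_matI) auto

lemma kron_one_right: "kron A (1\<^sub>m 1) = A"
  by (rule eq_matI) auto

lemma flip_kron:
  assumes "S \<in> carrier_mat m m" "T \<in> carrier_mat n n"
  shows "flip_mat m n * kron S T = kron T S * flip_mat m n"
proof (rule eq_matI)
  fix i j assume "i < dim_row (kron T S * flip_mat m n)" "j < dim_col (kron T S * flip_mat m n)"
  then have i: "i < n * m" and j: "j < m * n" using assms by (simp_all add: flip_mat_def)
  note d = div_mod_less[OF i] div_mod_less[OF j]
  have S: "dim_row S = m" "dim_col S = m" "dim_row T = n" "dim_col T = n" using assms by auto
  have k1: "i mod m * n + i div m < m * n" using d by (intro mult_add_bound)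
  have k2: "j mod n * m + j div n < n * m" using d by (intro mult_add_bound)
  have "(flip_mat m n * kron S T) $$ (i, j) = (\<Sum>k<m * n. (if k = i mod m * n + i div m then 1 else 0) * kron S T $$ (k, j))"
  proof -
    have "i div m = k mod n \<and> i mod m = k div n \<longleftrightarrow> k = i mod m * n + i div m" if "k < m * n" for k
      using d eq_mult_add_iff by metis
    then show ?thesis
      using i j S by (auto simp: flip_mat_def scalar_prod_def atLeast0LessThan intro!: sum.cong)
  qed
  also have "\<dots> = kron S T $$ (i mod m * n + i div m, j)" using k1 by (simp add: if_distrib[of "\<lambda>x. x * _"] cong: if_cong)
  also have "\<dots> = S $$ (i mod m, j div n) * T $$ (i div m, j mod n)"
    using k1 j S d by simp
  finally have 1: "(flip_mat m n * kron S T) $$ (i, j) = S $$ (i mod m, j div n) * T $$ (i div m, j mod n)" .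
  have "(kron T S * flip_mat m n) $$ (i, j) = (\<Sum>k<n * m. kron T S $$ (i, k) * (if k = j mod n * m + j div n then 1 else 0))"
  proof -
    have "k div m = j mod n \<and> k mod m = j div n \<longleftrightarrow> k = j mod n * m + j div n" if "k < n * m" for k
      using d eq_mult_add_iff by metis
    then show ?thesis
      using i j S by (auto simp: flip_mat_def scalar_prod_def atLeast0LessThan intro!: sum.cong)
  qed
  also have "\<dots> = kron T S $$ (i, j mod n * m + j div n)" using k2 by (simp add: if_distrib[of "\<lambda>x. _ * x"] cong: if_cong)
  also have "\<dots> = T $$ (i div m, j mod n) * S $$ (i mod m, j div n)"
    using k2 i S d by simp
  finally show "(flip_mat m n * kron S T) $$ (i, j) = (kron T S * flip_mat m n) $$ (i, j)"
    using 1 by simp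
qed (use assms in \<open>auto simp: flip_mat_def\<close>)

text \<open>
  The matrix that sends the basis vector \<open>j\<close> to the basis vector \<open>f j\<close>. All structure maps of \<open>Fun(G)\<close>
  are such matrices or adjoints of such matrices, so that their identities reduce to identities between
  functions on indices.
\<close>

definition fmat :: "nat \<Rightarrow> nat \<Rightarrow> (nat \<Rightarrow> nat) \<Rightarrow> complex mat" where
  "fmat r c f = mat r c (\<lambda>(i, j). if i = f j then 1 else 0)"

lemma fmat_dim [simp]: "dim_row (fmat r c f) = r" "dim_col (fmat r c f) = c" "fmat r c f \<in> carrier_mat r c"
  by (simp_all add: fmat_def)

lemma fmat_index [simp]: "i < r \<Longrightarrow> j < c \<Longrightarrow> fmat r c f $$ (i, j) = (if i = f j then 1 else 0)"
  by (simp add: fmat_def)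

lemma fmat_cong: "(\<And>j. j < c \<Longrightarrow> f j = g j) \<Longrightarrow> fmat r c f = fmat r c g"
  by (rule eq_matI) auto

lemma fmat_one: "1\<^sub>m n = fmat n n (\<lambda>j. j)"
  by (rule eq_matI) auto

lemma mult_fmat_index:
  assumes "i < dim_row A" "j < c" "f j < dim_col A" "dim_col A = r"
  shows "(A * fmat r c f) $$ (i, j) = A $$ (i, f j)"
proof -
  have "(A * fmat r c f) $$ (i, j) = (\<Sum>k<r. A $$ (i, k) * (if k = f j then 1 else 0))"
    using assms by (simp add: scalar_prod_def atLeast0LessThan)
  also have "\<dots> = A $$ (i, f j)" using assms by (simp add: if_distrib[of "\<lambda>x. _ * x"] cong: if_cong)
  finally show ?thesis .
qed

lemma fmat_mult:
  assumes "\<And>j. j < c \<Longrightarrow> h j < k"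
  shows "fmat r k f * fmat k c h = fmat r c (\<lambda>j. f (h j))"
  by (rule eq_matI) (auto simp: mult_fmat_index assms simp del: index_mult_mat(1))

lemma fmat_kron:
  assumes "\<And>j. j < c' \<Longrightarrow> f' j < r'"
  shows "kron (fmat r c f) (fmat r' c' f') = fmat (r * r') (c * c') (\<lambda>j. f (j div c') * r' + f' (j mod c'))"
proof (rule eq_matI)
  fix i j assume "i < dim_row (fmat (r * r') (c * c') (\<lambda>j. f (j div c') * r' + f' (j mod c')))"
    "j < dim_col (fmat (r * r') (c * c') (\<lambda>j. f (j div c') * r' + f' (j mod c')))"
  then have i: "i < r * r'" and j: "j < c * c'" by simp_all
  note d = div_mod_less[OF i] div_mod_less[OF j]
  have "i = f (j div c') * r' + f' (j mod c') \<longleftrightarrow> i div r' = f (j div c') \<and> i mod r' = f' (j mod c')"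
  proof
    assume "i = f (j div c') * r' + f' (j mod c')"
    then show "i div r' = f (j div c') \<and> i mod r' = f' (j mod c')" using assms[OF d(4)] by simp
  next
    assume "i div r' = f (j div c') \<and> i mod r' = f' (j mod c')"
    then show "i = f (j div c') * r' + f' (j mod c')" by (metis div_mult_mod_eq)
  qed
  then show "kron (fmat r c f) (fmat r' c' f') $$ (i, j) = fmat (r * r') (c * c') (\<lambda>j. f (j div c') * r' + f' (j mod c')) $$ (i, j)"
    using i j d by auto
qed simp_all

lemma adjoint_fmat_mult:
  assumes "\<And>j. j < c' \<Longrightarrow> h j < r"
  shows "mat_adjoint (fmat r c f) * fmat r c' h = mat c c' (\<lambda>(i, j). if f i = h j then 1 else 0)"
  by (rule eq_matI) (auto simp: mult_fmat_index assms simp del: index_mult_mat(1))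

lemma adjoint_fmat:
  assumes "\<And>i j. i < n \<Longrightarrow> j < n \<Longrightarrow> i = f j \<longleftrightarrow> j = g i"
  shows "mat_adjoint (fmat n n f) = fmat n n g"
  by (rule eq_matI) (use assms in auto)


section \<open>The function algebra in the category of representations\<close>

lemma Rep_simps:
  "Ob (Rep G) = ureps G" "source (Rep G) (V, T, W) = V" "target (Rep G) (V, T, W) = W"
  "ident (Rep G) V = (V, 1\<^sub>m (fst V), V)" "cmp (Rep G) (W, S, X) (V, T, W') = (V, S * T, X)"
  "tensor_ob (Rep G) = urep_tensor G" "unit_ob (Rep G) = urep_unit G"
  "zero_arr (Rep G) V W = (V, 0\<^sub>m (fst W) (fst V), W)"
  "add_arr (Rep G) (V, S, W) (V', T, W') = (V, S + T, W)"
  "scale_arr (Rep G) c (V, T, W) = (V, c \<cdot>\<^sub>m T, W)"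
  "adj (Rep G) (V, T, W) = (W, mat_adjoint T, V)"
  "tensor_arr (Rep G) (V, S, W) (V', T, W') = (urep_tensor G V V', kron S T, urep_tensor G W W')"
  "assr (Rep G) U V W = (urep_tensor G (urep_tensor G U V) W, 1\<^sub>m (fst U * fst V * fst W),
     urep_tensor G U (urep_tensor G V W))"
  "lunit (Rep G) V = (urep_tensor G (urep_unit G) V, 1\<^sub>m (fst V), V)"
  "runit (Rep G) V = (urep_tensor G V (urep_unit G), 1\<^sub>m (fst V), V)"
  "braid (Rep G) V W = (urep_tensor G V W, flip_mat (fst V) (fst W), urep_tensor G W V)"
  by (simp_all add: Rep_def)

lemma Rep_Hom: "f \<in> Hom (Rep G) V W \<longleftrightarrow>
    V \<in> ureps G \<and> W \<in> ureps G \<and> (\<exists>T\<in>intertwiners G V W. f = (V, T, W))"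
  by (auto simp: Hom_def Rep_def)

lemma Rep_HomI: "V \<in> ureps G \<Longrightarrow> W \<in> ureps G \<Longrightarrow> T \<in> carrier_mat (fst W) (fst V) \<Longrightarrow>
    (\<And>g. g \<in> carrier G \<Longrightarrow> T * snd V g = snd W g * T) \<Longrightarrow> (V, T, W) \<in> Hom (Rep G) V W"
  by (auto simp: Rep_Hom intertwiners_def)

lemma urepsD:
  assumes "V \<in> ureps G" "g \<in> carrier G"
  shows "snd V g \<in> carrier_mat (fst V) (fst V)" "mat_adjoint (snd V g) * snd V g = 1\<^sub>m (fst V)"
    "snd V g * mat_adjoint (snd V g) = 1\<^sub>m (fst V)"
    "h \<in> carrier G \<Longrightarrow> snd V (g \<otimes>\<^bsub>G\<^esub> h) = snd V g * snd V h"
proof -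
  show 1: "snd V g \<in> carrier_mat (fst V) (fst V)" and 2: "mat_adjoint (snd V g) * snd V g = 1\<^sub>m (fst V)"
    and "h \<in> carrier G \<Longrightarrow> snd V (g \<otimes>\<^bsub>G\<^esub> h) = snd V g * snd V h"
    using assms by (auto simp: ureps_def)
  show "snd V g * mat_adjoint (snd V g) = 1\<^sub>m (fst V)"
    by (rule mat_mult_left_right_inverse[OF _ 1 2]) (use 1 in auto)
qed

lemma urepsI:
  assumes "snd V \<in> extensional (carrier G)"
    "\<And>g. g \<in> carrier G \<Longrightarrow> snd V g \<in> carrier_mat (fst V) (fst V)"
    "\<And>g. g \<in> carrier G \<Longrightarrow> mat_adjoint (snd V g) * snd V g = 1\<^sub>m (fst V)"
    "\<And>g h. g \<in> carrier G \<Longrightarrow> h \<in> carrier G \<Longrightarrow> snd V (g \<otimes>\<^bsub>G\<^esub> h) = snd V g * snd V h"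
  shows "V \<in> ureps G"
  using assms by (cases V) (auto simp: ureps_def)

lemma urep_tensor_assoc: "urep_tensor G (urep_tensor G U V) W = urep_tensor G U (urep_tensor G V W)"
  by (auto simp: urep_tensor_def kron_assoc mult.assoc fun_eq_iff restrict_def)

lemma urep_tensor_unit:
  assumes "V \<in> ureps G" shows "urep_tensor G (urep_unit G) V = V" "urep_tensor G V (urep_unit G) = V"
proof -
  obtain n \<pi> where V: "V = (n, \<pi>)" "\<pi> \<in> extensional (carrier G)" using assms by (auto simp: ureps_def)
  have "(\<lambda>g\<in>carrier G. \<pi> g) = \<pi>" by (rule extensional_restrict[OF V(2)])
  then show "urep_tensor G (urep_unit G) V = V" "urep_tensor G V (urep_unit G) = V"
    by (simp_all add: urep_tensor_def urep_unit_def V(1) kron_one_left[unfolded One_nat_def]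
        kron_one_right[unfolded One_nat_def] cong: restrict_cong)
qed

context group
begin

lemma urep_tensor_closed:
  assumes "V \<in> ureps G" "W \<in> ureps G" shows "urep_tensor G V W \<in> ureps G"
proof (rule urepsI)
  fix g assume g: "g \<in> carrier G"
  note V = urepsD[OF assms(1) g] and W = urepsD[OF assms(2) g]
  show "snd (urep_tensor G V W) g \<in> carrier_mat (fst (urep_tensor G V W)) (fst (urep_tensor G V W))"
    using V(1) W(1) g by (auto simp: urep_tensor_def)
  show "mat_adjoint (snd (urep_tensor G V W) g) * snd (urep_tensor G V W) g = 1\<^sub>m (fst (urep_tensor G V W))"
    using V W g by (simp add: urep_tensor_def kron_adjoint kron_mult kron_one)
  fix h assume h: "h \<in> carrier G"
  show "snd (urep_tensor G V W) (g \<otimes> h) = snd (urep_tensor G V W) g * snd (urep_tensor G V W) h"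
    using V W urepsD(1)[OF assms(1) h] urepsD(1)[OF assms(2) h] g h
    by (auto simp: urep_tensor_def kron_mult)
qed (simp add: urep_tensor_def)

lemma urep_unit_closed: "urep_unit G \<in> ureps G"
  by (rule urepsI) (auto simp: urep_unit_def)

lemma Rep_ident: "V \<in> ureps G \<Longrightarrow> ident (Rep G) V \<in> Hom (Rep G) V V"
  unfolding Rep_simps
proof (rule Rep_HomI)
  fix g assume "V \<in> ureps G" "g \<in> carrier G"
  from urepsD(1)[OF this] show "1\<^sub>m (fst V) * snd V g = snd V g * 1\<^sub>m (fst V)" by simp
qed simp_all

lemma Rep_cmp:
  assumes "(V, T, W) \<in> Hom (Rep G) V W" "(W, S, X) \<in> Hom (Rep G) W X"
  shows "(V, S * T, X) \<in> Hom (Rep G) V X"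
proof (rule Rep_HomI)
  have T: "T \<in> intertwiners G V W" "V \<in> ureps G" "W \<in> ureps G" and S: "S \<in> intertwiners G W X" "X \<in> ureps G"
    using assms by (auto simp: Rep_Hom)
  then show "V \<in> ureps G" "X \<in> ureps G" "S * T \<in> carrier_mat (fst X) (fst V)" by (auto simp: intertwiners_def)
  fix g assume g: "g \<in> carrier G"
  have c: "T \<in> carrier_mat (fst W) (fst V)" "S \<in> carrier_mat (fst X) (fst W)" "snd V g \<in> carrier_mat (fst V) (fst V)"
    "snd W g \<in> carrier_mat (fst W) (fst W)" "snd X g \<in> carrier_mat (fst X) (fst X)"
    using S T urepsD(1)[OF _ g] by (auto simp: intertwiners_def)
  have e: "T * snd V g = snd W g * T" "S * snd W g = snd X g * S" using S T g by (auto simp: intertwiners_def)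
  have "S * T * snd V g = S * (T * snd V g)" using c by (intro assoc_mult_mat)
  also have "\<dots> = S * snd W g * T" unfolding e(1) using c by (intro assoc_mult_mat[symmetric])
  also have "\<dots> = snd X g * (S * T)" unfolding e(2) using c by (intro assoc_mult_mat)
  finally show "S * T * snd V g = snd X g * (S * T)" .
qed

lemma Rep_adj:
  assumes "(V, T, W) \<in> Hom (Rep G) V W" shows "(W, mat_adjoint T, V) \<in> Hom (Rep G) W V"
proof (rule Rep_HomI)
  have T: "T \<in> intertwiners G V W" "V \<in> ureps G" "W \<in> ureps G"
    using assms by (auto simp: Rep_Hom)
  then show "W \<in> ureps G" "V \<in> ureps G" "mat_adjoint T \<in> carrier_mat (fst V) (fst W)"
    by (auto simp: intertwiners_def)
  fix g assume g: "g \<in> carrier G"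
  note V = urepsD[OF T(2) g] and W = urepsD[OF T(3) g]
  have c: "T \<in> carrier_mat (fst W) (fst V)" "mat_adjoint T \<in> carrier_mat (fst V) (fst W)"
    "mat_adjoint (snd V g) \<in> carrier_mat (fst V) (fst V)" "mat_adjoint (snd W g) \<in> carrier_mat (fst W) (fst W)"
    using T V W by (auto simp: intertwiners_def)
  have "T * snd V g = snd W g * T" using T g by (auto simp: intertwiners_def)
  then have "mat_adjoint (T * snd V g) = mat_adjoint (snd W g * T)" by simp
  then have e: "mat_adjoint (snd V g) * mat_adjoint T = mat_adjoint T * mat_adjoint (snd W g)"
    using c V W by (simp add: mat_adjoint_mult)
  have "mat_adjoint T * snd W g = snd V g * mat_adjoint (snd V g) * mat_adjoint T * snd W g"
    using V(3) c by simp
  also have "\<dots> = snd V g * (mat_adjoint (snd V g) * mat_adjoint T) * snd W g"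
    using c V(1) by (simp add: assoc_mult_mat[of _ "fst V" "fst V" _ "fst V" _ "fst W"])
  also have "\<dots> = snd V g * (mat_adjoint T * (mat_adjoint (snd W g) * snd W g))"
    unfolding e using c V(1) W(1)
    by (simp add: assoc_mult_mat[of "snd V g" "fst V" "fst V" "mat_adjoint T * mat_adjoint (snd W g)" "fst W" "snd W g" "fst W"]
      assoc_mult_mat[of "mat_adjoint T" "fst V" "fst W" "mat_adjoint (snd W g)" "fst W" "snd W g" "fst W"])
  also have "\<dots> = snd V g * mat_adjoint T" using W(2) c by simp
  finally show "mat_adjoint T * snd W g = snd V g * mat_adjoint T" .
qed

lemma Rep_tensor:
  assumes "(V, T, W) \<in> Hom (Rep G) V W" "(V', T', W') \<in> Hom (Rep G) V' W'"
  shows "(urep_tensor G V V', kron T T', urep_tensor G W W')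
    \<in> Hom (Rep G) (urep_tensor G V V') (urep_tensor G W W')"
proof (rule Rep_HomI)
  have T: "T \<in> intertwiners G V W" "V \<in> ureps G" "W \<in> ureps G"
    and T': "T' \<in> intertwiners G V' W'" "V' \<in> ureps G" "W' \<in> ureps G"
    using assms by (auto simp: Rep_Hom)
  then show "urep_tensor G V V' \<in> ureps G" "urep_tensor G W W' \<in> ureps G"
    "kron T T' \<in> carrier_mat (fst (urep_tensor G W W')) (fst (urep_tensor G V V'))"
    using urep_tensor_closed by (auto simp: intertwiners_def urep_tensor_def)
  fix g assume g: "g \<in> carrier G"
  note V = urepsD(1)[OF T(2) g] urepsD(1)[OF T(3) g] urepsD(1)[OF T'(2) g] urepsD(1)[OF T'(3) g]
  have "T * snd V g = snd W g * T" "T' * snd V' g = snd W' g * T'" "T \<in> carrier_mat (fst W) (fst V)"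
    "T' \<in> carrier_mat (fst W') (fst V')" using T T' g by (auto simp: intertwiners_def)
  then show "kron T T' * snd (urep_tensor G V V') g = snd (urep_tensor G W W') g * kron T T'"
    using V g by (auto simp: urep_tensor_def kron_mult)
qed

lemma Rep_braid:
  assumes "V \<in> ureps G" "W \<in> ureps G"
  shows "braid (Rep G) V W \<in> Hom (Rep G) (urep_tensor G V W) (urep_tensor G W V)"
  unfolding Rep_simps
proof (rule Rep_HomI)
  show "urep_tensor G V W \<in> ureps G" "urep_tensor G W V \<in> ureps G" using assms urep_tensor_closed by auto
  show "flip_mat (fst V) (fst W) \<in> carrier_mat (fst (urep_tensor G W V)) (fst (urep_tensor G V W))"
    by (simp add: flip_mat_def urep_tensor_def)
  fix g assume g: "g \<in> carrier G"
  show "flip_mat (fst V) (fst W) * snd (urep_tensor G V W) g = snd (urep_tensor G W V) g * flip_mat (fst V) (fst W)"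
    using flip_kron[OF urepsD(1)[OF assms(1) g] urepsD(1)[OF assms(2) g]] g by (simp add: urep_tensor_def)
qed

lemma character_rep_closed:
  assumes \<phi>: "\<phi> \<in> carrier (dual_group G)" shows "character_rep G \<phi> \<in> ureps G"
proof (rule urepsI)
  fix g assume g: "g \<in> carrier G"
  show "mat_adjoint (snd (character_rep G \<phi>) g) * snd (character_rep G \<phi>) g = 1\<^sub>m (fst (character_rep G \<phi>))"
    by (rule eq_matI) (use g dual_groupD(2)[OF \<phi> g] in \<open>auto simp: character_rep_def scalar_prod_def\<close>)
  fix h assume h: "h \<in> carrier G"
  show "snd (character_rep G \<phi>) (g \<otimes> h) = snd (character_rep G \<phi>) g * snd (character_rep G \<phi>) h"
    by (rule eq_matI) (use g h dual_groupD(3)[OF \<phi> g h] in \<open>auto simp: character_rep_def scalar_prod_def\<close>)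
qed (auto simp: character_rep_def)

lemma character_rep_mult:
  "urep_tensor G (character_rep G \<phi>) (character_rep G \<psi>) = character_rep G (\<lambda>g\<in>carrier G. \<phi> g * \<psi> g)"
  by (auto simp: urep_tensor_def character_rep_def kron_def fun_eq_iff restrict_def intro!: eq_matI)

lemma character_rep_one: "character_rep G (\<lambda>g\<in>carrier G. 1) = urep_unit G"
  by (auto simp: urep_unit_def character_rep_def fun_eq_iff restrict_def intro!: eq_matI)

end

locale finite_group = group G for G :: "('g, 'b) monoid_scheme" (structure) +
  assumes finite_carrier: "finite (carrier G)"
begin

abbreviation N where "N \<equiv> card (carrier G)"
abbreviation e where "e \<equiv> from_nat_into (carrier G)"
text \<open>
  The number of a group element. The representation \<open>Fun(G)\<close> has one basis vector for every element,
  numbered by \<open>e\<close>; \<open>lperm\<close> and \<open>rperm\<close> are left and right translation on these numbers.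
\<close>

definition ix where "ix g = inv_into {..<N} e g"
abbreviation lperm where "lperm g j \<equiv> ix (g \<otimes> e j)"
abbreviation rperm where "rperm g j \<equiv> ix (e j \<otimes> g)"

lemma e_bij: "bij_betw e {..<N} (carrier G)"
  by (rule bij_betw_from_nat_into_finite[OF finite_carrier])

lemma N_pos: "N > 0"
  using finite_carrier one_closed by (auto simp: card_gt_0_iff)

lemma e_closed [simp]: "i < N \<Longrightarrow> e i \<in> carrier G"
  using e_bij by (auto simp: bij_betw_def)

lemma ix_less [simp]: "g \<in> carrier G \<Longrightarrow> ix g < N"
  unfolding ix_def using e_bij inv_into_into[of g e "{..<N}"] by (simp add: bij_betw_def)

lemma e_ix [simp]: "g \<in> carrier G \<Longrightarrow> e (ix g) = g"
  unfolding ix_def using e_bij by (simp add: bij_betw_def f_inv_into_f)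

lemma ix_e [simp]: "i < N \<Longrightarrow> ix (e i) = i"
  unfolding ix_def using e_bij by (simp add: bij_betw_def inv_into_f_f)

lemma e_eq_iff: "i < N \<Longrightarrow> g \<in> carrier G \<Longrightarrow> e i = g \<longleftrightarrow> i = ix g"
  by auto

abbreviation fn where "fn \<equiv> fun_ob G"

lemma fun_ob_fmat: "fun_ob G = (N, \<lambda>g\<in>carrier G. fmat N N (lperm g))"
  unfolding fun_ob_def by (auto simp: fun_eq_iff restrict_def e_eq_iff intro!: eq_matI)

lemma fun_aut_fmat: "g \<in> carrier G \<Longrightarrow> fun_aut G g = (fn, fmat N N (rperm g), fn)"
  unfolding fun_aut_def by (auto simp: e_eq_iff intro!: eq_matI)

lemma fn_simps [simp]: "fst fn = N" "g \<in> carrier G \<Longrightarrow> snd fn g = fmat N N (lperm g)"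
  by (simp_all add: fun_ob_fmat)

lemma adjoint_lperm: "g \<in> carrier G \<Longrightarrow> mat_adjoint (fmat N N (lperm g)) = fmat N N (lperm (inv g))"
  by (rule adjoint_fmat) (auto simp: m_assoc[symmetric])

lemma adjoint_rperm: "g \<in> carrier G \<Longrightarrow> mat_adjoint (fmat N N (rperm g)) = fmat N N (rperm (inv g))"
  by (rule adjoint_fmat) (auto simp: m_assoc)

lemma fn_closed: "fn \<in> ureps G"
proof (rule urepsI)
  fix g assume g: "g \<in> carrier G"
  show "mat_adjoint (snd fn g) * snd fn g = 1\<^sub>m (fst fn)"
    using g by (simp add: adjoint_lperm fmat_mult fmat_one m_assoc[symmetric] cong: fmat_cong)
  fix h assume h: "h \<in> carrier G"
  show "snd fn (g \<otimes> h) = snd fn g * snd fn h"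
    using g h by (simp add: fmat_mult m_assoc cong: fmat_cong)
qed (auto simp: fun_ob_fmat)

abbreviation fn2 where "fn2 \<equiv> urep_tensor G fn fn"

lemma fn2_simps [simp]: "fst fn2 = N * N"
  "g \<in> carrier G \<Longrightarrow> snd fn2 g = fmat (N * N) (N * N) (\<lambda>j. lperm g (j div N) * N + lperm g (j mod N))"
  by (simp_all add: urep_tensor_def fmat_kron)

text \<open>
  The comultiplication \<open>\<delta>\<^sub>g \<mapsto> \<delta>\<^sub>g \<otimes> \<delta>\<^sub>g\<close> and the counit \<open>\<delta>\<^sub>g \<mapsto> 1\<close>. The multiplication and the unit of \<open>Fun(G)\<close>
  are their adjoints. These two are column maps, which makes them easier to compute with.
\<close>

definition dm where "dm = fmat (N * N) N (\<lambda>i. i * N + i)"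
definition em where "em = fmat 1 N (\<lambda>_. 0)"

lemma dm_bound [simp]: "i < N \<Longrightarrow> i * N + i < N * N"
  by (rule mult_add_bound)

lemma dm_Hom: "(fn, dm, fn2) \<in> Hom (Rep G) fn fn2"
  by (rule Rep_HomI)
    (auto simp: fn_closed urep_tensor_closed dm_def fmat_mult intro!: fmat_cong)

lemma em_Hom: "(fn, em, urep_unit G) \<in> Hom (Rep G) fn (urep_unit G)"
proof (rule Rep_HomI)
  fix g assume "g \<in> carrier G"
  then show "em * snd fn g = snd (urep_unit G) g * em"
    by (simp add: em_def fmat_mult urep_unit_def left_mult_one_mat[unfolded One_nat_def])
qed (simp_all add: fn_closed urep_unit_closed, simp_all add: em_def urep_unit_def)

lemma fun_alg_eq: "alg_ob (fun_alg G) = fn" "alg_mult (fun_alg G) = (fn2, mat_adjoint dm, fn)"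
  "alg_unit (fun_alg G) = (urep_unit G, mat_adjoint em, fn)"
proof -
  show "alg_ob (fun_alg G) = fn" by (simp add: fun_alg_def Let_def)
  have "mat N (N * N) (\<lambda>(i, j). if i = j div N \<and> i = j mod N then 1 else 0) = mat_adjoint dm"
    by (rule eq_matI) (auto simp: dm_def eq_mult_add_iff)
  then show "alg_mult (fun_alg G) = (fn2, mat_adjoint dm, fn)" by (simp add: fun_alg_def Let_def)
  have "mat N 1 (\<lambda>_. 1) = mat_adjoint em" by (rule eq_matI) (auto simp: em_def)
  then show "alg_unit (fun_alg G) = (urep_unit G, mat_adjoint em, fn)" by (simp add: fun_alg_def Let_def)
qed

abbreviation mm where "mm \<equiv> (fn2, mat_adjoint dm, fn)"
abbreviation uu where "uu \<equiv> (urep_unit G, mat_adjoint em, fn)"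
abbreviation aa where "aa g \<equiv> (fn, fmat N N (rperm g), fn)"
abbreviation tt where "tt \<equiv> (urep_unit G, dm * mat_adjoint em, fn2)"
text \<open>
  The vector \<open>\<Sum> \<phi>(g)\<^sup>* \<delta>\<^sub>g\<close>, which is an eigenvector of left translations and of right translations.
\<close>

definition ww where "ww \<phi> = (character_rep G \<phi>, mat N 1 (\<lambda>(i, _). cnj (\<phi> (e i))), fn)"

lemma mm_Hom: "mm \<in> Hom (Rep G) fn2 fn" by (rule Rep_adj[OF dm_Hom])
lemma uu_Hom: "uu \<in> Hom (Rep G) (urep_unit G) fn" by (rule Rep_adj[OF em_Hom])
lemma tt_Hom: "tt \<in> Hom (Rep G) (urep_unit G) fn2" by (rule Rep_cmp[OF uu_Hom dm_Hom])

lemma aa_Hom: assumes "g \<in> carrier G" shows "aa g \<in> Hom (Rep G) fn fn"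
  by (rule Rep_HomI) (use assms in \<open>auto simp: fn_closed fmat_mult m_assoc intro!: fmat_cong\<close>)

lemma ww_Hom: assumes \<phi>: "\<phi> \<in> carrier (dual_group G)" shows "ww \<phi> \<in> Hom (Rep G) (character_rep G \<phi>) fn"
  unfolding ww_def
proof (rule Rep_HomI)
  let ?w = "mat N 1 (\<lambda>(i, _). cnj (\<phi> (e i)))"
  fix g assume g: "g \<in> carrier G"
  show "?w * snd (character_rep G \<phi>) g = snd fn g * ?w"
  proof (rule eq_matI)
    fix i j assume "i < dim_row (snd fn g * ?w)" "j < dim_col (snd fn g * ?w)"
    then have ij: "i < N" "j = 0" using g by simp_all
    have "i = lperm g k \<longleftrightarrow> k = lperm (inv g) i" if "k < N" for k
      using g ij(1) that by (auto simp: m_assoc[symmetric])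
    then have "(snd fn g * ?w) $$ (i, j) = (\<Sum>k<N. (if k = lperm (inv g) i then 1 else 0) * cnj (\<phi> (e k)))"
      using g ij by (simp add: scalar_prod_def atLeast0LessThan)
    also have "\<dots> = cnj (\<phi> (inv g \<otimes> e i))"
      using g ij by (simp add: if_distrib[of "\<lambda>x. x * _"] cong: if_cong)
    also have "\<dots> = cnj (\<phi> (inv g)) * cnj (\<phi> (e i))" using g ij dual_groupD(3)[OF \<phi>] by simp
    also have "cnj (\<phi> (inv g)) = \<phi> g"
    proof -
      have i: "\<phi> (inv g) * \<phi> g = \<phi> \<one>" using g dual_groupD(3)[OF \<phi>, of "inv g" g] by simp
      have "\<phi> \<one> * \<phi> \<one> = \<phi> \<one>" using dual_groupD(3)[OF \<phi>, of \<one> \<one>] by simp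
      then have "\<phi> \<one> = 1" using dual_groupD(1)[OF \<phi>, of \<one>] by auto
      then have "cnj (\<phi> (inv g)) * (\<phi> (inv g) * \<phi> g) = cnj (\<phi> (inv g))" using i by simp
      then show ?thesis using dual_groupD(2)[OF \<phi>, of "inv g"] g by (simp flip: mult.assoc)
    qed
    finally show "(?w * snd (character_rep G \<phi>) g) $$ (i, j) = (snd fn g * ?w) $$ (i, j)"
      using g ij by (simp add: character_rep_def scalar_prod_def mult.commute)
  qed (use g in \<open>simp_all add: character_rep_def\<close>)
qed (simp_all add: fn_closed character_rep_closed[OF \<phi>], simp_all add: character_rep_def)

lemma dm_coassoc: "kron dm (1\<^sub>m N) * dm = kron (1\<^sub>m N) dm * dm"
proof -
  have "kron dm (1\<^sub>m N) * dm = fmat (N * N * N) N (\<lambda>i. (i * N + i) * N + i)"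
    unfolding dm_def fmat_one by (subst fmat_kron, simp, subst fmat_mult) (auto intro!: fmat_cong simp: mult_add_bound)
  moreover have "kron (1\<^sub>m N) dm * dm = fmat (N * (N * N)) N (\<lambda>i. i * (N * N) + (i * N + i))"
    unfolding dm_def fmat_one by (subst fmat_kron, simp, subst fmat_mult) (auto intro!: fmat_cong simp: mult_add_bound)
  ultimately show ?thesis by (simp add: algebra_simps)
qed

lemma em_counit: "kron em (1\<^sub>m N) * dm = 1\<^sub>m N" "kron (1\<^sub>m N) em * dm = 1\<^sub>m N"
proof -
  show "kron em (1\<^sub>m N) * dm = 1\<^sub>m N"
    unfolding dm_def em_def fmat_one by (subst fmat_kron, simp, simp, subst fmat_mult) (auto intro!: fmat_cong)
  show "kron (1\<^sub>m N) em * dm = 1\<^sub>m N"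
    unfolding dm_def em_def fmat_one by (subst fmat_kron, simp, simp, subst fmat_mult) (auto intro!: fmat_cong)
qed

lemma dm_cocomm: "mat_adjoint dm * flip_mat N N = mat_adjoint dm"
proof -
  have f: "flip_mat N N = fmat (N * N) (N * N) (\<lambda>j. j mod N * N + j div N)"
  proof (rule eq_matI)
    fix i j assume "i < dim_row (fmat (N * N) (N * N) (\<lambda>j. j mod N * N + j div N))" "j < dim_col (fmat (N * N) (N * N) (\<lambda>j. j mod N * N + j div N))"
    then have ij: "i < N * N" "j < N * N" by simp_all
    show "flip_mat N N $$ (i, j) = fmat (N * N) (N * N) (\<lambda>j. j mod N * N + j div N) $$ (i, j)"
      using ij div_mod_less[OF ij(2)] eq_mult_add_iff[of "j div N" N i "j mod N"] by (auto simp: flip_mat_def)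
  qed (simp_all add: flip_mat_def)
  have s: "i * N + i = j mod N * N + j div N \<longleftrightarrow> i * N + i = j" if ij: "i < N" "j < N * N" for i j
  proof -
    have "i * N + i = j mod N * N + j div N \<longleftrightarrow> i = j mod N \<and> i = j div N"
      using eq_mult_add_iff[of "j div N" N "i * N + i" "j mod N"] ij div_mod_less[OF ij(2)] by simp
    moreover have "i * N + i = j \<longleftrightarrow> j div N = i \<and> j mod N = i"
      using eq_mult_add_iff[of i N j i] ij by auto
    ultimately show ?thesis by auto
  qed
  show ?thesis
    unfolding dm_def f
    by (subst adjoint_fmat_mult) (auto simp: div_mod_less mult_add_bound s intro!: eq_matI)
qed

text \<open>
  The Frobenius law of the Q-system.
\<close>

lemma frobenius: "kron (mat_adjoint dm) (1\<^sub>m N) * kron (1\<^sub>m N) dm = dm * mat_adjoint dm"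
proof -
  have dN: "d < N" if "i < N * N" "d = i div N \<or> d = i mod N" for d i using that div_mod_less by auto
  have 1: "mat_adjoint (kron dm (1\<^sub>m N)) * kron (1\<^sub>m N) dm
    = mat (N * N) (N * N) (\<lambda>(i, j). if i = j \<and> i div N = i mod N then 1 else 0)"
    unfolding dm_def fmat_one
  proof (subst fmat_kron, simp, subst fmat_kron, simp, subst mult.assoc, subst adjoint_fmat_mult)
    fix j assume "j < N * N"
    then show "j div N * (N * N) + (j mod N * N + j mod N) < N * (N * N)"
      by (intro mult_add_bound) (auto simp: div_mod_less)
  next
    show "mat (N * N) (N * N) (\<lambda>(i, j). if (i div N * N + i div N) * N + i mod N = j div N * (N * N) + (j mod N * N + j mod N) then 1 else 0)
       = mat (N * N) (N * N) (\<lambda>(i, j). if i = j \<and> i div N = i mod N then 1 else 0)"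
    proof (rule cong_mat)
      fix i j assume ij: "i < N * N" "j < N * N"
      note b = div_mod_less[OF ij(1)] div_mod_less[OF ij(2)]
      have "(i div N * N + i div N) * N + i mod N = (j div N * N + j mod N) * N + j mod N
         \<longleftrightarrow> i div N * N + i div N = j div N * N + j mod N \<and> i mod N = j mod N"
        using eq_mult_add_iff[of "j mod N" N "(i div N * N + i div N) * N + i mod N"] b by simp
      also have "i div N * N + i div N = j div N * N + j mod N \<longleftrightarrow> i div N = j div N \<and> i div N = j mod N"
        by (rule trans[OF eq_mult_add_iff[OF b(4)]]) (use b in simp)
      also have "(i div N = j div N \<and> i div N = j mod N) \<and> i mod N = j mod N \<longleftrightarrow> i = j \<and> i div N = i mod N"
        using div_mult_mod_eq[of i N] div_mult_mod_eq[of j N] by metis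
      finally have f: "(i div N * N + i div N) * N + i mod N = (j div N * N + j mod N) * N + j mod N \<longleftrightarrow> i = j \<and> i div N = i mod N" .
      have r: "j div N * (N * N) + (j mod N * N + j mod N) = (j div N * N + j mod N) * N + j mod N"
        by (simp only: add_mult_distrib mult.assoc add.assoc)
      show "(case (i, j) of (i, j) \<Rightarrow> if (i div N * N + i div N) * N + i mod N = j div N * (N * N) + (j mod N * N + j mod N) then 1 else 0)
          = (case (i, j) of (i, j) \<Rightarrow> if i = j \<and> i div N = i mod N then 1 else 0)"
        by (simp only: prod.case r f)
    qed simp_all
  qed
  have 2: "dm * mat_adjoint dm = mat (N * N) (N * N) (\<lambda>(i, j). if i = j \<and> i div N = i mod N then 1 else 0)"
  proof (rule eq_matI)
    fix i j assume "i < dim_row (mat (N * N) (N * N) (\<lambda>(i, j). if i = j \<and> i div N = i mod N then 1 else 0 :: complex))"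
      "j < dim_col (mat (N * N) (N * N) (\<lambda>(i, j). if i = j \<and> i div N = i mod N then 1 else 0 :: complex))"
    then have ij: "i < N * N" "j < N * N" by simp_all
    note b = div_mod_less[OF ij(1)] div_mod_less[OF ij(2)]
    have k: "x = k * N + k \<longleftrightarrow> k = x div N \<and> x div N = x mod N" if "k < N" for k x
      using eq_mult_add_iff[of k N x k] that by auto
    have "(dm * mat_adjoint dm) $$ (i, j)
      = (\<Sum>k<N. (if i = k * N + k then 1 else 0) * cnj (if j = k * N + k then 1 else 0))"
      using ij by (simp add: dm_def scalar_prod_def atLeast0LessThan)
    also have "\<dots> = (\<Sum>k<N. if k = i div N then (if i = j \<and> i div N = i mod N then 1 else 0) else 0)"
    proof (rule sum.cong)
      fix q assume q: "q \<in> {..<N}"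
      show "(if i = q * N + q then 1 else 0) * cnj (if j = q * N + q then 1 else 0)
        = (if q = i div N then (if i = j \<and> i div N = i mod N then 1 else 0 :: complex) else 0)"
      proof -
        have ij': "i = j \<longleftrightarrow> i div N = j div N \<and> i mod N = j mod N" by (metis div_mult_mod_eq)
        have qN: "q < N" using q by simp
        show ?thesis unfolding k[OF qN] ij' by simp
      qed
    qed simp
    also have "\<dots> = (if i = j \<and> i div N = i mod N then 1 else 0)" using b by simp
    finally show "(dm * mat_adjoint dm) $$ (i, j) = mat (N * N) (N * N) (\<lambda>(i, j). if i = j \<and> i div N = i mod N then 1 else 0) $$ (i, j)"
      using ij by simp
  qed (simp_all add: dm_def)
  show ?thesis using 1 2 by (simp add: kron_adjoint)
qed

end


section \<open>Matrix identities of the function algebra\<close>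

context finite_group
begin

lemma dm_carrier [simp]: "dm \<in> carrier_mat (N * N) N" "mat_adjoint dm \<in> carrier_mat N (N * N)"
  "dim_row dm = N * N" "dim_col dm = N"
  by (auto simp: dm_def)

lemma em_carrier [simp]: "em \<in> carrier_mat 1 N" "mat_adjoint em \<in> carrier_mat N 1"
  "dim_row em = 1" "dim_col em = N"
  by (auto simp: em_def)

lemma mult_coassoc: "mat_adjoint dm * kron (mat_adjoint dm) (1\<^sub>m N) = mat_adjoint dm * kron (1\<^sub>m N) (mat_adjoint dm)"
  using arg_cong[OF dm_coassoc, of mat_adjoint] by (simp add: mat_adjoint_mult kron_adjoint)

lemma mult_counit: "mat_adjoint dm * kron (mat_adjoint em) (1\<^sub>m N) = 1\<^sub>m N"
  "mat_adjoint dm * kron (1\<^sub>m N) (mat_adjoint em) = 1\<^sub>m N"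
  using arg_cong[OF em_counit(1), of mat_adjoint] arg_cong[OF em_counit(2), of mat_adjoint]
  by (simp_all add: mat_adjoint_mult kron_adjoint)

lemma rperm_mult: "g \<in> carrier G \<Longrightarrow> h \<in> carrier G \<Longrightarrow> fmat N N (rperm g) * fmat N N (rperm h) = fmat N N (rperm (h \<otimes> g))"
  by (simp add: fmat_mult m_assoc cong: fmat_cong)

lemma rperm_unitary:
  assumes g: "g \<in> carrier G"
  shows "mat_adjoint (fmat N N (rperm g)) * fmat N N (rperm g) = 1\<^sub>m N"
    "fmat N N (rperm g) * mat_adjoint (fmat N N (rperm g)) = 1\<^sub>m N"
  using g by (simp_all add: adjoint_rperm rperm_mult fmat_one cong: fmat_cong)

lemma rperm_mult_alg:
  assumes g: "g \<in> carrier G"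
  shows "fmat N N (rperm g) * mat_adjoint dm = mat_adjoint dm * kron (fmat N N (rperm g)) (fmat N N (rperm g))"
proof -
  let ?a = "fmat N N (rperm (inv g))"
  have "kron ?a ?a * dm = dm * ?a"
    unfolding dm_def using g
    by (subst fmat_kron, simp, subst fmat_mult, simp, subst fmat_mult) (auto intro!: fmat_cong)
  then have "mat_adjoint (kron ?a ?a * dm) = mat_adjoint (dm * ?a)" by simp
  moreover have "mat_adjoint ?a = fmat N N (rperm g)" using g adjoint_rperm[of "inv g"] by simp
  ultimately show ?thesis by (simp add: mat_adjoint_mult kron_adjoint)
qed

lemma rperm_unit:
  assumes g: "g \<in> carrier G" shows "fmat N N (rperm g) * mat_adjoint em = mat_adjoint em"
proof -
  have "em * fmat N N (rperm (inv g)) = em"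
    unfolding em_def using g by (subst fmat_mult) (auto intro!: fmat_cong)
  then have "mat_adjoint (em * fmat N N (rperm (inv g))) = mat_adjoint em" by simp
  moreover have "mat_adjoint (fmat N N (rperm (inv g))) = fmat N N (rperm g)" using g adjoint_rperm[of "inv g"] by simp
  ultimately show ?thesis by (simp add: mat_adjoint_mult)
qed

text \<open>
  On the basis this is \<open>\<delta>\<^sub>k \<mapsto> \<delta>\<^sub>k \<delta>\<^sub>k\<^sub>g\<close>, and right translation by \<open>g \<noteq> 1\<close> has no fixed point.
\<close>

lemma dm_rperm_dm:
  assumes g: "g \<in> carrier G"
  shows "mat_adjoint dm * (kron (1\<^sub>m N) (fmat N N (rperm g)) * dm) = (if g = \<one> then 1\<^sub>m N else 0\<^sub>m N N)"
proof -
  have 1: "kron (1\<^sub>m N) (fmat N N (rperm g)) * dm = fmat (N * N) N (\<lambda>j. j * N + rperm g j)"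
    unfolding dm_def fmat_one using g
    by (subst fmat_kron, simp, subst fmat_mult) (auto intro!: fmat_cong)
  have 2: "i * N + i = j * N + rperm g j \<longleftrightarrow> i = j \<and> g = \<one>" if ij: "i < N" "j < N" for i j
  proof -
    have "i * N + i = j * N + rperm g j \<longleftrightarrow> i = j \<and> i = rperm g j"
      by (rule trans[OF eq_mult_add_iff]) (use ij g in auto)
    also have "\<dots> \<longleftrightarrow> i = j \<and> e i = e j \<otimes> g" using ij g e_eq_iff[of i "e j \<otimes> g"] by auto
    also have "\<dots> \<longleftrightarrow> i = j \<and> g = \<one>" using ij g r_cancel_one'[of g "e i"] l_cancel_one[of "e i" g] by auto
    finally show ?thesis .
  qed
  have "mat_adjoint dm * fmat (N * N) N (\<lambda>j. j * N + rperm g j)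
      = mat N N (\<lambda>(i, j). if i * N + i = j * N + rperm g j then 1 else 0)"
    unfolding dm_def using g by (intro adjoint_fmat_mult mult_add_bound) auto
  also have "\<dots> = mat N N (\<lambda>(i, j). if i = j \<and> g = \<one> then 1 else 0)"
    by (rule cong_mat) (simp_all add: 2)
  also have "\<dots> = (if g = \<one> then 1\<^sub>m N else 0\<^sub>m N N)"
    by (auto intro!: eq_matI)
  finally show ?thesis using 1 by simp
qed

lemma mult_act_tt:
  assumes g: "g \<in> carrier G"
  shows "mat_adjoint dm * (kron (1\<^sub>m N) (fmat N N (rperm g)) * (dm * mat_adjoint em))
    = (if g = \<one> then mat_adjoint em else 0\<^sub>m N 1)"
proof -
  let ?k = "kron (1\<^sub>m N) (fmat N N (rperm g))"
  have k: "?k \<in> carrier_mat (N * N) (N * N)" by auto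
  have "mat_adjoint dm * (?k * (dm * mat_adjoint em)) = mat_adjoint dm * (?k * dm) * mat_adjoint em"
    using k assoc_mult_mat[OF k dm_carrier(1) em_carrier(2)]
      assoc_mult_mat[OF dm_carrier(2) mult_carrier_mat[OF k dm_carrier(1)] em_carrier(2)] by simp
  also have "\<dots> = (if g = \<one> then mat_adjoint em else 0\<^sub>m N 1)"
    unfolding dm_rperm_dm[OF g] by (simp add: left_mult_one_mat'[of _ N] left_mult_zero_mat[OF em_carrier(2)])
  finally show ?thesis .
qed

text \<open>
  The Frobenius law, followed by the counit laws.
\<close>

lemma tt_dual: "kron em (1\<^sub>m N) * (kron (mat_adjoint dm) (1\<^sub>m N) * kron (1\<^sub>m N) (dm * mat_adjoint em)) = 1\<^sub>m N"
proof -
  let ?I = "1\<^sub>m N :: complex mat"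
  have k: "kron em ?I \<in> carrier_mat N (N * N)" "kron ?I (mat_adjoint em) \<in> carrier_mat (N * N) N"
    "kron (mat_adjoint dm) ?I \<in> carrier_mat (N * N) (N * N * N)" "kron ?I dm \<in> carrier_mat (N * N * N) (N * N)"
    by (auto simp: mult.assoc)
  have 1: "kron ?I (dm * mat_adjoint em) = kron ?I dm * kron ?I (mat_adjoint em)" by (simp add: kron_mult)
  have 2: "mat_adjoint dm * kron ?I (mat_adjoint em) = ?I" by (rule mult_counit)
  have "kron (mat_adjoint dm) ?I * kron ?I (dm * mat_adjoint em)
      = kron (mat_adjoint dm) ?I * kron ?I dm * kron ?I (mat_adjoint em)"
    unfolding 1 by (rule assoc_mult_mat[OF k(3,4,2), symmetric])
  also have "\<dots> = dm * (mat_adjoint dm * kron ?I (mat_adjoint em))"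
    unfolding frobenius by (rule assoc_mult_mat[OF dm_carrier(1,2) k(2)])
  also have "\<dots> = dm" unfolding 2 by (rule right_mult_one_mat[OF dm_carrier(1)])
  finally show ?thesis using em_counit(1) by simp
qed

lemma em_norm: "em * mat_adjoint em = of_nat N \<cdot>\<^sub>m 1\<^sub>m 1"
  by (rule eq_matI) (auto simp: em_def scalar_prod_def)

text \<open>
  An invariant function on \<open>G\<close> is constant, because translations act transitively.
\<close>

lemma unit_intertwiner:
  assumes "f \<in> Hom (Rep G) (urep_unit G) fn"
  shows "\<exists>c. f = scale_arr (Rep G) c uu"
proof -
  obtain T where T: "f = (urep_unit G, T, fn)" "T \<in> intertwiners G (urep_unit G) fn"
    using assms by (auto simp: Rep_Hom)
  have Tc: "T \<in> carrier_mat N 1" and Ti: "\<And>g. g \<in> carrier G \<Longrightarrow> T * snd (urep_unit G) g = snd fn g * T"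
    using T(2) by (auto simp: intertwiners_def urep_unit_def)
  have c: "T $$ (i, 0) = T $$ (0, 0)" if i: "i < N" for i
  proof -
    define g where "g = e 0 \<otimes> inv (e i)"
    have g: "g \<in> carrier G" "g \<otimes> e i = e 0" using i N_pos by (simp_all add: g_def m_assoc)
    have "T $$ (0, 0) = (T * snd (urep_unit G) g) $$ (0, 0)"
      using g Tc by (simp add: urep_unit_def right_mult_one_mat[unfolded One_nat_def])
    also have "\<dots> = (fmat N N (lperm g) * T) $$ (0, 0)" using Ti[OF g(1)] g by simp
    also have "\<dots> = (\<Sum>k<N. (if 0 = lperm g k then 1 else 0) * T $$ (k, 0))"
      using Tc N_pos by (simp add: scalar_prod_def atLeast0LessThan)
    also have "\<dots> = (\<Sum>k<N. (if k = i then 1 else 0) * T $$ (k, 0))"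
    proof (rule sum.cong)
      fix k assume k: "k \<in> {..<N}"
      have "0 = lperm g k \<longleftrightarrow> e 0 = g \<otimes> e k" using k g N_pos e_eq_iff[of 0 "g \<otimes> e k"] by auto
      also have "\<dots> \<longleftrightarrow> e i = e k" unfolding g(2)[symmetric] using inj_on_eq_iff[OF inj_on_cmult[OF g(1)], of "e i" "e k"] k i by simp
      also have "\<dots> \<longleftrightarrow> k = i" using k i by (metis ix_e lessThan_iff)
      finally show "(if 0 = lperm g k then 1 else 0) * T $$ (k, 0) = (if k = i then 1 else 0) * T $$ (k, 0)" by simp
    qed simp
    also have "\<dots> = T $$ (i, 0)" using i by (simp add: if_distrib[of "\<lambda>x. x * _"] cong: if_cong)
    finally show ?thesis by simp
  qed
  define \<tau> where "\<tau> = T $$ (0, 0)"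
  have "T = \<tau> \<cdot>\<^sub>m mat_adjoint em"
    by (rule eq_matI) (use Tc c in \<open>auto simp: em_def simp flip: \<tau>_def\<close>)
  then show ?thesis by (auto simp: T(1) Rep_simps)
qed

abbreviation wm where "wm \<phi> \<equiv> mat N 1 (\<lambda>(i, _). cnj (\<phi> (e i)))"

lemma wm_norm:
  assumes \<phi>: "\<phi> \<in> carrier (dual_group G)"
  shows "mat_adjoint (wm \<phi>) * wm \<phi> = of_nat N \<cdot>\<^sub>m 1\<^sub>m 1"
proof (rule eq_matI)
  fix i j assume "i < dim_row (of_nat N \<cdot>\<^sub>m 1\<^sub>m 1 :: complex mat)" "j < dim_col (of_nat N \<cdot>\<^sub>m 1\<^sub>m 1 :: complex mat)"
  then have [simp]: "i = 0" "j = 0" by auto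
  have "(mat_adjoint (wm \<phi>) * wm \<phi>) $$ (i, j) = (\<Sum>k<N. \<phi> (e k) * cnj (\<phi> (e k)))"
    by (simp add: scalar_prod_def atLeast0LessThan)
  also have "\<dots> = (\<Sum>k<N. 1)"
    by (rule sum.cong) (use dual_groupD(2)[OF \<phi>] in \<open>auto simp: mult.commute\<close>)
  finally show "(mat_adjoint (wm \<phi>) * wm \<phi>) $$ (i, j) = (of_nat N \<cdot>\<^sub>m 1\<^sub>m 1) $$ (i, j)" by simp
qed auto

text \<open>
  The entry at \<open>(\<delta>\<^sub>h, \<delta>\<^sub>k)\<close> of the left side is \<open>\<phi>(h)\<^sup>* \<phi>(k)\<close>, and on the right only the term with
  \<open>k g = h\<close> survives.
\<close>

lemma wm_sum:
  assumes \<phi>: "\<phi> \<in> carrier (dual_group G)"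
  shows "wm \<phi> * mat_adjoint (wm \<phi>) = mat N N (\<lambda>(i, j). \<Sum>g\<in>carrier G. if i = rperm g j then cnj (\<phi> g) else 0)"
proof (rule eq_matI)
  fix i j assume "i < dim_row (mat N N (\<lambda>(i, j). \<Sum>g\<in>carrier G. if i = rperm g j then cnj (\<phi> g) else 0))"
    "j < dim_col (mat N N (\<lambda>(i, j). \<Sum>g\<in>carrier G. if i = rperm g j then cnj (\<phi> g) else 0))"
  then have ij: "i < N" "j < N" by simp_all
  let ?g = "inv (e j) \<otimes> e i"
  have "i = rperm g j \<longleftrightarrow> g = ?g" if g: "g \<in> carrier G" for g
  proof -
    have "i = rperm g j \<longleftrightarrow> e i = e j \<otimes> g" using ij g e_eq_iff[of i "e j \<otimes> g"] by auto
    also have "\<dots> \<longleftrightarrow> g = ?g" using ij g inv_solve_left[of g "e j" "e i"] by auto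
    finally show ?thesis .
  qed
  then have "(\<Sum>g\<in>carrier G. if i = rperm g j then cnj (\<phi> g) else 0) = (\<Sum>g\<in>carrier G. if g = ?g then cnj (\<phi> g) else 0)"
    by (intro sum.cong) auto
  also have "\<dots> = cnj (\<phi> ?g)" using ij finite_carrier by simp
  also have "\<dots> = cnj (\<phi> (e i)) * \<phi> (e j)"
  proof -
    have "\<phi> (e i) = \<phi> (e j) * \<phi> ?g"
      using dual_groupD(3)[OF \<phi>, of "e j" ?g] ij by (simp add: m_assoc[symmetric])
    then have "cnj (\<phi> (e j)) * \<phi> (e i) = \<phi> ?g"
      using dual_groupD(2)[OF \<phi>, of "e j"] ij by (simp flip: mult.assoc)
    then have "cnj (\<phi> ?g) = cnj (cnj (\<phi> (e j)) * \<phi> (e i))" by simp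
    then show ?thesis by (simp add: mult.commute)
  qed
  finally show "(wm \<phi> * mat_adjoint (wm \<phi>)) $$ (i, j)
      = mat N N (\<lambda>(i, j). \<Sum>g\<in>carrier G. if i = rperm g j then cnj (\<phi> g) else 0) $$ (i, j)"
    using ij by (simp add: scalar_prod_def)
qed simp_all

lemma Rep_add:
  assumes "(V, S, W) \<in> Hom (Rep G) V W" "(V, T, W) \<in> Hom (Rep G) V W"
  shows "(V, S + T, W) \<in> Hom (Rep G) V W"
proof (rule Rep_HomI)
  show "V \<in> ureps G" "W \<in> ureps G" "S + T \<in> carrier_mat (fst W) (fst V)"
    using assms by (auto simp: Rep_Hom intertwiners_def)
  fix g assume g: "g \<in> carrier G"
  have "S * snd V g = snd W g * S" "T * snd V g = snd W g * T" "S \<in> carrier_mat (fst W) (fst V)"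
    "T \<in> carrier_mat (fst W) (fst V)" "snd V g \<in> carrier_mat (fst V) (fst V)" "snd W g \<in> carrier_mat (fst W) (fst W)"
    using assms g urepsD(1)[OF _ g] by (auto simp: Rep_Hom intertwiners_def)
  then show "(S + T) * snd V g = snd W g * (S + T)"
    by (simp add: add_mult_distrib_mat[of S _ _ T] mult_add_distrib_mat[of _ _ _ S _ T])
qed

lemma Rep_scale:
  assumes "(V, T, W) \<in> Hom (Rep G) V W" shows "(V, c \<cdot>\<^sub>m T, W) \<in> Hom (Rep G) V W"
proof (rule Rep_HomI)
  show "V \<in> ureps G" "W \<in> ureps G" "c \<cdot>\<^sub>m T \<in> carrier_mat (fst W) (fst V)"
    using assms by (auto simp: Rep_Hom intertwiners_def)
  fix g assume g: "g \<in> carrier G"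
  have "T * snd V g = snd W g * T" "T \<in> carrier_mat (fst W) (fst V)" "snd V g \<in> carrier_mat (fst V) (fst V)"
    "snd W g \<in> carrier_mat (fst W) (fst W)"
    using assms g urepsD(1)[OF _ g] by (auto simp: Rep_Hom intertwiners_def)
  then show "c \<cdot>\<^sub>m T * snd V g = snd W g * (c \<cdot>\<^sub>m T)"
    by (simp add: mult_smult_assoc_mat[of T] mult_smult_distrib[of "snd W g" _ _ T])
qed

end


section \<open>Transport along the embedding\<close>

locale rep_embedding = finite_group G + braided_cstar_tensor_category C + unitary_braided_embedding "Rep G" C F
  for G :: "('g, 'b) monoid_scheme" and C :: "('o, 'm, 'z) braided_data_scheme" (structure)
    and F :: "('g, 'o, 'm) rep_embedding"
begin

abbreviation I where "I \<equiv> urep_unit G"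
abbreviation F2 where "F2 V W \<equiv> F_tensor F V W"
abbreviation F0 where "F0 \<equiv> F_unit F"
abbreviation Fa where "Fa f \<equiv> F_arr F f"
abbreviation Fo where "Fo V \<equiv> F_ob F V"
abbreviation AA where "AA \<equiv> image_alg C F (fun_alg G)"
abbreviation \<alpha> where "\<alpha> g \<equiv> F_arr F (fun_aut G g)"

lemma F_Hom:
  assumes "f \<in> Hom (Rep G) V W" shows "Fa f \<in> Hom C (Fo V) (Fo W)"
proof -
  have "V \<in> Ob (Rep G)" "W \<in> Ob (Rep G)" using assms by (auto simp: Rep_Hom Rep_simps)
  from fully_faithful[OF this] show ?thesis using assms by (auto simp: bij_betw_def)
qed

lemma F_simps:
  assumes "f \<in> Hom (Rep G) V W"
  shows "Fa f \<in> Arr C" "source C (Fa f) = Fo V" "target C (Fa f) = Fo W"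
  using F_Hom[OF assms] unfolding Hom_iff by blast+

lemma Fo_Ob [simp]: "V \<in> ureps G \<Longrightarrow> Fo V \<in> Ob C"
  using F_Ob[of V] by (simp add: Rep_simps)

lemma F2_simps [simp]:
  assumes "V \<in> ureps G" "W \<in> ureps G"
  shows "F2 V W \<in> Arr C" "source C (F2 V W) = Fo V \<star> Fo W" "target C (F2 V W) = Fo (urep_tensor G V W)"
    "(F2 V W)\<dagger> \<cdot> F2 V W = ident C (Fo V \<star> Fo W)" "F2 V W \<cdot> (F2 V W)\<dagger> = ident C (Fo (urep_tensor G V W))"
proof -
  have "V \<in> Ob (Rep G)" "W \<in> Ob (Rep G)" using assms by (simp_all add: Rep_simps)
  note h = F_tensor_Hom[OF this] F_tensor_unitary[OF this]
  show 1: "F2 V W \<in> Arr C" "source C (F2 V W) = Fo V \<star> Fo W" "target C (F2 V W) = Fo (urep_tensor G V W)"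
    using h(1) unfolding Hom_iff Rep_simps by blast+
  show "(F2 V W)\<dagger> \<cdot> F2 V W = ident C (Fo V \<star> Fo W)" "F2 V W \<cdot> (F2 V W)\<dagger> = ident C (Fo (urep_tensor G V W))"
    using unitaryD(2,3)[OF h(2)] by (simp_all add: 1)
qed

lemma F0_simps [simp]: "F0 \<in> Arr C" "source C F0 = unit_ob C" "target C F0 = Fo I"
  "F0\<dagger> \<cdot> F0 = ident C (unit_ob C)" "F0 \<cdot> F0\<dagger> = ident C (Fo I)"
proof -
  show 1: "F0 \<in> Arr C" "source C F0 = unit_ob C" "target C F0 = Fo I"
    using F_unit_Hom unfolding Hom_iff Rep_simps by blast+
  show "F0\<dagger> \<cdot> F0 = ident C (unit_ob C)" "F0 \<cdot> F0\<dagger> = ident C (Fo I)"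
    using unitaryD(2,3)[OF F_unit_unitary] by (simp_all add: 1)
qed

lemmas closed [simp] = fn_closed urep_unit_closed urep_tensor_closed

lemma F_comp:
  assumes "f \<in> Hom (Rep G) V W" "g \<in> Hom (Rep G) W X"
  shows "Fa g \<cdot> Fa f = Fa (cmp (Rep G) g f)"
  using F_cmp[OF assms] by simp

lemma F_one: "V \<in> ureps G \<Longrightarrow> Fa (V, 1\<^sub>m (fst V), V) = ident C (Fo V)"
  using F_ident[of V] by (simp add: Rep_simps)

lemma F_nat:
  assumes "(V, S, W) \<in> Hom (Rep G) V W" "(V', T, W') \<in> Hom (Rep G) V' W'"
  shows "F2 W W' \<cdot> (Fa (V, S, W) \<diamondop> Fa (V', T, W')) = Fa (urep_tensor G V V', kron S T, urep_tensor G W W') \<cdot> F2 V V'"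
  using F_tensor_natural[OF assms] by (simp add: Rep_simps)

lemma ident_Hom': "V \<in> ureps G \<Longrightarrow> (V, 1\<^sub>m (fst V), V) \<in> Hom (Rep G) V V"
  using Rep_ident[of V] by (simp add: Rep_simps)

lemma F_nat_right:
  assumes f: "(V, S, W) \<in> Hom (Rep G) V W" and [simp]: "X \<in> ureps G"
  shows "F2 W X \<cdot> (Fa (V, S, W) \<triangleleft> Fo X) = Fa (urep_tensor G V X, kron S (1\<^sub>m (fst X)), urep_tensor G W X) \<cdot> F2 V X"
  using F_nat[OF f ident_Hom'[OF assms(2)]] by (simp add: F_one)

lemma F_nat_left:
  assumes f: "(V, S, W) \<in> Hom (Rep G) V W" and [simp]: "X \<in> ureps G"
  shows "F2 X W \<cdot> (Fo X \<triangleright> Fa (V, S, W)) = Fa (urep_tensor G X V, kron (1\<^sub>m (fst X)) S, urep_tensor G X W) \<cdot> F2 X V"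
  using F_nat[OF ident_Hom'[OF assms(2)] f] by (simp add: F_one)

lemma F_tensor_right: "(V, S, W) \<in> Hom (Rep G) V W \<Longrightarrow> X \<in> ureps G \<Longrightarrow>
    (urep_tensor G V X, kron S (1\<^sub>m (fst X)), urep_tensor G W X) \<in> Hom (Rep G) (urep_tensor G V X) (urep_tensor G W X)"
  by (rule Rep_tensor[OF _ ident_Hom'])

lemma F_tensor_left: "(V, S, W) \<in> Hom (Rep G) V W \<Longrightarrow> X \<in> ureps G \<Longrightarrow>
    (urep_tensor G X V, kron (1\<^sub>m (fst X)) S, urep_tensor G X W) \<in> Hom (Rep G) (urep_tensor G X V) (urep_tensor G X W)"
  by (rule Rep_tensor[OF ident_Hom'])

lemma F_assoc: "F2 fn2 fn \<cdot> (F2 fn fn \<triangleleft> Fo fn) = F2 fn fn2 \<cdot> (Fo fn \<triangleright> F2 fn fn) \<cdot> assr C (Fo fn) (Fo fn) (Fo fn)"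
proof -
  have "Fa (assr (Rep G) fn fn fn) = ident C (Fo (urep_tensor G fn2 fn))"
    using F_one[of "urep_tensor G fn2 fn"]
    by (simp add: Rep_simps urep_tensor_assoc) (simp add: urep_tensor_def mult.assoc)
  then show ?thesis
    using F_assr[of fn fn fn] by (simp add: Rep_simps urep_tensor_assoc)
qed

lemma F_unit_right: "F2 fn I \<cdot> (Fo fn \<triangleright> F0) = runit C (Fo fn)"
  using F_runit[of fn] F_one[of fn] by (simp add: Rep_simps urep_tensor_unit)

lemma F_unit_left: "F2 I fn \<cdot> (F0 \<triangleleft> Fo fn) = lunit C (Fo fn)"
  using F_lunit[of fn] F_one[of fn] by (simp add: Rep_simps urep_tensor_unit)

abbreviation Fm where "Fm \<equiv> Fa mm"
abbreviation Fu where "Fu \<equiv> Fa uu"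

lemmas gens [simp] = F_simps[OF mm_Hom] F_simps[OF uu_Hom] F_simps[OF tt_Hom] F_simps[OF aa_Hom]

lemma AA_simps: "alg_ob AA = Fo fn" "alg_mult AA = Fm \<cdot> F2 fn fn" "alg_unit AA = Fu \<cdot> F0"
  by (simp_all add: image_alg_def fun_alg_eq)

lemma act_eq: "g \<in> carrier G \<Longrightarrow> \<alpha> g = Fa (aa g)"
  by (simp only: fun_aut_fmat)

lemma AA_assoc: "alg_mult AA \<cdot> (alg_mult AA \<triangleleft> Fo fn)
    = alg_mult AA \<cdot> (Fo fn \<triangleright> alg_mult AA) \<cdot> assr C (Fo fn) (Fo fn) (Fo fn)"
proof -
  let ?m1 = "(urep_tensor G fn2 fn, kron (mat_adjoint dm) (1\<^sub>m N), fn2)"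
  let ?m2 = "(urep_tensor G fn fn2, kron (1\<^sub>m N) (mat_adjoint dm), fn2)"
  have 1: "F2 fn fn \<cdot> (Fm \<triangleleft> Fo fn) = Fa ?m1 \<cdot> F2 fn2 fn" using F_nat_right[OF mm_Hom fn_closed] by simp
  have 2: "F2 fn fn \<cdot> (Fo fn \<triangleright> Fm) = Fa ?m2 \<cdot> F2 fn fn2" using F_nat_left[OF mm_Hom fn_closed] by simp
  have h1: "?m1 \<in> Hom (Rep G) (urep_tensor G fn2 fn) fn2" using F_tensor_right[OF mm_Hom fn_closed] by simp
  have h2: "?m2 \<in> Hom (Rep G) (urep_tensor G fn fn2) fn2" using F_tensor_left[OF mm_Hom fn_closed] by simp
  have 3: "Fm \<cdot> Fa ?m1 = Fm \<cdot> Fa ?m2"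
    using F_comp[OF h1 mm_Hom] F_comp[OF h2 mm_Hom] by (simp add: Rep_simps mult_coassoc urep_tensor_assoc)
  note [simp] = F_simps[OF h1] F_simps[OF h2]
  have "alg_mult AA \<cdot> (alg_mult AA \<triangleleft> Fo fn) = Fm \<cdot> (F2 fn fn \<cdot> (Fm \<triangleleft> Fo fn)) \<cdot> (F2 fn fn \<triangleleft> Fo fn)"
    by (simp add: AA_simps)
  also have "\<dots> = (Fm \<cdot> Fa ?m1) \<cdot> (F2 fn2 fn \<cdot> (F2 fn fn \<triangleleft> Fo fn))" unfolding 1 by simp
  also have "\<dots> = Fm \<cdot> (Fa ?m2 \<cdot> F2 fn fn2) \<cdot> (Fo fn \<triangleright> F2 fn fn) \<cdot> assr C (Fo fn) (Fo fn) (Fo fn)"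
    unfolding F_assoc 3 by simp
  also have "\<dots> = alg_mult AA \<cdot> (Fo fn \<triangleright> alg_mult AA) \<cdot> assr C (Fo fn) (Fo fn) (Fo fn)"
    unfolding 2[symmetric] by (simp add: AA_simps)
  finally show ?thesis .
qed

lemma AA_unit_right: "alg_mult AA \<cdot> (Fo fn \<triangleright> alg_unit AA) = runit C (Fo fn)"
proof -
  let ?k = "(fn, kron (1\<^sub>m N) (mat_adjoint em), fn2)"
  have 1: "F2 fn fn \<cdot> (Fo fn \<triangleright> Fu) = Fa ?k \<cdot> F2 fn I"
    using F_nat_left[OF uu_Hom fn_closed] by (simp add: urep_tensor_unit)
  have h: "?k \<in> Hom (Rep G) fn fn2" using F_tensor_left[OF uu_Hom fn_closed] by (simp add: urep_tensor_unit)
  have 2: "Fm \<cdot> Fa ?k = ident C (Fo fn)"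
    using F_comp[OF h mm_Hom] F_one[of fn] by (simp add: Rep_simps mult_counit)
  note [simp] = F_simps[OF h] urep_tensor_unit
  have "alg_mult AA \<cdot> (Fo fn \<triangleright> alg_unit AA) = Fm \<cdot> (F2 fn fn \<cdot> (Fo fn \<triangleright> Fu)) \<cdot> (Fo fn \<triangleright> F0)"
    by (simp add: AA_simps)
  also have "\<dots> = (Fm \<cdot> Fa ?k) \<cdot> (F2 fn I \<cdot> (Fo fn \<triangleright> F0))" unfolding 1 by simp
  finally show ?thesis unfolding 2 F_unit_right by simp
qed

lemma AA_unit_left: "alg_mult AA \<cdot> (alg_unit AA \<triangleleft> Fo fn) = lunit C (Fo fn)"
proof -
  let ?k = "(fn, kron (mat_adjoint em) (1\<^sub>m N), fn2)"
  have 1: "F2 fn fn \<cdot> (Fu \<triangleleft> Fo fn) = Fa ?k \<cdot> F2 I fn"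
    using F_nat_right[OF uu_Hom fn_closed] by (simp add: urep_tensor_unit)
  have h: "?k \<in> Hom (Rep G) fn fn2" using F_tensor_right[OF uu_Hom fn_closed] by (simp add: urep_tensor_unit)
  have 2: "Fm \<cdot> Fa ?k = ident C (Fo fn)"
    using F_comp[OF h mm_Hom] F_one[of fn] by (simp add: Rep_simps mult_counit)
  note [simp] = F_simps[OF h] urep_tensor_unit
  have "alg_mult AA \<cdot> (alg_unit AA \<triangleleft> Fo fn) = Fm \<cdot> (F2 fn fn \<cdot> (Fu \<triangleleft> Fo fn)) \<cdot> (F0 \<triangleleft> Fo fn)"
    by (simp add: AA_simps)
  also have "\<dots> = (Fm \<cdot> Fa ?k) \<cdot> (F2 I fn \<cdot> (F0 \<triangleleft> Fo fn))" unfolding 1 by simp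
  finally show ?thesis unfolding 2 F_unit_left by simp
qed

lemma AA_comm: "alg_mult AA \<cdot> braid C (Fo fn) (Fo fn) = alg_mult AA"
proof -
  have h: "braid (Rep G) fn fn \<in> Hom (Rep G) fn2 fn2" by (rule Rep_braid) simp_all
  have 1: "Fm \<cdot> Fa (braid (Rep G) fn fn) = Fm"
    using F_comp[OF h mm_Hom] by (simp add: Rep_simps dm_cocomm)
  have 2: "Fa (braid (Rep G) fn fn) \<cdot> F2 fn fn = F2 fn fn \<cdot> braid C (Fo fn) (Fo fn)"
    using F_braid[of fn fn] by (simp add: Rep_simps)
  note [simp] = F_simps[OF h]
  have "alg_mult AA \<cdot> braid C (Fo fn) (Fo fn) = Fm \<cdot> (F2 fn fn \<cdot> braid C (Fo fn) (Fo fn))"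
    by (simp add: AA_simps)
  also have "\<dots> = (Fm \<cdot> Fa (braid (Rep G) fn fn)) \<cdot> F2 fn fn" unfolding 2[symmetric] by simp
  finally show ?thesis unfolding 1 by (simp add: AA_simps)
qed

lemma AA_commutative: "commutative_algebra C AA"
  by unfold_locales (use AA_assoc AA_unit_right AA_unit_left AA_comm in \<open>simp_all only: AA_simps(1)\<close>,
    simp_all add: AA_simps Hom_iff)

lemma AA_norm: "(alg_unit AA)\<dagger> \<cdot> alg_unit AA = of_nat N *\<^sub>a ident C (unit_ob C)"
proof -
  have a: "Fu\<dagger> = Fa (adj (Rep G) uu)" using F_adj[OF uu_Hom] by simp
  have h: "adj (Rep G) uu \<in> Hom (Rep G) fn I" using em_Hom by (simp add: Rep_simps)
  have "Fu\<dagger> \<cdot> Fu = Fa (scale_arr (Rep G) (of_nat N) (ident (Rep G) I))"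
    unfolding a using F_comp[OF uu_Hom h] by (simp add: Rep_simps em_norm urep_unit_def)
  also have "\<dots> = of_nat N *\<^sub>a ident C (Fo I)"
    using F_scale[OF Rep_ident[OF urep_unit_closed]] F_ident[of I] by (simp add: Rep_simps)
  finally have 1: "Fu\<dagger> \<cdot> Fu = of_nat N *\<^sub>a ident C (Fo I)" .
  show ?thesis by (simp add: AA_simps chain2[OF 1])
qed

text \<open>
  Full faithfulness reduces the claim to \<open>unit_intertwiner\<close>.
\<close>

lemma AA_connected: "connected_algebra C AA"
proof -
  interpret A: commutative_algebra C AA by (rule AA_commutative)
  have n: "(of_nat N :: complex) \<noteq> 0" using N_pos by simp
  show ?thesis
  proof
    show "alg_unit AA \<noteq> zero_arr C (unit_ob C) (alg_ob AA)"
    proof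
      assume z: "alg_unit AA = zero_arr C (unit_ob C) (alg_ob AA)"
      have "of_nat N *\<^sub>a ident C (unit_ob C) = zero_arr C (unit_ob C) (unit_ob C)"
        using AA_norm unfolding z by simp
      then show False using scale_eq_zeroD[OF _ ident_Hom[OF unit_Ob] n] unit_nonzero by simp
    qed
    show "Hom C (unit_ob C) (alg_ob AA) = range (\<lambda>c. c *\<^sub>a alg_unit AA)"
    proof
      show "range (\<lambda>c. c *\<^sub>a alg_unit AA) \<subseteq> Hom C (unit_ob C) (alg_ob AA)" by (auto simp: Hom_iff)
      show "Hom C (unit_ob C) (alg_ob AA) \<subseteq> range (\<lambda>c. c *\<^sub>a alg_unit AA)"
      proof
        fix f assume f: "f \<in> Hom C (unit_ob C) (alg_ob AA)"
        then have [simp]: "f \<in> Arr C" "source C f = unit_ob C" "target C f = Fo fn" by (simp_all add: Hom_iff AA_simps)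
        have "Fa ` Hom (Rep G) I fn = Hom C (Fo I) (Fo fn)"
          using fully_faithful[of I fn] by (simp add: bij_betw_def Rep_simps)
        moreover have "f \<cdot> F0\<dagger> \<in> Hom C (Fo I) (Fo fn)" by (simp add: Hom_iff)
        ultimately obtain h where h: "h \<in> Hom (Rep G) I fn" "f \<cdot> F0\<dagger> = Fa h" by blast
        obtain c where "h = scale_arr (Rep G) c uu" using unit_intertwiner[OF h(1)] by blast
        then have "f \<cdot> F0\<dagger> = c *\<^sub>a Fu" using h(2) F_scale[OF uu_Hom] by simp
        then have "(f \<cdot> F0\<dagger>) \<cdot> F0 = (c *\<^sub>a Fu) \<cdot> F0" by simp
        then have "f = c *\<^sub>a alg_unit AA" by (simp add: AA_simps)
        then show "f \<in> range (\<lambda>c. c *\<^sub>a alg_unit AA)" by blast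
      qed
    qed
  qed
qed

lemma act_unitary_arr: assumes g [simp]: "g \<in> carrier G" shows "unitary_arr C (\<alpha> g)"
proof -
  have a: "(Fa (aa g))\<dagger> = Fa (adj (Rep G) (aa g))" using F_adj[OF aa_Hom[OF g]] by simp
  have h: "adj (Rep G) (aa g) \<in> Hom (Rep G) fn fn" using Rep_adj[OF aa_Hom[OF g]] by (simp add: Rep_simps)
  have "Fa (adj (Rep G) (aa g)) \<cdot> Fa (aa g) = ident C (Fo fn)"
    using F_comp[OF aa_Hom[OF g] h] F_one[of fn] by (simp add: Rep_simps rperm_unitary[OF g])
  moreover have "Fa (aa g) \<cdot> Fa (adj (Rep G) (aa g)) = ident C (Fo fn)"
    using F_comp[OF h aa_Hom[OF g]] F_one[of fn] by (simp add: Rep_simps rperm_unitary[OF g])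
  ultimately show ?thesis unfolding act_eq[OF g] unitary_arr_def by (simp add: a)
qed

text \<open>
  Additivity of the embedding on Hom spaces, with the membership statement carried along because the
  embedding is only known to be additive on intertwiners.
\<close>

lemma act_sum_matrix:
  assumes "S \<subseteq> carrier G"
  shows "(fn, mat N N (\<lambda>(i, j). \<Sum>g\<in>S. if i = rperm g j then c g else 0), fn) \<in> Hom (Rep G) fn fn \<and>
    hsum (Fo fn) (Fo fn) (\<lambda>g. c g *\<^sub>a \<alpha> g) S = Fa (fn, mat N N (\<lambda>(i, j). \<Sum>g\<in>S. if i = rperm g j then c g else 0), fn)"
  using finite_subset[OF assms finite_carrier] assms
proof (induction S rule: finite_induct)
  case empty
  have z: "mat N N (\<lambda>(i, j). \<Sum>g\<in>{}. if i = rperm g j then c g else 0) = 0 \<cdot>\<^sub>m 1\<^sub>m N"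
    by (rule eq_matI) auto
  have "Fa (fn, 0 \<cdot>\<^sub>m 1\<^sub>m N, fn) = 0 *\<^sub>a ident C (Fo fn)"
    using F_scale[OF Rep_ident[OF fn_closed], of 0] F_ident[of fn] by (simp add: Rep_simps)
  then show ?case
    unfolding z using Rep_scale[OF ident_Hom'[OF fn_closed], of 0] by (simp add: hsum_empty)
next
  case (insert h S)
  let ?M = "\<lambda>S. mat N N (\<lambda>(i, j). \<Sum>g\<in>S. if i = rperm g j then c g else 0)"
  have h [simp]: "h \<in> carrier G" using insert by auto
  have IH: "(fn, ?M S, fn) \<in> Hom (Rep G) fn fn" "hsum (Fo fn) (Fo fn) (\<lambda>g. c g *\<^sub>a \<alpha> g) S = Fa (fn, ?M S, fn)"
    using insert by auto
  have M: "?M (insert h S) = c h \<cdot>\<^sub>m fmat N N (rperm h) + ?M S"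
    by (rule eq_matI) (use insert in auto)
  have hH: "(fn, c h \<cdot>\<^sub>m fmat N N (rperm h), fn) \<in> Hom (Rep G) fn fn"
    by (rule Rep_scale[OF aa_Hom[OF h]])
  have "Fa (fn, ?M (insert h S), fn) = Fa (fn, c h \<cdot>\<^sub>m fmat N N (rperm h), fn) \<^bold>+ Fa (fn, ?M S, fn)"
    unfolding M using F_add[OF hH IH(1)] by (simp add: Rep_simps)
  also have "Fa (fn, c h \<cdot>\<^sub>m fmat N N (rperm h), fn) = c h *\<^sub>a \<alpha> h"
    unfolding act_eq[OF h] using F_scale[OF aa_Hom[OF h], of "c h"] by (simp add: Rep_simps)
  also have "c h *\<^sub>a \<alpha> h \<^bold>+ Fa (fn, ?M S, fn) = hsum (Fo fn) (Fo fn) (\<lambda>g. c g *\<^sub>a \<alpha> g) (insert h S)"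
    unfolding IH(2)[symmetric] using insert by (subst hsum_insert) (auto simp: act_eq Hom_iff)
  finally show ?case unfolding M using Rep_add[OF hH IH(1)] by simp
qed

lemma ww_facts:
  assumes \<phi>: "\<phi> \<in> carrier (dual_group G)"
  shows "Fa (ww \<phi>) \<in> Hom C (Fo (character_rep G \<phi>)) (Fo fn)"
    "(Fa (ww \<phi>))\<dagger> \<cdot> Fa (ww \<phi>) = of_nat N *\<^sub>a ident C (Fo (character_rep G \<phi>))"
    "Fa (ww \<phi>) \<cdot> (Fa (ww \<phi>))\<dagger> = hsum (Fo fn) (Fo fn) (\<lambda>g. cnj (\<phi> g) *\<^sub>a \<alpha> g) (carrier G)"
proof -
  note W = ww_Hom[OF \<phi>]
  show "Fa (ww \<phi>) \<in> Hom C (Fo (character_rep G \<phi>)) (Fo fn)" by (rule F_Hom[OF W])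
  have a: "(Fa (ww \<phi>))\<dagger> = Fa (adj (Rep G) (ww \<phi>))" using F_adj[OF W] by simp
  have h: "adj (Rep G) (ww \<phi>) \<in> Hom (Rep G) fn (character_rep G \<phi>)"
    using Rep_adj[OF W[unfolded ww_def]] by (simp add: Rep_simps ww_def)
  have c: "character_rep G \<phi> \<in> ureps G" by (rule character_rep_closed[OF \<phi>])
  have "(Fa (ww \<phi>))\<dagger> \<cdot> Fa (ww \<phi>) = Fa (scale_arr (Rep G) (of_nat N) (ident (Rep G) (character_rep G \<phi>)))"
    unfolding a using F_comp[OF W h] wm_norm[OF \<phi>] by (simp add: Rep_simps ww_def character_rep_def)
  also have "\<dots> = of_nat N *\<^sub>a ident C (Fo (character_rep G \<phi>))"
    using F_scale[OF Rep_ident[OF c]] F_ident[of "character_rep G \<phi>"] c by (simp add: Rep_simps)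
  finally show "(Fa (ww \<phi>))\<dagger> \<cdot> Fa (ww \<phi>) = of_nat N *\<^sub>a ident C (Fo (character_rep G \<phi>))" .
  have "Fa (ww \<phi>) \<cdot> (Fa (ww \<phi>))\<dagger> = Fa (fn, wm \<phi> * mat_adjoint (wm \<phi>), fn)"
    unfolding a using F_comp[OF h W] by (simp add: Rep_simps ww_def)
  then show "Fa (ww \<phi>) \<cdot> (Fa (ww \<phi>))\<dagger> = hsum (Fo fn) (Fo fn) (\<lambda>g. cnj (\<phi> g) *\<^sub>a \<alpha> g) (carrier G)"
    using act_sum_matrix[of "carrier G" "\<lambda>g. cnj (\<phi> g)"] unfolding wm_sum[OF \<phi>] by simp
qed

text \<open>
  The Galois element \<open>\<Sum> \<delta>\<^sub>g \<otimes> \<delta>\<^sub>g\<close> of the image algebra.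
\<close>

definition tB where "tB = (F2 fn fn)\<dagger> \<cdot> Fa tt \<cdot> F0"

lemma mult_act_tB:
  assumes g [simp]: "g \<in> carrier G"
  shows "alg_mult AA \<cdot> (Fo fn \<triangleright> \<alpha> g) \<cdot> tB = (if g = \<one>\<^bsub>G\<^esub> then alg_unit AA else zero_arr C (unit_ob C) (Fo fn))"
proof -
  let ?k = "(fn2, kron (1\<^sub>m N) (fmat N N (rperm g)), fn2)"
  have h: "?k \<in> Hom (Rep G) fn2 fn2" using F_tensor_left[OF aa_Hom[OF g] fn_closed] by simp
  note [simp] = F_simps[OF h]
  have 1: "F2 fn fn \<cdot> (Fo fn \<triangleright> Fa (aa g)) = Fa ?k \<cdot> F2 fn fn" using F_nat_left[OF aa_Hom[OF g] fn_closed] by simp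
  have "alg_mult AA \<cdot> (Fo fn \<triangleright> \<alpha> g) \<cdot> tB = Fm \<cdot> (F2 fn fn \<cdot> (Fo fn \<triangleright> Fa (aa g))) \<cdot> (F2 fn fn)\<dagger> \<cdot> Fa tt \<cdot> F0"
    by (simp add: AA_simps tB_def act_eq)
  also have "\<dots> = (Fm \<cdot> (Fa ?k \<cdot> Fa tt)) \<cdot> F0" unfolding 1 by (simp add: chain2[OF F2_simps(5)])
  also have "Fa ?k \<cdot> Fa tt = Fa (I, kron (1\<^sub>m N) (fmat N N (rperm g)) * (dm * mat_adjoint em), fn2)"
    using F_comp[OF tt_Hom h] by (simp add: Rep_simps)
  also have "Fm \<cdot> \<dots> = Fa (I, if g = \<one>\<^bsub>G\<^esub> then mat_adjoint em else 0\<^sub>m N 1, fn)"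
    using F_comp[OF Rep_cmp[OF tt_Hom h] mm_Hom] mult_act_tt[OF g] by (simp add: Rep_simps)
  also have "\<dots> = (if g = \<one>\<^bsub>G\<^esub> then Fu else zero_arr C (Fo I) (Fo fn))"
  proof -
    have "0\<^sub>m N 1 = 0 \<cdot>\<^sub>m mat_adjoint em" by (rule eq_matI) (auto simp: em_def)
    then have "Fa (I, 0\<^sub>m N 1, fn) = 0 *\<^sub>a Fu" using F_scale[OF uu_Hom, of 0] by (simp add: Rep_simps)
    then show ?thesis by simp
  qed
  finally show ?thesis by (simp add: AA_simps)
qed

lemma tB_dual: "lunit C (Fo fn) \<cdot> ((alg_unit AA)\<dagger> \<triangleleft> Fo fn) \<cdot> merge (Fo fn) (Fo fn) (alg_mult AA) (Fo fn)
    \<cdot> (Fo fn \<triangleright> tB) \<cdot> (runit C (Fo fn))\<dagger> = ident C (Fo fn)"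
proof -
  let ?A = "Fo fn"
  let ?m1 = "(urep_tensor G fn fn2, kron (mat_adjoint dm) (1\<^sub>m N), fn2)"
  let ?t1 = "(fn, kron (1\<^sub>m N) (dm * mat_adjoint em), urep_tensor G fn fn2)"
  let ?u1 = "(fn2, kron em (1\<^sub>m N), fn)"
  have hm: "?m1 \<in> Hom (Rep G) (urep_tensor G fn fn2) fn2"
    using F_tensor_right[OF mm_Hom fn_closed] by (simp add: urep_tensor_assoc)
  have ht: "?t1 \<in> Hom (Rep G) fn (urep_tensor G fn fn2)"
    using F_tensor_left[OF tt_Hom fn_closed] by (simp add: urep_tensor_unit)
  have hu: "?u1 \<in> Hom (Rep G) fn2 fn"
    using F_tensor_right[OF em_Hom fn_closed] by (simp add: urep_tensor_unit)
  note [simp] = F_simps[OF hm] F_simps[OF ht] F_simps[OF hu] urep_tensor_unit urep_tensor_assoc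
  have fu: "Fu\<dagger> = Fa (fn, em, I)" using F_adj[OF uu_Hom] by (simp add: Rep_simps)
  have [simp]: "Fa (fn, em, I) \<in> Arr C" "source C (Fa (fn, em, I)) = ?A" "target C (Fa (fn, em, I)) = Fo I"
    by (rule F_simps[OF em_Hom])+
  have n_t: "(?A \<triangleright> Fa tt) \<cdot> (F2 fn I)\<dagger> = (F2 fn fn2)\<dagger> \<cdot> Fa ?t1"
  proof -
    have "F2 fn fn2 \<cdot> (?A \<triangleright> Fa tt) = Fa ?t1 \<cdot> F2 fn I" using F_nat_left[OF tt_Hom fn_closed] by simp
    then have "(F2 fn fn2)\<dagger> \<cdot> (F2 fn fn2 \<cdot> (?A \<triangleright> Fa tt)) \<cdot> (F2 fn I)\<dagger> = (F2 fn fn2)\<dagger> \<cdot> (Fa ?t1 \<cdot> F2 fn I) \<cdot> (F2 fn I)\<dagger>" by simp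
    then show ?thesis using chain2[OF F2_simps(4)[of fn fn2]] F2_simps(5)[of fn I] by simp
  qed
  have n_m: "(Fm \<triangleleft> ?A) \<cdot> (F2 fn2 fn)\<dagger> = (F2 fn fn)\<dagger> \<cdot> Fa ?m1"
  proof -
    have "F2 fn fn \<cdot> (Fm \<triangleleft> ?A) = Fa ?m1 \<cdot> F2 fn2 fn" using F_nat_right[OF mm_Hom fn_closed] by simp
    then have "(F2 fn fn)\<dagger> \<cdot> (F2 fn fn \<cdot> (Fm \<triangleleft> ?A)) \<cdot> (F2 fn2 fn)\<dagger> = (F2 fn fn)\<dagger> \<cdot> (Fa ?m1 \<cdot> F2 fn2 fn) \<cdot> (F2 fn2 fn)\<dagger>" by simp
    then show ?thesis using chain2[OF F2_simps(4)[of fn fn]] F2_simps(5)[of fn2 fn] by simp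
  qed
  have n_u: "(Fa (fn, em, I) \<triangleleft> ?A) \<cdot> (F2 fn fn)\<dagger> = (F2 I fn)\<dagger> \<cdot> Fa ?u1"
  proof -
    have "F2 I fn \<cdot> (Fa (fn, em, I) \<triangleleft> ?A) = Fa ?u1 \<cdot> F2 fn fn" using F_nat_right[OF em_Hom fn_closed] by simp
    then have "(F2 I fn)\<dagger> \<cdot> (F2 I fn \<cdot> (Fa (fn, em, I) \<triangleleft> ?A)) \<cdot> (F2 fn fn)\<dagger> = (F2 I fn)\<dagger> \<cdot> (Fa ?u1 \<cdot> F2 fn fn) \<cdot> (F2 fn fn)\<dagger>" by simp
    then show ?thesis using chain2[OF F2_simps(4)[of I fn]] F2_simps(5)[of fn fn] by simp
  qed
  have r: "(?A \<triangleright> F0) \<cdot> (runit C ?A)\<dagger> = (F2 fn I)\<dagger>"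
  proof -
    have e0: "(?A \<triangleright> F0) \<cdot> (?A \<triangleright> F0\<dagger>) = ident C (?A \<star> Fo I)" by (simp flip: lwhisk_cmp)
    have "(?A \<triangleright> F0) \<cdot> (F2 fn I \<cdot> (?A \<triangleright> F0))\<dagger> = (F2 fn I)\<dagger>" by (simp add: chain2[OF e0])
    then show ?thesis unfolding F_unit_right .
  qed
  have l: "(F0\<dagger> \<triangleleft> ?A) \<cdot> (F2 I fn)\<dagger> = (lunit C ?A)\<dagger>"
  proof -
    have "(F2 I fn \<cdot> (F0 \<triangleleft> ?A))\<dagger> = (lunit C ?A)\<dagger>" unfolding F_unit_left ..
    then show ?thesis by simp
  qed
  have as: "(F2 fn fn \<triangleleft> ?A) \<cdot> (assr C ?A ?A ?A)\<dagger> \<cdot> (?A \<triangleright> (F2 fn fn)\<dagger>) \<cdot> (F2 fn fn2)\<dagger> = (F2 fn2 fn)\<dagger>"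
  proof -
    have e0: "(F2 fn fn \<triangleleft> ?A) \<cdot> ((F2 fn fn)\<dagger> \<triangleleft> ?A) = ident C (Fo fn2 \<star> ?A)" by (simp flip: rwhisk_cmp)
    have "(F2 fn fn \<triangleleft> ?A) \<cdot> (F2 fn2 fn \<cdot> (F2 fn fn \<triangleleft> ?A))\<dagger> = (F2 fn2 fn)\<dagger>" by (simp add: chain2[OF e0])
    then show ?thesis unfolding F_assoc by simp
  qed
  have c1: "Fa ?m1 \<cdot> Fa ?t1 = Fa (fn, kron (mat_adjoint dm) (1\<^sub>m N) * kron (1\<^sub>m N) (dm * mat_adjoint em), fn2)"
    using F_comp[OF ht hm] by (simp add: Rep_simps)
  have c2: "Fa ?u1 \<cdot> (Fa ?m1 \<cdot> Fa ?t1) = ident C ?A"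
    unfolding c1 using F_comp[OF Rep_cmp[OF ht hm] hu] F_one[of fn] tt_dual by (simp add: Rep_simps)
  have "(?A \<triangleright> tB) \<cdot> (runit C ?A)\<dagger> = (?A \<triangleright> (F2 fn fn)\<dagger>) \<cdot> (?A \<triangleright> Fa tt) \<cdot> ((?A \<triangleright> F0) \<cdot> (runit C ?A)\<dagger>)"
    by (simp add: tB_def)
  also have "\<dots> = (?A \<triangleright> (F2 fn fn)\<dagger>) \<cdot> (F2 fn fn2)\<dagger> \<cdot> Fa ?t1" unfolding r n_t ..
  finally have s: "(?A \<triangleright> tB) \<cdot> (runit C ?A)\<dagger> = (?A \<triangleright> (F2 fn fn)\<dagger>) \<cdot> (F2 fn fn2)\<dagger> \<cdot> Fa ?t1" .
  have "merge ?A ?A (alg_mult AA) ?A \<cdot> (?A \<triangleright> tB) \<cdot> (runit C ?A)\<dagger>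
      = (Fm \<triangleleft> ?A) \<cdot> ((F2 fn fn \<triangleleft> ?A) \<cdot> (assr C ?A ?A ?A)\<dagger> \<cdot> (?A \<triangleright> (F2 fn fn)\<dagger>) \<cdot> (F2 fn fn2)\<dagger>) \<cdot> Fa ?t1"
    unfolding s by (simp add: merge_def AA_simps)
  also have "\<dots> = ((Fm \<triangleleft> ?A) \<cdot> (F2 fn2 fn)\<dagger>) \<cdot> Fa ?t1" unfolding as by simp
  also have "\<dots> = (F2 fn fn)\<dagger> \<cdot> Fa ?m1 \<cdot> Fa ?t1" unfolding n_m by simp
  finally have m: "merge ?A ?A (alg_mult AA) ?A \<cdot> (?A \<triangleright> tB) \<cdot> (runit C ?A)\<dagger> = (F2 fn fn)\<dagger> \<cdot> Fa ?m1 \<cdot> Fa ?t1" .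
  have "lunit C ?A \<cdot> ((alg_unit AA)\<dagger> \<triangleleft> ?A) \<cdot> (merge ?A ?A (alg_mult AA) ?A \<cdot> (?A \<triangleright> tB) \<cdot> (runit C ?A)\<dagger>)
      = lunit C ?A \<cdot> (F0\<dagger> \<triangleleft> ?A) \<cdot> ((Fa (fn, em, I) \<triangleleft> ?A) \<cdot> (F2 fn fn)\<dagger>) \<cdot> (Fa ?m1 \<cdot> Fa ?t1)"
    unfolding m by (simp add: AA_simps fu)
  also have "\<dots> = lunit C ?A \<cdot> ((F0\<dagger> \<triangleleft> ?A) \<cdot> (F2 I fn)\<dagger>) \<cdot> (Fa ?u1 \<cdot> (Fa ?m1 \<cdot> Fa ?t1))"
    unfolding n_u by simp
  also have "\<dots> = ident C ?A" unfolding l c2 by simp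
  finally show ?thesis .
qed

end


section \<open>The exact sequence\<close>

lemma dual_group_group:
  assumes "group G" shows "group (dual_group G)"
proof -
  interpret group G by (rule assms)
  have D: "\<phi> \<in> carrier (dual_group G) \<longleftrightarrow> \<phi> \<in> extensional (carrier G) \<and> (\<forall>g\<in>carrier G. cmod (\<phi> g) = 1)
      \<and> (\<forall>g\<in>carrier G. \<forall>h\<in>carrier G. \<phi> (g \<otimes>\<^bsub>G\<^esub> h) = \<phi> g * \<phi> h)" for \<phi> :: "'a \<Rightarrow> complex"
    by (auto simp: dual_group_def U1_def hom_def)
  show ?thesis
  proof (rule groupI)
    fix \<phi> \<psi> :: "'a \<Rightarrow> complex"
    assume "\<phi> \<in> carrier (dual_group G)" "\<psi> \<in> carrier (dual_group G)"
    then show "\<phi> \<otimes>\<^bsub>dual_group G\<^esub> \<psi> \<in> carrier (dual_group G)"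
      unfolding D by (auto simp: dual_group_def norm_mult)
  next
    show "\<one>\<^bsub>dual_group G\<^esub> \<in> carrier (dual_group G)" unfolding D by (auto simp: dual_group_def)
  next
    fix \<phi> \<psi> \<chi> :: "'a \<Rightarrow> complex"
    show "\<phi> \<otimes>\<^bsub>dual_group G\<^esub> \<psi> \<otimes>\<^bsub>dual_group G\<^esub> \<chi> = \<phi> \<otimes>\<^bsub>dual_group G\<^esub> (\<psi> \<otimes>\<^bsub>dual_group G\<^esub> \<chi>)"
      by (auto simp: dual_group_def fun_eq_iff restrict_def)
  next
    fix \<phi> :: "'a \<Rightarrow> complex" assume \<phi>: "\<phi> \<in> carrier (dual_group G)"
    show "\<one>\<^bsub>dual_group G\<^esub> \<otimes>\<^bsub>dual_group G\<^esub> \<phi> = \<phi>"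
      using \<phi> by (auto simp: dual_group_def fun_eq_iff restrict_def extensional_def)
    show "\<exists>\<psi>\<in>carrier (dual_group G). \<psi> \<otimes>\<^bsub>dual_group G\<^esub> \<phi> = \<one>\<^bsub>dual_group G\<^esub>"
    proof (rule bexI[of _ "\<lambda>g\<in>carrier G. cnj (\<phi> g)"])
      show "(\<lambda>g\<in>carrier G. cnj (\<phi> g)) \<otimes>\<^bsub>dual_group G\<^esub> \<phi> = \<one>\<^bsub>dual_group G\<^esub>"
        using dual_groupD(2)[OF \<phi>] by (auto simp: dual_group_def fun_eq_iff restrict_def)
      show "(\<lambda>g\<in>carrier G. cnj (\<phi> g)) \<in> carrier (dual_group G)"
        using \<phi> unfolding D by auto
    qed
  qed
qed

context rep_embedding
begin

text \<open>
  The identity \<open>act_sum\<close> is the case of the trivial character in \<open>w_sum\<close>, since the unit of \<open>Fun(G)\<close>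
  is the corresponding invariant vector.
\<close>

lemma galois: "galois_algebra C AA G \<alpha> tB (\<lambda>\<phi>. Fo (character_rep G \<phi>)) (\<lambda>\<phi>. Fa (ww \<phi>))"
proof -
  interpret A: connected_algebra C AA by (rule AA_connected)
  show ?thesis
  proof
    show "finite (carrier G)" by (rule finite_carrier)
    show "(alg_unit AA)\<dagger> \<cdot> alg_unit AA = of_nat (card (carrier G)) *\<^sub>a ident C (unit_ob C)" by (rule AA_norm)
    show "tB \<in> Hom C (unit_ob C) (alg_ob AA \<star> alg_ob AA)"
      by (simp add: tB_def AA_simps Hom_iff)
    show "lunit C (alg_ob AA) \<cdot> ((alg_unit AA)\<dagger> \<triangleleft> alg_ob AA) \<cdot> merge (alg_ob AA) (alg_ob AA) (alg_mult AA) (alg_ob AA)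
        \<cdot> (alg_ob AA \<triangleright> tB) \<cdot> (runit C (alg_ob AA))\<dagger> = ident C (alg_ob AA)"
      using tB_dual by (simp only: AA_simps(1))
    have one: "(\<lambda>g\<in>carrier G. 1) \<in> carrier (dual_group G)"
      using group.is_monoid[OF dual_group_group[OF group_axioms]] monoid.one_closed[of "dual_group G"]
      by (simp add: dual_group_def)
    have "hsum (alg_ob AA) (alg_ob AA) \<alpha> (carrier G)
        = hsum (Fo fn) (Fo fn) (\<lambda>g. cnj ((\<lambda>g\<in>carrier G. 1) g) *\<^sub>a \<alpha> g) (carrier G)"
      unfolding AA_simps(1) by (rule hsum_cong) (auto simp: act_eq Hom_iff)
    also have "\<dots> = Fa (ww (\<lambda>g\<in>carrier G. 1)) \<cdot> (Fa (ww (\<lambda>g\<in>carrier G. 1)))\<dagger>"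
      by (rule ww_facts(3)[OF one, symmetric])
    also have "ww (\<lambda>g\<in>carrier G. 1) = uu"
    proof -
      have "wm (\<lambda>g\<in>carrier G. 1) = mat_adjoint em" by (rule eq_matI) (auto simp: em_def)
      then show ?thesis by (simp add: ww_def character_rep_one)
    qed
    also have "Fu \<cdot> Fu\<dagger> = alg_unit AA \<cdot> (alg_unit AA)\<dagger>"
      by (simp add: AA_simps chain2[OF F0_simps(5)])
    finally show "hsum (alg_ob AA) (alg_ob AA) \<alpha> (carrier G) = alg_unit AA \<cdot> (alg_unit AA)\<dagger>" .
  next
    fix g assume g [simp]: "g \<in> carrier G"
    show "\<alpha> g \<in> Hom C (alg_ob AA) (alg_ob AA)" by (simp add: act_eq AA_simps Hom_iff)
    show "unitary_arr C (\<alpha> g)" by (rule act_unitary_arr[OF g])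
    let ?k = "(fn2, kron (fmat N N (rperm g)) (fmat N N (rperm g)), fn2)"
    have h: "?k \<in> Hom (Rep G) fn2 fn2" by (rule Rep_tensor[OF aa_Hom[OF g] aa_Hom[OF g]])
    note [simp] = F_simps[OF h]
    have 1: "Fa (aa g) \<cdot> Fm = Fm \<cdot> Fa ?k"
      using F_comp[OF mm_Hom aa_Hom[OF g]] F_comp[OF h mm_Hom] rperm_mult_alg[OF g] by (simp add: Rep_simps)
    have 2: "Fa ?k \<cdot> F2 fn fn = F2 fn fn \<cdot> (Fa (aa g) \<diamondop> Fa (aa g))"
      by (rule F_nat[OF aa_Hom[OF g] aa_Hom[OF g], symmetric])
    have "\<alpha> g \<cdot> alg_mult AA = (Fa (aa g) \<cdot> Fm) \<cdot> F2 fn fn" by (simp add: act_eq AA_simps)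
    also have "\<dots> = Fm \<cdot> (Fa ?k \<cdot> F2 fn fn)" unfolding 1 by simp
    also have "\<dots> = alg_mult AA \<cdot> (\<alpha> g \<diamondop> \<alpha> g)" unfolding 2 by (simp add: act_eq AA_simps)
    finally show "\<alpha> g \<cdot> alg_mult AA = alg_mult AA \<cdot> (\<alpha> g \<diamondop> \<alpha> g)" .
    have 3: "Fa (aa g) \<cdot> Fu = Fu"
      using F_comp[OF uu_Hom aa_Hom[OF g]] rperm_unit[OF g] by (simp add: Rep_simps)
    show "\<alpha> g \<cdot> alg_unit AA = alg_unit AA"
      by (simp add: act_eq AA_simps chain2[OF 3])
    show "alg_mult AA \<cdot> (alg_ob AA \<triangleright> \<alpha> g) \<cdot> tB
        = (if g = \<one>\<^bsub>G\<^esub> then alg_unit AA else zero_arr C (unit_ob C) (alg_ob AA))"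
      using mult_act_tB[OF g] by (simp only: AA_simps(1))
    fix h assume h [simp]: "h \<in> carrier G"
    show "\<alpha> g \<cdot> \<alpha> h = \<alpha> (h \<otimes>\<^bsub>G\<^esub> g)"
      using F_comp[OF aa_Hom[OF h] aa_Hom[OF g]] rperm_mult[OF g h] by (simp add: act_eq Rep_simps)
  next
    fix \<phi> :: "'g \<Rightarrow> complex" assume \<phi>: "\<phi> \<in> carrier (dual_group G)"
    show "Fa (ww \<phi>) \<in> Hom C (Fo (character_rep G \<phi>)) (alg_ob AA)"
      using ww_facts(1)[OF \<phi>] by (simp only: AA_simps(1))
    show "(Fa (ww \<phi>))\<dagger> \<cdot> Fa (ww \<phi>) = of_nat (card (carrier G)) *\<^sub>a ident C (Fo (character_rep G \<phi>))"
      by (rule ww_facts(2)[OF \<phi>])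
    show "Fa (ww \<phi>) \<cdot> (Fa (ww \<phi>))\<dagger> = hsum (alg_ob AA) (alg_ob AA) (\<lambda>g. cnj (\<phi> g) *\<^sub>a \<alpha> g) (carrier G)"
      using ww_facts(3)[OF \<phi>] by (simp only: AA_simps(1))
  qed
qed

interpretation A: galois_algebra C AA G \<alpha> tB "\<lambda>\<phi>. Fo (character_rep G \<phi>)" "\<lambda>\<phi>. Fa (ww \<phi>)"
  by (rule galois)

lemma act_ob_eq: "act_ob G C F g (Y, \<rho>) = (Y, \<rho> \<cdot> (Y \<triangleright> \<alpha> g))"
  by (simp add: act_ob_def)

text \<open>
  The two notions differ only in that morphisms of modules carry their source and target. The
  translations reverse products, and so the twisted modules compose in the order of the group.
\<close>

lemma equivariant_iff:
  assumes Y: "(Y, \<rho>) \<in> right_modules C AA"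
  shows "(\<exists>v. unitary_equivariant_structure G C F (Y, \<rho>) v) \<longleftrightarrow> A.equivariant (Y, \<rho>)"
proof
  note [simp] = A.moduleD(1-4)[OF Y] act_ob_eq deequivariantization_def
  assume "\<exists>v. unitary_equivariant_structure G C F (Y, \<rho>) v"
  then obtain v where v: "\<And>g. g \<in> carrier G \<Longrightarrow> v g \<in> Hom A.\<M> (Y, \<rho> \<cdot> (Y \<triangleright> \<alpha> g)) (Y, \<rho>)"
    "\<And>g. g \<in> carrier G \<Longrightarrow> unitary_arr C (fst (snd (v g)))"
    "\<And>g h. g \<in> carrier G \<Longrightarrow> h \<in> carrier G \<Longrightarrow> v (g \<otimes>\<^bsub>G\<^esub> h) = cmp A.\<M> (v g) (act_arr G C F g (v h))"
    unfolding unitary_equivariant_structure_def by auto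
  define V where "V g = fst (snd (v g))" for g
  have vV: "v g = ((Y, \<rho> \<cdot> (Y \<triangleright> \<alpha> g)), V g, (Y, \<rho>))" "V g \<in> module_maps C AA (Y, \<rho> \<cdot> (Y \<triangleright> \<alpha> g)) (Y, \<rho>)"
    if "g \<in> carrier G" for g
    using v(1)[OF that] unfolding A.Module_Hom V_def by auto
  show "A.equivariant (Y, \<rho>)"
    unfolding A.equivariant_def
  proof (intro exI[of _ V] conjI ballI)
    fix g assume g [simp]: "g \<in> carrier G"
    note m = A.module_mapD[OF vV(2)[OF g]]
    show "V g \<in> Hom C (fst (Y, \<rho>)) (fst (Y, \<rho>))" using m(1-3) by (simp add: Hom_iff)
    show "V g \<cdot> snd (Y, \<rho>) \<cdot> (fst (Y, \<rho>) \<triangleright> \<alpha> g) = snd (Y, \<rho>) \<cdot> (V g \<triangleleft> alg_ob AA)"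
      using m(4) by simp
    show "unitary_arr C (V g)" using v(2)[OF g] by (simp add: V_def)
    fix h assume h: "h \<in> carrier G"
    have "v (g \<otimes>\<^bsub>G\<^esub> h) = cmp A.\<M> (v g) (act_arr G C F g (v h))" by (rule v(3)[OF g h])
    then show "V (g \<otimes>\<^bsub>G\<^esub> h) = V g \<cdot> V h"
      using vV(1)[OF g] vV(1)[OF h] vV(1)[of "g \<otimes>\<^bsub>G\<^esub> h"] h by (simp add: act_arr_def A.Module_cmp)
  qed
next
  note [simp] = A.moduleD(1-4)[OF Y] act_ob_eq deequivariantization_def
  assume "A.equivariant (Y, \<rho>)"
  then obtain V where V: "\<And>g. g \<in> carrier G \<Longrightarrow> V g \<in> Hom C Y Y"
    "\<And>g. g \<in> carrier G \<Longrightarrow> V g \<cdot> \<rho> \<cdot> (Y \<triangleright> \<alpha> g) = \<rho> \<cdot> (V g \<triangleleft> alg_ob AA)"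
    "\<And>g. g \<in> carrier G \<Longrightarrow> unitary_arr C (V g)"
    "\<And>g h. g \<in> carrier G \<Longrightarrow> h \<in> carrier G \<Longrightarrow> V (g \<otimes>\<^bsub>G\<^esub> h) = V g \<cdot> V h"
    unfolding A.equivariant_def by auto
  define v where "v g = ((Y, \<rho> \<cdot> (Y \<triangleright> \<alpha> g)), V g, (Y, \<rho>))" for g
  have "unitary_equivariant_structure G C F (Y, \<rho>) v"
    unfolding unitary_equivariant_structure_def
  proof (intro conjI ballI)
    fix g assume g [simp]: "g \<in> carrier G"
    have "V g \<in> module_maps C AA (Y, \<rho> \<cdot> (Y \<triangleright> \<alpha> g)) (Y, \<rho>)"
      using V(1,2)[OF g] by (simp add: module_maps_def)
    then show "v g \<in> Hom (deequivariantization G C F) (act_ob G C F g (Y, \<rho>)) (Y, \<rho>)"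
      using A.twisted_module[OF Y g] Y by (auto simp: A.Module_Hom v_def)
    show "unitary_arr C (fst (snd (v g)))" using V(3)[OF g] by (simp add: v_def)
    fix h assume h [simp]: "h \<in> carrier G"
    have "\<alpha> h \<cdot> \<alpha> g = \<alpha> (g \<otimes>\<^bsub>G\<^esub> h)" by (rule A.act_comp[OF h g])
    then have "(\<rho> \<cdot> (Y \<triangleright> \<alpha> h)) \<cdot> (Y \<triangleright> \<alpha> g) = \<rho> \<cdot> (Y \<triangleright> \<alpha> (g \<otimes>\<^bsub>G\<^esub> h))"
      using lwhisk_cmp[of "\<alpha> g" "\<alpha> h" Y] by (simp add: act_eq AA_simps)
    then show "v (g \<otimes>\<^bsub>G\<^esub> h) = v g \<cdot>\<^bsub>deequivariantization G C F\<^esub> act_arr G C F g (v h)"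
      using V(4)[OF g h] by (simp add: v_def act_arr_def A.Module_cmp del: assoc)
  qed
  then show "\<exists>v. unitary_equivariant_structure G C F (Y, \<rho>) v" by blast
qed

lemma Inv_lift_eq: "Inv_lift G C F = A.lift_group"
proof -
  have "(\<exists>v. unitary_equivariant_structure G C F y v) \<longleftrightarrow> A.equivariant y" if "invertible_ob A.\<M> y" for y
    using that equivariant_iff[of "fst y" "snd y"] by (simp add: invertible_ob_def A.Module_simps)
  then have "{iso_class A.\<M> y | y. invertible_ob A.\<M> y \<and> (\<exists>v. unitary_equivariant_structure G C F y v)}
      = {iso_class A.\<M> y | y. invertible_ob A.\<M> y \<and> A.equivariant y}" by blast
  then show ?thesis by (simp add: Inv_lift_def A.lift_group_def deequivariantization_def)
qed

lemma free_module_map_eq: "free_module_map G C F = A.free_map"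
  by (rule ext) (simp add: free_module_map_def A.free_map_def deequivariantization_def)

lemma character_tensor:
  assumes "\<phi> \<in> carrier (dual_group G)" "\<psi> \<in> carrier (dual_group G)"
  shows "iso_ob C (Fo (character_rep G \<phi>) \<star> Fo (character_rep G \<psi>)) (Fo (character_rep G (\<phi> \<otimes>\<^bsub>dual_group G\<^esub> \<psi>)))"
proof -
  note [simp] = character_rep_closed[OF assms(1)] character_rep_closed[OF assms(2)]
  have "inverse_arrs (F2 (character_rep G \<phi>) (character_rep G \<psi>)) ((F2 (character_rep G \<phi>) (character_rep G \<psi>))\<dagger>)"
    by (simp add: inverse_arrs_def)
  from iso_obI[OF this] show ?thesis by (simp add: character_rep_mult dual_group_def)
qed

lemma character_invertible:
  assumes \<phi>: "\<phi> \<in> carrier (dual_group G)" shows "invertible_ob C (Fo (character_rep G \<phi>))"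
proof -
  interpret D: group "dual_group G" by (rule dual_group_group[OF group_axioms])
  let ?\<psi> = "inv\<^bsub>dual_group G\<^esub> \<phi>"
  have \<psi>: "?\<psi> \<in> carrier (dual_group G)" by (rule D.inv_closed[OF \<phi>])
  have "\<phi> \<otimes>\<^bsub>dual_group G\<^esub> ?\<psi> = (\<lambda>g\<in>carrier G. 1)" using D.r_inv[OF \<phi>] by (simp add: dual_group_def)
  then have "iso_ob C (Fo (character_rep G \<phi>) \<star> Fo (character_rep G ?\<psi>)) (Fo I)"
    using character_tensor[OF \<phi> \<psi>] by (simp add: character_rep_one)
  moreover have "iso_ob C (Fo I) (unit_ob C)"
    using iso_obI[of "F0\<dagger>" F0] by (simp add: inverse_arrs_def)
  ultimately show ?thesis
    using iso_ob_trans character_rep_closed[OF \<phi>] character_rep_closed[OF \<psi>]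
    by (intro invertibleI[of _ "Fo (character_rep G ?\<psi>)"]) auto
qed

text \<open>
  An isomorphism of the images lifts to intertwiners between one-dimensional representations. An
  invertible one is a nonzero number, which forces the characters to agree.
\<close>

lemma character_inj:
  assumes \<phi>: "\<phi> \<in> carrier (dual_group G)" and \<psi>: "\<psi> \<in> carrier (dual_group G)"
    and iso: "iso_ob C (Fo (character_rep G \<phi>)) (Fo (character_rep G \<psi>))"
  shows "\<phi> = \<psi>"
proof -
  let ?V = "character_rep G \<phi>" and ?W = "character_rep G \<psi>"
  have V: "?V \<in> ureps G" "?W \<in> ureps G" using character_rep_closed \<phi> \<psi> by auto
  obtain f f' where f: "f \<in> Hom C (Fo ?V) (Fo ?W)" "f' \<in> Hom C (Fo ?W) (Fo ?V)" "f' \<cdot> f = ident C (Fo ?V)"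
    using iso unfolding iso_ob_def by blast
  have full: "Fa ` Hom (Rep G) X Z = Hom C (Fo X) (Fo Z)" "inj_on Fa (Hom (Rep G) X Z)"
    if "X \<in> ureps G" "Z \<in> ureps G" for X Z
    using fully_faithful[of X Z] that by (auto simp: bij_betw_def Rep_simps)
  obtain h h' where h: "h \<in> Hom (Rep G) ?V ?W" "f = Fa h" "h' \<in> Hom (Rep G) ?W ?V" "f' = Fa h'"
    using f(1,2) full(1)[OF V] full(1)[OF V(2,1)] by blast
  obtain T T' where T: "h = (?V, T, ?W)" "T \<in> intertwiners G ?V ?W" "h' = (?W, T', ?V)" "T' \<in> intertwiners G ?W ?V"
    using h(1,3) unfolding Rep_Hom by blast
  have hh: "(?V, T, ?W) \<in> Hom (Rep G) ?V ?W" "(?W, T', ?V) \<in> Hom (Rep G) ?W ?V"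
    using h(1,3) unfolding T(1,3) .
  have "Fa (?V, T' * T, ?V) = Fa (?V, 1\<^sub>m (fst ?V), ?V)"
    using F_comp[OF hh] f(3) h(2,4) F_one[OF V(1)] by (simp add: T(1,3) Rep_simps)
  from inj_onD[OF full(2)[OF V(1) V(1)] this Rep_cmp[OF hh] ident_Hom'[OF V(1)]]
  have TT: "T' * T = 1\<^sub>m 1" by (simp add: character_rep_def)
  have c: "T \<in> carrier_mat 1 1" "T' \<in> carrier_mat 1 1" using T by (auto simp: intertwiners_def character_rep_def)
  have "(T' * T) $$ (0, 0) = 1" by (simp add: TT)
  then have t: "T $$ (0, 0) \<noteq> 0" using c by (auto simp: scalar_prod_def)
  show ?thesis
  proof (rule extensionalityI[of _ "carrier G"])
    show "\<phi> \<in> extensional (carrier G)" "\<psi> \<in> extensional (carrier G)" using \<phi> \<psi> by (auto simp: dual_group_def)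
    fix g assume g: "g \<in> carrier G"
    have "T * snd ?V g = snd ?W g * T" using T(2) g by (auto simp: intertwiners_def)
    then have "(T * snd ?V g) $$ (0, 0) = (snd ?W g * T) $$ (0, 0)" by simp
    then have "T $$ (0, 0) * \<phi> g = \<psi> g * T $$ (0, 0)"
      using c g by (simp add: character_rep_def scalar_prod_def)
    then show "\<phi> g = \<psi> g" using t by simp
  qed
qed

lemma exact_sequence: "short_exact (dual_group G) (Inv C) (Inv_lift G C F) (character_map G C F) (free_module_map G C F)"
  unfolding short_exact_def Inv_lift_eq free_module_map_eq
proof (intro conjI)
  show "group (dual_group G)" by (rule dual_group_group[OF group_axioms])
  show "group (Inv C)" by (rule Inv_group)
  show "group A.lift_group" by (rule A.lift_group)
  show "A.free_map \<in> epi (Inv C) A.lift_group" by (rule A.free_map_epi)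
  have m: "character_map G C F \<phi> = iso_class C (Fo (character_rep G \<phi>))" for \<phi> by (simp add: character_map_def)
  show "character_map G C F ` carrier (dual_group G) = kernel (Inv C) A.lift_group A.free_map"
    using A.free_map_kernel[OF character_invertible] by (simp add: m)
  show "character_map G C F \<in> mon (dual_group G) (Inv C)"
    unfolding mon_def hom_def mem_Collect_eq
  proof (intro conjI inj_onI ballI funcsetI)
    fix \<phi> assume \<phi>: "\<phi> \<in> carrier (dual_group G)"
    note o = invertible_Ob[OF character_invertible[OF \<phi>]]
    show "character_map G C F \<phi> \<in> carrier (Inv C)"
      unfolding m Inv_carrier using character_invertible[OF \<phi>] by blast
    fix \<psi> assume \<psi>: "\<psi> \<in> carrier (dual_group G)"
    note o' = invertible_Ob[OF character_invertible[OF \<psi>]]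
    show "character_map G C F (\<phi> \<otimes>\<^bsub>dual_group G\<^esub> \<psi>) = character_map G C F \<phi> \<otimes>\<^bsub>Inv C\<^esub> character_map G C F \<psi>"
      unfolding m Inv_mult[OF o o'] by (rule iso_class_eqI[OF iso_ob_sym[OF character_tensor[OF \<phi> \<psi>]]])
    show "\<phi> = \<psi>" if "character_map G C F \<phi> = character_map G C F \<psi>"
      using that character_inj[OF \<phi> \<psi>] iso_class_eq_iff[OF o] unfolding m by blast
  qed
qed

end

theorem proposition4p10:
  fixes G :: "('g, 'b) monoid_scheme"
    and B :: "('o, 'm) braided_data"
    and F :: "('g, 'o, 'm) rep_embedding"
  assumes "group G" and "finite (carrier G)"
    and "braided_cstar_tensor_category B"
    and "unitary_braided_embedding (Rep G) B F"
  shows "short_exact (dual_group G) (Inv B) (Inv_lift G B F)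
           (character_map G B F) (free_module_map G B F)"
proof -
  interpret rep_embedding G B F
    using assms by (simp add: rep_embedding_def finite_group_def finite_group_axioms_def)
  show ?thesis by (rule exact_sequence)
qed

end
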